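(* Let $r\ge 2$ and let $G$ be a Hodge group with complex Lie algebra $\mathfrak{g}_{\mathbb C}=\mathfrak{sp}_{2r}\mathbb{C}$. Assume that $(V,\varphi)$ is a Hodge representation of $G$ with the property that $V_{\mathbb R}$ is an irreducible $G_{\mathbb R}$-module. Let $\mathtt{T}_\varphi$ be the associated grading element, and assume the normalization $\sigma_i(\mathtt{T}_\varphi)\ge 0$ for all $1\le i\le r$. Then the Hodge representation is principal if and only if one of the following holds: (a) $V_{\mathbb C}=\mathbb{C}^{2r}$ is the standard representation, and $\mathtt{T}_\varphi=\mathtt{T}^1+\cdots+\mathtt{T}^r$; (b) $r=2$, $V_{\mathbb C}\subset\bigwedge^2\mathbb{C}^4$ is the irreducible $G_{\mathbb C}$-module of highest weight $\omega_2$, and $\mathtt{T}_\varphi=\mathtt{T}^1+\mathtt{T}^2$; (c) $r=3$, $V_{\mathbb C}\subset\bigwedge^3\mathbb{C}^6$ is the irreducible $G_{\mathbb C}$-module of highest weight $\omega_3$, and $\mathtt{T}_\varphi=3\,\mathtt{T}^1+\mathtt{T}^2+\mathtt{T}^3$.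
   Context: Hodge representations. Let $V$ be a (finite-dimensional) rational vector space, $w\in\mathbb{Z}$, and $Q:V\times V\to\mathbb{Q}$ a nondegenerate bilinear form with $Q(u,v)=(-1)^wQ(v,u)$. A $Q$-polarized Hodge structure of weight $w$ on $V$ is a nonconstant homomorphism $\phi:S^1\to\mathrm{Aut}(V_{\mathbb R},Q)$ of $\mathbb{R}$-algebraic groups with $\phi(-1)=(-1)^w\mathrm{Id}$ and $Q(v,\phi(\mathbf{i})\overline v)>0$ for all $0\ne v\in V_{\mathbb C}$. Its Hodge decomposition is $V_{\mathbb C}=\bigoplus_{p+q=w}V^{p,q}$, $V^{p,q}=\{v\in V_{\mathbb C}\mid \phi(z)v=z^{p-q}v\ \forall z\in S^1\}$. Let $G$ be a $\mathbb{Q}$-algebraic group, $\pi:G\to\mathrm{Aut}(V,Q)$ a homomorphism of $\mathbb{Q}$-algebraic groups such that $\pi_*:\mathfrak{g}_{\mathbb C}\to\mathrm{End}(V_{\mathbb C},Q)$ is injective, and $\varphi:S^1\to G_{\mathbb R}$ a nonconstant homomorphism of $\mathbb{R}$-algebraic groups. Then $(V,Q,\pi,\varphi)$, abbreviated $(V,\varphi)$, is a Hodge representation of $G$ if $\pi\circ\varphi$ is a $Q$-polarized Hodge structure on $V$. A $\mathbb{Q}$-algebraic group admitting a Hodge representation is a Hodge group. Grading element. Given $(V,\varphi)$, the grading element $\mathtt{T}_\varphi\in\mathbf{i}\,\mathfrak{g}_{\mathbb R}$ is the semisimple element (tangent, up to scaling, to $\varphi(S^1)$) that acts on $V^{p,q}$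 with eigenvalue $(p-q)/2$. Let $V_\ell\subset V_{\mathbb C}$ be the $\ell$-eigenspace of $\mathtt{T}_\varphi$. Fix a compact maximal torus $T\subset G_{\mathbb R}$ with $\varphi(S^1)\subset T$ and $\dim_{\mathbb R}T=\mathrm{rank}(G_{\mathbb R})$; let $\mathfrak{t}_{\mathbb C}\subset\mathfrak{g}_{\mathbb C}$ be the corresponding Cartan subalgebra, so $\mathtt{T}_\varphi\in\mathfrak{t}_{\mathbb C}$. One chooses a Borel subalgebra containing $\mathfrak{t}_{\mathbb C}$ and contained in the sum of the eigenspaces of $\mathrm{ad}\,\mathtt{T}_\varphi$ with nonnegative eigenvalue; let $\sigma_1,\dots,\sigma_r$ be the corresponding simple roots, $\omega_1,\dots,\omega_r$ the fundamental weights, and $\mathtt{T}^1,\dots,\mathtt{T}^r\in\mathfrak{t}_{\mathbb C}$ the basis dual to the simple roots, $\sigma_i(\mathtt{T}^j)=\delta_i^j$. Then $\mathtt{T}_\varphi=\sum_i n_i\mathtt{T}^i$ with $n_i=\sigma_i(\mathtt{T}_\varphi)\in\mathbb{Z}_{\ge 0}$ (this nonnegativity is the normalization). Simple roots are numbered in the standard (Bourbaki) way, so that $\mathbb{C}^{2r}$ has highest weight $\omega_1=\sigma_1+\cdots+\sigma_{r-1}+\tfrac12\sigma_r$. Principal. Let $m$ be the largest $\mathtt{T}_\varphi$-eigenvalue on $V_{\mathbb C}$, so $V_{\mathbb C}=V_m\oplus V_{m-1}\oplus\cdots\oplus V_{1-m}\oplus V_{-m}$. The Hodge representation is principal if its Hodge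 numbers are $(1,1,\dots,1)$, i.e. $\dim_{\mathbb C}V_\ell=1$ for $\ell=m,m-1,\dots,-m$. *)

theory Defs
  imports "HOL-Analysis.Analysis"
begin

section \<open>Linear algebraic groups over subfields of the complex numbers\<close>

inductive_set poly_fun :: "complex set \<Rightarrow> (complex^'n^'n \<Rightarrow> complex) set" for K
  where
    const: "c \<in> K \<Longrightarrow> (\<lambda>_. c) \<in> poly_fun K"
  | entry: "(\<lambda>A. A $ i $ j) \<in> poly_fun K"
  | add: "\<lbrakk>P \<in> poly_fun K; P' \<in> poly_fun K\<rbrakk> \<Longrightarrow> (\<lambda>A. P A + P' A) \<in> poly_fun K"
  | mult: "\<lbrakk>P \<in> poly_fun K; P' \<in> poly_fun K\<rbrakk> \<Longrightarrow> (\<lambda>A. P A * P' A) \<in> poly_fun K"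

text \<open>A \<open>K\<close>-algebraic group (\<open>K\<close> a subfield of the complex numbers) is represented by its
  group of complex points inside some \<open>GL\<^sub>n\<close>, cut out by polynomials with coefficients in \<open>K\<close>.
  As the characteristic is zero, no information is lost.\<close>

definition alg_group :: "complex set \<Rightarrow> (complex^'n^'n) set \<Rightarrow> bool" where
  "alg_group K G \<longleftrightarrow>
     (\<exists>S. S \<subseteq> poly_fun K \<and> G = {g. invertible g \<and> (\<forall>P\<in>S. P g = 0)}) \<and>
     mat 1 \<in> G \<and> (\<forall>g\<in>G. \<forall>h\<in>G. g ** h \<in> G) \<and> (\<forall>g\<in>G. matrix_inv g \<in> G)"

text \<open>\<open>regular_rep K G f P m\<close>: on \<open>G\<close> the function \<open>f\<close> is represented by the element
  \<open>P / det\<^sup>m\<close> of the coordinate ring of \<open>GL\<^sub>n\<close> over \<open>K\<close>.\<close>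

definition regular_rep ::
    "complex set \<Rightarrow> (complex^'n^'n) set \<Rightarrow> (complex^'n^'n \<Rightarrow> complex) \<Rightarrow>
     (complex^'n^'n \<Rightarrow> complex) \<Rightarrow> nat \<Rightarrow> bool" where
  "regular_rep K G f P m \<longleftrightarrow> P \<in> poly_fun K \<and> (\<forall>g\<in>G. f g = P g / det g ^ m)"

definition alg_hom ::
    "complex set \<Rightarrow> (complex^'n^'n) set \<Rightarrow> (complex^'m^'m) set \<Rightarrow>
     (complex^'n^'n \<Rightarrow> complex^'m^'m) \<Rightarrow> bool" where
  "alg_hom K G H f \<longleftrightarrow>
     (\<forall>g\<in>G. f g \<in> H) \<and> (\<forall>g\<in>G. \<forall>h\<in>G. f (g ** h) = f g ** f h) \<and>
     (\<forall>i j. \<exists>P m. regular_rep K G (\<lambda>g. f g $ i $ j) P m)"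

definition alg_iso ::
    "complex set \<Rightarrow> (complex^'n^'n) set \<Rightarrow> (complex^'m^'m) set \<Rightarrow>
     (complex^'n^'n \<Rightarrow> complex^'m^'m) \<Rightarrow> bool" where
  "alg_iso K G H f \<longleftrightarrow>
     alg_hom K G H f \<and> bij_betw f G H \<and> alg_hom K H G (inv_into G f)"

definition nonconstant_on :: "'a set \<Rightarrow> ('a \<Rightarrow> 'b) \<Rightarrow> bool" where
  "nonconstant_on G f \<longleftrightarrow> (\<exists>g\<in>G. \<exists>h\<in>G. f g \<noteq> f h)"

section \<open>Complex Lie algebras of algebraic groups\<close>

definition scale_mat :: "complex \<Rightarrow> complex^'n^'m \<Rightarrow> complex^'n^'m" where
  "scale_mat c = map_matrix ((*) c)"

definition lie_bracket :: "complex^'n^'n \<Rightarrow> complex^'n^'n \<Rightarrow> complex^'n^'n" where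
  "lie_bracket X Y = X ** Y - Y ** X"

text \<open>The (Zariski) tangent space at the identity, that is, the complexified Lie algebra.\<close>

definition lie_alg :: "(complex^'n^'n) set \<Rightarrow> (complex^'n^'n) set" where
  "lie_alg G =
     {X. \<forall>P\<in>poly_fun UNIV. (\<forall>g\<in>G. P g = 0) \<longrightarrow>
        ((\<lambda>t. P (mat 1 + scale_mat t X)) has_field_derivative 0) (at 0)}"

text \<open>The differential at the identity of a morphism \<open>f\<close> defined on \<open>G\<close>. For \<open>X\<close> in the Lie
  algebra of \<open>G\<close> the derivative of an entry of \<open>f\<close> in direction \<open>X\<close> does not depend on the
  regular function on \<open>GL\<^sub>n\<close> that represents this entry on \<open>G\<close>.\<close>

definition differential ::
    "(complex^'n^'n) set \<Rightarrow> (complex^'n^'n \<Rightarrow> complex^'m^'m) \<Rightarrow> complex^'n^'n \<Rightarrow> complex^'m^'m" where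
  "differential G f X =
     (THE Y. \<forall>i j P m. regular_rep UNIV G (\<lambda>g. f g $ i $ j) P m \<longrightarrow>
        ((\<lambda>t. P (mat 1 + scale_mat t X) / det (mat 1 + scale_mat t X) ^ m)
           has_field_derivative (Y $ i $ j)) (at 0))"

definition lie_iso ::
    "(complex^'n^'n) set \<Rightarrow> (complex^'m^'m) set \<Rightarrow> (complex^'n^'n \<Rightarrow> complex^'m^'m) \<Rightarrow> bool" where
  "lie_iso g h \<theta> \<longleftrightarrow>
     bij_betw \<theta> g h \<and>
     (\<forall>X\<in>g. \<forall>Y\<in>g. \<theta> (X + Y) = \<theta> X + \<theta> Y) \<and>
     (\<forall>c. \<forall>X\<in>g. \<theta> (scale_mat c X) = scale_mat c (\<theta> X)) \<and>
     (\<forall>X\<in>g. \<forall>Y\<in>g. \<theta> (lie_bracket X Y) = lie_bracket (\<theta> X) (\<theta> Y))"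

definition symplectic_J :: "complex^('r::finite + 'r)^('r + 'r)" where
  "symplectic_J = (\<chi> p q. case (p, q) of
       (Inl i, Inr j) \<Rightarrow> if i = j then 1 else 0
     | (Inr i, Inl j) \<Rightarrow> if i = j then -1 else 0
     | _ \<Rightarrow> 0)"

text \<open>With \<open>r = CARD('r)\<close> this is \<open>\<ss>\<pp>\<^sub>2\<^sub>r\<close>.\<close>

definition sp :: "(complex^('r::finite + 'r)^('r + 'r)) set" where
  "sp = {X. transpose X ** symplectic_J + symplectic_J ** X = 0}"

section \<open>Compact tori\<close>

definition rotation_mat :: "('d::finite \<Rightarrow> complex) \<Rightarrow> ('d \<Rightarrow> complex) \<Rightarrow> complex^('d + 'd)^('d + 'd)"
  where
  "rotation_mat a b = (\<chi> p q. case (p, q) of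
       (Inl i, Inl j) \<Rightarrow> if i = j then a i else 0
     | (Inl i, Inr j) \<Rightarrow> if i = j then - b i else 0
     | (Inr i, Inl j) \<Rightarrow> if i = j then b i else 0
     | (Inr i, Inr j) \<Rightarrow> if i = j then a i else 0)"

text \<open>The complex points of the real algebraic group \<open>(S\<^sup>1)\<^sup>d = SO(2)\<^sup>d\<close>, where \<open>d = CARD('d)\<close>.\<close>

definition std_compact_torus :: "(complex^('d::finite + 'd)^('d + 'd)) set" where
  "std_compact_torus = {rotation_mat a b | a b. \<forall>k. (a k)\<^sup>2 + (b k)\<^sup>2 = 1}"

abbreviation circle_group :: "(complex^(1 + 1)^(1 + 1)) set" where
  "circle_group \<equiv> std_compact_torus"

text \<open>The real point of \<open>circle_group\<close> given by a complex number of modulus one.\<close>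

definition circle_point :: "complex \<Rightarrow> complex^(1 + 1)^(1 + 1)" where
  "circle_point z = rotation_mat (\<lambda>_. of_real (Re z)) (\<lambda>_. of_real (Im z))"

definition cartan_subalgebra :: "(complex^'n^'n) set \<Rightarrow> (complex^'n^'n) set \<Rightarrow> bool" where
  "cartan_subalgebra g t \<longleftrightarrow>
     t \<subseteq> g \<and> module.subspace scale_mat t \<and>
     (\<forall>X\<in>t. \<forall>Y\<in>t. lie_bracket X Y \<in> t) \<and>
     (\<exists>k. \<forall>Xs Y. set Xs \<subseteq> t \<and> length Xs = k \<and> Y \<in> t \<longrightarrow> foldr lie_bracket Xs Y = 0) \<and>
     (\<forall>X\<in>g. (\<forall>H\<in>t. lie_bracket X H \<in> t) \<longrightarrow> X \<in> t)"

text \<open>A compact torus of dimension \<open>CARD('d)\<close> in \<open>G\<close> whose dimension is the rank of \<open>G\<close>; the latter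
  is expressed by its complexified Lie algebra being a Cartan subalgebra.\<close>

definition compact_maximal_torus ::
    "'d::finite itself \<Rightarrow> (complex^'n^'n) set \<Rightarrow> (complex^'n^'n) set \<Rightarrow> bool" where
  "compact_maximal_torus _ G T \<longleftrightarrow>
     alg_group \<real> T \<and> T \<subseteq> G \<and>
     (\<exists>\<psi>. alg_iso \<real> (std_compact_torus :: (complex^('d + 'd)^('d + 'd)) set) T \<psi>) \<and>
     cartan_subalgebra (lie_alg G) (lie_alg T)"

section \<open>Polarized Hodge structures and Hodge representations\<close>

text \<open>The rational vector space \<open>V\<close> is \<open>rat^'v\<close>, so that its complexification is \<open>complex^'v\<close>.\<close>

definition complexify_form ::
    "(rat^'v \<Rightarrow> rat^'v \<Rightarrow> rat) \<Rightarrow> complex^'v \<Rightarrow> complex^'v \<Rightarrow> complex" where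
  "complexify_form Q u v = (\<Sum>i\<in>UNIV. \<Sum>j\<in>UNIV. u $ i * of_rat (Q (axis i 1) (axis j 1)) * v $ j)"

definition weight_form :: "int \<Rightarrow> (rat^'v \<Rightarrow> rat^'v \<Rightarrow> rat) \<Rightarrow> bool" where
  "weight_form w Q \<longleftrightarrow>
     (\<forall>u. Vector_Spaces.linear (*s) (*) (Q u)) \<and>
     (\<forall>v. Vector_Spaces.linear (*s) (*) (\<lambda>u. Q u v)) \<and>
     (\<forall>u. u \<noteq> 0 \<longrightarrow> (\<exists>v. Q u v \<noteq> 0)) \<and>
     (\<forall>u v. Q u v = (-1) powi w * Q v u)"

definition aut_form :: "(rat^'v \<Rightarrow> rat^'v \<Rightarrow> rat) \<Rightarrow> (complex^'v^'v) set" where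
  "aut_form Q = {g. invertible g \<and>
     (\<forall>u v. complexify_form Q (g *v u) (g *v v) = complexify_form Q u v)}"

definition cnj_vec :: "complex^'v \<Rightarrow> complex^'v" where
  "cnj_vec v = (\<chi> i. cnj (v $ i))"

text \<open>In the last clause \<open><\<close> is the order of the complex numbers for which \<open>0 < z\<close> means that
  \<open>z\<close> is real and positive.\<close>

definition polarized_hodge_structure ::
    "int \<Rightarrow> (rat^'v \<Rightarrow> rat^'v \<Rightarrow> rat) \<Rightarrow> (complex^(1 + 1)^(1 + 1) \<Rightarrow> complex^'v^'v) \<Rightarrow> bool" where
  "polarized_hodge_structure w Q \<phi> \<longleftrightarrow>
     alg_hom \<real> circle_group (aut_form Q) \<phi> \<and> nonconstant_on circle_group \<phi> \<and>
     \<phi> (circle_point (-1)) = mat ((-1) powi w) \<and>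
     (\<forall>v. v \<noteq> 0 \<longrightarrow> 0 < complexify_form Q v (\<phi> (circle_point \<i>) *v cnj_vec v))"

definition hodge_piece ::
    "(complex^(1 + 1)^(1 + 1) \<Rightarrow> complex^'v^'v) \<Rightarrow> int \<Rightarrow> int \<Rightarrow> (complex^'v) set" where
  "hodge_piece \<phi> p q = {v. \<forall>z. norm z = 1 \<longrightarrow> \<phi> (circle_point z) *v v = (z powi (p - q)) *s v}"

definition hodge_representation ::
    "(complex^'n^'n) set \<Rightarrow> int \<Rightarrow> (rat^'v \<Rightarrow> rat^'v \<Rightarrow> rat) \<Rightarrow>
     (complex^'n^'n \<Rightarrow> complex^'v^'v) \<Rightarrow> (complex^(1 + 1)^(1 + 1) \<Rightarrow> complex^'n^'n) \<Rightarrow> bool" where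
  "hodge_representation G w Q \<pi> \<phi> \<longleftrightarrow>
     alg_group \<rat> G \<and> weight_form w Q \<and>
     alg_hom \<rat> G (aut_form Q) \<pi> \<and> inj_on (differential G \<pi>) (lie_alg G) \<and>
     alg_hom \<real> circle_group G \<phi> \<and> nonconstant_on circle_group \<phi> \<and>
     polarized_hodge_structure w Q (\<pi> \<circ> \<phi>)"

text \<open>The real form \<open>\<gg>\<^sub>\<real>\<close> consists of the matrices in \<open>lie_alg G\<close> with real entries. Since
  \<open>V\<close> is the sum of its Hodge pieces and the differential of \<open>\<pi>\<close> is injective, there is exactly
  one grading element, and it is semisimple.\<close>

definition grading_element ::
    "(complex^'n^'n) set \<Rightarrow> int \<Rightarrow> (complex^'n^'n \<Rightarrow> complex^'v^'v) \<Rightarrow>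
     (complex^(1 + 1)^(1 + 1) \<Rightarrow> complex^'n^'n) \<Rightarrow> complex^'n^'n \<Rightarrow> bool" where
  "grading_element G w \<pi> \<phi> E \<longleftrightarrow>
     (\<exists>X\<in>lie_alg G. (\<forall>i j. X $ i $ j \<in> \<real>) \<and> E = scale_mat \<i> X) \<and>
     (\<forall>p q. p + q = w \<longrightarrow>
        (\<forall>v\<in>hodge_piece (\<pi> \<circ> \<phi>) p q. differential G \<pi> E *v v = (of_int (p - q) / 2) *s v))"

definition eigenspace :: "complex^'v^'v \<Rightarrow> complex \<Rightarrow> (complex^'v) set" where
  "eigenspace A l = {v. A *v v = l *s v}"

text \<open>To be applied to the grading element as an endomorphism \<open>A\<close> of \<open>complex^'v\<close>. Its largest
  eigenvalue \<open>m\<close> is a half-integer, so \<open>m - k\<close> runs through \<open>m, m - 1, \<dots>, -m\<close>.\<close>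

definition is_principal :: "complex^'v^'v \<Rightarrow> bool" where
  "is_principal A \<longleftrightarrow>
     (\<exists>m::real. eigenspace A (of_real m) \<noteq> {0} \<and>
        (\<forall>l. eigenspace A l \<noteq> {0} \<longrightarrow> l \<le> of_real m) \<and>
        (\<forall>k::nat. real k \<le> 2 * m \<longrightarrow> vec.dim (eigenspace A (of_real (m - real k))) = 1))"

section \<open>Irreducibility\<close>

definition complexify_subspace :: "(real^'v) set \<Rightarrow> (complex^'v) set" where
  "complexify_subspace W = {(\<chi> i. Complex (x $ i) (y $ i)) | x y. x \<in> W \<and> y \<in> W}"

text \<open>A real subspace is a submodule for the real algebraic group \<open>G\<^sub>\<real>\<close> iff its complexification
  is stable under all complex points of \<open>G\<close>.\<close>

definition irreducible_real_module ::
    "(complex^'n^'n) set \<Rightarrow> (complex^'n^'n \<Rightarrow> complex^'v^'v) \<Rightarrow> bool" where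
  "irreducible_real_module G \<pi> \<longleftrightarrow>
     (\<forall>W::(real^'v) set. subspace W \<and>
        (\<forall>g\<in>G. \<forall>x\<in>complexify_subspace W. \<pi> g *v x \<in> complexify_subspace W) \<longrightarrow>
        W = {0} \<or> W = UNIV)"

definition irreducible_module ::
    "(complex^'n^'n) set \<Rightarrow> (complex^'n^'n \<Rightarrow> complex^'v^'v) \<Rightarrow> bool" where
  "irreducible_module g \<rho> \<longleftrightarrow>
     (\<forall>W. vec.subspace W \<and> (\<forall>X\<in>g. \<forall>x\<in>W. \<rho> X *v x \<in> W) \<longrightarrow> W = {0} \<or> W = UNIV)"

section \<open>Roots and weights\<close>

text \<open>Linear functionals on \<open>t\<close> are represented by functions on all matrices; only their values
  on \<open>t\<close> matter.\<close>

definition functional_on :: "(complex^'n^'n) set \<Rightarrow> (complex^'n^'n \<Rightarrow> complex) \<Rightarrow> bool" where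
  "functional_on t \<alpha> \<longleftrightarrow>
     (\<forall>X\<in>t. \<forall>Y\<in>t. \<alpha> (X + Y) = \<alpha> X + \<alpha> Y) \<and> (\<forall>c. \<forall>X\<in>t. \<alpha> (scale_mat c X) = c * \<alpha> X)"

definition root_space ::
    "(complex^'n^'n) set \<Rightarrow> (complex^'n^'n) set \<Rightarrow> (complex^'n^'n \<Rightarrow> complex) \<Rightarrow> (complex^'n^'n) set"
  where
  "root_space g t \<alpha> = {X\<in>g. \<forall>H\<in>t. lie_bracket H X = scale_mat (\<alpha> H) X}"

definition is_root ::
    "(complex^'n^'n) set \<Rightarrow> (complex^'n^'n) set \<Rightarrow> (complex^'n^'n \<Rightarrow> complex) \<Rightarrow> bool" where
  "is_root g t \<alpha> \<longleftrightarrow>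
     functional_on t \<alpha> \<and> (\<exists>H\<in>t. \<alpha> H \<noteq> 0) \<and> (\<exists>X\<in>root_space g t \<alpha>. X \<noteq> 0)"

definition nat_combination ::
    "(complex^'n^'n) set \<Rightarrow> nat \<Rightarrow> (nat \<Rightarrow> complex^'n^'n \<Rightarrow> complex) \<Rightarrow>
     (complex^'n^'n \<Rightarrow> complex) \<Rightarrow> bool" where
  "nat_combination t r \<sigma> \<alpha> \<longleftrightarrow>
     (\<exists>k::nat \<Rightarrow> nat. \<forall>H\<in>t. \<alpha> H = (\<Sum>i\<in>{1..r}. of_nat (k i) * \<sigma> i H))"

definition simple_roots ::
    "(complex^'n^'n) set \<Rightarrow> (complex^'n^'n) set \<Rightarrow> nat \<Rightarrow> (nat \<Rightarrow> complex^'n^'n \<Rightarrow> complex) \<Rightarrow> bool"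
  where
  "simple_roots g t r \<sigma> \<longleftrightarrow>
     (\<forall>i\<in>{1..r}. is_root g t (\<sigma> i)) \<and>
     (\<forall>c. (\<forall>H\<in>t. (\<Sum>i\<in>{1..r}. c i * \<sigma> i H) = 0) \<longrightarrow> (\<forall>i\<in>{1..r}. c i = 0)) \<and>
     (\<forall>\<alpha>. is_root g t \<alpha> \<longrightarrow>
        nat_combination t r \<sigma> \<alpha> \<or> nat_combination t r \<sigma> (\<lambda>H. - \<alpha> H))"

definition is_coroot ::
    "(complex^'n^'n) set \<Rightarrow> (complex^'n^'n) set \<Rightarrow> (complex^'n^'n \<Rightarrow> complex) \<Rightarrow> complex^'n^'n \<Rightarrow> bool"
  where
  "is_coroot g t \<alpha> H \<longleftrightarrow>
     H \<in> t \<and> \<alpha> H = 2 \<and>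
     (\<exists>X\<in>root_space g t \<alpha>. \<exists>Y\<in>root_space g t (\<lambda>H. - \<alpha> H). H = lie_bracket X Y)"

text \<open>The Cartan integers of \<open>C\<^sub>r\<close> in the numbering of Bourbaki: \<open>\<sigma>\<^sub>r\<close> is the long simple root.
  This fixes the numbering also for \<open>r = 2\<close>.\<close>

definition cartan_integer_C :: "nat \<Rightarrow> nat \<Rightarrow> nat \<Rightarrow> complex" where
  "cartan_integer_C r i j =
     (if i = j then 2
      else if i = r \<and> j + 1 = r then -2
      else if i = j + 1 \<or> j = i + 1 then -1
      else 0)"

definition bourbaki_numbering_C ::
    "(complex^'n^'n) set \<Rightarrow> (complex^'n^'n) set \<Rightarrow> nat \<Rightarrow> (nat \<Rightarrow> complex^'n^'n \<Rightarrow> complex) \<Rightarrow> bool"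
  where
  "bourbaki_numbering_C g t r \<sigma> \<longleftrightarrow>
     (\<forall>i\<in>{1..r}. \<forall>j\<in>{1..r}. \<forall>H. is_coroot g t (\<sigma> j) H \<longrightarrow> \<sigma> i H = cartan_integer_C r i j)"

definition fundamental_weights ::
    "(complex^'n^'n) set \<Rightarrow> (complex^'n^'n) set \<Rightarrow> nat \<Rightarrow> (nat \<Rightarrow> complex^'n^'n \<Rightarrow> complex) \<Rightarrow>
     (nat \<Rightarrow> complex^'n^'n \<Rightarrow> complex) \<Rightarrow> bool" where
  "fundamental_weights g t r \<sigma> \<omega> \<longleftrightarrow>
     (\<forall>i\<in>{1..r}. functional_on t (\<omega> i) \<and>
        (\<forall>j\<in>{1..r}. \<forall>H. is_coroot g t (\<sigma> j) H \<longrightarrow> \<omega> i H = (if i = j then 1 else 0)))"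

definition dual_basis ::
    "(complex^'n^'n) set \<Rightarrow> nat \<Rightarrow> (nat \<Rightarrow> complex^'n^'n \<Rightarrow> complex) \<Rightarrow> (nat \<Rightarrow> complex^'n^'n) \<Rightarrow> bool"
  where
  "dual_basis t r \<sigma> D \<longleftrightarrow>
     (\<forall>j\<in>{1..r}. D j \<in> t \<and> (\<forall>i\<in>{1..r}. \<sigma> i (D j) = (if i = j then 1 else 0)))"

text \<open>\<open>\<rho>\<close> is the action of \<open>g\<close>.\<close>

definition irreducible_with_highest_weight ::
    "(complex^'n^'n) set \<Rightarrow> (complex^'n^'n) set \<Rightarrow> nat \<Rightarrow> (nat \<Rightarrow> complex^'n^'n \<Rightarrow> complex) \<Rightarrow>
     (complex^'n^'n \<Rightarrow> complex^'v^'v) \<Rightarrow> (complex^'n^'n \<Rightarrow> complex) \<Rightarrow> bool" where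
  "irreducible_with_highest_weight g t r \<sigma> \<rho> \<mu> \<longleftrightarrow>
     irreducible_module g \<rho> \<and>
     (\<exists>v. v \<noteq> 0 \<and> (\<forall>H\<in>t. \<rho> H *v v = \<mu> H *s v) \<and>
        (\<forall>\<alpha>. is_root g t \<alpha> \<and> nat_combination t r \<sigma> \<alpha> \<longrightarrow> (\<forall>X\<in>root_space g t \<alpha>. \<rho> X *v v = 0)))"

section \<open>The standard representation and its exterior powers\<close>

text \<open>\<open>\<theta>\<close> is the action of \<open>g\<close> on \<open>complex^'b\<close>.\<close>

definition isomorphic_modules ::
    "(complex^'n^'n) set \<Rightarrow> (complex^'n^'n \<Rightarrow> complex^'v^'v) \<Rightarrow> (complex^'n^'n \<Rightarrow> complex^'b^'b) \<Rightarrow> bool"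
  where
  "isomorphic_modules g \<rho> \<theta> \<longleftrightarrow>
     (\<exists>f. Vector_Spaces.linear (*s) (*s) f \<and> bij f \<and> (\<forall>X\<in>g. \<forall>v. f (\<rho> X *v v) = \<theta> X *v f v))"

text \<open>The \<open>k\<close>-th exterior power of \<open>complex^'b\<close>: antisymmetric tensors of degree \<open>k\<close>, a tensor being
  given by its coordinates, indexed by lists of length \<open>k\<close> over \<open>'b\<close>.\<close>

definition ext_power :: "nat \<Rightarrow> ('b list \<Rightarrow> complex) set" where
  "ext_power k = {x.
     (\<forall>bs. length bs \<noteq> k \<longrightarrow> x bs = 0) \<and>
     (\<forall>bs i j. length bs = k \<and> i < j \<and> j < k \<longrightarrow> x (bs[i := bs ! j, j := bs ! i]) = - x bs)}"

text \<open>The action of an endomorphism of \<open>complex^'b\<close> on tensors, as a derivation.\<close>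

definition tensor_action :: "complex^'b^'b \<Rightarrow> ('b list \<Rightarrow> complex) \<Rightarrow> 'b::finite list \<Rightarrow> complex" where
  "tensor_action A x bs = (\<Sum>i<length bs. \<Sum>a\<in>UNIV. A $ (bs ! i) $ a * x (bs[i := a]))"

definition submodule_of_ext_power ::
    "(complex^'n^'n) set \<Rightarrow> (complex^'n^'n \<Rightarrow> complex^'v^'v) \<Rightarrow> nat \<Rightarrow>
     (complex^'n^'n \<Rightarrow> complex^'b^'b) \<Rightarrow> bool" where
  "submodule_of_ext_power g \<rho> k \<theta> \<longleftrightarrow>
     (\<exists>f. (\<forall>bs. Vector_Spaces.linear (*s) (*) (\<lambda>v. f v bs)) \<and>
        inj f \<and> range f \<subseteq> ext_power k \<and>
        (\<forall>X\<in>g. \<forall>v. f (\<rho> X *v v) = tensor_action (\<theta> X) (f v)))"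

end

theory Submission
  imports Defs "HOL-Computational_Algebra.Fundamental_Theorem_Algebra"
begin

text \<open>Let \<open>U\<close> be an irreducible \<open>\<gg>\<close>-submodule of \<open>V\<close>. If the representation is principal, then
  the eigenspaces of the grading element are lines, so all weights of \<open>V\<close> have multiplicity one.
  Comparing the two vectors obtained from an extremal weight vector by lowering along two adjacent
  simple roots in both orders shows that such a \<open>U\<close> is trivial, the standard representation or, for
  \<open>r \<le> 3\<close>, the last fundamental representation. These have different dimensions, and \<open>V\<close> has no
  repeated weights, so the translates of \<open>U\<close> under the group and its complex conjugate coincide with
  \<open>U\<close>; hence \<open>U = V\<close> by irreducibility over \<open>\<real>\<close>. The grading element is then found by sorting
  its eigenvalues \<open>\<plusminus> t\<^sub>i\<close>, respectively \<open>\<plusminus> t\<^sub>1 \<plusminus> \<dots> \<plusminus> t\<^sub>r\<close> together with \<open>0\<close> (\<open>r = 2\<close>)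
  or \<open>\<plusminus> t\<^sub>i\<close> (\<open>r = 3\<close>). Conversely the eigenvalues in the three cases can be listed.\<close>

section \<open>Directional derivatives of polynomial functions\<close>

text \<open>Only the group G_R, which may be disconnected, acts irreducibly, and neither complete
  reducibility nor a classification of irreducible modules is invoked. The one-dimensional
  eigenspaces of the grading element replace them: every submodule for the Lie algebra is the span
  of its weight lines and is determined by its set of weights, so comparing minimal submodules
  becomes comparing the cardinalities 1, 2r, and 5 (r = 2) or 14 (r = 3). The bound r <= 3 arises
  because for r >= 4 a sign vector with two entries replaced by 0 is a weight that still contains
  the chain 1 > 0 > -1. The embedding of V into an exterior power cannot rest on irreducibility of
  the kernel of the contraction, which is not known in advance. It suffices that the grading of this
  kernel is simple with degrees in the spectrum of V: a nonzero tensor paired with the vector 0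
  could be used to cancel the tensor paired with an eigenvector, and irreducibility of V forbids a
  nonzero vector paired with the tensor 0. Parity of the Hodge weight and reality of the form make
  the spectrum symmetric with steps 1, which turns counting into equations for the t_i.\<close>

definition pd :: "(complex^'n^'n \<Rightarrow> complex) \<Rightarrow> complex^'n^'n \<Rightarrow> complex^'n^'n \<Rightarrow> complex" where
  "pd P A B = deriv (\<lambda>t. P (A + scale_mat t B)) 0"

definition mat_deriv :: "(complex \<Rightarrow> complex^'n^'m) \<Rightarrow> complex^'n^'m \<Rightarrow> complex \<Rightarrow> bool" where
  "mat_deriv F F' z \<longleftrightarrow> (\<forall>i j. ((\<lambda>z. F z $ i $ j) has_field_derivative F' $ i $ j) (at z))"

lemma scale_mat_nth [simp]: "scale_mat c A $ i $ j = c * A $ i $ j"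
  by (simp add: scale_mat_def)

lemma scale_mat_0 [simp]: "scale_mat 0 A = 0" "scale_mat c 0 = 0"
  by (simp_all add: vec_eq_iff)

lemma mat_deriv_affine: "mat_deriv (\<lambda>t. A + scale_mat t B) B z"
  unfolding mat_deriv_def by (auto intro!: derivative_eq_intros)

lemma mat_deriv_const: "mat_deriv (\<lambda>t. A) 0 z"
  unfolding mat_deriv_def by auto

lemma mat_deriv_mult:
  assumes "mat_deriv F F' z" "mat_deriv K K' z"
  shows "mat_deriv (\<lambda>t. F t ** K t) (F' ** K z + F z ** K') z"
  using assms unfolding mat_deriv_def matrix_matrix_mult_def
  by (auto intro!: derivative_eq_intros sum.cong simp: sum.distrib[symmetric] algebra_simps)

lemma poly_fun_mono: "P \<in> poly_fun K \<Longrightarrow> K \<subseteq> L \<Longrightarrow> P \<in> poly_fun L"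
  by (induction rule: poly_fun.induct) (auto intro: poly_fun.intros)

lemma poly_fun_UNIV: "P \<in> poly_fun K \<Longrightarrow> P \<in> poly_fun UNIV"
  by (rule poly_fun_mono) auto

text \<open>Functions in \<open>poly_fun\<close> carry no formal expression, so first and second
  derivatives are produced along the induction on their construction. The clauses are carried
  together because the product case mixes them; the symmetry of \<open>D2\<close> is what later
  closes the tangent space under brackets. Curves with moving directions occur so that
  \<open>D1 (F z) (Y z)\<close> can be differentiated in both arguments.\<close>

lemma poly_fun_smooth:
  fixes P :: "complex^'n^'n \<Rightarrow> complex"
  assumes "P \<in> poly_fun UNIV"
  shows "\<exists>D1 D2.
    (\<forall>F F' z. mat_deriv F F' z \<longrightarrow> ((\<lambda>z. P (F z)) has_field_derivative D1 (F z) F') (at z)) \<and>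
    (\<forall>F F' Y Y' z. mat_deriv F F' z \<and> mat_deriv Y Y' z \<longrightarrow>
       ((\<lambda>z. D1 (F z) (Y z)) has_field_derivative D2 (F z) F' (Y z) + D1 (F z) Y') (at z)) \<and>
    (\<forall>A B C. D2 A B C = D2 A C B) \<and>
    (\<forall>L. (\<forall>i j. (\<lambda>A. L A $ i $ j) \<in> poly_fun UNIV) \<longrightarrow> (\<lambda>A. D1 A (L A)) \<in> poly_fun UNIV) \<and>
    (\<forall>A B C. D1 A (B + C) = D1 A B + D1 A C) \<and> (\<forall>A c B. D1 A (scale_mat c B) = c * D1 A B)"
  using assms
proof (induction rule: poly_fun.induct)
  case (const c)
  show ?case
    by (rule exI[of _ "\<lambda>_ _. 0"], rule exI[of _ "\<lambda>_ _ _. 0"]) (auto intro: poly_fun.intros)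
next
  case (entry i j)
  show ?case
    by (rule exI[of _ "\<lambda>_ B. B $ i $ j"], rule exI[of _ "\<lambda>_ _ _. 0"])
      (auto intro: poly_fun.intros simp: mat_deriv_def)
next
  case (add P P')
  then obtain D1 D2 E1 E2 where
    D: "\<forall>F F' z. mat_deriv F F' z \<longrightarrow> ((\<lambda>z. P (F z)) has_field_derivative D1 (F z) F') (at z)"
    "\<forall>F F' Y Y' z. mat_deriv F F' z \<and> mat_deriv Y Y' z \<longrightarrow>
       ((\<lambda>z. D1 (F z) (Y z)) has_field_derivative D2 (F z) F' (Y z) + D1 (F z) Y') (at z)"
    "\<forall>A B C. D2 A B C = D2 A C B"
    "\<forall>L. (\<forall>i j. (\<lambda>A. L A $ i $ j) \<in> poly_fun UNIV) \<longrightarrow> (\<lambda>A. D1 A (L A)) \<in> poly_fun UNIV"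
    "\<forall>A B C. D1 A (B + C) = D1 A B + D1 A C" "\<forall>A c B. D1 A (scale_mat c B) = c * D1 A B"
    and E: "\<forall>F F' z. mat_deriv F F' z \<longrightarrow> ((\<lambda>z. P' (F z)) has_field_derivative E1 (F z) F') (at z)"
    "\<forall>F F' Y Y' z. mat_deriv F F' z \<and> mat_deriv Y Y' z \<longrightarrow>
       ((\<lambda>z. E1 (F z) (Y z)) has_field_derivative E2 (F z) F' (Y z) + E1 (F z) Y') (at z)"
    "\<forall>A B C. E2 A B C = E2 A C B"
    "\<forall>L. (\<forall>i j. (\<lambda>A. L A $ i $ j) \<in> poly_fun UNIV) \<longrightarrow> (\<lambda>A. E1 A (L A)) \<in> poly_fun UNIV"
    "\<forall>A B C. E1 A (B + C) = E1 A B + E1 A C" "\<forall>A c B. E1 A (scale_mat c B) = c * E1 A B"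
    by (elim exE conjE) blast
  show ?case
  proof (rule exI[of _ "\<lambda>A B. D1 A B + E1 A B"],
      rule exI[of _ "\<lambda>A B C. D2 A B C + E2 A B C"], intro conjI allI impI)
    fix F Y :: "complex \<Rightarrow> complex^'n^'n" and F' Y' z assume *: "mat_deriv F F' z \<and> mat_deriv Y Y' z"
    have "D2 (F z) F' (Y z) + E2 (F z) F' (Y z) + (D1 (F z) Y' + E1 (F z) Y')
        = (D2 (F z) F' (Y z) + D1 (F z) Y') + (E2 (F z) F' (Y z) + E1 (F z) Y')" by simp
    then show "((\<lambda>z. D1 (F z) (Y z) + E1 (F z) (Y z)) has_field_derivative
      D2 (F z) F' (Y z) + E2 (F z) F' (Y z) + (D1 (F z) Y' + E1 (F z) Y')) (at z)"
      using D(2) E(2) * by (simp only:) (intro DERIV_add; simp)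
  next
    fix F :: "complex \<Rightarrow> complex^'n^'n" and F' z assume "mat_deriv F F' z"
    then show "((\<lambda>z. P (F z) + P' (F z)) has_field_derivative D1 (F z) F' + E1 (F z) F') (at z)"
      using D(1) E(1) by (intro DERIV_add) simp_all
  next
    fix A B C show "D2 A B C + E2 A B C = D2 A C B + E2 A C B" using D(3) E(3) by metis
  qed (insert D(4,5,6) E(4,5,6), auto intro!: poly_fun.add simp: algebra_simps)
next
  case (mult P P')
  then obtain D1 D2 E1 E2 where
    D: "\<forall>F F' z. mat_deriv F F' z \<longrightarrow> ((\<lambda>z. P (F z)) has_field_derivative D1 (F z) F') (at z)"
    "\<forall>F F' Y Y' z. mat_deriv F F' z \<and> mat_deriv Y Y' z \<longrightarrow>
       ((\<lambda>z. D1 (F z) (Y z)) has_field_derivative D2 (F z) F' (Y z) + D1 (F z) Y') (at z)"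
    "\<forall>A B C. D2 A B C = D2 A C B"
    "\<forall>L. (\<forall>i j. (\<lambda>A. L A $ i $ j) \<in> poly_fun UNIV) \<longrightarrow> (\<lambda>A. D1 A (L A)) \<in> poly_fun UNIV"
    "\<forall>A B C. D1 A (B + C) = D1 A B + D1 A C" "\<forall>A c B. D1 A (scale_mat c B) = c * D1 A B"
    and E: "\<forall>F F' z. mat_deriv F F' z \<longrightarrow> ((\<lambda>z. P' (F z)) has_field_derivative E1 (F z) F') (at z)"
    "\<forall>F F' Y Y' z. mat_deriv F F' z \<and> mat_deriv Y Y' z \<longrightarrow>
       ((\<lambda>z. E1 (F z) (Y z)) has_field_derivative E2 (F z) F' (Y z) + E1 (F z) Y') (at z)"
    "\<forall>A B C. E2 A B C = E2 A C B"
    "\<forall>L. (\<forall>i j. (\<lambda>A. L A $ i $ j) \<in> poly_fun UNIV) \<longrightarrow> (\<lambda>A. E1 A (L A)) \<in> poly_fun UNIV"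
    "\<forall>A B C. E1 A (B + C) = E1 A B + E1 A C" "\<forall>A c B. E1 A (scale_mat c B) = c * E1 A B"
    by (elim exE conjE) blast
  show ?case
  proof (rule exI[of _ "\<lambda>A B. D1 A B * P' A + P A * E1 A B"],
      rule exI[of _ "\<lambda>A B C. D2 A B C * P' A + D1 A C * E1 A B + D1 A B * E1 A C + P A * E2 A B C"],
      intro conjI allI impI)
    fix F :: "complex \<Rightarrow> complex^'n^'n" and F' z assume "mat_deriv F F' z"
    then show "((\<lambda>z. P (F z) * P' (F z)) has_field_derivative
      D1 (F z) F' * P' (F z) + P (F z) * E1 (F z) F') (at z)"
      using D(1) E(1) by (auto intro!: derivative_eq_intros)
  next
    fix F Y :: "complex \<Rightarrow> complex^'n^'n" and F' Y' z assume *: "mat_deriv F F' z \<and> mat_deriv Y Y' z"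
    then show "((\<lambda>z. D1 (F z) (Y z) * P' (F z) + P (F z) * E1 (F z) (Y z)) has_field_derivative
      D2 (F z) F' (Y z) * P' (F z) + D1 (F z) (Y z) * E1 (F z) F' + D1 (F z) F' * E1 (F z) (Y z)
        + P (F z) * E2 (F z) F' (Y z) + (D1 (F z) Y' * P' (F z) + P (F z) * E1 (F z) Y')) (at z)"
      using D(1)[rule_format, of F F' z] D(2)[rule_format, OF *]
        E(1)[rule_format, of F F' z] E(2)[rule_format, OF *]
      by (auto intro!: derivative_eq_intros simp: algebra_simps)
  next
    fix A B C show "D2 A B C * P' A + D1 A C * E1 A B + D1 A B * E1 A C + P A * E2 A B C =
        D2 A C B * P' A + D1 A B * E1 A C + D1 A C * E1 A B + P A * E2 A C B"
      using D(3)[rule_format, of A B C] E(3)[rule_format, of A B C] by simp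
  next
    fix L :: "complex^'n^'n \<Rightarrow> complex^'n^'n" assume "\<forall>i j. (\<lambda>A. L A $ i $ j) \<in> poly_fun UNIV"
    then show "(\<lambda>A. D1 A (L A) * P' A + P A * E1 A (L A)) \<in> poly_fun UNIV"
      using D(4) E(4) mult.hyps by (intro poly_fun.add poly_fun.mult) blast+
  qed (insert D(5,6) E(5,6), auto simp: algebra_simps)
qed

lemma
  fixes P :: "complex^'n^'n \<Rightarrow> complex"
  assumes "P \<in> poly_fun UNIV"
  shows pd_chain: "mat_deriv F F' z \<Longrightarrow> ((\<lambda>z. P (F z)) has_field_derivative pd P (F z) F') (at z)"
    and pd_add: "pd P A (B + C) = pd P A B + pd P A C"
    and pd_scale: "pd P A (scale_mat c B) = c * pd P A B"
    and pd_poly_fun: "(\<And>i j. (\<lambda>A. L A $ i $ j) \<in> poly_fun UNIV) \<Longrightarrow> (\<lambda>A. pd P A (L A)) \<in> poly_fun UNIV"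
    and pd_pd: "\<exists>D2. (\<forall>F F' Y Y' z. mat_deriv F F' z \<and> mat_deriv Y Y' z \<longrightarrow>
       ((\<lambda>z. pd P (F z) (Y z)) has_field_derivative D2 (F z) F' (Y z) + pd P (F z) Y') (at z)) \<and>
       (\<forall>A B C. D2 A B C = D2 A C B)"
proof -
  obtain D1 D2 where D: "\<forall>F F' z. mat_deriv F F' z \<longrightarrow> ((\<lambda>z. P (F z)) has_field_derivative D1 (F z) F') (at z)"
    "\<forall>F F' Y Y' z. mat_deriv F F' z \<and> mat_deriv Y Y' z \<longrightarrow>
       ((\<lambda>z. D1 (F z) (Y z)) has_field_derivative D2 (F z) F' (Y z) + D1 (F z) Y') (at z)"
    "\<forall>A B C. D2 A B C = D2 A C B"
    "\<forall>L. (\<forall>i j. (\<lambda>A. L A $ i $ j) \<in> poly_fun UNIV) \<longrightarrow> (\<lambda>A. D1 A (L A)) \<in> poly_fun UNIV"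
    "\<forall>A B C. D1 A (B + C) = D1 A B + D1 A C" "\<forall>A c B. D1 A (scale_mat c B) = c * D1 A B"
    using poly_fun_smooth[OF assms] by (elim exE conjE) blast
  \<comment> \<open>Differentiating along lines forces the witness \<open>D1\<close> to be
    \<open>pd\<close>, which turns the clauses of \<open>poly_fun_smooth\<close> into properties of
    \<open>pd\<close>.\<close>
  have "pd P A B = D1 A B" for A B
    unfolding pd_def using D(1)[rule_format, OF mat_deriv_affine, of A B 0]
    by (intro DERIV_imp_deriv) simp
  then have [simp]: "pd P = D1" by (intro ext)
  show "mat_deriv F F' z \<Longrightarrow> ((\<lambda>z. P (F z)) has_field_derivative pd P (F z) F') (at z)"
    using D(1) by simp
  show "pd P A (B + C) = pd P A B + pd P A C" using D(5) by simp
  show "pd P A (scale_mat c B) = c * pd P A B" using D(6) by simp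
  show "(\<And>i j. (\<lambda>A. L A $ i $ j) \<in> poly_fun UNIV) \<Longrightarrow> (\<lambda>A. pd P A (L A)) \<in> poly_fun UNIV"
    using D(4) by simp
  show "\<exists>D2. (\<forall>F F' Y Y' z. mat_deriv F F' z \<and> mat_deriv Y Y' z \<longrightarrow>
       ((\<lambda>z. pd P (F z) (Y z)) has_field_derivative D2 (F z) F' (Y z) + pd P (F z) Y') (at z)) \<and>
       (\<forall>A B C. D2 A B C = D2 A C B)"
    using D(2,3) by auto
qed

lemma pd_line: "P \<in> poly_fun UNIV \<Longrightarrow>
    ((\<lambda>t. P (A + scale_mat t B)) has_field_derivative pd P A B) (at 0)"
  using pd_chain[OF _ mat_deriv_affine, of P A B 0] by simp

lemma pd_unique:
  "P \<in> poly_fun UNIV \<Longrightarrow> ((\<lambda>t. P (A + scale_mat t B)) has_field_derivative d) (at 0) \<Longrightarrow> pd P A B = d"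
  using DERIV_unique[OF pd_line] by blast

lemma pd_fun_add: "P \<in> poly_fun UNIV \<Longrightarrow> P' \<in> poly_fun UNIV \<Longrightarrow>
    pd (\<lambda>A. P A + P' A) A B = pd P A B + pd P' A B"
  by (intro pd_unique poly_fun.add DERIV_add pd_line)

lemma pd_fun_mult: "P \<in> poly_fun UNIV \<Longrightarrow> P' \<in> poly_fun UNIV \<Longrightarrow>
    pd (\<lambda>A. P A * P' A) A B = pd P A B * P' A + P A * pd P' A B"
  apply (intro pd_unique poly_fun.mult)
    apply assumption+
  using DERIV_mult[OF pd_line[of P A B] pd_line[of P' A B]] by (simp add: mult.commute)

lemma pd_const: "pd (\<lambda>_. c) A B = 0"
  by (intro pd_unique poly_fun.const) auto

lemma pd_entry: "pd (\<lambda>A. A $ i $ j) A B = B $ i $ j"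
  by (intro pd_unique poly_fun.entry) (auto intro!: derivative_eq_intros)

lemma poly_fun_sum: "finite I \<Longrightarrow> 0 \<in> K \<Longrightarrow> (\<And>i. i \<in> I \<Longrightarrow> P i \<in> poly_fun K) \<Longrightarrow>
    (\<lambda>A. \<Sum>i\<in>I. P i A) \<in> poly_fun K"
  by (induction I rule: finite_induct) (auto intro: poly_fun.intros)

lemma poly_fun_prod: "finite I \<Longrightarrow> 1 \<in> K \<Longrightarrow> (\<And>i. i \<in> I \<Longrightarrow> P i \<in> poly_fun K) \<Longrightarrow>
    (\<lambda>A. \<Prod>i\<in>I. P i A) \<in> poly_fun K"
  by (induction I rule: finite_induct) (auto intro: poly_fun.intros)

lemma poly_fun_power: "1 \<in> K \<Longrightarrow> P \<in> poly_fun K \<Longrightarrow> (\<lambda>A. P A ^ m) \<in> poly_fun K"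
  by (induction m) (auto intro: poly_fun.intros)

lemma poly_fun_det: "det \<in> poly_fun UNIV"
proof -
  have "(\<lambda>A::complex^'n^'n. \<Sum>p\<in>{p. p permutes (UNIV::'n set)}. of_int (sign p) * (\<Prod>i\<in>UNIV. A $ i $ p i))
      \<in> poly_fun UNIV"
    by (intro poly_fun_sum poly_fun.mult poly_fun_prod) (auto intro: poly_fun.intros)
  then show ?thesis by (simp add: det_def[abs_def])
qed

lemma poly_fun_mult_left: "(\<lambda>A. (C ** A) $ i $ j) \<in> poly_fun UNIV"
  unfolding matrix_matrix_mult_def
  by (simp, intro poly_fun_sum poly_fun.mult) (auto intro: poly_fun.intros)

lemma poly_fun_mult_right: "(\<lambda>A. (A ** C) $ i $ j) \<in> poly_fun UNIV"
  unfolding matrix_matrix_mult_def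
  by (simp, intro poly_fun_sum poly_fun.mult) (auto intro: poly_fun.intros)

lemma poly_fun_compose:
  assumes "P \<in> poly_fun K" "\<And>i j. (\<lambda>A. L A $ i $ j) \<in> poly_fun K"
  shows "(\<lambda>A. P (L A)) \<in> poly_fun K"
  using assms by (induction rule: poly_fun.induct) (auto intro: poly_fun.intros)

text \<open>Used at the base point 1, where it makes the differential of a morphism over a subfield
  of the reals commute with complex conjugation.\<close>

lemma poly_fun_real:
  assumes "P \<in> poly_fun \<real>" "\<And>i j. A $ i $ j \<in> \<real>" "\<And>i j. B $ i $ j \<in> \<real>"
  shows "P A \<in> \<real> \<and> pd P A B \<in> \<real>"
  using assms
proof (induction rule: poly_fun.induct)
  case (add P P')
  then show ?case using pd_fun_add[OF poly_fun_UNIV poly_fun_UNIV, of P _ P'] by auto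
next
  case (mult P P')
  then show ?case using pd_fun_mult[OF poly_fun_UNIV poly_fun_UNIV, of P _ P'] by auto
qed (auto simp: pd_const pd_entry)

section \<open>The Lie algebra of an algebraic group\<close>

definition mult_closed :: "(complex^'n^'n) set \<Rightarrow> bool" where
  "mult_closed G \<longleftrightarrow> mat 1 \<in> G \<and> (\<forall>g\<in>G. \<forall>h\<in>G. g ** h \<in> G)"

lemma alg_group_mult_closed: "alg_group K G \<Longrightarrow> mult_closed G"
  by (simp add: alg_group_def mult_closed_def)

lemma lie_alg_iff: "X \<in> lie_alg G \<longleftrightarrow>
    (\<forall>P\<in>poly_fun UNIV. (\<forall>g\<in>G. P g = 0) \<longrightarrow> pd P (mat 1) X = 0)"
proof -
  have "((\<lambda>t. P (mat 1 + scale_mat t X)) has_field_derivative 0) (at 0) \<longleftrightarrow> pd P (mat 1) X = 0"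
    if "P \<in> poly_fun UNIV" for P
    using pd_unique[OF that] pd_line[OF that, of "mat 1" X] by metis
  then show ?thesis unfolding lie_alg_def by blast
qed

lemma lie_algD: "X \<in> lie_alg G \<Longrightarrow> P \<in> poly_fun UNIV \<Longrightarrow> (\<And>g. g \<in> G \<Longrightarrow> P g = 0) \<Longrightarrow> pd P (mat 1) X = 0"
  by (simp add: lie_alg_iff)

lemma lie_alg_add: "X \<in> lie_alg G \<Longrightarrow> Y \<in> lie_alg G \<Longrightarrow> X + Y \<in> lie_alg G"
  by (auto simp: lie_alg_iff pd_add)

lemma lie_alg_scale: "X \<in> lie_alg G \<Longrightarrow> scale_mat c X \<in> lie_alg G"
  by (auto simp: lie_alg_iff pd_scale)

lemma scale_mat_minus_one: "scale_mat (-1) X = - X"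
  by (simp add: vec_eq_iff)

lemma lie_alg_0: "0 \<in> lie_alg G"
  using pd_scale[of _ "mat 1" 0] by (auto simp: lie_alg_iff)

lemma mat_deriv_line1: "mat_deriv (\<lambda>t. A ** (mat 1 + scale_mat t X)) (A ** X) z"
  using mat_deriv_mult[OF mat_deriv_const[of A] mat_deriv_affine[of "mat 1" X]] by simp

lemma mat_deriv_line2: "mat_deriv (\<lambda>t. (mat 1 + scale_mat t X) ** A) (X ** A) z"
  using mat_deriv_mult[OF mat_deriv_affine[of "mat 1" X] mat_deriv_const[of A]] by simp

lemma pd_diff_arg: "P \<in> poly_fun UNIV \<Longrightarrow> pd P A (B - C) = pd P A B - pd P A C"
  using pd_add[of P A B "scale_mat (-1) C"] pd_scale[of P A "-1" C] by (simp add: scale_mat_minus_one)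

text \<open>The second derivative of \<open>P\<close> is symmetric; hence antisymmetrizing
  the derivative of \<open>g \<mapsto> pd P g (g X)\<close> leaves only the first-order term.\<close>

lemma pd_bracket:
  assumes P: "P \<in> poly_fun UNIV"
  shows "pd P (mat 1) (lie_bracket X Y) =
    pd (\<lambda>g. pd P g (g ** Y)) (mat 1) X - pd (\<lambda>g. pd P g (g ** X)) (mat 1) Y"
proof -
  obtain D2 where D: "\<forall>F F' Y Y' z. mat_deriv F F' z \<and> mat_deriv Y Y' z \<longrightarrow>
       ((\<lambda>z. pd P (F z) (Y z)) has_field_derivative D2 (F z) F' (Y z) + pd P (F z) Y') (at z)"
    and sym: "\<forall>A B C. D2 A B C = D2 A C B"
    using pd_pd[OF P] by (elim exE conjE)
  have *: "pd (\<lambda>g. pd P g (g ** X)) (mat 1) Y = D2 (mat 1) Y X + pd P (mat 1) (Y ** X)" for X Y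
  proof (rule pd_unique)
    show "(\<lambda>g. pd P g (g ** X)) \<in> poly_fun UNIV"
      by (intro pd_poly_fun P poly_fun_mult_right)
    show "((\<lambda>t. pd P (mat 1 + scale_mat t Y) ((mat 1 + scale_mat t Y) ** X)) has_field_derivative
       D2 (mat 1) Y X + pd P (mat 1) (Y ** X)) (at 0)"
      using D[rule_format, OF conjI, OF mat_deriv_affine[where A="mat 1" and B=Y and z=0] mat_deriv_line2[where A=X and X=Y]] by simp
  qed
  show ?thesis unfolding * lie_bracket_def using P sym[rule_format, of "mat 1" X Y] by (simp add: pd_diff_arg)
qed

text \<open>The ideal of \<open>G\<close> is stable under left and right translation by elements of
  \<open>G\<close>, so both invariant vector fields with value \<open>X\<close> at 1 annihilate it
  at every point of \<open>G\<close>, not only at 1.\<close>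

lemma pd_vanish:
  assumes "mult_closed G" "X \<in> lie_alg G" "P \<in> poly_fun UNIV" "\<And>g. g \<in> G \<Longrightarrow> P g = 0"
  shows "g \<in> G \<Longrightarrow> pd P g (g ** X) = 0" "g \<in> G \<Longrightarrow> pd P g (X ** g) = 0"
proof -
  assume g: "g \<in> G"
  have "pd (\<lambda>h. P (g ** h)) (mat 1) X = 0"
    using assms g
    by (intro lie_algD[OF assms(2)] poly_fun_compose[OF assms(3)] poly_fun_mult_left)
      (simp add: mult_closed_def)
  moreover have "pd (\<lambda>h. P (g ** h)) (mat 1) X = pd P g (g ** X)"
    using pd_chain[OF assms(3) mat_deriv_line1, of g X 0]
    by (intro pd_unique poly_fun_compose[OF assms(3)] poly_fun_mult_left) simp_all
  ultimately show "pd P g (g ** X) = 0" by simp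
  have "pd (\<lambda>h. P (h ** g)) (mat 1) X = 0"
    using assms g
    by (intro lie_algD[OF assms(2)] poly_fun_compose[OF assms(3)] poly_fun_mult_right)
      (simp add: mult_closed_def)
  moreover have "pd (\<lambda>h. P (h ** g)) (mat 1) X = pd P g (X ** g)"
    using pd_chain[OF assms(3) mat_deriv_line2, of X g 0]
    by (intro pd_unique poly_fun_compose[OF assms(3)] poly_fun_mult_right) simp_all
  ultimately show "pd P g (X ** g) = 0" by simp
qed

text \<open>By \<open>pd_vanish\<close> the function \<open>g\<close> to
  \<open>pd P g (g ** Z)\<close> again vanishes on \<open>G\<close>, so a second tangent vector
  kills it; \<open>pd_bracket\<close> writes the bracket as a difference of two such terms.\<close>

lemma lie_alg_bracket:
  assumes "mult_closed G" "X \<in> lie_alg G" "Y \<in> lie_alg G"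
  shows "lie_bracket X Y \<in> lie_alg G"
  unfolding lie_alg_iff
proof (intro ballI impI)
  fix P :: "complex^'a^'a \<Rightarrow> complex" assume P: "P \<in> poly_fun UNIV" "\<forall>g\<in>G. P g = 0"
  have "pd (\<lambda>g. pd P g (g ** Z)) (mat 1) W = 0" if "Z \<in> lie_alg G" "W \<in> lie_alg G" for Z W
    using P by (intro lie_algD[OF that(2)] pd_poly_fun P(1) poly_fun_mult_right
      pd_vanish(1)[OF assms(1) that(1) P(1)]) simp_all
  then show "pd P (mat 1) (lie_bracket X Y) = 0"
    using assms by (simp add: pd_bracket[OF P(1)])
qed

lemma lie_alg_Ad:
  assumes "mult_closed G" "X \<in> lie_alg G" "g \<in> G" "g' \<in> G" "g ** g' = mat 1"
  shows "g ** X ** g' \<in> lie_alg G"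
  unfolding lie_alg_iff
proof (intro ballI impI)
  fix P :: "complex^'a^'a \<Rightarrow> complex" assume P: "P \<in> poly_fun UNIV" "\<forall>g\<in>G. P g = 0"
  let ?P = "\<lambda>h. P (g ** h ** g')"
  have pf: "?P \<in> poly_fun UNIV"
    using poly_fun_compose[OF poly_fun_compose[OF P(1), of "\<lambda>h. h ** g'"], of "\<lambda>h. g ** h"]
    by (simp add: poly_fun_mult_left poly_fun_mult_right)
  have "pd ?P (mat 1) X = 0"
    using assms P by (intro lie_algD[OF assms(2) pf]) (simp add: mult_closed_def)
  moreover have "mat_deriv (\<lambda>t. g ** (mat 1 + scale_mat t X) ** g') (g ** X ** g') 0"
    using mat_deriv_mult[OF mat_deriv_line1[of g X] mat_deriv_const[of g']] by simp
  then have "pd ?P (mat 1) X = pd P (mat 1) (g ** X ** g')"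
    using pd_chain[OF P(1), of "\<lambda>t. g ** (mat 1 + scale_mat t X) ** g'" "g ** X ** g'" 0] assms(5)
    by (intro pd_unique pf) simp_all
  ultimately show "pd P (mat 1) (g ** X ** g') = 0" by simp
qed

section \<open>The differential of a morphism\<close>

text \<open>Stated for polynomial entries so that it applies both to the determinant, as a 1 by 1
  matrix, and to a rational morphism multiplied by its common denominator \<open>det g ^ M\<close>.
  Multiplicativity is available only on \<open>G\<close>; it yields information about
  \<open>D\<close> by differentiating polynomial identities that vanish on \<open>G\<close>.\<close>

lemma poly_hom_bracket:
  fixes P :: "'m::finite \<Rightarrow> 'm \<Rightarrow> complex^'n^'n \<Rightarrow> complex"
  assumes G: "mult_closed G" and P: "\<And>i j. P i j \<in> poly_fun UNIV"
    and mult: "\<And>g h. g \<in> G \<Longrightarrow> h \<in> G \<Longrightarrow> (\<chi> i j. P i j (g ** h)) = (\<chi> i j. P i j g) ** (\<chi> i j. P i j h :: complex^'m^'m)"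
    and one: "(\<chi> i j. P i j (mat 1)) = (mat 1 :: complex^'m^'m)"
    and X: "X \<in> lie_alg G" and Y: "Y \<in> lie_alg G"
  defines "D \<equiv> \<lambda>X. (\<chi> i j. pd (P i j) (mat 1) X) :: complex^'m^'m"
  shows "D (lie_bracket X Y) = lie_bracket (D X) (D Y)"
    and "g \<in> G \<Longrightarrow> g' \<in> G \<Longrightarrow> g ** g' = mat 1 \<Longrightarrow> g' ** g = mat 1 \<Longrightarrow>
      (\<chi> i j. P i j g) ** D X = D (g ** X ** g') ** (\<chi> i j. P i j g)"
proof -
  have mult': "P i j (g ** h) = (\<Sum>k\<in>UNIV. P i k g * P k j h)" if "g \<in> G" "h \<in> G" for i j g h
    using arg_cong[OF mult[OF that], of "\<lambda>A. A $ i $ j"] by (simp add: matrix_matrix_mult_def)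
  have one': "P i j (mat 1) = (if i = j then 1 else 0)" for i j
    using arg_cong[OF one, of "\<lambda>A. A $ i $ j"] by (simp add: mat_def)
  have left: "pd (P i j) g (g ** Z) = (\<Sum>k\<in>UNIV. P i k g * pd (P k j) (mat 1) Z)"
    if g: "g \<in> G" and Z: "Z \<in> lie_alg G" for g Z i j
  proof -
    let ?F = "\<lambda>h. P i j (g ** h) + - 1 * (\<Sum>k\<in>UNIV. P i k g * P k j h)"
    have F: "?F \<in> poly_fun UNIV"
      by (intro poly_fun.add poly_fun.mult poly_fun_sum poly_fun.const poly_fun_compose[OF P]
          poly_fun_mult_left P) auto
    have "pd ?F (mat 1) Z = 0" by (rule lie_algD[OF Z F]) (simp add: mult'[OF g])
    moreover have "pd ?F (mat 1) Z = pd (P i j) g (g ** Z) + - 1 * (\<Sum>k\<in>UNIV. P i k g * pd (P k j) (mat 1) Z)"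
      using pd_chain[OF P mat_deriv_line1, of i j g Z 0] pd_line[OF P, of _ j "mat 1" Z]
      by (intro pd_unique F DERIV_add DERIV_cmult DERIV_sum) simp_all
    ultimately show ?thesis by simp
  qed
  have right: "pd (P i j) g (Z ** g) = (\<Sum>k\<in>UNIV. pd (P i k) (mat 1) Z * P k j g)"
    if g: "g \<in> G" and Z: "Z \<in> lie_alg G" for g Z i j
  proof -
    let ?F = "\<lambda>h. P i j (h ** g) + - 1 * (\<Sum>k\<in>UNIV. P k j g * P i k h)"
    have F: "?F \<in> poly_fun UNIV"
      by (intro poly_fun.add poly_fun.mult poly_fun_sum poly_fun.const poly_fun_compose[OF P]
          poly_fun_mult_right P) auto
    have "pd ?F (mat 1) Z = 0" by (rule lie_algD[OF Z F]) (simp add: mult'[OF _ g] mult.commute)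
    moreover have "pd ?F (mat 1) Z = pd (P i j) g (Z ** g) + - 1 * (\<Sum>k\<in>UNIV. P k j g * pd (P i k) (mat 1) Z)"
      using pd_chain[OF P mat_deriv_line2, of i j Z g 0] pd_line[OF P, of i _ "mat 1" Z]
      by (intro pd_unique F DERIV_add DERIV_cmult DERIV_sum) simp_all
    ultimately show ?thesis by (simp add: mult.commute)
  qed
  \<comment> \<open>The identity \<open>left\<close> is again polynomial in \<open>g\<close> and
    valid on \<open>G\<close>, so it may be differentiated once more.\<close>
  have second: "pd (\<lambda>g. pd (P i j) g (g ** Z)) (mat 1) W =
      (\<Sum>k\<in>UNIV. pd (P i k) (mat 1) W * pd (P k j) (mat 1) Z)"
    if Z: "Z \<in> lie_alg G" and W: "W \<in> lie_alg G" for Z W i j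
  proof -
    let ?F = "\<lambda>g. pd (P i j) g (g ** Z) + - 1 * (\<Sum>k\<in>UNIV. P i k g * pd (P k j) (mat 1) Z)"
    have Q: "(\<lambda>g. pd (P i j) g (g ** Z)) \<in> poly_fun UNIV"
      by (intro pd_poly_fun P poly_fun_mult_right)
    have F: "?F \<in> poly_fun UNIV"
      by (intro poly_fun.add poly_fun.mult poly_fun_sum poly_fun.const Q P) auto
    have "pd ?F (mat 1) W = 0" by (rule lie_algD[OF W F]) (simp add: left[OF _ Z])
    moreover have "pd ?F (mat 1) W = pd (\<lambda>g. pd (P i j) g (g ** Z)) (mat 1) W
        + - 1 * (\<Sum>k\<in>UNIV. pd (P i k) (mat 1) W * pd (P k j) (mat 1) Z)"
      using pd_line[OF Q, of "mat 1" W] pd_line[OF P, of i _ "mat 1" W]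
      by (intro pd_unique F DERIV_add DERIV_cmult DERIV_sum DERIV_cmult_right) simp_all
    ultimately show ?thesis by simp
  qed
  show "D (lie_bracket X Y) = lie_bracket (D X) (D Y)"
    using X Y unfolding D_def by (simp add: vec_eq_iff pd_bracket[OF P] second)
      (simp add: lie_bracket_def matrix_matrix_mult_def)
  assume g: "g \<in> G" "g' \<in> G" "g ** g' = mat 1" "g' ** g = mat 1"
  have "g ** X ** g' ** g = g ** X" by (simp add: g(4) flip: matrix_mul_assoc)
  then show "(\<chi> i j. P i j g) ** D X = D (g ** X ** g') ** (\<chi> i j. P i j g)"
    using left[OF g(1) X] right[OF g(1) lie_alg_Ad[OF G X g(1,2,3)]]
    unfolding D_def by (simp add: vec_eq_iff matrix_matrix_mult_def)
qed

lemma rational_subset: "\<rat> \<subseteq> (\<real> :: complex set)"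
proof
  fix x :: complex assume "x \<in> \<rat>"
  then obtain a b where "x = of_int a / of_int b" by (auto elim: Rats_cases')
  then show "x \<in> \<real>" by auto
qed

lemma matrix_mult_nth: "(A ** B) $ i $ j = (\<Sum>k\<in>UNIV. A $ i $ k * B $ k $ j)"
  by (simp add: matrix_matrix_mult_def)

lemma mat_nth: "mat c $ i $ j = (if i = j then c else 0)"
  by (simp add: mat_def)

lemma mm_diff_left: "A ** (B - C) = A ** B - A ** (C :: complex^'p^'n)"
  and mm_diff_right: "(B' - C') ** A' = B' ** A' - C' ** (A' :: complex^'p^'n)"
  by (simp_all add: vec_eq_iff matrix_mult_nth algebra_simps sum_subtractf)

text \<open>The parameter runs through the punctured plane with base point 1 because the curves to
  come are one-parameter groups of the multiplicative group.\<close>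

lemma lie_alg_path:
  assumes F: "\<And>z. z \<noteq> 0 \<Longrightarrow> F z \<in> G" "F 1 = mat 1" "mat_deriv F F' 1"
  shows "F' \<in> lie_alg G"
  unfolding lie_alg_iff
  proof (intro ballI impI)
    have ev: "eventually (\<lambda>z::complex. z \<noteq> 0) (nhds 1)"
      by (rule t1_space_nhds) simp
    fix P :: "complex^'a^'a \<Rightarrow> complex" assume P: "P \<in> poly_fun UNIV" "\<forall>g\<in>G. P g = 0"
    have "((\<lambda>z. P (F z)) has_field_derivative pd P (F 1) F') (at 1)"
      by (rule pd_chain[OF P(1) F(3)])
    moreover have "((\<lambda>z. P (F z)) has_field_derivative 0) (at 1)"
      by (rule DERIV_cong_ev[THEN iffD2, OF refl _ refl, of _ "\<lambda>_. 0"]) (use ev P(2) F(1) in \<open>auto elim: eventually_mono\<close>)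
    ultimately show "pd P (mat 1) F' = 0" using DERIV_unique F(2) by metis
  qed

locale algebraic_hom =
  fixes K :: "complex set" and G :: "(complex^'n^'n) set" and H :: "(complex^'m^'m) set"
    and \<pi> :: "complex^'n^'n \<Rightarrow> complex^'m^'m"
  assumes G: "alg_group K G" and H: "\<And>h. h \<in> H \<Longrightarrow> invertible h" and hom: "alg_hom K G H \<pi>"
begin

abbreviation "\<rho> \<equiv> differential G \<pi>"

lemma G1: "mat 1 \<in> G" and Gm: "g \<in> G \<Longrightarrow> h \<in> G \<Longrightarrow> g ** h \<in> G"
  and Gi: "g \<in> G \<Longrightarrow> matrix_inv g \<in> G" and Ginv: "g \<in> G \<Longrightarrow> invertible g"
  using G by (auto simp: alg_group_def)

lemma Gmc: "mult_closed G" using G by (rule alg_group_mult_closed)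

lemma matrix_inv_mult: "invertible (g :: complex^'k^'k) \<Longrightarrow> g ** matrix_inv g = mat 1 \<and> matrix_inv g ** g = mat 1"
  unfolding invertible_def matrix_inv_def by (rule someI_ex)

lemma pi_mult: "g \<in> G \<Longrightarrow> h \<in> G \<Longrightarrow> \<pi> (g ** h) = \<pi> g ** \<pi> h"
  and pi_H: "g \<in> G \<Longrightarrow> \<pi> g \<in> H"
  using hom by (auto simp: alg_hom_def)

lemma pi_1: "\<pi> (mat 1) = mat 1"
proof -
  have "\<pi> (mat 1) ** \<pi> (mat 1) = \<pi> (mat 1)" using pi_mult[OF G1 G1] by simp
  moreover have "invertible (\<pi> (mat 1))" using H pi_H[OF G1] by blast
  ultimately show ?thesis
    by (metis matrix_inv_mult matrix_mul_assoc matrix_mul_rid)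
qed

lemma pi_inv: "g \<in> G \<Longrightarrow> \<pi> g ** \<pi> (matrix_inv g) = mat 1" "g \<in> G \<Longrightarrow> \<pi> (matrix_inv g) ** \<pi> g = mat 1"
  using pi_mult Gi matrix_inv_mult[OF Ginv] pi_1 by metis+

lemma det_G: "g \<in> G \<Longrightarrow> det g \<noteq> 0"
  using Ginv invertible_det_nz by blast

text \<open>Since \<open>det (mat 1) = 1\<close>, each side is the derivative at 1 of a quotient
  \<open>P / det ^ m\<close>. Clearing denominators gives a polynomial that vanishes on
  \<open>G\<close>, so in a tangent direction the choice of representative does not matter.\<close>

lemma regular_rep_cong_pd:
  assumes "regular_rep UNIV G f P m" "regular_rep UNIV G f P' m'" "X \<in> lie_alg G"
  shows "pd P (mat 1) X - of_nat m * P (mat 1) * pd det (mat 1) X =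
         pd P' (mat 1) X - of_nat m' * P' (mat 1) * pd det (mat 1) X"
proof -
  have P: "P \<in> poly_fun UNIV" "P' \<in> poly_fun UNIV" using assms by (auto simp: regular_rep_def)
  have eq: "P (mat 1) = P' (mat 1)" using assms G1 by (force simp: regular_rep_def)
  let ?F = "\<lambda>g. P g * det g ^ m' + - 1 * (P' g * det g ^ m)"
  have F: "?F \<in> poly_fun UNIV"
    by (intro poly_fun.add poly_fun.mult poly_fun.const P poly_fun_power poly_fun_det) auto
  have "pd ?F (mat 1) X = 0"
  proof (rule lie_algD[OF assms(3) F])
    fix g assume g: "g \<in> G"
    then have "P g / det g ^ m = P' g / det g ^ m'"
      using assms(1,2) by (metis regular_rep_def)
    then show "?F g = 0" using det_G[OF g] by (simp add: field_simps)
  qed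
  moreover have "pd ?F (mat 1) X =
    (pd P (mat 1) X + P (mat 1) * (of_nat m' * pd det (mat 1) X)) +
     - 1 * (pd P' (mat 1) X + P' (mat 1) * (of_nat m * pd det (mat 1) X))"
    by (rule pd_unique[OF F])
      (auto intro!: derivative_eq_intros pd_line P poly_fun_det simp: algebra_simps)
  ultimately show ?thesis by (simp add: eq algebra_simps)
qed

lemma regular_path:
  assumes "P \<in> poly_fun UNIV" "mat_deriv F F' z" "F z = mat 1"
  shows "((\<lambda>t. P (F t) / det (F t) ^ m) has_field_derivative
    pd P (mat 1) F' - of_nat m * P (mat 1) * pd det (mat 1) F') (at z)"
  using pd_chain[OF assms(1,2)] pd_chain[OF poly_fun_det assms(2)]
  by (auto intro!: derivative_eq_intros simp: assms(3) det_I)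

lemma ex_regular_rep:
  obtains P M where "\<And>i j. regular_rep UNIV G (\<lambda>g. \<pi> g $ i $ j) (P i j) M"
proof -
  have "\<forall>i j. \<exists>P m. regular_rep UNIV G (\<lambda>g. \<pi> g $ i $ j) P m"
    using hom poly_fun_UNIV[of _ K] unfolding alg_hom_def regular_rep_def by metis
  then obtain P m where P: "\<And>i j. regular_rep UNIV G (\<lambda>g. \<pi> g $ i $ j) (P i j) (m i j)" by metis
  define M where "M = (\<Sum>i\<in>UNIV. \<Sum>j\<in>UNIV. m i j)"
  have "m i j \<le> M" for i j
    unfolding M_def using member_le_sum[of j UNIV "m i"] member_le_sum[of i UNIV "\<lambda>i. \<Sum>j\<in>UNIV. m i j"]
    by (simp add: order_trans[of "m i j"])
  then have M: "det g ^ M = det g ^ (M - m i j) * det g ^ m i j" for g :: "complex^'n^'n" and i j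
    by (simp flip: power_add)
  have "regular_rep UNIV G (\<lambda>g. \<pi> g $ i $ j) (\<lambda>g. P i j g * det g ^ (M - m i j)) M" for i j
    using P[of i j] det_G unfolding regular_rep_def M[of _ i j]
    by (auto intro!: poly_fun.mult poly_fun_power poly_fun_det)
  then show ?thesis by (rule that)
qed

text \<open>The description in \<open>differential\<close> has exactly one solution: representatives
  with a common denominator give one, and every entry has some representative that determines its
  derivative.\<close>

lemma differential_entry:
  assumes "X \<in> lie_alg G" "regular_rep UNIV G (\<lambda>g. \<pi> g $ i $ j) P m"
  shows "\<rho> X $ i $ j = pd P (mat 1) X - of_nat m * P (mat 1) * pd det (mat 1) X"
proof -
  obtain P0 M where P0: "\<And>i j. regular_rep UNIV G (\<lambda>g. \<pi> g $ i $ j) (P0 i j) M"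
    using ex_regular_rep by blast
  define Y where "Y = (\<chi> i j. pd (P0 i j) (mat 1) X - of_nat M * P0 i j (mat 1) * pd det (mat 1) X)"
  have line: "((\<lambda>t. P (mat 1 + scale_mat t X) / det (mat 1 + scale_mat t X) ^ m) has_field_derivative
    pd P (mat 1) X - of_nat m * P (mat 1) * pd det (mat 1) X) (at 0)"
    if "regular_rep UNIV G (\<lambda>g. \<pi> g $ i $ j) P m" for i j P m
    using that by (intro regular_path mat_deriv_affine) (auto simp: regular_rep_def)
  have Y: "Y $ i $ j = pd P (mat 1) X - of_nat m * P (mat 1) * pd det (mat 1) X"
    if "regular_rep UNIV G (\<lambda>g. \<pi> g $ i $ j) P m" for i j P m
    unfolding Y_def using regular_rep_cong_pd[OF P0 that assms(1)] by simp
  have "\<rho> X = Y" unfolding differential_def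
  proof (rule the_equality)
    show "\<forall>i j P m. regular_rep UNIV G (\<lambda>g. \<pi> g $ i $ j) P m \<longrightarrow>
        ((\<lambda>t. P (mat 1 + scale_mat t X) / det (mat 1 + scale_mat t X) ^ m)
           has_field_derivative (Y $ i $ j)) (at 0)"
      using line Y by simp
  next
    fix Z assume "\<forall>i j P m. regular_rep UNIV G (\<lambda>g. \<pi> g $ i $ j) P m \<longrightarrow>
        ((\<lambda>t. P (mat 1 + scale_mat t X) / det (mat 1 + scale_mat t X) ^ m)
           has_field_derivative (Z $ i $ j)) (at 0)"
    then have "Z $ i $ j = Y $ i $ j" for i j
      unfolding Y[OF P0] using P0[of i j] by (intro DERIV_unique[OF _ line[OF P0, of i j]]) blast
    then show "Z = Y" by (simp add: vec_eq_iff)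
  qed
  then show ?thesis using Y[OF assms(2)] by simp
qed

lemma differential_add: "X \<in> lie_alg G \<Longrightarrow> Y \<in> lie_alg G \<Longrightarrow> \<rho> (X + Y) = \<rho> X + \<rho> Y"
  and differential_scale: "X \<in> lie_alg G \<Longrightarrow> \<rho> (scale_mat c X) = scale_mat c (\<rho> X)"
  and differential_bracket: "X \<in> lie_alg G \<Longrightarrow> Y \<in> lie_alg G \<Longrightarrow>
        \<rho> (lie_bracket X Y) = lie_bracket (\<rho> X) (\<rho> Y)"
  and differential_Ad: "X \<in> lie_alg G \<Longrightarrow> g \<in> G \<Longrightarrow> \<pi> g ** \<rho> X = \<rho> (g ** X ** matrix_inv g) ** \<pi> g"
proof -
  obtain P M where P: "\<And>i j. regular_rep UNIV G (\<lambda>g. \<pi> g $ i $ j) (P i j) M"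
    using ex_regular_rep by blast
  have pf: "P i j \<in> poly_fun UNIV" for i j using P by (simp add: regular_rep_def)
  have Pg: "P i j g = det g ^ M * \<pi> g $ i $ j" if "g \<in> G" for i j g
    using P[of i j] det_G[OF that] that by (simp add: regular_rep_def)
  have P1: "P i j (mat 1) = (if i = j then 1 else 0)" for i j
    using Pg[OF G1, of i j] by (simp add: pi_1) (simp add: mat_def)
  have \<rho>: "\<rho> X $ i $ j = pd (P i j) (mat 1) X - of_nat M * (if i = j then 1 else 0) * pd det (mat 1) X"
    if "X \<in> lie_alg G" for X i j
    using differential_entry[OF that P] by (simp add: P1)
  define D where "D X = (\<chi> i j. pd (P i j) (mat 1) X)" for X
  define Pm where "Pm g = (\<chi> i j. P i j g)" for g
  \<comment> \<open>The quotient rule contributes a scalar matrix, which commutes with everything;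
    so \<open>\<rho>\<close> and \<open>D\<close> give the same brackets.\<close>
  have \<rho>': "\<rho> X = D X - mat (of_nat M * pd det (mat 1) X)" if "X \<in> lie_alg G" for X
    by (simp add: vec_eq_iff \<rho>[OF that] D_def mat_def)
  show "X \<in> lie_alg G \<Longrightarrow> Y \<in> lie_alg G \<Longrightarrow> \<rho> (X + Y) = \<rho> X + \<rho> Y"
    by (simp add: vec_eq_iff \<rho> lie_alg_add pd_add pf poly_fun_det algebra_simps)
  show "X \<in> lie_alg G \<Longrightarrow> \<rho> (scale_mat c X) = scale_mat c (\<rho> X)"
    by (simp add: vec_eq_iff \<rho> lie_alg_scale pd_scale pf poly_fun_det algebra_simps)
  have Pm: "Pm g = scale_mat (det g ^ M) (\<pi> g)" if "g \<in> G" for g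
    by (simp add: vec_eq_iff Pm_def Pg[OF that])
  have "Pm (g ** h) = Pm g ** Pm h" if "g \<in> G" "h \<in> G" for g h
    using that by (simp add: Pm Gm vec_eq_iff matrix_mult_nth pi_mult det_mul power_mult_distrib
      sum_distrib_left mult_ac)
  moreover have "Pm (mat 1) = mat 1" by (simp add: vec_eq_iff Pm_def P1) (simp add: mat_def)
  ultimately have hyp: "g \<in> G \<Longrightarrow> h \<in> G \<Longrightarrow> (\<chi> i j. P i j (g ** h)) = (\<chi> i j. P i j g) ** (\<chi> i j. P i j h)"
    "(\<chi> i j. P i j (mat 1)) = mat 1" for g h
    by (simp_all add: Pm_def)
  note main = poly_hom_bracket[OF Gmc pf hyp, folded D_def Pm_def]
  \<comment> \<open>The determinant is viewed as a morphism to 1 by 1 matrices. These commute, so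
    its derivative vanishes on brackets and is invariant under conjugation.\<close>
  let ?d = "\<lambda>(_::1) (_::1). det :: complex^'n^'n \<Rightarrow> complex"
  have dh: "(\<chi> i j. ?d i j (g ** h)) = (\<chi> i j. ?d i j g) ** (\<chi> i j. ?d i j h)"
    "(\<chi> i j. ?d i j (mat 1)) = mat 1" for g h
    by (simp_all add: vec_eq_iff matrix_mult_nth mat_nth det_mul)
  note detm = poly_hom_bracket[OF Gmc poly_fun_det dh(1,2)]
  have det_br: "pd det (mat 1) (lie_bracket X Y) = 0" if "X \<in> lie_alg G" "Y \<in> lie_alg G" for X Y
    using arg_cong[OF detm(1)[OF that], of "\<lambda>A. A $ 1 $ 1"]
    by (simp add: lie_bracket_def matrix_matrix_mult_def)
  have det_Ad: "pd det (mat 1) (g ** X ** matrix_inv g) = pd det (mat 1) X"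
    if "X \<in> lie_alg G" "g \<in> G" for X g
    using arg_cong[OF detm(2)[OF that(1,1,2) Gi[OF that(2)]], of "\<lambda>A. A $ 1 $ 1"] det_G[OF that(2)]
      matrix_inv_mult[OF Ginv[OF that(2)]]
    by (simp add: matrix_matrix_mult_def)
  have matm: "A ** mat c = scale_mat c A" "mat c ** A = scale_mat c A" for A :: "complex^'m^'m" and c
    by (simp_all add: vec_eq_iff matrix_matrix_mult_def mat_def if_distrib if_distribR cong: if_cong)
  show "\<rho> (lie_bracket X Y) = lie_bracket (\<rho> X) (\<rho> Y)" if X: "X \<in> lie_alg G" and Y: "Y \<in> lie_alg G"
  proof -
    have "\<rho> (lie_bracket X Y) = lie_bracket (D X) (D Y)"
      using \<rho>'[OF lie_alg_bracket[OF Gmc X Y]] main(1)[OF _ _ X Y] det_br[OF X Y]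
      by (simp add: vec_eq_iff mat_def)
    also have "\<dots> = lie_bracket (\<rho> X) (\<rho> Y)"
      by (simp add: \<rho>' X Y lie_bracket_def mm_diff_left mm_diff_right matm)
        (simp add: vec_eq_iff mat_nth algebra_simps)
    finally show ?thesis .
  qed
  show "\<pi> g ** \<rho> X = \<rho> (g ** X ** matrix_inv g) ** \<pi> g" if X: "X \<in> lie_alg G" and g: "g \<in> G"
  proof -
    let ?X = "g ** X ** matrix_inv g"
    note i = matrix_inv_mult[OF Ginv[OF g], THEN conjunct1] matrix_inv_mult[OF Ginv[OF g], THEN conjunct2]
    have X': "?X \<in> lie_alg G" by (rule lie_alg_Ad[OF Gmc X g Gi[OF g] i(1)])
    have "Pm g ** D X = D ?X ** Pm g" using main(2)[OF _ _ X X g Gi[OF g] i] by simp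
    then have "scale_mat (det g ^ M) (\<pi> g ** D X) = scale_mat (det g ^ M) (D ?X ** \<pi> g)"
      unfolding Pm[OF g] by (simp add: vec_eq_iff matrix_matrix_mult_def sum_distrib_left mult_ac)
    then have "\<pi> g ** D X = D ?X ** \<pi> g" using det_G[OF g] by (simp add: vec_eq_iff)
    then show ?thesis
      by (simp add: \<rho>' X X' mm_diff_left mm_diff_right matm det_Ad[OF X g])
  qed
qed

lemma lie_alg_conj: "X \<in> lie_alg G \<Longrightarrow> g \<in> G \<Longrightarrow> g ** X ** matrix_inv g \<in> lie_alg G"
  using lie_alg_Ad[OF Gmc _ _ Gi] matrix_inv_mult[OF Ginv] by blast

lemma differential_real:
  assumes "K \<subseteq> \<real>" "X \<in> lie_alg G" "\<And>i j. X $ i $ j \<in> \<real>"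
  shows "\<rho> X $ i $ j \<in> \<real>"
proof -
  obtain P m where P: "regular_rep K G (\<lambda>g. \<pi> g $ i $ j) P m"
    using hom unfolding alg_hom_def by blast
  then have PK: "P \<in> poly_fun \<real>" using poly_fun_mono[OF _ assms(1)] by (auto simp: regular_rep_def)
  have "regular_rep UNIV G (\<lambda>g. \<pi> g $ i $ j) P m" using P poly_fun_UNIV by (auto simp: regular_rep_def)
  note 1 = differential_entry[OF assms(2) this]
  have "(det :: complex^'n^'n \<Rightarrow> complex) \<in> poly_fun \<real>"
  proof -
    have "(\<lambda>A::complex^'n^'n. \<Sum>p\<in>{p. p permutes (UNIV::'n set)}. of_int (sign p) * (\<Prod>i\<in>UNIV. A $ i $ p i))
        \<in> poly_fun \<real>"
      by (intro poly_fun_sum poly_fun.mult poly_fun_prod) (auto intro: poly_fun.intros)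
    then show ?thesis by (simp add: det_def[abs_def])
  qed
  then have "pd det (mat 1) X \<in> \<real>" "pd P (mat 1) X \<in> \<real>" "P (mat 1) \<in> \<real>"
    using poly_fun_real[OF _ _ assms(3), of _ "mat 1"] PK by (auto simp: mat_def)
  then show ?thesis unfolding 1 by auto
qed

lemma differential_path:
  assumes F: "\<And>z. z \<noteq> 0 \<Longrightarrow> F z \<in> G" "F 1 = mat 1" "mat_deriv F F' 1"
  shows "F' \<in> lie_alg G" and "mat_deriv (\<lambda>z. \<pi> (F z)) (\<rho> F') 1"
proof -
  have ev: "eventually (\<lambda>z::complex. z \<noteq> 0) (nhds 1)"
    by (rule t1_space_nhds) simp
  show F': "F' \<in> lie_alg G" by (rule lie_alg_path[OF F])
  show "mat_deriv (\<lambda>z. \<pi> (F z)) (\<rho> F') 1" unfolding mat_deriv_def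
  proof (intro allI)
    fix i j
    obtain P M where P: "\<And>i j. regular_rep UNIV G (\<lambda>g. \<pi> g $ i $ j) (P i j) M"
      using ex_regular_rep by blast
    have "((\<lambda>z. P i j (F z) / det (F z) ^ M) has_field_derivative \<rho> F' $ i $ j) (at 1)"
      unfolding differential_entry[OF F' P] using P[of i j]
      by (intro regular_path[OF _ F(3,2)]) (simp add: regular_rep_def)
    then show "((\<lambda>z. \<pi> (F z) $ i $ j) has_field_derivative \<rho> F' $ i $ j) (at 1)"
      by (rule DERIV_cong_ev[THEN iffD1, rotated -1])
        (use ev P F(1) in \<open>auto simp: regular_rep_def elim!: eventually_mono\<close>)
  qed
qed

end

section \<open>Eigenvectors\<close>

text \<open>Applying \<open>A - a\<close> removes the summand with eigenvalue \<open>a\<close> and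
  multiplies the others by the nonzero numbers \<open>k - a\<close>. Indexing by the eigenvalues
  themselves makes them distinct; \<open>W = {0}\<close> gives the independence of
  eigenvectors.\<close>

lemma eigen_sum_in_stable:
  fixes A :: "complex^'v^'v"
  assumes "finite S" "\<And>k. k \<in> S \<Longrightarrow> A *v f k = k *s f k" "(\<Sum>k\<in>S. f k) \<in> W"
    and W: "vec.subspace W" "\<And>x. x \<in> W \<Longrightarrow> A *v x \<in> W"
  shows "k \<in> S \<Longrightarrow> f k \<in> W"
  using assms(1-3)
proof (induction S arbitrary: f k rule: finite_induct)
  case (insert a S)
  let ?s = "\<Sum>k\<in>insert a S. f k"
  have "A *v ?s - a *s ?s = (\<Sum>k\<in>insert a S. A *v f k - a *s f k)"
    by (simp only: vec.linear_sum[OF matrix_vector_mul_linear_gen] vec.scale_sum_right sum_subtractf)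
  also have "\<dots> = (\<Sum>k\<in>S. (k - a) *s f k)"
    using insert by (simp add: vec.scale_left_diff_distrib)
  finally have sW: "(\<Sum>k\<in>S. (k - a) *s f k) \<in> W"
    using vec.subspace_diff[OF W(1) W(2)[OF insert.prems(3)] vec.subspace_scale[OF W(1) insert.prems(3), of a]]
    by simp
  have *: "(k - a) *s f k \<in> W" if "k \<in> S" for k
  proof (rule insert.IH[OF that _ sW])
    fix k assume "k \<in> S"
    then have "A *v f k = k *s f k" using insert.prems(2) by blast
    then show "A *v ((k - a) *s f k) = k *s ((k - a) *s f k)"
      by (simp only: vector_scalar_commute vector_smult_assoc mult.commute)
  qed
  have S: "f k \<in> W" if "k \<in> S" for k
  proof -
    have "k - a \<noteq> 0" using that insert.hyps by auto
    then have "f k = inverse (k - a) *s ((k - a) *s f k)" by (simp only: vector_smult_assoc left_inverse vector_smult_lid not_False_eq_True)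
    then show ?thesis using vec.subspace_scale[OF W(1) *[OF that], of "inverse (k - a)"] by simp
  qed
  have "?s - (\<Sum>k\<in>S. f k) \<in> W"
    by (rule vec.subspace_diff[OF W(1) insert.prems(3) vec.subspace_sum[OF W(1) S]])
  then have "f a \<in> W" using insert.hyps by simp
  then show ?case using S insert.prems(1) by auto
qed simp

lemma eigen_decomposition:
  fixes A :: "complex^'v^'v"
  assumes "x \<in> vec.span {y. \<exists>k\<in>L. A *v y = k *s y}"
  obtains S f where "finite S" "S \<subseteq> L" "\<And>k. k \<in> S \<Longrightarrow> A *v f k = k *s f k" "x = (\<Sum>k\<in>S. f k)"
proof -
  have "\<exists>S f. finite S \<and> S \<subseteq> L \<and> (\<forall>k\<in>S. A *v f k = k *s f k) \<and> x = (\<Sum>k\<in>S. f k)" (is "?P x")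
    using assms
  proof (induction rule: vec.span_induct_alt)
    case base show ?case by (rule exI[of _ "{}"]) simp
  next
    case (step c y z)
    then obtain k S f where *: "k \<in> L" "A *v y = k *s y" "finite S" "S \<subseteq> L"
      "\<forall>k\<in>S. A *v f k = k *s f k" "z = (\<Sum>k\<in>S. f k)" by auto
    let ?g = "\<lambda>j. (if j = k then c *s y else 0) + (if j \<in> S then f j else 0)"
    have "c *s y + z = (\<Sum>j\<in>insert k S. ?g j)"
      proof -
      have "(\<Sum>j\<in>insert k S. if j \<in> S then f j else 0) = z"
        unfolding *(6) using *(3) by (intro sum.mono_neutral_cong_right) auto
      then show ?thesis unfolding sum.distrib using *(3) by simp
    qed
    then show ?case using * 
      by (intro exI[of _ "insert k S"] exI[of _ ?g])
        (auto simp: vec.scale_right_distrib matrix_vector_right_distrib vector_scalar_commute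
          vector_smult_assoc mult.commute)
  qed
  then show ?thesis using that by blast
qed

lemma eigen_span_zero:
  fixes A :: "complex^'v^'v"
  assumes "x \<in> vec.span {y. \<exists>k\<in>L. A *v y = k *s y}" "A *v x = a *s x" "a \<notin> L"
  shows "x = 0"
proof -
  from assms(1) obtain S f where S: "finite S" "S \<subseteq> L" "\<And>k. k \<in> S \<Longrightarrow> A *v f k = k *s f k"
    "x = (\<Sum>k\<in>S. f k)" by (rule eigen_decomposition) blast
  then have a: "a \<notin> S" using assms(3) by auto
  have "(\<Sum>k\<in>S. (f(a := - x)) k) = x"
    unfolding S(4) using a by (intro sum.cong) auto
  then have "(\<Sum>k\<in>insert a S. (f(a := - x)) k) = 0"
    using S(1) a by simp
  moreover have "A *v (f(a := - x)) k = k *s (f(a := - x)) k" if "k \<in> insert a S" for k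
  proof (cases "k = a")
    case True
    then show ?thesis using assms(2) by (simp add: vec.neg)
  next
    case False
    then show ?thesis using S(3)[of k] that by simp
  qed
  ultimately have "(f(a := - x)) a \<in> {0}"
    by (intro eigen_sum_in_stable[of "insert a S" A "f(a := - x)" "{0}" a])
      (simp_all only: finite_insert S(1) insertI1 singleton_iff vec.subspace_single_0 matrix_vector_mult_0_right)
  then show ?thesis by simp
qed

section \<open>Diagonalizability and the exclusion of Jordan blocks\<close>

definition diagonalizable :: "complex^'v^'v \<Rightarrow> bool" where
  "diagonalizable A \<longleftrightarrow> vec.span {y. \<exists>k. A *v y = k *s y} = UNIV"

lemma diagonalizable_stable:
  fixes A :: "complex^'v^'v"
  assumes "diagonalizable A" "vec.subspace W" "\<And>x. x \<in> W \<Longrightarrow> A *v x \<in> W" "x \<in> W"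
  shows "x \<in> vec.span {y\<in>W. \<exists>k. A *v y = k *s y}"
proof -
  have "x \<in> vec.span {y. \<exists>k\<in>UNIV. A *v y = k *s y}" using assms(1) by (simp add: diagonalizable_def)
  then obtain S f where S: "finite S" "\<And>k. k \<in> S \<Longrightarrow> A *v f k = k *s f k" "x = (\<Sum>k\<in>S. f k)"
    by (rule eigen_decomposition) blast
  have "f k \<in> W" if "k \<in> S" for k
    by (rule eigen_sum_in_stable[of S A f W, OF S(1,2) _ assms(2,3) that]) (use S(3) assms(4) in auto)
  then show ?thesis unfolding S(3) using S(2) by (intro vec.span_sum vec.span_base) blast
qed

text \<open>No Jordan block of size two: \<open>y\<close> is a combination of eigenvectors with
  eigenvalues different from \<open>a\<close>, and at the same time satisfies the eigenvector
  equation for \<open>a\<close>.\<close>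

lemma diagonalizable_double:
  fixes A :: "complex^'v^'v"
  assumes "diagonalizable A" "y = A *v x - a *s x" "A *v y = a *s y"
  shows "y = 0"
proof -
  have "x \<in> vec.span {y. \<exists>k\<in>UNIV. A *v y = k *s y}" using assms(1) by (simp add: diagonalizable_def)
  then obtain S f where S: "finite S" "\<And>k. k \<in> S \<Longrightarrow> A *v f k = k *s f k" "x = (\<Sum>k\<in>S. f k)"
    by (rule eigen_decomposition) blast
  have "y = (\<Sum>k\<in>S. A *v f k - a *s f k)"
    unfolding assms(2) S(3)
    by (simp only: vec.linear_sum[OF matrix_vector_mul_linear_gen] vec.scale_sum_right sum_subtractf)
  also have "\<dots> = (\<Sum>k\<in>S. (k - a) *s f k)" using S(2) by (simp add: vec.scale_left_diff_distrib)
  also have "\<dots> \<in> vec.span {y. \<exists>k\<in>-{a}. A *v y = k *s y}"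
  proof (intro vec.span_sum)
    fix k assume k: "k \<in> S"
    show "(k - a) *s f k \<in> vec.span {y. \<exists>k\<in>-{a}. A *v y = k *s y}"
    proof (cases "k = a")
      case False
      then show ?thesis using S(2)[OF k] by (intro vec.span_scale vec.span_base) auto
    qed (simp add: vec.span_zero)
  qed
  finally show ?thesis using eigen_span_zero[OF _ assms(3)] by blast
qed

text \<open>The same exclusion for \<open>ad A\<close>. If \<open>u\<close> is an eigenvector of
  \<open>A\<close> for \<open>k\<close>, then the vectors \<open>Z *v u\<close> and
  \<open>Y *v u\<close> would form a Jordan block of \<open>A\<close> for the eigenvalue
  \<open>k + c\<close>.\<close>

lemma diagonalizable_ad_double:
  fixes A :: "complex^'n^'n"
  assumes "diagonalizable A" "Y = lie_bracket A Z - scale_mat c Z" "lie_bracket A Y = scale_mat c Y"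
  shows "Y = 0"
proof -
  have scale: "scale_mat c M *v u = c *s (M *v u)" for M :: "complex^'n^'n" and u
    by (simp add: vec_eq_iff matrix_vector_mult_def sum_distrib_left mult.assoc)
  have zero: "Y *v u = 0" if u: "A *v u = k *s u" for u k
  proof (rule diagonalizable_double[OF assms(1), of _ "Z *v u" "k + c"])
    show "Y *v u = A *v (Z *v u) - (k + c) *s (Z *v u)"
      unfolding assms(2) lie_bracket_def
      by (simp add: matrix_vector_mult_diff_rdistrib scale flip: matrix_vector_mul_assoc)
        (simp add: u vector_scalar_commute vec.scale_left_distrib)
    have "A *v (Y *v u) - Y *v (A *v u) = c *s (Y *v u)"
      using arg_cong[OF assms(3), of "\<lambda>M. M *v u"]
      by (simp add: lie_bracket_def matrix_vector_mult_diff_rdistrib scale matrix_vector_mul_assoc)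
    then show "A *v (Y *v u) = (k + c) *s (Y *v u)"
      by (simp add: u vector_scalar_commute vec.scale_left_distrib algebra_simps)
  qed
  have "Y *v u = 0" for u
  proof -
    have "u \<in> vec.span {y. \<exists>k. A *v y = k *s y}" using assms(1) by (simp add: diagonalizable_def)
    then show ?thesis
    proof (induction rule: vec.span_induct_alt)
      case (step c x y)
      then have "Y *v x = 0" using zero by blast
      then show ?case using step by (simp add: matrix_vector_right_distrib vector_scalar_commute)
    qed simp
  qed
  then show ?thesis by (metis matrix_eq matrix_vector_mult_0)
qed

text \<open>The value at \<open>x\<close> of the polynomial \<open>p\<close> in \<open>A\<close>.
  The cutoff \<open>N\<close> replaces the degree so that a polynomial and its factors are evaluated
  by sums of the same length.\<close>

definition poly_vec :: "nat \<Rightarrow> complex poly \<Rightarrow> complex^'v^'v \<Rightarrow> complex^'v \<Rightarrow> complex^'v" where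
  "poly_vec N p A x = (\<Sum>i<N. coeff p i *s (((*v) A) ^^ i) x)"

lemma funpow_mv_linear:
  "(((*v) (A::complex^'v^'v)) ^^ i) (x - a *s y) = (((*v) A) ^^ i) x - a *s (((*v) A) ^^ i) y"
  by (induction i arbitrary: x y) (simp_all add: matrix_vector_mult_diff_distrib vector_scalar_commute)

lemma poly_vec_mult:
  assumes "degree q + 1 < N"
  shows "poly_vec N ([:- a, 1:] * q) A x = poly_vec N q A (A *v x - a *s x)"
proof -
  obtain M where N: "N = Suc M" using assms by (cases N) auto
  have c: "coeff q M = 0" using assms N by (intro coeff_eq_0) simp
  have "poly_vec N ([:- a, 1:] * q) A x =
     (\<Sum>i<Suc M. (- a * coeff q i) *s (((*v) A) ^^ i) x) + (\<Sum>i<Suc M. coeff (pCons 0 q) i *s (((*v) A) ^^ i) x)"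
    unfolding poly_vec_def N by (simp add: vec.scale_left_distrib sum.distrib[symmetric] mult.commute del: sum.lessThan_Suc)
  also have "(\<Sum>i<Suc M. coeff (pCons 0 q) i *s (((*v) A) ^^ i) x) = (\<Sum>i<Suc M. coeff q i *s (((*v) A) ^^ i) (A *v x))"
    unfolding sum.lessThan_Suc_shift[of "\<lambda>i. coeff (pCons 0 q) i *s _ i"] by (simp add: c funpow_swap1)
  finally show ?thesis
    unfolding poly_vec_def N funpow_mv_linear
    by (simp add: sum.distrib[symmetric] vec.scale_right_diff_distrib vector_smult_assoc mult.commute del: sum.lessThan_Suc)
qed

text \<open>Roots of a polynomial annihilating \<open>x\<close> are peeled off one at a time: by
  \<open>step\<close>, a vector lies in the span of the eigenvectors as soon as its image under
  \<open>A - a\<close> does. This criterion allows diagonalizability to be carried through a Lie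
  algebra isomorphism, which does not relate eigenvectors.\<close>

lemma double_kernel_diagonalizable:
  fixes A :: "complex^'v^'v"
  assumes dbl: "\<And>x y a. y = A *v x - a *s x \<Longrightarrow> A *v y = a *s y \<Longrightarrow> y = 0"
  shows "diagonalizable A"
proof -
  let ?E = "vec.span {y. \<exists>k. A *v y = k *s y}"
  have step: "x \<in> ?E" if "A *v x - a *s x \<in> ?E" for a x
  proof -
    have "A *v x - a *s x \<in> vec.span {y. \<exists>k\<in>UNIV. A *v y = k *s y}" using that by simp
    then obtain S f where S: "finite S" "\<And>k. k \<in> S \<Longrightarrow> A *v f k = k *s f k"
      "A *v x - a *s x = (\<Sum>k\<in>S. f k)" by (rule eigen_decomposition) blast
    \<comment> \<open>\<open>u\<close> inverts \<open>A - a\<close> on the components with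
      eigenvalues other than \<open>a\<close>; what remains of \<open>A *v x - a *s x\<close> is
      killed by \<open>A - a\<close>, so \<open>dbl\<close> applies to \<open>x - u\<close>.\<close>
    define u where "u = (\<Sum>k\<in>S-{a}. inverse (k - a) *s f k)"
    have u: "A *v u - a *s u = (\<Sum>k\<in>S-{a}. f k)"
    proof -
      have "A *v u - a *s u = (\<Sum>k\<in>S-{a}. A *v (inverse (k - a) *s f k) - a *s (inverse (k - a) *s f k))"
        unfolding u_def
        by (simp only: vec.linear_sum[OF matrix_vector_mul_linear_gen] vec.scale_sum_right sum_subtractf)
      also have "\<dots> = (\<Sum>k\<in>S-{a}. f k)"
      proof (intro sum.cong refl)
        fix k assume k: "k \<in> S - {a}"
        have "A *v (inverse (k - a) *s f k) - a *s (inverse (k - a) *s f k) = (inverse (k - a) * (k - a)) *s f k"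
          using S(2)[of k] k
          by (simp add: vector_scalar_commute vector_smult_assoc right_diff_distrib left_diff_distrib vec.scale_left_diff_distrib mult.commute
              del: right_inverse left_inverse)
        then show "A *v (inverse (k - a) *s f k) - a *s (inverse (k - a) *s f k) = f k" using k by simp
      qed
      finally show ?thesis .
    qed
    have uE: "u \<in> ?E" unfolding u_def using S(2) by (intro vec.span_sum vec.span_scale vec.span_base) auto
    define y where "y = A *v (x - u) - a *s (x - u)"
    have "y = (A *v x - a *s x) - (A *v u - a *s u)"
      by (simp add: y_def matrix_vector_mult_diff_distrib vec.scale_right_diff_distrib)
    also have "\<dots> = (if a \<in> S then f a else 0)"
      unfolding S(3) u using S(1) by (auto simp: sum_diff1)
    finally have "A *v y = a *s y" using S(2) by auto
    then have "y = 0" using dbl[OF y_def] by blast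
    then have "x - u \<in> ?E" unfolding y_def by (intro vec.span_base) auto
    then show ?thesis using uE vec.span_add[of "x - u" _ u] by simp
  qed
  have main: "x \<in> ?E" if "p \<noteq> 0" "degree p < N" "poly_vec N p A x = 0" for p x N
    using that
  proof (induction "degree p" arbitrary: p x)
    case 0
    then obtain c where p: "p = [:c:]" "c \<noteq> 0" by (metis degree_eq_zeroE pCons_eq_0_iff)
    obtain M where "N = Suc M" using 0 by (cases N) auto
    then have "c *s x = 0" using 0(4) p unfolding poly_vec_def
      by (simp add: sum.lessThan_Suc_shift coeff_pCons del: sum.lessThan_Suc)
    then show ?case using p by (simp add: vec.span_zero)
  next
    case (Suc d)
    then obtain a where "poly p a = 0"
      using fundamental_theorem_of_algebra[of p] constant_degree[of p] by auto
    then obtain q where q: "p = [:- a, 1:] * q" by (metis poly_eq_0_iff_dvd dvdE)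
    have q0: "q \<noteq> 0" using Suc q by auto
    have d: "degree p = degree q + 1" unfolding q using q0 by (subst degree_mult_eq) auto
    have "poly_vec N q A (A *v x - a *s x) = 0"
      using poly_vec_mult[of q N a A x] d Suc.prems q by simp
    then have "A *v x - a *s x \<in> ?E" using Suc.hyps d q0 Suc.prems by (intro Suc.hyps(1)[of q]) auto
    then show ?case by (rule step)
  qed
  have "x \<in> ?E" for x
  proof -
    let ?n = "Suc (CARD('v))"
    \<comment> \<open>There are more powers than dimensions. If two powers coincide, dependence of
      the set of vectors does not detect it, and the relation is their difference.\<close>
    have "\<exists>c. (\<exists>i<?n. c i \<noteq> 0) \<and> (\<Sum>i<?n. c i *s (((*v) A) ^^ i) x) = 0"
    proof (cases "inj_on (\<lambda>i. (((*v) A) ^^ i) x) {..<?n}")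
      case True
      let ?B = "(\<lambda>i. (((*v) A) ^^ i) x) ` {..<?n}"
      have "card ?B = ?n" using True by (simp add: card_image)
      then have "vec.dependent ?B"
        using vec.dim_eq_card_independent[of ?B] dim_subset_UNIV_cart_gen[of ?B] by fastforce
      then obtain u v where u: "v \<in> ?B" "u v \<noteq> 0" "(\<Sum>v\<in>?B. u v *s v) = 0"
        using vec.dependent_finite[of ?B] by auto
      then show ?thesis using True
        by (intro exI[of _ "\<lambda>i. u ((((*v) A) ^^ i) x)"]) (auto simp: sum.reindex)
    next
      case False
      then obtain i j where ij: "i < ?n" "j < ?n" "i \<noteq> j" "(((*v) A) ^^ i) x = (((*v) A) ^^ j) x"
        by (auto simp: inj_on_def)
      let ?c = "\<lambda>k. (if k = i then 1 else 0) - (if k = j then 1 else 0) :: complex"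
      have "(\<Sum>k<?n. ?c k *s (((*v) A) ^^ k) x) = 0"
        using ij by (simp add: vec.scale_left_diff_distrib sum_subtractf if_distrib[of "\<lambda>c. c *s _"] cong: if_cong del: sum.lessThan_Suc)
      then show ?thesis using ij by (intro exI[of _ ?c]) auto
    qed
    then obtain c where c: "\<exists>i<?n. c i \<noteq> 0" "(\<Sum>i<?n. c i *s (((*v) A) ^^ i) x) = 0" by blast
    define p where "p = Poly (map c [0..<?n])"
    have coeff: "coeff p i = (if i < ?n then c i else 0)" for i
      by (simp add: p_def coeff_Poly_eq nth_default_def del: upt_Suc)
    then have "p \<noteq> 0" using c(1) by (metis coeff_0)
    moreover have "degree p < ?n" using coeff by (intro degree_lessI) auto
    moreover have "poly_vec ?n p A x = 0" using c(2) by (simp add: poly_vec_def coeff del: sum.lessThan_Suc)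
    ultimately show ?thesis by (rule main)
  qed
  then show ?thesis unfolding diagonalizable_def by blast
qed

text \<open>Bounds strings: operators that shift an eigenvalue by a fixed nonzero amount cannot have
  infinitely many nonzero iterates on an eigenvector.\<close>

lemma finite_eigenvalues:
  fixes A :: "complex^'v^'v"
  assumes "inj (c :: nat \<Rightarrow> complex)" "\<And>i. v i \<noteq> 0" "\<And>i. A *v v i = c i *s v i"
  shows False
proof -
  let ?n = "Suc (CARD('v))"
  have inj: "inj_on v {..<?n}"
  proof (rule inj_onI)
    fix i j assume "v i = v j"
    then have "c i *s v i = c j *s v i" using assms(3)[of i] assms(3)[of j] by metis
    then show "i = j" using assms(1,2) by (simp add: inj_eq)
  qed
  have "vec.independent (v ` {..<?n})"
  proof
    assume "vec.dependent (v ` {..<?n})"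
    then obtain u j where u: "j < ?n" "u (v j) \<noteq> 0" "(\<Sum>w\<in>v ` {..<?n}. u w *s w) = 0"
      using vec.dependent_finite[of "v ` {..<?n}"] by auto
    let ?g = "\<lambda>k. u (v (inv c k)) *s v (inv c k)"
    have "(\<Sum>k\<in>c ` {..<?n}. ?g k) = 0"
      using u(3) inj assms(1) by (simp add: sum.reindex inj_on_subset[OF assms(1)] del: sum.lessThan_Suc)
    moreover have "A *v ?g k = k *s ?g k" if "k \<in> c ` {..<?n}" for k
      using that assms(1,3) by (auto simp: vector_scalar_commute vector_smult_assoc mult.commute)
    ultimately have "?g (c j) \<in> {0}"
      using u(1) by (intro eigen_sum_in_stable[of "c ` {..<?n}" A ?g "{0}" "c j"]) auto
    then show False using u(2) assms(1,2) by simp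
  qed
  then have "card (v ` {..<?n}) \<le> CARD('v)"
    using vec.dim_eq_card_independent[of "v ` {..<?n}"] dim_subset_UNIV_cart_gen[of "v ` {..<?n}"] by simp
  then show False using inj by (simp add: card_image)
qed

definition common_eigenvectors :: "(complex^'v^'v) set \<Rightarrow> (complex^'v) set" where
  "common_eigenvectors F = {x. \<forall>A\<in>F. \<exists>k. A *v x = k *s x}"

text \<open>The induction is on the dimension of \<open>W\<close> because \<open>F\<close> may be
  infinite. A member of \<open>F\<close> that is not scalar on \<open>W\<close> splits it into
  smaller eigenspaces, which are stable since \<open>F\<close> commutes.\<close>

lemma commuting_diagonalizable_stable:
  fixes F :: "(complex^'v^'v) set"
  assumes "\<And>A. A \<in> F \<Longrightarrow> diagonalizable A" "\<And>A B. A \<in> F \<Longrightarrow> B \<in> F \<Longrightarrow> A ** B = B ** A"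
    "vec.subspace W" "\<And>A x. A \<in> F \<Longrightarrow> x \<in> W \<Longrightarrow> A *v x \<in> W"
  shows "W \<subseteq> vec.span (common_eigenvectors F)"
  using assms(3,4)
proof (induction "vec.dim W" arbitrary: W rule: less_induct)
  case less
  show ?case
  proof (cases "\<forall>A\<in>F. \<exists>k. \<forall>x\<in>W. A *v x = k *s x")
    case True
    then have "W \<subseteq> common_eigenvectors F" by (auto simp: common_eigenvectors_def)
    then show ?thesis using vec.span_superset by blast
  next
    case False
    then obtain A where A: "A \<in> F" "\<And>k. \<exists>x\<in>W. A *v x \<noteq> k *s x" by blast
    show ?thesis
    proof
      fix x assume "x \<in> W"
      then have "x \<in> vec.span {y\<in>W. \<exists>k. A *v y = k *s y}"
        using diagonalizable_stable[OF assms(1)[OF A(1)] less.prems(1)] less.prems(2) A(1) by blast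
      moreover have "{y\<in>W. \<exists>k. A *v y = k *s y} \<subseteq> vec.span (common_eigenvectors F)"
      proof safe
        fix y k assume y: "y \<in> W" "A *v y = k *s y"
        let ?W = "{y\<in>W. A *v y = k *s y}"
        have sub: "vec.subspace ?W" using less.prems(1)
          by (auto simp: vec.subspace_def matrix_vector_right_distrib vector_scalar_commute
              vec.scale_right_distrib vector_smult_assoc mult.commute)
        have "?W \<subset> W" using A(2)[of k] by blast
        then have "vec.dim ?W < vec.dim W"
          using vec.dim_psubset[of ?W W] sub less.prems(1) by (simp add: vec.span_eq_iff[THEN iffD2])
        moreover have "B *v z \<in> ?W" if "B \<in> F" "z \<in> ?W" for B z
        proof -
          have "A *v (B *v z) = B *v (A *v z)"
            by (simp add: matrix_vector_mul_assoc assms(2)[OF A(1) that(1)])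
          then show ?thesis using that less.prems(2) by (auto simp: vector_scalar_commute)
        qed
        ultimately have "?W \<subseteq> vec.span (common_eigenvectors F)"
          using less.hyps sub by blast
        then show "y \<in> vec.span (common_eigenvectors F)" using y by blast
      qed
      ultimately show "x \<in> vec.span (common_eigenvectors F)"
        by (meson in_mono vec.span_minimal vec.subspace_span)
    qed
  qed
qed

lemma commuting_diagonalizable:
  fixes F :: "(complex^'v^'v) set"
  assumes "\<And>A. A \<in> F \<Longrightarrow> diagonalizable A" "\<And>A B. A \<in> F \<Longrightarrow> B \<in> F \<Longrightarrow> A ** B = B ** A"
  shows "vec.span (common_eigenvectors F) = UNIV"
  using commuting_diagonalizable_stable[OF assms vec.subspace_UNIV] by blast

section \<open>Strings of an \<open>sl\<^sub>2\<close>-triple\<close>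

lemma last_nonzero:
  assumes "f (0::nat) \<noteq> (0 :: 'a :: zero)" "f i = 0"
  shows "\<exists>j. f j \<noteq> 0 \<and> f (Suc j) = 0"
proof (rule ccontr)
  assume *: "\<not> ?thesis"
  have "f k \<noteq> 0" for k by (induction k) (use assms(1) * in auto)
  then show False using assms(2) by blast
qed

text \<open>Raising \<open>v\<close> as often as possible, say \<open>j\<close> times, gives a
  primitive vector of weight \<open>N = c + 2 j\<close>, whose last nonzero lowering is the
  \<open>N\<close>-th. Hence \<open>c\<close> is an integer. For \<open>k \<le> c\<close> one has
  \<open>k + j \<le> N\<close>, so \<open>j\<close> raisings followed by \<open>k + j\<close>
  lowerings give a nonzero vector; its weight is \<open>c - 2 k\<close>, which shows that the string
  below \<open>c\<close> is present.\<close>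

lemma sl2_string:
  fixes X Y H :: "complex^'v^'v"
  assumes XY: "X ** Y - Y ** X = H" and HX: "H ** X - X ** H = scale_mat 2 X"
    and HY: "H ** Y - Y ** H = scale_mat (-2) Y"
    and v: "v \<noteq> 0" "H *v v = c *s v"
  shows "\<exists>n j. c = of_int n \<and> (\<forall>k::nat. int k \<le> n \<longrightarrow> (((*v) Y) ^^ (k + j)) ((((*v) X) ^^ j) v) \<noteq> 0)"
proof -
  have scale: "scale_mat c M *v u = c *s (M *v u)" for c and M :: "complex^'v^'v" and u
    by (simp add: vec_eq_iff matrix_vector_mult_def sum_distrib_left mult.assoc)
  have X: "H *v (X *v u) = X *v (H *v u) + 2 *s (X *v u)" for u
    using arg_cong[OF HX, of "\<lambda>M. M *v u"]
    by (simp add: matrix_vector_mult_diff_rdistrib scale algebra_simps flip: matrix_vector_mul_assoc)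
  have Y: "H *v (Y *v u) = Y *v (H *v u) + (-2) *s (Y *v u)" for u
    using arg_cong[OF HY, of "\<lambda>M. M *v u"]
    by (simp add: matrix_vector_mult_diff_rdistrib scale algebra_simps flip: matrix_vector_mul_assoc)
  have XYu: "X *v (Y *v u) = Y *v (X *v u) + H *v u" for u
    using arg_cong[OF XY, of "\<lambda>M. M *v u"]
    by (simp add: matrix_vector_mult_diff_rdistrib algebra_simps flip: matrix_vector_mul_assoc)
  have Xi: "H *v ((((*v) X) ^^ i) v) = (c + 2 * of_nat i) *s ((((*v) X) ^^ i) v)" for i
  proof (induction i)
    case (Suc i)
    have "H *v ((((*v) X) ^^ Suc i) v) = (c + 2 * of_nat i) *s ((((*v) X) ^^ Suc i) v) + 2 *s ((((*v) X) ^^ Suc i) v)"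
      by (simp only: X Suc.IH vector_scalar_commute funpow.simps o_apply)
    also have "\<dots> = (c + 2 * of_nat (Suc i)) *s ((((*v) X) ^^ Suc i) v)"
      unfolding vec.scale_left_distrib[symmetric] by (rule arg_cong[where f = "\<lambda>a. a *s _"]) simp
    finally show ?case .
  qed (simp add: v)
  have "\<exists>i. (((*v) X) ^^ i) v = 0"
  proof (rule ccontr)
    assume "\<not> ?thesis"
    then show False
      using finite_eigenvalues[of "\<lambda>i. c + 2 * of_nat i" "\<lambda>i. (((*v) X) ^^ i) v" H] Xi
      by (auto simp: inj_def)
  qed
  then obtain j where j: "(((*v) X) ^^ j) v \<noteq> 0" "(((*v) X) ^^ Suc j) v = 0"
    using last_nonzero[of "\<lambda>i. (((*v) X) ^^ i) v"] v(1) by auto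
  define u where "u = (((*v) X) ^^ j) v"
  define N where "N = c + 2 * of_nat j"
  have u: "u \<noteq> 0" "X *v u = 0" "H *v u = N *s u" using j Xi[of j] by (simp_all add: u_def N_def)
  let ?y = "\<lambda>i. (((*v) Y) ^^ i) u"
  have Yi: "H *v ?y i = (N - 2 * of_nat i) *s ?y i" for i
  proof (induction i)
    case (Suc i)
    have "H *v ?y (Suc i) = (N - 2 * of_nat i) *s ?y (Suc i) + (- 2) *s ?y (Suc i)"
      by (simp only: Y Suc.IH vector_scalar_commute funpow.simps o_apply)
    also have "\<dots> = (N - 2 * of_nat (Suc i)) *s ?y (Suc i)"
      unfolding vec.scale_left_distrib[symmetric] by (rule arg_cong[where f = "\<lambda>a. a *s _"]) simp
    finally show ?case .
  qed (simp add: u)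
  have XYi: "X *v ?y (Suc i) = (of_nat (Suc i) * (N - of_nat i)) *s ?y i" for i
  proof (induction i)
    case 0 show ?case by (simp add: XYu u)
  next
    case (Suc i)
    have "X *v ?y (Suc (Suc i)) = Y *v (X *v ?y (Suc i)) + H *v ?y (Suc i)"
      by (simp add: XYu)
    also have "\<dots> = (of_nat (Suc i) * (N - of_nat i)) *s ?y (Suc i) + (N - 2 * of_nat (Suc i)) *s ?y (Suc i)"
      unfolding Suc.IH Yi[of "Suc i"] by (simp add: vector_scalar_commute)
    also have "\<dots> = (of_nat (Suc (Suc i)) * (N - of_nat (Suc i))) *s ?y (Suc i)"
      unfolding vec.scale_left_distrib[symmetric] by (simp add: algebra_simps)
    finally show ?case .
  qed
  have "\<exists>i. ?y i = 0"
  proof (rule ccontr)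
    assume "\<not> ?thesis"
    then show False
      using finite_eigenvalues[of "\<lambda>i. N - 2 * of_nat i" ?y H] Yi by (auto simp: inj_def)
  qed
  then obtain l where l: "?y l \<noteq> 0" "?y (Suc l) = 0"
    using last_nonzero[of "\<lambda>i. (((*v) Y) ^^ i) u"] u(1) by auto
  \<comment> \<open>\<open>XYi\<close> raises the first vanishing term back to a multiple of the
    last nonzero one, so the factor \<open>N - l\<close> must be zero.\<close>
  then have "(of_nat (Suc l) * (N - of_nat l)) *s ?y l = 0" using XYi[of l] by simp
  then have "N - of_nat l = 0" using l(1) by (metis mult_eq_0_iff of_nat_eq_0_iff old.nat.distinct(1) vec.scale_eq_0_iff)
  then have N: "N = of_nat l" by simp
  have nz: "?y i \<noteq> 0" if "i \<le> l" for i
  proof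
    assume "?y i = 0"
    moreover have "(((*v) Y) ^^ k) 0 = 0" for k by (induction k) simp_all
    ultimately have "?y (l - i + i) = 0" unfolding funpow_add o_def by simp
    then show False using l(1) that by simp
  qed
  have "c = of_int (int l - 2 * int j)" using N by (simp add: N_def algebra_simps)
  moreover have "\<forall>k::nat. int k \<le> int l - 2 * int j \<longrightarrow> ?y (k + j) \<noteq> 0" using nz by auto
  ultimately show ?thesis unfolding u_def by blast
qed

section \<open>Compact tori\<close>

lemma sum_UNIV_Plus:
  "(\<Sum>x\<in>UNIV. f x) = (\<Sum>i\<in>UNIV. f (Inl i)) + (\<Sum>j\<in>UNIV. f (Inr j))"
  for f :: "'a::finite + 'b::finite \<Rightarrow> 'c::comm_monoid_add"
  unfolding UNIV_Plus_UNIV[symmetric] by (subst sum.Plus) auto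

lemma forall_Plus: "(\<forall>x::'a+'b. P x) \<longleftrightarrow> (\<forall>i. P (Inl i)) \<and> (\<forall>j. P (Inr j))"
  by (metis sum.exhaust)

lemma rotation_mat_mult:
  "rotation_mat a b ** rotation_mat a' b' = rotation_mat (\<lambda>k. a k * a' k - b k * b' k) (\<lambda>k. a k * b' k + b k * a' k)"
  by (simp add: vec_eq_iff matrix_mult_nth forall_Plus sum_UNIV_Plus rotation_mat_def
      if_distrib[of "\<lambda>x. x * _"] if_distrib[of "\<lambda>x. _ * x"] cong: if_cong)

lemma rotation_mat_one: "rotation_mat (\<lambda>_. 1) (\<lambda>_. 0) = mat 1"
  by (simp add: vec_eq_iff mat_nth forall_Plus rotation_mat_def)

text \<open>The transpose inverts \<open>M\<close>. On the torus, dividing by the determinant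
  therefore amounts to multiplying by it, which keeps the entries of morphisms Laurent along the
  coordinate circles.\<close>

lemma torus_det: "M \<in> std_compact_torus \<Longrightarrow> det M * det M = 1"
proof -
  assume "M \<in> std_compact_torus"
  then obtain a b where M: "M = rotation_mat a b" "\<forall>k. (a k)\<^sup>2 + (b k)\<^sup>2 = 1"
    by (auto simp: std_compact_torus_def)
  have "M ** rotation_mat a (\<lambda>k. - b k) = mat 1"
    using M(2) unfolding M(1) rotation_mat_mult rotation_mat_one[symmetric] power2_eq_square
    by (simp add: mult.commute[of "b _" "a _"])
  moreover have "rotation_mat a (\<lambda>k. - b k) = transpose M"
    by (simp add: M(1) vec_eq_iff transpose_def forall_Plus rotation_mat_def)
  ultimately show ?thesis
    by (metis det_I det_mul det_transpose)
qed

lemma torus_commute: "M \<in> std_compact_torus \<Longrightarrow> N \<in> std_compact_torus \<Longrightarrow> M ** N = N ** M"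
  by (auto simp: std_compact_torus_def rotation_mat_mult mult.commute add.commute)

lemma torus_one: "mat 1 \<in> std_compact_torus"
  unfolding std_compact_torus_def rotation_mat_one[symmetric] by (auto intro!: exI)

text \<open>The isomorphism of the multiplicative group with the \<open>k\<close>-th factor SO(2):
  the equations \<open>z = a + \<i> b\<close> and \<open>1 / z = a - \<i> b\<close> solved for
  \<open>a\<close> and \<open>b\<close>. For \<open>norm z = 1\<close> these are the real and
  imaginary parts of \<open>z\<close>.\<close>

definition coordinate_circle :: "'d::finite \<Rightarrow> complex \<Rightarrow> complex^('d + 'd)^('d + 'd)" where
  "coordinate_circle k z = rotation_mat (\<lambda>j. if j = k then (z + 1 / z) / 2 else 1)
     (\<lambda>j. if j = k then (z - 1 / z) / (2 * \<i>) else 0)"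

lemma coordinate_circle_in: "z \<noteq> 0 \<Longrightarrow> coordinate_circle k z \<in> std_compact_torus"
  unfolding coordinate_circle_def std_compact_torus_def
  by (intro CollectI exI conjI allI, rule refl) (auto simp: field_simps power2_eq_square)

lemma coordinate_circle_mult:
  "z \<noteq> 0 \<Longrightarrow> w \<noteq> 0 \<Longrightarrow> coordinate_circle k (z * w) = coordinate_circle k z ** coordinate_circle k w"
  unfolding coordinate_circle_def rotation_mat_mult
  by (rule arg_cong2[of _ _ _ _ rotation_mat]) (auto simp: field_simps fun_eq_iff)

lemma coordinate_circle_1: "coordinate_circle k 1 = mat 1"
  unfolding coordinate_circle_def rotation_mat_one[symmetric]
  by (rule arg_cong2[of _ _ _ _ rotation_mat]) auto

lemma torus_induct:
  assumes "M \<in> std_compact_torus" "P (mat 1)"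
    "\<And>k z N. z \<noteq> 0 \<Longrightarrow> N \<in> std_compact_torus \<Longrightarrow> P N \<Longrightarrow> P (coordinate_circle k z ** N)"
  shows "P M"
proof -
  have "P (rotation_mat a b)"
    if "finite S" "\<And>k. (a k)\<^sup>2 + (b k)\<^sup>2 = 1" "\<And>k. k \<notin> S \<Longrightarrow> a k = 1 \<and> b k = 0" for S a b
    using that
  proof (induction S arbitrary: a b rule: finite_induct)
    case empty
    then have "a = (\<lambda>_. 1)" "b = (\<lambda>_. 0)" by auto
    then show ?case using assms(2) by (simp add: rotation_mat_one)
  next
    case (insert k S)
    let ?a = "a(k := 1)" and ?b = "b(k := 0)"
    \<comment> \<open>By the equation of the circle, \<open>z\<close> is invertible with inverse
      \<open>a k - \<i> * b k\<close>; this splits off the \<open>k\<close>-th coordinate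
      circle.\<close>
    define z where "z = a k + \<i> * b k"
    have zw: "z * (a k - \<i> * b k) = 1"
      using insert.prems(1)[of k] by (simp add: z_def algebra_simps power2_eq_square)
    then have z: "z \<noteq> 0" "1 / z = a k - \<i> * b k" by (auto simp: divide_eq_eq mult.commute)
    have "rotation_mat a b = coordinate_circle k z ** rotation_mat ?a ?b"
      unfolding coordinate_circle_def rotation_mat_mult z(2)
      by (rule arg_cong2[of _ _ _ _ rotation_mat]) (auto simp: z_def field_simps fun_eq_iff)
    moreover have "P (rotation_mat ?a ?b)" using insert by (intro insert.IH) auto
    moreover have "rotation_mat ?a ?b \<in> std_compact_torus"
    proof -
      have "\<forall>j. (?a j)\<^sup>2 + (?b j)\<^sup>2 = 1" using insert.prems(1) by simp
      then show ?thesis unfolding std_compact_torus_def by blast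
    qed
    ultimately show ?case using assms(3) z(1) by simp
  qed
  from this[of UNIV] show ?thesis using assms(1) by (auto simp: std_compact_torus_def)
qed

section \<open>Laurent functions and representations of the multiplicative group\<close>

definition laurent :: "(complex \<Rightarrow> complex) \<Rightarrow> bool" where
  "laurent f \<longleftrightarrow> (\<exists>p N. \<forall>z. z \<noteq> 0 \<longrightarrow> f z = poly p z / z ^ N)"

lemma laurent_const: "laurent (\<lambda>_. c)"
  unfolding laurent_def by (rule exI[of _ "[:c:]"], rule exI[of _ 0]) simp

lemma laurent_id: "laurent (\<lambda>z. z)"
  unfolding laurent_def by (rule exI[of _ "[:0,1:]"], rule exI[of _ 0]) simp

lemma laurent_inverse: "laurent (\<lambda>z. 1 / z)"
  unfolding laurent_def by (rule exI[of _ "[:1:]"], rule exI[of _ 1]) simp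

lemma laurent_add: "laurent f \<Longrightarrow> laurent g \<Longrightarrow> laurent (\<lambda>z. f z + g z)"
proof -
  assume "laurent f" "laurent g"
  then obtain p N q M where "\<And>z. z \<noteq> 0 \<Longrightarrow> f z = poly p z / z ^ N" "\<And>z. z \<noteq> 0 \<Longrightarrow> g z = poly q z / z ^ M"
    by (auto simp: laurent_def)
  then show ?thesis unfolding laurent_def
    by (intro exI[of _ "p * monom 1 M + q * monom 1 N"] exI[of _ "N + M"])
      (auto simp: poly_monom power_add field_simps)
qed

lemma laurent_mult: "laurent f \<Longrightarrow> laurent g \<Longrightarrow> laurent (\<lambda>z. f z * g z)"
proof -
  assume "laurent f" "laurent g"
  then obtain p N q M where "\<And>z. z \<noteq> 0 \<Longrightarrow> f z = poly p z / z ^ N" "\<And>z. z \<noteq> 0 \<Longrightarrow> g z = poly q z / z ^ M"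
    by (auto simp: laurent_def)
  then show ?thesis unfolding laurent_def
    by (intro exI[of _ "p * q"] exI[of _ "N + M"]) (auto simp: power_add)
qed

lemma laurent_if: "laurent f \<Longrightarrow> laurent g \<Longrightarrow> laurent (\<lambda>z. if P then f z else g z)"
  by (cases P) simp_all

lemma laurent_poly_fun:
  assumes "P \<in> poly_fun K" "\<And>i j. laurent (\<lambda>z. F z $ i $ j)"
  shows "laurent (\<lambda>z. P (F z))"
  using assms(1) by induction (auto intro: laurent_const laurent_add laurent_mult assms(2))

lemma laurent_coordinate_circle: "laurent (\<lambda>z. coordinate_circle k z $ i $ j)"
proof -
  have 1: "laurent (\<lambda>z. (z + 1 / z) / 2)"
    using laurent_mult[OF laurent_add[OF laurent_id laurent_inverse] laurent_const[of "1/2"]] by simp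
  have "laurent (\<lambda>z. (z + (- 1) * (1 / z)) * (c / (2 * \<i>)))" for c
    by (intro laurent_mult laurent_add laurent_id laurent_inverse laurent_const)
  from this[of 1] this[of "-1"]
  have 2: "laurent (\<lambda>z. (z - 1 / z) / (2 * \<i>))" "laurent (\<lambda>z. - ((z - 1 / z) / (2 * \<i>)))"
    by (simp_all add: mult.commute)
  have 3: "laurent (\<lambda>z. - (if P then (z - 1 / z) / (2 * \<i>) else 0))" for P
    using 2(2) laurent_const[of 0] by (cases P) simp_all
  show ?thesis
    unfolding coordinate_circle_def rotation_mat_def
    by (cases i; cases j) (simp_all only: vec_lambda_beta prod.case sum.case,
      (intro laurent_if 1 2 3 laurent_const)+)
qed

lemma laurent_alg_hom:
  assumes "alg_hom K std_compact_torus H f"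
  shows "laurent (\<lambda>z. f (coordinate_circle k z) $ i $ j)"
proof -
  obtain P m where P: "P \<in> poly_fun K"
    and f: "\<And>g. g \<in> std_compact_torus \<Longrightarrow> f g $ i $ j = P g / det g ^ m"
    using assms unfolding alg_hom_def regular_rep_def by metis
  have eq: "f (coordinate_circle k z) $ i $ j = P (coordinate_circle k z) * det (coordinate_circle k z) ^ m" if "z \<noteq> 0" for z
  proof -
    let ?d = "det (coordinate_circle k z) ^ m"
    have d: "?d * ?d = 1"
      using torus_det[OF coordinate_circle_in[OF that, of k]] by (simp flip: power_mult_distrib)
    have "?d \<noteq> 0"
    proof
      assume "?d = 0"
      with d show False by (simp only: mult_zero_left zero_neq_one)
    qed
    then have "P (coordinate_circle k z) / ?d = P (coordinate_circle k z) * ?d"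
      using d by (simp only: divide_eq_eq mult.assoc mult_1_right) simp
    then show ?thesis using f[OF coordinate_circle_in[OF that, of k]] by simp
  qed
  have "laurent (\<lambda>z. P (coordinate_circle k z) * det (coordinate_circle k z) ^ m)"
    by (rule laurent_poly_fun[of "\<lambda>M. P M * det M ^ m" UNIV])
      (auto intro!: poly_fun.mult poly_fun_UNIV[OF P] poly_fun_power poly_fun_det laurent_coordinate_circle)
  then show ?thesis using eq unfolding laurent_def by simp
qed

lemma sum_mv: "(\<Sum>l\<in>S. A l) *v x = (\<Sum>l\<in>S. A l *v x)"
  by (induction S rule: infinite_finite_induct) (simp_all add: matrix_vector_mult_add_rdistrib)

text \<open>Write \<open>F z\<close> as the sum of \<open>z ^ l / z ^ N\<close> times constant
  matrices \<open>A l\<close>. Comparing powers of \<open>w\<close> in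
  \<open>F z ** F w = F (z * w)\<close> shows that \<open>F z\<close> acts on the image of
  \<open>A l\<close> as the scalar \<open>z ^ l / z ^ N\<close>; and \<open>F 1 = mat 1\<close>
  shows that these images span.\<close>

lemma laurent_representation:
  fixes F :: "complex \<Rightarrow> complex^'v^'v"
  assumes L: "\<And>i j. laurent (\<lambda>z. F z $ i $ j)" and one: "F 1 = mat 1"
    and mult: "\<And>z w. z \<noteq> 0 \<Longrightarrow> w \<noteq> 0 \<Longrightarrow> F (z * w) = F z ** F w"
  shows "vec.span {y. \<exists>k::int. \<forall>z. z \<noteq> 0 \<longrightarrow> F z *v y = (z powi k) *s y} = UNIV"
proof -
  have "\<forall>i j. \<exists>p N. \<forall>z. z \<noteq> 0 \<longrightarrow> F z $ i $ j = poly p z / z ^ N" using L by (auto simp: laurent_def)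
  then obtain p' m where p': "\<And>i j z. z \<noteq> 0 \<Longrightarrow> F z $ i $ j = poly (p' i j) z / z ^ m i j" by metis
  define N where "N = (\<Sum>i\<in>UNIV. \<Sum>j\<in>UNIV. m i j)"
  have m: "m i j \<le> N" for i j
    unfolding N_def using member_le_sum[of j UNIV "m i"] member_le_sum[of i UNIV "\<lambda>i. \<Sum>j\<in>UNIV. m i j"]
    by (simp add: order_trans[of "m i j"])
  define p where "p i j = p' i j * monom 1 (N - m i j)" for i j
  have p: "F z $ i $ j = poly (p i j) z / z ^ N" if "z \<noteq> 0" for i j z
  proof -
    have "z ^ N = z ^ (N - m i j) * z ^ m i j" using m[of i j] by (simp flip: power_add)
    then show ?thesis using that by (simp add: p_def p' poly_monom)
  qed
  define A where "A l = (\<chi> i j. coeff (p i j) l)" for l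
  have FA: "F z ** A l = scale_mat (z ^ l / z ^ N) (A l)" if z: "z \<noteq> 0" for z l
  proof -
    have "(\<Sum>k\<in>UNIV. F z $ i $ k * coeff (p k j) l) = z ^ l / z ^ N * coeff (p i j) l" for i j
    proof -
      \<comment> \<open>For fixed \<open>z\<close> this is an entry of the multiplicativity relation
        as a polynomial in \<open>w\<close>, after multiplication by \<open>w ^ N\<close>. It
        vanishes at every nonzero \<open>w\<close>, hence identically.\<close>
      let ?q = "(\<Sum>k\<in>UNIV. smult (F z $ i $ k) (p k j)) - smult (1 / z ^ N) (pcompose (p i j) [:0, z:])"
      have "poly ?q w = 0" if w: "w \<noteq> 0" for w
      proof -
        have "(\<Sum>k\<in>UNIV. F z $ i $ k * F w $ k $ j) = F (z * w) $ i $ j"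
          using mult[OF z w] by (simp add: matrix_mult_nth)
        then have "(\<Sum>k\<in>UNIV. F z $ i $ k * poly (p k j) w) / w ^ N = poly (p i j) (z * w) / (z * w) ^ N"
          using z w by (simp add: p[of w] p[of "z * w"] sum_divide_distrib)
        then have "(\<Sum>k\<in>UNIV. F z $ i $ k * poly (p k j) w) = poly (p i j) (z * w) / z ^ N"
          using z w by (simp add: power_mult_distrib field_simps)
        then show ?thesis by (simp add: poly_sum poly_pcompose mult.commute)
      qed
      then have "- {0} \<subseteq> {w. poly ?q w = 0}" by auto
      moreover have "infinite (- {0::complex})"
        by (simp add: infinite_UNIV_char_0 Compl_eq_Diff_UNIV)
      ultimately have "infinite {w. poly ?q w = 0}" using finite_subset by blast
      then have "?q = 0" using poly_roots_finite[of ?q] by blast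
      then have "coeff ?q l = 0" by simp
      then show ?thesis by (simp add: coeff_sum coeff_pcompose_linear)
    qed
    then show ?thesis by (simp add: vec_eq_iff matrix_mult_nth A_def)
  qed
  define d where "d = (\<Sum>i\<in>UNIV. \<Sum>j\<in>UNIV. degree (p i j))"
  have d: "degree (p i j) \<le> d" for i j
    unfolding d_def using member_le_sum[of j UNIV "\<lambda>j. degree (p i j)"]
      member_le_sum[of i UNIV "\<lambda>i. \<Sum>j\<in>UNIV. degree (p i j)"]
    by (simp add: order_trans[of "degree (p i j)"])
  have "mat 1 = (\<Sum>l\<le>d. A l)"
  proof -
    have "mat 1 $ i $ j = (\<Sum>l\<le>d. coeff (p i j) l)" for i j
    proof -
      have "mat 1 $ i $ j = poly (p i j) 1" using p[of 1 i j] one by simp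
      also have "\<dots> = (\<Sum>l\<le>degree (p i j). coeff (p i j) l)" by (simp add: poly_altdef)
      also have "\<dots> = (\<Sum>l\<le>d. coeff (p i j) l)"
        using d[of i j] by (intro sum.mono_neutral_left) (auto intro: coeff_eq_0)
      finally show ?thesis .
    qed
    then show ?thesis by (simp add: vec_eq_iff A_def)
  qed
  then have sum: "x = (\<Sum>l\<le>d. A l *v x)" for x
    using arg_cong[of "mat 1" _ "\<lambda>M. M *v x"] by (metis matrix_vector_mul_lid sum_mv)
  have "A l *v x \<in> {y. \<exists>k::int. \<forall>z. z \<noteq> 0 \<longrightarrow> F z *v y = (z powi k) *s y}" for l x
  proof (intro CollectI exI allI impI)
    fix z :: complex assume z: "z \<noteq> 0"
    have "F z *v (A l *v x) = (z ^ l / z ^ N) *s (A l *v x)"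
      unfolding matrix_vector_mul_assoc FA[OF z]
      by (simp add: vec_eq_iff matrix_vector_mult_def sum_distrib_left mult.assoc)
    then show "F z *v (A l *v x) = (z powi (int l - int N)) *s (A l *v x)"
      using z by (simp add: power_int_diff)
  qed
  then have "x \<in> vec.span {y. \<exists>k::int. \<forall>z. z \<noteq> 0 \<longrightarrow> F z *v y = (z powi k) *s y}" for x
    using sum[of x] by (metis (no_types, lifting) vec.span_base vec.span_sum)
  then show ?thesis by blast
qed

lemma powi_diagonalizable:
  assumes "vec.span {y. \<exists>k::int. \<forall>z. z \<noteq> 0 \<longrightarrow> F z *v y = (z powi k) *s y} = UNIV" "z \<noteq> 0"
  shows "diagonalizable (F z)"
proof -
  have "{y. \<exists>k::int. \<forall>z. z \<noteq> 0 \<longrightarrow> F z *v y = (z powi k) *s y} \<subseteq> {y. \<exists>k. F z *v y = k *s y}"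
    using assms(2) by blast
  from vec.span_mono[OF this] show ?thesis unfolding diagonalizable_def assms(1) by blast
qed

text \<open>The coordinate circles act by commuting diagonalizable matrices and generate the torus,
  so their common eigenvectors serve for all of \<open>T\<close>.\<close>

lemma torus_common_eigenvectors:
  assumes T: "alg_group L T" and iso: "alg_iso K std_compact_torus T \<psi>"
  shows "\<exists>E. vec.span E = UNIV \<and> (\<forall>u\<in>E. \<forall>g\<in>T. \<exists>k. g *v u = k *s u)"
proof -
  have hom: "alg_hom K std_compact_torus T \<psi>" and bij: "bij_betw \<psi> std_compact_torus T"
    using iso by (auto simp: alg_iso_def)
  have mult: "\<psi> (M ** N) = \<psi> M ** \<psi> N" if "M \<in> std_compact_torus" "N \<in> std_compact_torus" for M N
    using hom that by (simp add: alg_hom_def)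
  have inv: "invertible (\<psi> M)" if "M \<in> std_compact_torus" for M
    using hom T that by (auto simp: alg_hom_def alg_group_def)
  have one: "\<psi> (mat 1) = mat 1"
  proof -
    have "\<psi> (mat 1) ** \<psi> (mat 1) = \<psi> (mat 1)" using mult[OF torus_one torus_one] by simp
    then show ?thesis using inv[OF torus_one] unfolding invertible_def
      by (metis matrix_mul_assoc matrix_mul_rid)
  qed
  define F where "F = {\<psi> (coordinate_circle k z) | k z. z \<noteq> 0}"
  have "diagonalizable A" if AF: "A \<in> F" for A
  proof -
    obtain k z where A: "A = \<psi> (coordinate_circle k z)" "z \<noteq> 0" using AF by (auto simp: F_def)
    have "vec.span {y. \<exists>l::int. \<forall>z. z \<noteq> 0 \<longrightarrow> \<psi> (coordinate_circle k z) *v y = (z powi l) *s y} = UNIV"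
      by (rule laurent_representation)
        (auto intro: laurent_alg_hom[OF hom] simp: coordinate_circle_1 one coordinate_circle_mult mult coordinate_circle_in)
    then show ?thesis unfolding A(1) using A(2) by (rule powi_diagonalizable)
  qed
  moreover have "A ** B = B ** A" if "A \<in> F" "B \<in> F" for A B
    using that unfolding F_def by (auto simp: mult[symmetric] coordinate_circle_in torus_commute)
  ultimately have span: "vec.span (common_eigenvectors F) = UNIV" by (rule commuting_diagonalizable)
  have "\<exists>k. g *v u = k *s u" if u: "u \<in> common_eigenvectors F" and "g \<in> T" for u g
  proof -
    obtain M where M: "M \<in> std_compact_torus" "g = \<psi> M" using bij \<open>g \<in> T\<close> by (auto simp: bij_betw_def)
    have "\<exists>k. \<psi> M *v u = k *s u" using M(1)
    proof (rule torus_induct[where P = "\<lambda>M. \<exists>k. \<psi> M *v u = k *s u"])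
      show "\<exists>k. \<psi> (mat 1) *v u = k *s u" by (rule exI[of _ 1]) (simp add: one)
    next
      fix k and z :: complex and N assume *: "z \<noteq> 0" "N \<in> std_compact_torus" "\<exists>k. \<psi> N *v u = k *s u"
      then obtain a b where "\<psi> N *v u = a *s u" "\<psi> (coordinate_circle k z) *v u = b *s u"
        using u unfolding common_eigenvectors_def F_def by blast
      then show "\<exists>l. \<psi> (coordinate_circle k z ** N) *v u = l *s u"
        by (simp add: mult[OF coordinate_circle_in[OF *(1)] *(2)] matrix_vector_mul_assoc[symmetric] vector_scalar_commute
            vector_smult_assoc)
    qed
    then show ?thesis unfolding M(2) .
  qed
  then show ?thesis using span by blast
qed

text \<open>Proportionality of \<open>g *v u\<close> to \<open>u\<close> is a system of homogeneous
  linear equations in \<open>g\<close>. A linear form that vanishes on \<open>G\<close> equals its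
  own derivative, hence vanishes on the tangent space.\<close>

lemma lie_alg_eigenvector:
  fixes u :: "complex^'n" and X :: "complex^'n^'n"
  assumes u: "\<forall>g\<in>G. \<exists>k. g *v u = k *s u" and X: "X \<in> lie_alg G"
  shows "\<exists>k. X *v u = k *s u"
proof (cases "u = 0")
  case False
  then obtain l where l: "u $ l \<noteq> 0" by (auto simp: vec_eq_iff)
  have *: "u $ l * (X *v u) $ m = u $ m * (X *v u) $ l" for m
  proof -
    let ?P = "\<lambda>A. u $ l * (\<Sum>j\<in>UNIV. A $ m $ j * u $ j) + (- u $ m) * (\<Sum>j\<in>UNIV. A $ l $ j * u $ j)"
    have P: "?P \<in> poly_fun UNIV"
      by (intro poly_fun.add poly_fun.mult poly_fun_sum poly_fun.const poly_fun.entry) auto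
    have "?P g = 0" if g: "g \<in> G" for g
    proof -
      obtain k where "g *v u = k *s u" using u g by blast
      then have "(\<Sum>j\<in>UNIV. g $ i $ j * u $ j) = k * u $ i" for i
        by (simp add: vec_eq_iff matrix_vector_mult_def)
      then show ?thesis by simp
    qed
    then have "pd ?P (mat 1) X = 0" by (rule lie_algD[OF X P])
    moreover have "pd ?P (mat 1) X = ?P X"
      by (rule pd_unique[OF P]) (auto intro!: derivative_eq_intros)
    ultimately show ?thesis by (simp add: matrix_vector_mult_def)
  qed
  have "X *v u = ((X *v u) $ l / u $ l) *s u"
    using * l by (simp add: vec_eq_iff field_simps)
  then show ?thesis by blast
qed (auto intro: exI[of _ 0])

lemma torus_lie_alg:
  assumes T: "alg_group L T" and iso: "alg_iso K std_compact_torus T \<psi>"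
  shows "X \<in> lie_alg T \<Longrightarrow> diagonalizable X"
    and "X \<in> lie_alg T \<Longrightarrow> Y \<in> lie_alg T \<Longrightarrow> lie_bracket X Y = 0"
proof -
  obtain E where E: "vec.span E = UNIV" "\<forall>u\<in>E. \<forall>g\<in>T. \<exists>k. g *v u = k *s u"
    using torus_common_eigenvectors[OF assms] by blast
  have ev: "\<exists>k. X *v u = k *s u" if "u \<in> E" "X \<in> lie_alg T" for u X
    using lie_alg_eigenvector[of T u X] E(2) that by blast
  show "diagonalizable X" if "X \<in> lie_alg T"
  proof -
    have "vec.span E \<subseteq> vec.span {y. \<exists>k. X *v y = k *s y}" using ev that by (intro vec.span_mono) blast
    then show ?thesis unfolding diagonalizable_def E(1) by blast
  qed
  show "lie_bracket X Y = 0" if X: "X \<in> lie_alg T" and Y: "Y \<in> lie_alg T"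
  proof -
    have "lie_bracket X Y *v u = 0" for u
    proof -
      have "u \<in> vec.span E" using E(1) by simp
      then show ?thesis
      proof (induction rule: vec.span_induct_alt)
        case (step c x y)
        obtain a b where "X *v x = a *s x" "Y *v x = b *s x" using ev[OF step(1)] X Y by blast
        then have "lie_bracket X Y *v x = 0"
          by (simp add: lie_bracket_def matrix_vector_mult_diff_rdistrib matrix_vector_mul_assoc[symmetric]
              vector_scalar_commute vector_smult_assoc mult.commute)
        then show ?case using step by (simp add: matrix_vector_right_distrib vector_scalar_commute)
      qed simp
    qed
    then show ?thesis by (metis matrix_eq matrix_vector_mult_0)
  qed
qed

lemma laurent_deriv: "laurent f \<Longrightarrow> \<exists>d. (f has_field_derivative d) (at 1)"
proof -
  assume "laurent f"
  then obtain p N where f: "\<And>z. z \<noteq> 0 \<Longrightarrow> f z = poly p z / z ^ N" by (auto simp: laurent_def)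
  have "eventually (\<lambda>z::complex. z \<noteq> 0) (nhds 1)"
    by (rule t1_space_nhds) simp
  then have ev: "eventually (\<lambda>z. f z = poly p z / z ^ N) (nhds 1)" by eventually_elim (rule f)
  have "\<exists>d. ((\<lambda>z. poly p z / z ^ N) has_field_derivative d) (at 1)"
    by (rule exI) (auto intro!: derivative_eq_intros)
  then show ?thesis using DERIV_cong_ev[OF refl ev refl] by blast
qed

section \<open>The grading element\<close>

lemma circle_point_eq: "norm z = 1 \<Longrightarrow> circle_point z = coordinate_circle 1 z"
proof -
  assume z: "norm z = 1"
  then have "z * cnj z = 1" using complex_norm_square[of z] by simp
  then have "1 / z = cnj z" using z by (auto simp: divide_eq_eq mult.commute)
  then have "of_real (Re z) = (z + 1 / z) / 2" "of_real (Im z) = (z - 1 / z) / (2 * \<i>)"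
    by (simp_all add: complex_eq_iff)
  then show ?thesis
    unfolding circle_point_def coordinate_circle_def
    by (intro arg_cong2[of _ _ _ _ rotation_mat] ext) (simp_all add: num1_eq_iff)
qed

lemma weight_derivative:
  assumes F: "mat_deriv F F' 1" and y: "\<And>z. z \<noteq> 0 \<Longrightarrow> F z *v y = (z powi k) *s y"
  shows "F' *v y = of_int k *s y"
proof -
  have "(F' *v y) $ i = of_int k * y $ i" for i
  proof (rule DERIV_unique)
    show "((\<lambda>z. \<Sum>j\<in>UNIV. F z $ i $ j * y $ j) has_field_derivative (F' *v y) $ i) (at 1)"
      using F unfolding mat_deriv_def matrix_vector_mult_def by (auto intro!: derivative_eq_intros)
    have ev: "eventually (\<lambda>z::complex. z \<noteq> 0) (nhds 1)"
      by (rule t1_space_nhds) simp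
    have "eventually (\<lambda>z. (\<Sum>j\<in>UNIV. F z $ i $ j * y $ j) = z powi k * y $ i) (nhds 1)"
      using ev
    proof eventually_elim
      case (elim z)
      show ?case using arg_cong[OF y[OF elim], of "\<lambda>v. v $ i"] by (simp add: matrix_vector_mult_def)
    qed
    moreover have "((\<lambda>z. z powi k * y $ i) has_field_derivative of_int k * y $ i) (at 1)"
      by (auto intro!: derivative_eq_intros)
    ultimately show "((\<lambda>z. \<Sum>j\<in>UNIV. F z $ i $ j * y $ j) has_field_derivative of_int k * y $ i) (at 1)"
      by (rule DERIV_cong_ev[OF refl _ refl, THEN iffD2])
  qed
  then show ?thesis by (simp add: vec_eq_iff)
qed

lemma mat_mv: "mat c *v y = c *s (y :: complex^'v)"
  by (simp add: vec_eq_iff matrix_vector_mult_def mat_nth if_distrib[of "\<lambda>x. x * _"] cong: if_cong)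

text \<open>The derivative \<open>F'\<close> of \<open>\<phi>\<close> at 1 along the coordinate
  circle lies in \<open>lie_alg T\<close> and acts on a vector of weight \<open>k\<close> as
  \<open>k\<close>, whereas \<open>E\<close> acts as \<open>k / 2\<close>; injectivity of the
  differential makes \<open>E\<close> half of \<open>F'\<close>. The parity of \<open>k\<close> is
  read off from the value of \<open>\<pi> \<circ> \<phi>\<close> at -1 and will make all eigenvalues
  congruent modulo 1.\<close>

lemma grading_element_diagonalizable:
  assumes hr: "hodge_representation G w Q \<pi> \<phi>" and T: "\<phi> ` circle_group \<subseteq> T"
    and gr: "grading_element G w \<pi> \<phi> E" and TG: "T \<subseteq> G"
  shows "E \<in> lie_alg T"
    and "vec.span {y. \<exists>k::int. even (k - w) \<and> differential G \<pi> E *v y = (of_int k / 2) *s y} = UNIV"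
proof -
  have G: "alg_group \<rat> G" and pi: "alg_hom \<rat> G (aut_form Q) \<pi>"
    and inj: "inj_on (differential G \<pi>) (lie_alg G)" and phi: "alg_hom \<real> circle_group G \<phi>"
    and phs: "polarized_hodge_structure w Q (\<pi> \<circ> \<phi>)"
    using hr by (auto simp: hodge_representation_def)
  interpret algebraic_hom \<rat> G "aut_form Q" \<pi>
    by unfold_locales (use G pi in \<open>auto simp: aut_form_def\<close>)
  let ?c = "coordinate_circle 1 :: complex \<Rightarrow> complex^(1 + 1)^(1 + 1)"
  have mult: "\<phi> (M ** N) = \<phi> M ** \<phi> N" if "M \<in> circle_group" "N \<in> circle_group" for M N
    using phi that by (simp add: alg_hom_def)
  have phiG: "\<phi> M \<in> G" if "M \<in> circle_group" for M
    using phi that by (auto simp: alg_hom_def)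
  have one: "\<phi> (mat 1) = mat 1"
  proof -
    have "\<phi> (mat 1) ** \<phi> (mat 1) = \<phi> (mat 1)" using mult[OF torus_one torus_one] by simp
    then show ?thesis using Ginv[OF phiG[OF torus_one]] unfolding invertible_def
      by (metis matrix_mul_assoc matrix_mul_rid)
  qed
  have "\<forall>i j. \<exists>d. ((\<lambda>z. \<phi> (?c z) $ i $ j) has_field_derivative d) (at 1)"
    using laurent_deriv[OF laurent_alg_hom[OF phi]] by blast
  then obtain d where d: "\<And>i j. ((\<lambda>z. \<phi> (?c z) $ i $ j) has_field_derivative d i j) (at 1)" by metis
  define F' where "F' = (\<chi> i j. d i j)"
  have F: "mat_deriv (\<lambda>z. \<phi> (?c z)) F' 1" using d by (simp add: mat_deriv_def F'_def)
  have in_T: "\<phi> (?c z) \<in> T" if "z \<noteq> 0" for z using T coordinate_circle_in[OF that] by blast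
  have F'T: "F' \<in> lie_alg T"
    by (rule lie_alg_path[OF in_T _ F]) (simp_all add: coordinate_circle_1 one)
  have in_G: "\<phi> (?c z) \<in> G" if "z \<noteq> 0" for z using in_T[OF that] TG by blast
  have F'G: "F' \<in> lie_alg G" and der: "mat_deriv (\<lambda>z. \<pi> (\<phi> (?c z))) (\<rho> F') 1"
    using differential_path[OF in_G _ F] by (simp_all add: coordinate_circle_1 one)
  have pp: "alg_hom \<real> circle_group (aut_form Q) (\<pi> \<circ> \<phi>)"
    and p1: "(\<pi> \<circ> \<phi>) (circle_point (-1)) = mat ((-1) powi w)"
    using phs by (auto simp: polarized_hodge_structure_def)
  let ?W = "{y. \<exists>k::int. \<forall>z. z \<noteq> 0 \<longrightarrow> \<pi> (\<phi> (?c z)) *v y = (z powi k) *s y}"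
  have span: "vec.span ?W = UNIV"
  proof (rule laurent_representation)
    show "laurent (\<lambda>z. \<pi> (\<phi> (?c z)) $ i $ j)" for i j
      using laurent_alg_hom[OF pp] by simp
  qed (simp_all add: coordinate_circle_1 one pi_1 coordinate_circle_mult mult coordinate_circle_in pi_mult phiG)
  have EG: "E \<in> lie_alg G"
    using gr lie_alg_scale by (auto simp: grading_element_def)
  have W: "\<exists>k::int. even (k - w) \<and> \<rho> E *v y = (of_int k / 2) *s y \<and> \<rho> F' *v y = of_int k *s y" if yW: "y \<in> ?W" for y
  proof (cases "y = 0")
    case True
    then show ?thesis by (intro exI[of _ w]) simp
  next
    case False
    obtain k where k: "\<And>z. z \<noteq> 0 \<Longrightarrow> \<pi> (\<phi> (?c z)) *v y = (z powi k) *s y" using yW by blast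
    have "((-1) powi w) *s y = ((-1) powi k) *s y"
      using k[of "-1"] p1 circle_point_eq[of "-1"] by (simp add: mat_mv)
    then have "(-1::complex) powi w = (-1) powi k" using False by simp
    then have ev: "even (k - w)" by (auto simp: power_int_minus_left split: if_splits)
    then obtain p where p: "k - w = 2 * p" by blast
    \<comment> \<open>With \<open>k = w + 2 p\<close> the Hodge type is \<open>(w + p, - p)\<close>:
      the entries add up to \<open>w\<close> and differ by \<open>k\<close>.\<close>
    have "y \<in> hodge_piece (\<pi> \<circ> \<phi>) (w + p) (- p)"
      unfolding hodge_piece_def
    proof (intro CollectI allI impI)
      fix z :: complex assume z: "norm z = 1"
      then have "z \<noteq> 0" by auto
      from k[OF this] show "(\<pi> \<circ> \<phi>) (circle_point z) *v y = z powi (w + p - (- p)) *s y"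
        using p by (simp add: circle_point_eq[OF z] algebra_simps)
    qed
    moreover have "\<forall>p q. p + q = w \<longrightarrow>
        (\<forall>v\<in>hodge_piece (\<pi> \<circ> \<phi>) p q. \<rho> E *v v = (of_int (p - q) / 2) *s v)"
      using gr unfolding grading_element_def by blast
    ultimately have "\<rho> E *v y = (of_int (w + p - (- p)) / 2) *s y"
      by (metis add_diff_cancel diff_conv_add_uminus)
    also have "w + p - (- p) = k" using p by simp
    finally show ?thesis using ev weight_derivative[OF der k] by blast
  qed
  have "\<rho> E *v x = \<rho> (scale_mat (1/2) F') *v x" for x
  proof -
    have "x \<in> vec.span ?W" using span by simp
    then show ?thesis
    proof (induction rule: vec.span_induct_alt)
      case (step c x y)
      then obtain k :: int where "\<rho> E *v x = (of_int k / 2) *s x" "\<rho> F' *v x = of_int k *s x" using W by blast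
      moreover have "scale_mat (1/2) (\<rho> F') *v x = (1/2) *s (\<rho> F' *v x)"
        by (simp add: vec_eq_iff matrix_vector_mult_def sum_divide_distrib)
      ultimately have "\<rho> E *v x = \<rho> (scale_mat (1/2) F') *v x"
        by (simp add: differential_scale[OF F'G] vector_smult_assoc)
      then show ?case using step.IH by (simp add: matrix_vector_right_distrib vector_scalar_commute)
    qed simp
  qed
  then have "\<rho> E = \<rho> (scale_mat (1/2) F')" by (simp add: matrix_eq)
  then have "E = scale_mat (1/2) F'" using inj EG lie_alg_scale[OF F'G] by (auto dest: inj_onD)
  then show "E \<in> lie_alg T" using lie_alg_scale[OF F'T] by simp
  have "vec.span ?W \<subseteq> vec.span {y. \<exists>k::int. even (k - w) \<and> \<rho> E *v y = (of_int k / 2) *s y}"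
    using W by (intro vec.span_mono) blast
  then show "vec.span {y. \<exists>k::int. even (k - w) \<and> \<rho> E *v y = (of_int k / 2) *s y} = UNIV"
    unfolding span by blast
qed

section \<open>The symplectic Lie algebra\<close>

text \<open>An element of \<open>'r + 'r\<close> is a signed index: \<open>Inl i\<close> stands for the weight
  \<open>\<epsilon>\<^sub>i\<close> of the standard representation and \<open>Inr i\<close> for \<open>- \<epsilon>\<^sub>i\<close>.\<close>

definition bar :: "'a + 'a \<Rightarrow> 'a + 'a" where
  "bar x = (case x of Inl i \<Rightarrow> Inr i | Inr i \<Rightarrow> Inl i)"

definition sg :: "'a + 'a \<Rightarrow> complex" where
  "sg x = (case x of Inl i \<Rightarrow> 1 | Inr i \<Rightarrow> -1)"

lemma bar_simps [simp]: "bar (Inl i) = Inr i" "bar (Inr i) = Inl i" "bar (bar a) = a"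
  "bar a \<noteq> a" "a \<noteq> bar a" "bar a = bar b \<longleftrightarrow> a = b"
  by (auto simp: bar_def split: sum.splits)

lemma sg_simps [simp]: "sg (Inl i) = 1" "sg (Inr i) = -1" "sg (bar a) = - sg a" "sg a * sg a = 1"
  "sg a \<noteq> 0" "sg a * (sg a * c) = c"
  by (auto simp: bar_def sg_def split: sum.splits)

lemma J_nth: "symplectic_J $ a $ b = (if b = bar a then sg a else 0)"
  by (cases a; cases b) (auto simp: symplectic_J_def)

lemma bij_bar: "bij (bar :: 'a + 'a \<Rightarrow> _)"
  by (rule o_bij[of bar]) (simp_all add: fun_eq_iff)

lemma sum_bar: "(\<Sum>a\<in>UNIV. f (bar a)) = (\<Sum>a\<in>UNIV. f a)"
  for f :: "'a::finite + 'a \<Rightarrow> 'b::comm_monoid_add"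
  by (rule sum.reindex_bij_betw[OF bij_bar])

lemma sp_iff: "A \<in> sp \<longleftrightarrow> (\<forall>p q. A $ bar p $ q = sg p * sg q * A $ bar q $ p)"
proof -
  have J': "symplectic_J $ a $ b = (if a = bar b then sg a else 0)" for a b :: "'a + 'a"
    by (auto simp: J_nth)
  have "(transpose A ** symplectic_J) $ p $ q = - sg q * A $ bar q $ p" for p q
    by (simp add: matrix_mult_nth transpose_def J' if_distrib[of "\<lambda>x. _ * x"] cong: if_cong)
  moreover have "(symplectic_J ** A) $ p $ q = sg p * A $ bar p $ q" for p q
    by (simp add: matrix_mult_nth J_nth if_distrib[of "\<lambda>x. x * _"] cong: if_cong)
  ultimately have "A \<in> sp \<longleftrightarrow> (\<forall>p q. - sg q * A $ bar q $ p + sg p * A $ bar p $ q = 0)"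
    by (simp add: sp_def vec_eq_iff)
  also have "\<dots> \<longleftrightarrow> (\<forall>p q. A $ bar p $ q = sg p * sg q * A $ bar q $ p)"
  proof -
    have "- sg q * x + sg p * y = 0 \<longleftrightarrow> y = sg p * sg q * x" for p q :: "'a + 'a" and x y
    proof -
      have "- sg q * x + sg p * y = 0 \<longleftrightarrow> sg p * y = sg q * x"
        by (subst eq_iff_diff_eq_0) (simp add: algebra_simps)
      also have "\<dots> \<longleftrightarrow> y = sg p * sg q * x"
        by (metis mult.assoc sg_simps(6))
      finally show ?thesis .
    qed
    then show ?thesis by (simp only:)
  qed
  finally show ?thesis .
qed

lemma spI: "(\<And>p q. A $ bar p $ q = sg p * sg q * A $ bar q $ p) \<Longrightarrow> A \<in> sp"
  unfolding sp_iff by blast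

lemma spD: "A \<in> sp \<Longrightarrow> A $ bar p $ q = sg p * sg q * A $ bar q $ p"
  unfolding sp_iff by blast

lemma sp_add: "A \<in> sp \<Longrightarrow> B \<in> sp \<Longrightarrow> A + B \<in> sp"
  by (rule spI) (metis (no_types) distrib_left spD vector_add_component)

lemma sp_scale: "A \<in> sp \<Longrightarrow> scale_mat c A \<in> sp"
  by (rule spI) (metis (no_types) mult.left_commute spD scale_mat_nth)

lemma sp_diff: "A \<in> sp \<Longrightarrow> B \<in> sp \<Longrightarrow> A - B \<in> sp"
  by (rule spI) (metis (no_types) right_diff_distrib spD vector_minus_component)

lemma sp_0: "0 \<in> sp"
  by (intro spI) simp

definition omega :: "complex^('r::finite + 'r) \<Rightarrow> complex^('r + 'r) \<Rightarrow> complex" where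
  "omega x y = (\<Sum>a\<in>UNIV. sg a * x $ a * y $ bar a)"

lemma omega_add: "omega (x + x') y = omega x y + omega x' y" "omega x (y + y') = omega x y + omega x y'"
  and omega_diff: "omega (x - x') y = omega x y - omega x' y" "omega x (y - y') = omega x y - omega x y'"
  and omega_scale: "omega (c *s x) y = c * omega x y" "omega x (c *s y) = c * omega x y"
  and omega_0: "omega 0 y = 0" "omega x 0 = 0"
  by (simp_all add: omega_def algebra_simps sum.distrib sum_subtractf sum_distrib_left)

lemma omega_sum: "omega (\<Sum>i\<in>S. f i) y = (\<Sum>i\<in>S. omega (f i) y)" "omega x (\<Sum>i\<in>S. f i) = (\<Sum>i\<in>S. omega x (f i))"
  by (induction S rule: infinite_finite_induct) (simp_all add: omega_add omega_0)

lemma omega_skew: "omega y x = - omega x y"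
proof -
  have "omega y x = (\<Sum>a\<in>UNIV. sg (bar a) * y $ bar a * x $ bar (bar a))"
    unfolding omega_def by (rule sum_bar[symmetric])
  then show ?thesis by (simp add: omega_def sum_negf[symmetric] mult_ac)
qed

lemma omega_self: "omega x x = 0"
  using omega_skew[of x x] by simp

lemma omega_axis: "omega x (axis a 1) = - sg a * x $ bar a"
proof -
  have "axis a 1 $ bar c = (if c = bar a then 1 else 0 :: complex)" for c
    by (auto simp: axis_def)
  then have "omega x (axis a 1) = (\<Sum>c\<in>UNIV. if c = bar a then - sg a * x $ bar a else 0)"
    unfolding omega_def by (intro sum.cong refl) auto
  then show ?thesis by simp
qed

lemma omega_nondegenerate: "x \<noteq> 0 \<Longrightarrow> \<exists>y. omega x y \<noteq> 0"
proof -
  assume "x \<noteq> 0"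
  then obtain a where "x $ a \<noteq> 0" by (auto simp: vec_eq_iff)
  then have "omega x (axis (bar a) 1) \<noteq> 0" by (simp add: omega_axis)
  then show ?thesis by blast
qed

lemma omega_sp: "A \<in> sp \<Longrightarrow> omega (A *v x) y = - omega x (A *v y)"
proof -
  assume "A \<in> sp"
  note A = spD[OF this]
  have "omega (A *v x) y = (\<Sum>a\<in>UNIV. \<Sum>b\<in>UNIV. sg a * A $ a $ b * x $ b * y $ bar a)"
    by (simp add: omega_def matrix_vector_mult_def sum_distrib_left sum_distrib_right mult.assoc)
  also have "\<dots> = (\<Sum>b\<in>UNIV. \<Sum>a\<in>UNIV. sg (bar a) * A $ bar a $ b * x $ b * y $ bar (bar a))"
    by (subst sum.swap) (intro sum.cong refl sum_bar[symmetric])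
  also have "\<dots> = (\<Sum>b\<in>UNIV. \<Sum>a\<in>UNIV. - (sg b * x $ b * (A $ bar b $ a * y $ a)))"
  proof (intro sum.cong refl)
    fix a b :: "'a + 'a"
    show "sg (bar a) * A $ bar a $ b * x $ b * y $ bar (bar a) = - (sg b * x $ b * (A $ bar b $ a * y $ a))"
      using A[of a b] by simp
  qed
  finally show ?thesis
    by (simp add: omega_def matrix_vector_mult_def sum_distrib_left sum_negf mult.assoc)
qed

text \<open>The identification of \<open>\<ss>\<pp>\<close> with the symmetric square of the standard representation.\<close>

definition sym_square :: "complex^('r::finite + 'r) \<Rightarrow> complex^('r + 'r) \<Rightarrow> complex^('r + 'r)^('r + 'r)" where
  "sym_square u w = (\<chi> i j. sg j * (w $ i * u $ bar j + u $ i * w $ bar j))"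

lemma sym_square_sp: "sym_square u w \<in> sp"
  by (rule spI) (simp add: sym_square_def mult_ac add.commute)

lemma sym_square_linear:
  "sym_square (u + u') w = sym_square u w + sym_square u' w"
  "sym_square (c *s u) w = scale_mat c (sym_square u w)"
  "sym_square u w = sym_square w u"
  by (simp_all add: vec_eq_iff sym_square_def algebra_simps)

text \<open>In each term of \<open>sym_square\<close> one vector stands on the left and one on the
  right. Left multiplication acts on the former; the identity \<open>*\<close>, which is skewness of
  \<open>A\<close> for \<open>omega\<close>, turns right multiplication into minus the action on the
  latter.\<close>

lemma sym_square_bracket:
  assumes "A \<in> sp"
  shows "lie_bracket A (sym_square u w) = sym_square (A *v u) w + sym_square u (A *v w)"
proof -
  note A = spD[OF assms]
  have *: "(\<Sum>k\<in>UNIV. sg k * (u $ bar k * A $ k $ j)) = - (sg j * (A *v u) $ bar j)" for u j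
  proof -
    have "(\<Sum>k\<in>UNIV. sg k * (u $ bar k * A $ k $ j)) = (\<Sum>k\<in>UNIV. sg (bar k) * (u $ bar (bar k) * A $ bar k $ j))"
      by (rule sum_bar[symmetric])
    also have "\<dots> = (\<Sum>k\<in>UNIV. - (sg j * (A $ bar j $ k * u $ k)))"
      by (simp add: A[of _ j] mult_ac)
    finally show ?thesis by (simp add: matrix_vector_mult_def sum_distrib_left sum_negf)
  qed
  have "lie_bracket A (sym_square u w) $ i $ j = (sym_square (A *v u) w + sym_square u (A *v w)) $ i $ j" for i j
  proof -
    have "(A ** sym_square u w) $ i $ j = sg j * ((A *v w) $ i * u $ bar j + (A *v u) $ i * w $ bar j)"
      by (simp add: matrix_mult_nth sym_square_def matrix_vector_mult_def sum_distrib_left sum_distrib_right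
          sum.distrib algebra_simps)
    moreover have "(sym_square u w ** A) $ i $ j =
        w $ i * (\<Sum>k\<in>UNIV. sg k * (u $ bar k * A $ k $ j)) + u $ i * (\<Sum>k\<in>UNIV. sg k * (w $ bar k * A $ k $ j))"
      by (simp add: matrix_mult_nth sym_square_def sum_distrib_left sum.distrib algebra_simps)
    ultimately show ?thesis
      unfolding * by (simp add: lie_bracket_def sym_square_def algebra_simps)
  qed
  then show ?thesis by (simp add: vec_eq_iff)
qed

section \<open>Lie algebras of matrices isomorphic to sp\<close>

locale sp_iso =
  fixes g :: "(complex^'n^'n) set" and \<theta> :: "complex^'n^'n \<Rightarrow> complex^('r::finite + 'r)^('r + 'r)"
  assumes iso: "lie_iso g sp \<theta>"
    and g_add: "X \<in> g \<Longrightarrow> Y \<in> g \<Longrightarrow> X + Y \<in> g" and g_scale: "X \<in> g \<Longrightarrow> scale_mat c X \<in> g"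
    and g_bracket: "X \<in> g \<Longrightarrow> Y \<in> g \<Longrightarrow> lie_bracket X Y \<in> g"
begin

lemma theta_sp: "X \<in> g \<Longrightarrow> \<theta> X \<in> sp"
  and theta_inj: "X \<in> g \<Longrightarrow> Y \<in> g \<Longrightarrow> \<theta> X = \<theta> Y \<Longrightarrow> X = Y"
  and theta_add: "X \<in> g \<Longrightarrow> Y \<in> g \<Longrightarrow> \<theta> (X + Y) = \<theta> X + \<theta> Y"
  and theta_scale: "X \<in> g \<Longrightarrow> \<theta> (scale_mat c X) = scale_mat c (\<theta> X)"
  and theta_bracket: "X \<in> g \<Longrightarrow> Y \<in> g \<Longrightarrow> \<theta> (lie_bracket X Y) = lie_bracket (\<theta> X) (\<theta> Y)"
  using iso by (auto simp: lie_iso_def bij_betw_def dest: inj_onD)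

definition inv_theta :: "complex^('r + 'r)^('r + 'r) \<Rightarrow> complex^'n^'n" where
  "inv_theta = inv_into g \<theta>"

lemma inv_theta: "A \<in> sp \<Longrightarrow> inv_theta A \<in> g" "A \<in> sp \<Longrightarrow> \<theta> (inv_theta A) = A"
  using iso unfolding inv_theta_def lie_iso_def bij_betw_def
  by (metis inv_into_into, metis f_inv_into_f)

lemma inv_theta_theta: "X \<in> g \<Longrightarrow> inv_theta (\<theta> X) = X"
  using theta_inj inv_theta theta_sp by blast

lemma g_diff: "X \<in> g \<Longrightarrow> Y \<in> g \<Longrightarrow> X - Y \<in> g"
  using g_add[of X "scale_mat (-1) Y"] g_scale[of Y "-1"] by (simp add: scale_mat_minus_one)

lemma theta_diff: "X \<in> g \<Longrightarrow> Y \<in> g \<Longrightarrow> \<theta> (X - Y) = \<theta> X - \<theta> Y"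
  using theta_add[of X "scale_mat (-1) Y"] g_scale[of Y "-1"] theta_scale[of Y "-1"]
  by (simp add: scale_mat_minus_one)

lemma g_0: "0 \<in> g"
  using g_scale[OF inv_theta(1)[OF sp_0], of 0] by simp

lemma theta_0: "\<theta> 0 = 0"
  using theta_scale[OF g_0, of 0] by simp

text \<open>If \<open>\<theta> X\<close> had a Jordan block \<open>x, y\<close>, then \<open>ad X\<close> would have the Jordan block
  \<open>x\<^sup>2, 2 x y, 2 y\<^sup>2\<close>.\<close>

lemma theta_diagonalizable:
  assumes X: "X \<in> g" and d: "diagonalizable X"
  shows "diagonalizable (\<theta> X)"
proof (rule double_kernel_diagonalizable)
  fix x y a assume y: "y = \<theta> X *v x - a *s x" and ay: "\<theta> X *v y = a *s y"
  let ?A = "\<theta> X" and ?M = "sym_square"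
  have A: "?A \<in> sp" using X by (rule theta_sp)
  have Ax: "?A *v x = a *s x + y" using y by simp
  define E where "E Z = lie_bracket X Z - scale_mat (2 * a) Z" for Z
  have Eg: "E Z \<in> g" if "Z \<in> g" for Z unfolding E_def using that X by (intro g_diff g_scale g_bracket)
  have tE: "\<theta> (E Z) = lie_bracket ?A (\<theta> Z) - scale_mat (2 * a) (\<theta> Z)" if "Z \<in> g" for Z
    unfolding E_def using that X by (simp add: theta_diff g_scale g_bracket theta_scale theta_bracket)
  define Z where "Z = inv_theta (?M x x)"
  have Z: "Z \<in> g" "\<theta> Z = ?M x x" by (simp_all add: Z_def inv_theta sym_square_sp)
  have Ml: "?M x (u + u') = ?M x u + ?M x u'" "?M x (c *s u) = scale_mat c (?M x u)" for x u u' c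
    using sym_square_linear by metis+
  have 1: "\<theta> (E Z) = scale_mat 2 (?M x y)"
    unfolding tE[OF Z(1)] Z(2) sym_square_bracket[OF A] Ax
    by (simp add: sym_square_linear(1,2) Ml sym_square_linear(3)[of y x]) (simp add: vec_eq_iff algebra_simps)
  have br: "lie_bracket ?A (scale_mat c N) = scale_mat c (lie_bracket ?A N)" for c N
    by (simp add: lie_bracket_def vec_eq_iff matrix_mult_nth algebra_simps sum_distrib_left)
  have 2: "\<theta> (E (E Z)) = scale_mat 2 (?M y y)"
    unfolding tE[OF Eg[OF Z(1)]] 1 br sym_square_bracket[OF A] Ax ay
    by (simp add: sym_square_linear(1,2) Ml) (simp add: vec_eq_iff algebra_simps)
  have EE: "E (E Z) \<in> g" using Z(1) by (intro Eg)
  have "\<theta> (lie_bracket X (E (E Z))) = \<theta> (scale_mat (2 * a) (E (E Z)))"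
    unfolding theta_bracket[OF X EE] theta_scale[OF EE] 2 br sym_square_bracket[OF A] ay
    by (simp add: sym_square_linear(1,2) Ml) (simp add: vec_eq_iff algebra_simps)
  then have "lie_bracket X (E (E Z)) = scale_mat (2 * a) (E (E Z))"
    using EE X by (intro theta_inj) (auto intro: g_bracket g_scale)
  then have "E (E Z) = 0" using diagonalizable_ad_double[OF d, of "E (E Z)" "E Z" "2 * a"] unfolding E_def by blast
  then have "scale_mat 2 (?M y y) = 0" using 2 theta_0 by simp
  then have "scale_mat 2 (?M y y) $ i $ bar i = 0" for i by simp
  then have "y $ i = 0" for i by (simp add: sym_square_def)
  then show "y = 0" by (simp add: vec_eq_iff)
qed

end

text \<open>A symplectic Gram-Schmidt process among common eigenvectors, adding one hyperbolic pair
  per index. Eigenvectors with nonzero pairing have opposite eigenvalues, and therefore removing the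
  components along the pairs already chosen again leaves a common eigenvector.\<close>

lemma symplectic_eigenbasis:
  fixes E :: "(complex^('r::finite + 'r)) set"
  assumes F: "F \<subseteq> sp" and E: "vec.span E = UNIV" "\<And>u A. u \<in> E \<Longrightarrow> A \<in> F \<Longrightarrow> \<exists>k. A *v u = k *s u"
  shows "\<exists>b :: 'r + 'r \<Rightarrow> complex^('r + 'r). (\<forall>a. \<forall>A\<in>F. \<exists>k. A *v b a = k *s b a) \<and> (\<forall>a c. omega (b a) (b c) = symplectic_J $ a $ c)"
proof -
  define I where "I S = Inl ` S \<union> Inr ` S" for S :: "'r set"
  have Ibar: "bar a \<in> I S \<longleftrightarrow> a \<in> I S" for a S by (cases a) (auto simp: I_def)
  have "\<exists>b. (\<forall>a\<in>I S. \<forall>A\<in>F. \<exists>k. A *v b a = k *s b a) \<and> (\<forall>a\<in>I S. \<forall>c\<in>I S. omega (b a) (b c) = symplectic_J $ a $ c)"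
    if "finite S" for S
    using that
  proof (induction S rule: finite_induct)
    case empty show ?case by (simp add: I_def)
  next
    case (insert i S)
    then obtain b where b: "\<And>a A. a \<in> I S \<Longrightarrow> A \<in> F \<Longrightarrow> \<exists>k. A *v b a = k *s b a"
      and J: "\<And>a c. a \<in> I S \<Longrightarrow> c \<in> I S \<Longrightarrow> omega (b a) (b c) = symplectic_J $ a $ c" by blast
    have fin: "finite (I S)" by simp
    define pr where "pr x = x - (\<Sum>a\<in>I S. (sg a * omega x (b (bar a))) *s b a)" for x
    have orth: "omega (pr x) (b c) = 0" if c: "c \<in> I S" for x c
    proof -
      have "omega (pr x) (b c) = omega x (b c) - (\<Sum>a\<in>I S. sg a * omega x (b (bar a)) * (if c = bar a then sg a else 0))"
        unfolding pr_def by (simp add: omega_diff omega_sum omega_scale J c J_nth)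
      also have "(\<Sum>a\<in>I S. sg a * omega x (b (bar a)) * (if c = bar a then sg a else 0))
         = (\<Sum>a\<in>I S. if a = bar c then omega x (b c) else 0)"
        by (rule sum.cong) (auto simp: mult_ac)
      also have "\<dots> = omega x (b c)" using c fin Ibar by simp
      finally show ?thesis by simp
    qed
    have ev: "\<exists>k. A *v pr x = k *s pr x" if xE: "x \<in> E" and A: "A \<in> F" for x A
    proof -
      have Asp: "A \<in> sp" using A F by blast
      obtain k where k: "A *v x = k *s x" using E(2)[OF xE A] by blast
      have "\<forall>a\<in>I S. \<exists>l. A *v b a = l *s b a" using b A by blast
      then obtain l where l: "\<And>a. a \<in> I S \<Longrightarrow> A *v b a = l a *s b a" by metis
      \<comment> \<open>Either the coefficient is 0, or \<open>x\<close> and \<open>b a\<close> have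
        the same eigenvalue, both being opposite to that of \<open>b (bar a)\<close>.\<close>
      have "A *v ((sg a * omega x (b (bar a))) *s b a) = k *s ((sg a * omega x (b (bar a))) *s b a)" if a: "a \<in> I S" for a
      proof -
        have ab: "bar a \<in> I S" using a Ibar by blast
        have "l a * omega (b a) (b (bar a)) = - l (bar a) * omega (b a) (b (bar a))"
          using omega_sp[OF Asp, of "b a" "b (bar a)"] l[OF a] l[OF ab] by (simp add: omega_scale)
        then have "(l (bar a) + l a) * sg a = 0" using J[OF a ab] by (simp add: J_nth algebra_simps)
        then have 1: "l (bar a) = - l a" by (simp add: eq_neg_iff_add_eq_0)
        have "k * omega x (b (bar a)) = - l (bar a) * omega x (b (bar a))"
          using omega_sp[OF Asp, of x "b (bar a)"] k l[OF ab] by (simp add: omega_scale)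
        then have "omega x (b (bar a)) = 0 \<or> k = l a" using 1 by auto
        then show ?thesis using l[OF a] by (auto simp: vector_scalar_commute vector_smult_assoc mult_ac)
      qed
      then have "A *v pr x = k *s pr x"
        unfolding pr_def
        by (simp add: matrix_vector_mult_diff_distrib vec.linear_sum[OF matrix_vector_mul_linear_gen] k
            vec.scale_right_diff_distrib vec.scale_sum_right)
      then show ?thesis by blast
    qed
    \<comment> \<open>Fewer than \<open>CARD('r)\<close> pairs cannot span the whole space, so some
      element of \<open>E\<close> survives the projection.\<close>
    have "\<exists>x\<in>E. pr x \<noteq> 0"
    proof (rule ccontr)
      assume "\<not> ?thesis"
      then have *: "x = (\<Sum>a\<in>I S. (sg a * omega x (b (bar a))) *s b a)" if "x \<in> E" for x
        using that by (simp add: pr_def)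
      have "x \<in> vec.span (b ` I S)" if "x \<in> E" for x
        by (subst *[OF that]) (intro vec.span_sum vec.span_scale vec.span_base imageI)
      then have "vec.span E \<subseteq> vec.span (b ` I S)" by (intro vec.span_minimal) auto
      then have "vec.dim (UNIV :: (complex^('r + 'r)) set) \<le> card (b ` I S)"
        using vec.dim_le_card[of UNIV "b ` I S"] fin E(1) by simp
      also have "\<dots> \<le> card (I S)" using fin by (rule card_image_le)
      also have "\<dots> \<le> card S + card S"
        unfolding I_def by (rule order_trans[OF card_Un_le]) (simp add: card_image)
      finally have "CARD('r + 'r) \<le> card S + card S" unfolding vec_dim_card .
      moreover have "card S < CARD('r)" using insert.hyps by (intro psubset_card_mono) auto
      ultimately show False by simp
    qed
    then obtain x where x: "x \<in> E" "pr x \<noteq> 0" by blast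
    have "\<exists>y\<in>E. omega (pr x) y \<noteq> 0"
    proof (rule ccontr)
      assume *: "\<not> ?thesis"
      have "omega (pr x) y = 0" for y
      proof -
        have "y \<in> vec.span E" using E(1) by simp
        then show ?thesis
          by (induction rule: vec.span_induct_alt) (use * in \<open>auto simp: omega_0 omega_add omega_scale\<close>)
      qed
      then show False using omega_nondegenerate[OF x(2)] by blast
    qed
    then obtain y where y: "y \<in> E" "omega (pr x) y \<noteq> 0" by blast
    define f where "f = pr y"
    define n where "n = omega (pr x) f"
    \<comment> \<open>Projecting the partner leaves the pairing unchanged, since \<open>pr x\<close>
      is already orthogonal to the chosen pairs.\<close>
    have "omega (pr x) f = omega (pr x) y"
      unfolding f_def pr_def[of y] by (simp add: omega_diff omega_sum omega_scale orth)
    then have n: "n \<noteq> 0" using y(2) by (simp add: n_def)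
    define b' where "b' = b(Inl i := pr x, Inr i := inverse n *s f)"
    have I': "I (insert i S) = insert (Inl i) (insert (Inr i) (I S))" by (auto simp: I_def)
    have nI: "Inl i \<notin> I S" "Inr i \<notin> I S" using insert.hyps by (auto simp: I_def)
    have b'S: "b' a = b a" if "a \<in> I S" for a using that nI by (auto simp: b'_def)
    have b'i: "b' (Inl i) = pr x" "b' (Inr i) = inverse n *s f" by (simp_all add: b'_def)
    have "\<forall>a\<in>I (insert i S). \<forall>A\<in>F. \<exists>k. A *v b' a = k *s b' a"
      unfolding I'
    proof safe
      fix A assume A: "A \<in> F"
      show "\<exists>k. A *v b' (Inl i) = k *s b' (Inl i)" unfolding b'i using ev[OF x(1) A] .
      obtain k where "A *v f = k *s f" using ev[OF y(1) A] by (auto simp: f_def)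
      then show "\<exists>k. A *v b' (Inr i) = k *s b' (Inr i)" unfolding b'i
        by (intro exI[of _ k]) (simp add: vector_scalar_commute vector_smult_assoc mult_ac)
      fix a assume "a \<in> I S"
      then show "\<exists>k. A *v b' a = k *s b' a" using b A by (simp add: b'S)
    qed
    moreover have "\<forall>a\<in>I (insert i S). \<forall>c\<in>I (insert i S). omega (b' a) (b' c) = symplectic_J $ a $ c"
    proof -
      have 1: "omega (pr z) (b c) = 0" "omega (b c) (pr z) = 0" if "c \<in> I S" for c z
        using orth[OF that, of z] omega_skew[of "b c" "pr z"] by simp_all
      have 2: "omega (pr x) f = n" "omega f (pr x) = - n" using omega_skew[of f "pr x"] by (simp_all add: n_def)
      have 3: "bar c \<noteq> Inl i" "bar c \<noteq> Inr i" "Inl i \<noteq> bar c" "Inr i \<noteq> bar c" if "c \<in> I S" for c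
        using that nI Ibar by metis+
      have 4: "c \<noteq> Inl i" "c \<noteq> Inr i" if "c \<in> I S" for c
        using that nI by auto
      show ?thesis unfolding I'
      proof (intro ballI)
        fix a c assume "a \<in> insert (Inl i) (insert (Inr i) (I S))" "c \<in> insert (Inl i) (insert (Inr i) (I S))"
        then show "omega (b' a) (b' c) = symplectic_J $ a $ c"
          by (elim insertE) (simp_all add: b'i 1 1[of _ y, folded f_def] 4 3 2 omega_scale omega_self n J_nth b'S J)
      qed
    qed
    ultimately show ?case by blast
  qed
  from this[of UNIV] obtain b where
    "(\<forall>a\<in>I UNIV. \<forall>A\<in>F. \<exists>k. A *v b a = k *s b a) \<and> (\<forall>a\<in>I UNIV. \<forall>c\<in>I UNIV. omega (b a) (b c) = symplectic_J $ a $ c)"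
    by auto
  moreover have "a \<in> I UNIV" for a by (cases a) (auto simp: I_def)
  ultimately show ?thesis by (intro exI[of _ b]) simp
qed

text \<open>A root vector of weight e_a - e_b, where e of \<open>bar a\<close> means minus e_a. Up
  to a factor \<open>Xm (bar b) (bar a)\<close> is the same element; for \<open>b = bar a\<close> it
  is twice an elementary matrix, and for \<open>b = a\<close> a coordinate vector of the diagonal
  subalgebra. Signed indices let one bracket formula cover short roots, long roots and the
  torus.\<close>

definition Xm :: "'r + 'r \<Rightarrow> 'r + 'r \<Rightarrow> complex^('r::finite + 'r)^('r + 'r)" where
  "Xm a b = (\<chi> p q. (if p = a \<and> q = b then 1 else 0) - sg a * sg b * (if p = bar b \<and> q = bar a then 1 else 0))"

definition sp_diag :: "(complex^('r::finite + 'r)^('r + 'r)) set" where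
  "sp_diag = {A\<in>sp. \<forall>p q. p \<noteq> q \<longrightarrow> A $ p $ q = 0}"

lemma Xm_sp: "Xm a b \<in> sp"
proof (rule spI)
  fix p q
  show "Xm a b $ bar p $ q = sg p * sg q * Xm a b $ bar q $ p"
    by (cases "bar p = a"; cases "q = b"; cases "bar q = a"; cases "p = b")
      (auto simp: Xm_def algebra_simps)
qed

lemma sp_diag_bar: "A \<in> sp_diag \<Longrightarrow> A $ bar a $ bar a = - A $ a $ a"
  using spD[of A a "bar a"] by (simp add: sp_diag_def)

lemma Xm_diag: "Xm a a \<in> sp_diag"
  using Xm_sp[of a a] by (auto simp: sp_diag_def Xm_def)

lemma diag_bracket:
  "A \<in> sp_diag \<Longrightarrow> lie_bracket A X $ a $ b = (A $ a $ a - A $ b $ b) * X $ a $ b"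
proof -
  assume "A \<in> sp_diag"
  then have A: "p \<noteq> q \<Longrightarrow> A $ p $ q = 0" for p q by (auto simp: sp_diag_def)
  have "(A ** X) $ a $ b = (\<Sum>k\<in>UNIV. if k = a then A $ a $ a * X $ a $ b else 0)"
    unfolding matrix_mult_nth by (intro sum.cong refl) (auto simp: A)
  moreover have "(X ** A) $ a $ b = (\<Sum>k\<in>UNIV. if k = b then A $ b $ b * X $ a $ b else 0)"
    unfolding matrix_mult_nth by (intro sum.cong refl) (auto simp: A)
  ultimately show ?thesis by (simp add: lie_bracket_def algebra_simps)
qed

lemma Xm_sym_square: "Xm a b = scale_mat (sg b) (sym_square (axis a 1) (axis (bar b) 1))"
proof -
  have "Xm a b $ p $ q = sg b * (sg q * ((if p = bar b then 1 else 0) * (if q = bar a then 1 else 0)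
      + (if p = a then 1 else 0) * (if q = b then 1 else 0)))" for p q
  proof -
    have "bar a = b \<Longrightarrow> sg a * sg b = -1 \<and> sg b * sg a = -1" by auto
    moreover have "bar b = a \<Longrightarrow> sg a * sg b = -1 \<and> sg b * sg a = -1" by auto
    ultimately show ?thesis
      by (cases "p = a"; cases "q = b"; cases "p = bar b"; cases "q = bar a") (simp_all add: Xm_def)
  qed
  moreover have "axis c 1 $ d = (if d = c then 1 else 0 :: complex)" for c d :: "'a + 'a"
    by (auto simp: axis_def)
  moreover have "bar q = a \<longleftrightarrow> q = bar a" for q by auto
  ultimately show ?thesis by (simp add: vec_eq_iff sym_square_def)
qed

lemma sym_square_axis: "sym_square (axis a 1) (axis b 1) = scale_mat (- sg b) (Xm a (bar b))"
  unfolding Xm_sym_square by (simp add: vec_eq_iff)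

lemma Xm_axis: "Xm a b *v axis c 1 = (if b = c then axis a 1 else 0) - (sg a * sg b) *s (if c = bar a then axis (bar b) 1 else 0)"
proof -
  have "(A *v axis c 1) $ i = A $ i $ c" for A :: "complex^('a + 'a)^('a + 'a)" and i
    by (simp add: matrix_vector_mult_def axis_def if_distrib[of "\<lambda>x. _ * x"] cong: if_cong)
  then show ?thesis by (auto simp: vec_eq_iff Xm_def axis_def)
qed

text \<open>Computed in the symmetric square, where \<open>Xm a b\<close> acts as a derivation
  through its action on basis vectors.\<close>

lemma Xm_bracket:
  "lie_bracket (Xm a b) (Xm c d) = (if b = c then Xm a d else 0) - (if d = a then Xm c b else 0)
     - scale_mat (sg a * sg b) ((if c = bar a then Xm (bar b) d else 0) - (if d = bar b then Xm c (bar a) else 0))"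
proof -
  have br: "lie_bracket A (scale_mat k N) = scale_mat k (lie_bracket A N)" for A N :: "complex^('a + 'a)^('a + 'a)" and k
    by (simp add: lie_bracket_def vec_eq_iff matrix_mult_nth algebra_simps sum_distrib_left)
  have ss: "scale_mat k (scale_mat l N) = scale_mat (k * l) N" for N :: "complex^('a + 'a)^('a + 'a)" and k l
    by (simp add: vec_eq_iff)
  have sum: "sym_square (u - k *s v) w = sym_square u w - scale_mat k (sym_square v w)" for u v w :: "complex^('a + 'a)" and k
    by (simp add: vec_eq_iff sym_square_def algebra_simps)
  have sum': "sym_square w (u - k *s v) = sym_square w u - scale_mat k (sym_square w v)" for u v w :: "complex^('a + 'a)" and k
    by (simp add: vec_eq_iff sym_square_def algebra_simps)
  have z: "sym_square 0 w = 0" "sym_square w 0 = 0" for w :: "complex^('a + 'a)"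
    by (simp_all add: vec_eq_iff sym_square_def)
  have "lie_bracket (Xm a b) (Xm c d) = scale_mat (sg d)
     ((if b = c then sym_square (axis a 1) (axis (bar d) 1) else 0)
      - scale_mat (sg a * sg b) (if c = bar a then sym_square (axis (bar b) 1) (axis (bar d) 1) else 0)
      + (if d = bar b then sym_square (axis c 1) (axis a 1) else 0)
      - scale_mat (sg a * sg b) (if d = a then sym_square (axis c 1) (axis (bar b) 1) else 0))"
    unfolding Xm_sym_square[of c d] br sym_square_bracket[OF Xm_sp] Xm_axis sum sum'
    by (auto simp: z sym_square_linear(3)[of "axis (bar d) 1" "axis (bar b) 1"] add.assoc add_diff_eq)
  also have "\<dots> = (if b = c then Xm a d else 0) - (if d = a then Xm c b else 0)
     - scale_mat (sg a * sg b) ((if c = bar a then Xm (bar b) d else 0) - (if d = bar b then Xm c (bar a) else 0))"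
    unfolding sym_square_axis by (auto simp: vec_eq_iff algebra_simps)
  finally show ?thesis .
qed

locale sp_frame = sp_iso g \<theta> for g :: "(complex^'n^'n) set" and \<theta> :: "complex^'n^'n \<Rightarrow> complex^('r::finite + 'r)^('r + 'r)" +
  fixes t :: "(complex^'n^'n) set"
  assumes tg: "t \<subseteq> g" and t_diag: "\<theta> ` t = sp_diag"
begin

definition wt :: "'r + 'r \<Rightarrow> complex^'n^'n \<Rightarrow> complex" where
  "wt a H = \<theta> H $ a $ a"

definition Xg :: "'r + 'r \<Rightarrow> 'r + 'r \<Rightarrow> complex^'n^'n" where
  "Xg a b = inv_theta (Xm a b)"

lemma Xg: "Xg a b \<in> g" "\<theta> (Xg a b) = Xm a b"
  by (simp_all add: Xg_def inv_theta Xm_sp)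

lemma Xg_t: "Xg a a \<in> t"
proof -
  obtain H where "H \<in> t" "\<theta> H = Xm a a" using t_diag Xm_diag[of a] by (metis imageE)
  then show ?thesis using theta_inj[of H "Xg a a"] Xg[of a a] tg by auto
qed

lemma theta_t: "H \<in> t \<Longrightarrow> \<theta> H \<in> sp_diag"
  using t_diag by blast

lemma wt_bar: "H \<in> t \<Longrightarrow> wt (bar a) H = - wt a H"
  unfolding wt_def by (rule sp_diag_bar[OF theta_t])

lemma wt_eqI: "H \<in> t \<Longrightarrow> H' \<in> t \<Longrightarrow> (\<And>i. wt (Inl i) H = wt (Inl i) H') \<Longrightarrow> H = H'"
proof -
  assume H: "H \<in> t" "H' \<in> t" and w: "\<And>i. wt (Inl i) H = wt (Inl i) H'"
  have w': "wt a H = wt a H'" for a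
    using w wt_bar[OF H(1), of "Inl _"] wt_bar[OF H(2), of "Inl _"] by (cases a) auto
  have "\<theta> H $ p $ q = \<theta> H' $ p $ q" for p q
    using w'[of p] theta_t[OF H(1)] theta_t[OF H(2)] by (cases "p = q") (auto simp: wt_def sp_diag_def)
  then have "\<theta> H = \<theta> H'" by (simp add: vec_eq_iff)
  then show ?thesis using H tg by (intro theta_inj) auto
qed

lemma wt_add: "H \<in> t \<Longrightarrow> H' \<in> t \<Longrightarrow> wt a (H + H') = wt a H + wt a H'"
  and wt_scale: "H \<in> t \<Longrightarrow> wt a (scale_mat c H) = c * wt a H"
  using subsetD[OF tg] by (simp_all add: wt_def theta_add theta_scale)

lemma t_add: "H \<in> t \<Longrightarrow> H' \<in> t \<Longrightarrow> H + H' \<in> t"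
  and t_scale: "H \<in> t \<Longrightarrow> scale_mat c H \<in> t"
proof -
  have inv: "X \<in> t" if X: "X \<in> g" "\<theta> X \<in> sp_diag" for X
  proof -
    obtain H where "H \<in> t" "\<theta> H = \<theta> X" using t_diag X(2) by (metis imageE)
    then show ?thesis using theta_inj[of H X] X tg by auto
  qed
  show "H \<in> t \<Longrightarrow> H' \<in> t \<Longrightarrow> H + H' \<in> t"
    using subsetD[OF tg] theta_t[of H] theta_t[of H'] by (intro inv g_add) (auto simp: theta_add[of H H'] sp_diag_def sp_add)
  show "H \<in> t \<Longrightarrow> scale_mat c H \<in> t"
    using subsetD[OF tg] theta_t[of H] by (intro inv g_scale) (auto simp: theta_scale[of H] sp_diag_def sp_scale)
qed

lemma wt_Xg: "wt c (Xg a a) = (if c = a then 1 else 0) - (if c = bar a then 1 else 0)"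
  by (simp add: wt_def Xg Xm_def)

lemma root_wt:
  assumes "is_root g t \<alpha>"
  shows "\<exists>a b. a \<noteq> b \<and> (\<forall>H\<in>t. \<alpha> H = wt a H - wt b H)"
proof -
  obtain X where X: "X \<in> g" "\<And>H. H \<in> t \<Longrightarrow> lie_bracket H X = scale_mat (\<alpha> H) X" "X \<noteq> 0"
    and nz: "\<exists>H\<in>t. \<alpha> H \<noteq> 0"
    using assms by (auto simp: is_root_def root_space_def)
  have "\<theta> X \<noteq> 0" using X(1,3) theta_inj[OF X(1) g_0] theta_0 by auto
  then obtain a b where ab: "\<theta> X $ a $ b \<noteq> 0" by (auto simp: vec_eq_iff)
  have *: "\<alpha> H = wt a H - wt b H" if H: "H \<in> t" for H
  proof -
    have "lie_bracket (\<theta> H) (\<theta> X) = scale_mat (\<alpha> H) (\<theta> X)"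
      using X(1,2) H tg by (metis subsetD theta_bracket theta_scale)
    from arg_cong[OF this, of "\<lambda>A. A $ a $ b"] show ?thesis
      using ab by (simp add: diag_bracket[OF theta_t[OF H]] wt_def)
  qed
  moreover have "a \<noteq> b" using * nz by auto
  ultimately show ?thesis by blast
qed

lemma Xg_root_space:
  assumes "\<And>H. H \<in> t \<Longrightarrow> \<alpha> H = wt a H - wt b H"
  shows "Xg a b \<in> root_space g t \<alpha>"
  unfolding root_space_def
proof (intro CollectI conjI ballI Xg)
  fix H assume H: "H \<in> t"
  have "\<theta> (lie_bracket H (Xg a b)) = \<theta> (scale_mat (\<alpha> H) (Xg a b))"
  proof -
    have "lie_bracket (\<theta> H) (Xm a b) = scale_mat (\<alpha> H) (Xm a b)"
      by (simp add: vec_eq_iff diag_bracket[OF theta_t[OF H]] assms[OF H] wt_def)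
        (auto simp: Xm_def sp_diag_bar[OF theta_t[OF H]])
    then show ?thesis using H tg by (auto simp: theta_bracket theta_scale Xg)
  qed
  then show "lie_bracket H (Xg a b) = scale_mat (\<alpha> H) (Xg a b)"
    using H tg by (intro theta_inj) (auto intro: g_bracket g_scale Xg)
qed

lemma coroot_short:
  assumes "\<And>H. H \<in> t \<Longrightarrow> \<alpha> H = wt a H - wt b H" "a \<noteq> b" "b \<noteq> bar a"
  shows "is_coroot g t \<alpha> (Xg a a - Xg b b)"
proof -
  have t: "Xg a a - Xg b b \<in> t"
    using t_add[OF Xg_t[of a] t_scale[OF Xg_t[of b], of "-1"]] by (simp add: scale_mat_minus_one)
  have w: "wt c (Xg a a - Xg b b) = wt c (Xg a a) - wt c (Xg b b)" for c
    by (simp add: wt_def theta_diff Xg)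
  have "\<theta> (Xg a a - Xg b b) = \<theta> (lie_bracket (Xg a b) (Xg b a))"
    using assms(2,3) by (auto simp: theta_diff Xg theta_bracket Xm_bracket)
  then have "Xg a a - Xg b b = lie_bracket (Xg a b) (Xg b a)"
    by (intro theta_inj g_diff g_bracket Xg)
  moreover have "\<alpha> (Xg a a - Xg b b) = 2"
    using assms(2,3) by (auto simp: assms(1)[OF t] w wt_Xg)
  moreover have "Xg a b \<in> root_space g t \<alpha>" "Xg b a \<in> root_space g t (\<lambda>H. - \<alpha> H)"
    by (intro Xg_root_space; simp add: assms(1))+
  ultimately show ?thesis using t unfolding is_coroot_def by blast
qed

lemma coroot_long:
  assumes "\<And>H. H \<in> t \<Longrightarrow> \<alpha> H = wt a H - wt (bar a) H"
  shows "is_coroot g t \<alpha> (Xg a a)"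
proof -
  have a: "\<alpha> (Xg a a) = 2" by (simp add: assms[OF Xg_t] wt_Xg)
  \<comment> \<open>The two long root vectors are each twice an elementary matrix, so their bracket
    is four times \<open>Xm a a\<close>; hence the factor 1/4.\<close>
  have "\<theta> (Xg a a) = \<theta> (lie_bracket (scale_mat (1/4) (Xg a (bar a))) (Xg (bar a) a))"
  proof -
    have "lie_bracket (scale_mat (1/4) A) B = scale_mat (1/4) (lie_bracket A B)" for A B :: "complex^('r + 'r)^('r + 'r)"
      by (simp add: lie_bracket_def vec_eq_iff matrix_mult_nth sum_divide_distrib diff_divide_distrib)
    then show ?thesis
      by (simp add: Xg theta_bracket theta_scale g_scale Xm_bracket)
        (simp add: vec_eq_iff Xm_def)
  qed
  then have "Xg a a = lie_bracket (scale_mat (1/4) (Xg a (bar a))) (Xg (bar a) a)"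
    by (intro theta_inj g_bracket g_scale Xg)
  moreover have "scale_mat (1/4) (Xg a (bar a)) \<in> root_space g t \<alpha>"
  proof -
    have "Xg a (bar a) \<in> root_space g t \<alpha>" by (rule Xg_root_space[OF assms])
    moreover have "lie_bracket H (scale_mat k X) = scale_mat k (lie_bracket H X)" for H X :: "complex^'n^'n" and k
      by (simp add: lie_bracket_def vec_eq_iff matrix_mult_nth algebra_simps sum_distrib_left)
    ultimately show ?thesis by (auto simp: root_space_def g_scale vec_eq_iff)
  qed
  moreover have "Xg (bar a) a \<in> root_space g t (\<lambda>H. - \<alpha> H)"
    by (rule Xg_root_space) (simp add: assms)
  ultimately show ?thesis using a Xg_t[of a] unfolding is_coroot_def by blast
qed

end

section \<open>Adapted coordinates\<close>

lemma omega_matrix: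
  fixes b :: "'r::finite + 'r \<Rightarrow> complex^('r + 'r)"
  assumes "\<And>a c. omega (b a) (b c) = symplectic_J $ a $ c"
  shows "\<exists>C. C ** (\<chi> i a. b a $ i) = mat 1 \<and> (\<chi> i a. b a $ i) ** C = mat 1"
proof -
  let ?B = "\<chi> i a. b a $ i"
  define C where "C = (\<chi> a i. sg a * sg i * b (bar a) $ bar i)"
  have "(C ** ?B) $ a $ c = mat 1 $ a $ c" for a c
  proof -
    have "(C ** ?B) $ a $ c = sg a * (\<Sum>i\<in>UNIV. sg i * b c $ i * b (bar a) $ bar i)"
      by (simp add: matrix_mult_nth C_def sum_distrib_left mult_ac)
    also have "\<dots> = sg a * omega (b c) (b (bar a))" by (simp add: omega_def)
    finally show ?thesis by (auto simp: assms J_nth mat_nth)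
  qed
  then have "C ** ?B = mat 1" by (simp add: vec_eq_iff)
  then show ?thesis using matrix_left_right_inverse by blast
qed

context sp_iso begin

text \<open>The matrix \<open>B\<close> with columns \<open>b\<close> is symplectic, so conjugation
  by it preserves sp, and it makes \<open>t\<close> diagonal. Conversely a diagonal element of sp
  commutes with \<open>t\<close>, and the normalizer hypothesis \<open>cartan\<close> puts it into
  \<open>t\<close>.\<close>

lemma frame_of_eigenbasis:
  fixes b :: "'r + 'r \<Rightarrow> complex^('r + 'r)"
  assumes J: "\<And>a c. omega (b a) (b c) = symplectic_J $ a $ c"
    and t: "t \<subseteq> g" "0 \<in> t" and cartan: "\<And>X. X \<in> g \<Longrightarrow> (\<And>H. H \<in> t \<Longrightarrow> lie_bracket X H \<in> t) \<Longrightarrow> X \<in> t"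
    and ev: "\<And>a H. H \<in> t \<Longrightarrow> \<theta> H *v b a = k a H *s b a"
    and B: "B = (\<chi> i a. b a $ i)" and CB: "C ** B = mat 1" and BC: "B ** C = mat 1"
  shows "sp_frame g (\<lambda>X. C ** \<theta> X ** B) t"
    and "H \<in> t \<Longrightarrow> (C ** \<theta> H ** B) $ a $ a = k a H"
proof -
  let ?\<theta> = "\<lambda>X. C ** \<theta> X ** B"
  have Baxis: "B *v axis a 1 = b a" for a
    by (simp add: vec_eq_iff B matrix_vector_mult_def axis_def if_distrib[of "\<lambda>x. _ * x"] cong: if_cong)
  have entry: "(A *v axis c 1) $ i = A $ i $ c" for A :: "complex^('r + 'r)^('r + 'r)" and i c
    by (simp add: matrix_vector_mult_def axis_def if_distrib[of "\<lambda>x. _ * x"] cong: if_cong)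
  have om: "omega (B *v x) (B *v y) = omega x y" for x y
  proof -
    have bv: "B *v x = (\<Sum>a\<in>UNIV. x $ a *s b a)" for x
      by (simp add: vec_eq_iff B matrix_vector_mult_def mult.commute)
    have "omega (B *v x) (B *v y) = (\<Sum>c\<in>UNIV. y $ c * (\<Sum>a\<in>UNIV. x $ a * (if c = bar a then sg a else 0)))"
      unfolding bv omega_sum omega_scale J J_nth ..
    also have "\<dots> = (\<Sum>c\<in>UNIV. y $ c * (\<Sum>a\<in>UNIV. if a = bar c then x $ a * sg a else 0))"
      by (intro sum.cong refl arg_cong2[of _ _ _ _ "(*)"]) auto
    also have "\<dots> = (\<Sum>c\<in>UNIV. sg (bar c) * x $ bar c * y $ bar (bar c))"
      by (simp add: mult_ac)
    also have "\<dots> = omega x y"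
      unfolding omega_def by (rule sum_bar)
    finally show ?thesis .
  qed
  have sp_omega: "A \<in> sp" if A: "\<And>x y. omega (A *v x) y = - omega x (A *v y)" for A :: "complex^('r + 'r)^('r + 'r)"
  proof (rule spI)
    fix p q
    have "omega (A *v axis q 1) (axis p 1) = - omega (axis q 1) (A *v axis p 1)" by (rule A)
    also have "\<dots> = omega (A *v axis p 1) (axis q 1)" by (simp add: omega_skew[of "axis q 1"])
    finally have "sg p * A $ bar p $ q = sg q * A $ bar q $ p" by (simp add: omega_axis entry)
    then show "A $ bar p $ q = sg p * sg q * A $ bar q $ p" by (metis mult.assoc sg_simps(6))
  qed
  have conj_sp: "M ** A ** N \<in> sp"
    if A: "A \<in> sp" and M: "\<And>x y. omega (M *v x) y = omega x (N *v y)" "N ** M = mat 1" "M ** N = mat 1"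
      "\<And>x y. omega (N *v x) (N *v y) = omega x y \<and> omega (M *v x) (M *v y) = omega x y" for A M N :: "complex^('r + 'r)^('r + 'r)"
  proof (rule sp_omega)
    fix x y
    have "omega ((M ** A ** N) *v x) y = omega (A *v (N *v x)) (N *v y)"
      by (simp add: matrix_vector_mul_assoc[symmetric] M(1))
    also have "\<dots> = - omega (N *v x) (A *v (N *v y))" by (rule omega_sp[OF A])
    also have "omega (N *v x) (A *v (N *v y)) = omega (M *v (N *v x)) (M *v (A *v (N *v y)))" using M(4) by simp
    also have "M *v (N *v x) = x" by (simp add: matrix_vector_mul_assoc M(3))
    finally show "omega ((M ** A ** N) *v x) y = - omega x ((M ** A ** N) *v y)"
      by (simp add: matrix_vector_mul_assoc[symmetric])
  qed
  have Cx: "B *v (C *v x) = x" "C *v (B *v x) = x" for x by (simp_all add: matrix_vector_mul_assoc BC CB)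
  have omC: "omega (C *v x) (C *v y) = omega x y" for x y using om[of "C *v x" "C *v y"] by (simp add: Cx)
  have om1: "omega (C *v x) y = omega x (B *v y)" "omega (B *v x) y = omega x (C *v y)" for x y
    using om[of "C *v x" y] om[of x "C *v y"] by (simp_all add: Cx)
  have to_sp: "?\<theta> X \<in> sp" if "X \<in> g" for X
    by (rule conj_sp[OF theta_sp[OF that]]) (simp_all add: om1 CB BC om omC Cx)
  have from_sp: "B ** A ** C \<in> sp" if "A \<in> sp" for A
    by (rule conj_sp[OF that]) (simp_all add: om1 CB BC om omC Cx)
  have cancel: "C ** (B ** A ** C) ** B = A" "B ** (C ** A ** B) ** C = A" for A
    by (metis BC CB matrix_mul_assoc matrix_mul_lid matrix_mul_rid)+
  have iso': "lie_iso g sp ?\<theta>"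
    unfolding lie_iso_def
  proof (intro conjI ballI allI)
    show "bij_betw ?\<theta> g sp"
    proof (rule bij_betw_byWitness[of _ "\<lambda>A. inv_theta (B ** A ** C)"])
      show "\<forall>X\<in>g. inv_theta (B ** ?\<theta> X ** C) = X" by (simp add: cancel inv_theta_theta)
      show "\<forall>A\<in>sp. ?\<theta> (inv_theta (B ** A ** C)) = A" by (simp add: inv_theta from_sp cancel)
    qed (use to_sp from_sp inv_theta in auto)
    fix X Y assume XY: "X \<in> g" "Y \<in> g"
    show "?\<theta> (X + Y) = ?\<theta> X + ?\<theta> Y"
      by (simp add: theta_add XY vec_eq_iff matrix_mult_nth sum.distrib algebra_simps)
    show "?\<theta> (lie_bracket X Y) = lie_bracket (?\<theta> X) (?\<theta> Y)"
    proof -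
      have "C ** (M ** N) ** B = (C ** M ** B) ** (C ** N ** B)" for M N
      proof -
        have "(C ** M ** B) ** (C ** N ** B) = C ** M ** (B ** C) ** N ** B" by (simp only: matrix_mul_assoc)
        then show ?thesis by (simp add: BC matrix_mul_assoc)
      qed
      then show ?thesis
        unfolding theta_bracket[OF XY] by (simp add: lie_bracket_def mm_diff_left mm_diff_right)
    qed
  next
    fix c X assume "X \<in> g"
    then show "?\<theta> (scale_mat c X) = scale_mat c (?\<theta> X)"
      by (simp add: theta_scale vec_eq_iff matrix_mult_nth sum_distrib_left sum_distrib_right mult_ac)
  qed
  interpret t': sp_iso g ?\<theta>
    by unfold_locales (use iso' g_add g_scale g_bracket in auto)
  have col: "?\<theta> H $ p $ a = (if p = a then k a H else 0)" if "H \<in> t" for H p a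
  proof -
    have "?\<theta> H *v axis a 1 = k a H *s axis a 1"
      using Cx(2)[of "axis a 1"] by (simp add: matrix_vector_mul_assoc[symmetric] Baxis ev[OF that] vector_scalar_commute)
    then have "(?\<theta> H *v axis a 1) $ p = (k a H *s axis a 1) $ p" by simp
    then show ?thesis unfolding entry by (auto simp: axis_def)
  qed
  then show "H \<in> t \<Longrightarrow> ?\<theta> H $ a $ a = k a H" by simp
  have img: "?\<theta> ` t = sp_diag"
  proof
    show "?\<theta> ` t \<subseteq> sp_diag" using to_sp col t by (auto simp: sp_diag_def)
    show "sp_diag \<subseteq> ?\<theta> ` t"
    proof
      fix A :: "complex^('r + 'r)^('r + 'r)" assume A: "A \<in> sp_diag"
      then have Asp: "A \<in> sp" by (simp add: sp_diag_def)
      define X where "X = t'.inv_theta A"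
      have X: "X \<in> g" "?\<theta> X = A" using t'.inv_theta[OF Asp] by (simp_all add: X_def)
      have "lie_bracket X H \<in> t" if H: "H \<in> t" for H
      proof -
        have "?\<theta> (lie_bracket X H) = lie_bracket A (?\<theta> H)"
          using t'.theta_bracket[OF X(1), of H] H t X(2) by auto
        also have "\<dots> = 0"
          by (simp only: vec_eq_iff diag_bracket[OF A] col[OF H]) simp
        finally have "lie_bracket X H = 0"
          using t'.theta_inj[OF g_bracket g_0, of X H] X(1) H t t'.theta_0 by auto
        then show ?thesis using t by simp
      qed
      then have "X \<in> t" using cartan X(1) by blast
      then show "A \<in> ?\<theta> ` t" using X(2) by blast
    qed
  qed
  show "sp_frame g ?\<theta> t"
    by unfold_locales (rule t(1), rule img)
qed

end

context sp_frame begin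

text \<open>Going down from the long simple root, the Cartan integers determine the simple roots up to
  a signed permutation.\<close>

lemma simple_roots_signed:
  assumes r: "r \<ge> 2" and simple: "simple_roots g t r \<sigma>" and C: "bourbaki_numbering_C g t r \<sigma>"
  shows "\<exists>s. (\<forall>i\<in>{1..r}. \<forall>j\<in>{1..r}. i \<noteq> j \<longrightarrow> s i \<noteq> s j \<and> s i \<noteq> bar (s j)) \<and>
    (\<forall>H\<in>t. \<sigma> r H = 2 * wt (s r) H \<and> (\<forall>i\<in>{1..<r}. \<sigma> i H = wt (s i) H - wt (s (Suc i)) H))"
proof -
  have ab: "\<exists>a b. a \<noteq> b \<and> (\<forall>H\<in>t. \<sigma> i H = wt a H - wt b H)" if "i \<in> {1..r}" for i
    using simple that by (intro root_wt) (simp add: simple_roots_def)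
  have Cij: "\<sigma> i H = cartan_integer_C r i j" if "i \<in> {1..r}" "j \<in> {1..r}" "is_coroot g t (\<sigma> j) H" for i j H
    using C that unfolding bourbaki_numbering_C_def by blast
  have wX: "wt a (Xg c c) = (if a = c then 1 else 0) - (if a = bar c then 1 else 0)" for a c
    by (rule wt_Xg)
  have wdiff: "wt a (Xg c c - Xg d d) = wt a (Xg c c) - wt a (Xg d d)" for a c d
    by (simp add: wt_def theta_diff Xg)
  have Xdt: "Xg c c - Xg d d \<in> t" for c d
    using t_add[OF Xg_t[of c] t_scale[OF Xg_t[of d], of "-1"]] by (simp add: scale_mat_minus_one)
  define q where "q = r - 1"
  have q: "q + 1 = r" "q < r" using r by (simp_all add: q_def)
  have r1: "r \<in> {1..r}" "q \<in> {1..r}" using r by (auto simp: q_def)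
  obtain a b where r_ab: "a \<noteq> b" "\<And>H. H \<in> t \<Longrightarrow> \<sigma> r H = wt a H - wt b H" using ab[OF r1(1)] by blast
  obtain c d where q_cd: "c \<noteq> d" "\<And>H. H \<in> t \<Longrightarrow> \<sigma> (q) H = wt c H - wt d H" using ab[OF r1(2)] by blast
  have Crq: "cartan_integer_C r r (q) = -2" "cartan_integer_C r (q) r = -1"
    using q by (auto simp: cartan_integer_C_def)
  \<comment> \<open>Suppose that \<open>\<sigma> r\<close> is short. A short root takes values of
    absolute value at most 1 on long coroots, so the Cartan integer -2 would make
    \<open>\<sigma> q\<close> short too; but short roots that pair to -2 are opposite, and then the
    reverse pairing would be -2 instead of -1.\<close>
  have long: "b = bar a"
  proof (rule ccontr)
    assume nb: "b \<noteq> bar a"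
    then have 1: "\<sigma> (q) (Xg a a - Xg b b) = -1"
      using Cij[OF r1(2,1) coroot_short[OF r_ab(2,1)]] Crq by simp
    show False
    proof (cases "d = bar c")
      case True
      then have "is_coroot g t (\<sigma> (q)) (Xg c c)" using coroot_long q_cd(2) by simp
      then have "\<sigma> r (Xg c c) = -2" using Cij[OF r1] Crq by simp
      then show False using nb r_ab(1) by (auto simp: r_ab(2)[OF Xg_t] wX split: if_splits)
    next
      case False
      then have "\<sigma> r (Xg c c - Xg d d) = -2"
        using Cij[OF r1 coroot_short[OF q_cd(2,1)]] Crq by simp
      then show False using nb r_ab(1) q_cd(1) False 1
        by (auto simp: r_ab(2)[OF Xdt] q_cd(2)[OF Xdt] wdiff wX split: if_splits)
    qed
  qed
  have \<sigma>r: "\<sigma> r H = 2 * wt a H" if "H \<in> t" for H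
    using r_ab(2)[OF that] long wt_bar[OF that] by simp
  have cor_r: "is_coroot g t (\<sigma> r) (Xg a a)" using coroot_long r_ab(2) long by simp
  have key: "\<exists>s. s r = a \<and> (\<forall>i\<in>{r-k..r}. \<forall>j\<in>{r-k..r}. i \<noteq> j \<longrightarrow> s i \<noteq> s j \<and> s i \<noteq> bar (s j)) \<and>
      (\<forall>i\<in>{r-k..<r}. \<forall>H\<in>t. \<sigma> i H = wt (s i) H - wt (s (Suc i)) H)" if "k < r" for k
    using that
  proof (induction k)
    case 0
    show ?case by (rule exI[of _ "\<lambda>_. a"]) auto
  next
    case (Suc k)
    then obtain s where s: "s r = a" "\<And>i j. i \<in> {r-k..r} \<Longrightarrow> j \<in> {r-k..r} \<Longrightarrow> i \<noteq> j \<Longrightarrow> s i \<noteq> s j \<and> s i \<noteq> bar (s j)"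
      "\<And>i H. i \<in> {r-k..<r} \<Longrightarrow> H \<in> t \<Longrightarrow> \<sigma> i H = wt (s i) H - wt (s (Suc i)) H" by auto
    define m where "m = r - Suc k"
    have m: "m \<in> {1..r}" "Suc m = r - k" "m < r" using Suc.prems by (auto simp: m_def)
    \<comment> \<open>These are the coordinates of \<open>\<sigma> m\<close> at the signed indices
      already placed. At \<open>r\<close> the coordinate vector is itself a coroot; below, each
      simple coroot is a difference of two coordinate vectors, so its Cartan integer yields the next
      coordinate.\<close>
    have zero: "\<sigma> m (Xg (s j) (s j)) = (if j = Suc m then -1 else 0)" if "j \<in> {Suc m..r}" for j
      using that
    proof (induction "r - j" arbitrary: j)
      case 0
      then have j: "j = r" by simp
      have "\<sigma> m (Xg a a) = cartan_integer_C r m r" by (rule Cij[OF m(1) r1(1) cor_r])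
      also have "\<dots> = (if r = Suc m then -1 else 0)" using m by (auto simp: cartan_integer_C_def)
      finally show ?case by (simp add: j s(1))
    next
      case (Suc l)
      then have j: "j \<in> {r-k..<r}" "j \<in> {1..r}" "Suc j \<in> {Suc m..r}" "j \<noteq> m" "Suc j \<noteq> Suc m" using m by auto
      have sj: "s j \<noteq> s (Suc j)" "s (Suc j) \<noteq> bar (s j)" using s(2)[of j "Suc j"] s(2)[of "Suc j" j] j m by auto
      have "is_coroot g t (\<sigma> j) (Xg (s j) (s j) - Xg (s (Suc j)) (s (Suc j)))"
        by (rule coroot_short[OF s(3)[OF j(1)] sj])
      then have "\<sigma> m (Xg (s j) (s j) - Xg (s (Suc j)) (s (Suc j))) = cartan_integer_C r m j"
        by (rule Cij[OF m(1) j(2)])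
      moreover have "cartan_integer_C r m j = (if j = Suc m then -1 else 0)"
        using j m by (auto simp: cartan_integer_C_def)
      moreover have "\<sigma> m (Xg (s (Suc j)) (s (Suc j))) = 0" using Suc.hyps j by simp
      moreover obtain c d where "\<And>H. H \<in> t \<Longrightarrow> \<sigma> m H = wt c H - wt d H" using ab[OF m(1)] by blast
      ultimately show ?case using Xg_t Xdt by (auto simp: wdiff)
    qed
    obtain c d where cd: "c \<noteq> d" "\<And>H. H \<in> t \<Longrightarrow> \<sigma> m H = wt c H - wt d H" using ab[OF m(1)] by blast
    let ?p = "s (Suc m)"
    have zp: "\<sigma> m (Xg ?p ?p) = -1" using zero[of "Suc m"] m by simp
    \<comment> \<open>The coordinate -1 means that \<open>?p\<close> is subtracted: either it is
      \<open>d\<close>, or \<open>c = bar ?p\<close> and the root is rewritten with both indices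
      barred and exchanged.\<close>
    have "\<exists>e. e \<noteq> ?p \<and> e \<noteq> bar ?p \<and> (\<forall>H\<in>t. \<sigma> m H = wt e H - wt ?p H)"
    proof (cases "d = ?p")
      case True
      then show ?thesis using cd zp by (intro exI[of _ c]) (auto simp: cd(2)[OF Xg_t] wX split: if_splits)
    next
      case False
      then have c: "c = bar ?p" using zp cd(1) by (auto simp: cd(2)[OF Xg_t] wX split: if_splits)
      then have "\<forall>H\<in>t. \<sigma> m H = wt (bar d) H - wt ?p H" by (auto simp: cd(2) wt_bar)
      moreover have "bar d \<noteq> ?p" using c cd(1) by (metis bar_simps(3))
      moreover have "bar d \<noteq> bar ?p" using False by simp
      ultimately show ?thesis by blast
    qed
    then obtain e where e: "e \<noteq> ?p" "e \<noteq> bar ?p" "\<And>H. H \<in> t \<Longrightarrow> \<sigma> m H = wt e H - wt ?p H" by blast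
    have ne: "e \<noteq> s j \<and> e \<noteq> bar (s j)" if j: "j \<in> {Suc m..r}" for j
    proof (cases "j = Suc m")
      case False
      then have z: "\<sigma> m (Xg (s j) (s j)) = 0" using zero[OF j] by simp
      have "?p \<noteq> s j" "?p \<noteq> bar (s j)" using s(2)[of "Suc m" j] j False m by auto
      then show ?thesis using z by (auto simp: e(3)[OF Xg_t] wX split: if_splits)
    qed (use e in auto)
    define s' where "s' = s(m := e)"
    have "\<forall>i\<in>{m..r}. \<forall>j\<in>{m..r}. i \<noteq> j \<longrightarrow> s' i \<noteq> s' j \<and> s' i \<noteq> bar (s' j)"
    proof (intro ballI impI)
      fix i j assume ij: "i \<in> {m..r}" "j \<in> {m..r}" "i \<noteq> j"
      show "s' i \<noteq> s' j \<and> s' i \<noteq> bar (s' j)"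
      proof (cases "i = m")
        case True
        then show ?thesis using ne[of j] ij by (auto simp: s'_def)
      next
        case i: False
        show ?thesis
        proof (cases "j = m")
          case True
          then show ?thesis using ne[of i] ij by (auto simp: s'_def)
        next
          case False
          then show ?thesis using s(2)[of i j] ij i m by (auto simp: s'_def)
        qed
      qed
    qed
    moreover have "\<forall>i\<in>{m..<r}. \<forall>H\<in>t. \<sigma> i H = wt (s' i) H - wt (s' (Suc i)) H"
      using s(3) e(3) m by (auto simp: s'_def)
    moreover have "s' r = a" using s(1) m by (simp add: s'_def)
    ultimately show ?case unfolding m_def[symmetric] by blast
  qed
  obtain s where s: "s r = a" "\<forall>i\<in>{1..r}. \<forall>j\<in>{1..r}. i \<noteq> j \<longrightarrow> s i \<noteq> s j \<and> s i \<noteq> bar (s j)"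
      "\<forall>i\<in>{1..<r}. \<forall>H\<in>t. \<sigma> i H = wt (s i) H - wt (s (Suc i)) H"
    using key[of "r - 1"] r by auto
  then show ?thesis using \<sigma>r by (intro exI[of _ s]) auto
qed

end

text \<open>Two eigenbases are used. The first makes \<open>t\<close> diagonal, so that the simple
  roots are known up to a signed permutation \<open>s\<close>; the second renames the basis by
  \<open>s\<close>, so that they become differences of consecutive coordinates and twice the last
  one.\<close>

lemma (in sp_iso) adapted_frame:
  fixes r :: nat
  assumes r: "r = CARD('r)" "r \<ge> 2"
    and t: "t \<subseteq> g" "0 \<in> t" and cartan: "\<And>X. X \<in> g \<Longrightarrow> (\<And>H. H \<in> t \<Longrightarrow> lie_bracket X H \<in> t) \<Longrightarrow> X \<in> t"
    and diag: "\<And>X. X \<in> t \<Longrightarrow> diagonalizable X" and comm: "\<And>X Y. X \<in> t \<Longrightarrow> Y \<in> t \<Longrightarrow> lie_bracket X Y = 0"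
    and simple: "simple_roots g t r \<sigma>" and bour: "bourbaki_numbering_C g t r \<sigma>"
  shows "\<exists>B C idx. B ** C = mat 1 \<and> C ** B = mat 1 \<and> sp_frame g (\<lambda>X. C ** \<theta> X ** B) t \<and>
    bij_betw idx {1..r} (UNIV :: 'r set) \<and>
    (\<forall>H\<in>t. \<sigma> r H = 2 * (C ** \<theta> H ** B) $ Inl (idx r) $ Inl (idx r) \<and>
      (\<forall>i\<in>{1..<r}. \<sigma> i H = (C ** \<theta> H ** B) $ Inl (idx i) $ Inl (idx i)
         - (C ** \<theta> H ** B) $ Inl (idx (Suc i)) $ Inl (idx (Suc i))))"
proof -
  let ?F = "\<theta> ` t"
  have "vec.span (common_eigenvectors ?F) = UNIV"
  proof (rule commuting_diagonalizable)
    show "diagonalizable A" if "A \<in> ?F" for A using that diag t theta_diagonalizable by blast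
    show "A ** B = B ** A" if AB: "A \<in> ?F" "B \<in> ?F" for A B
    proof -
      obtain X Y where XY: "X \<in> t" "A = \<theta> X" "Y \<in> t" "B = \<theta> Y" using AB by blast
      then have "\<theta> (lie_bracket X Y) = lie_bracket A B" using t theta_bracket by auto
      then show ?thesis using comm[OF XY(1,3)] theta_0 by (simp add: lie_bracket_def)
    qed
  qed
  then obtain b :: "'r + 'r \<Rightarrow> complex^('r + 'r)" where
    b: "\<forall>a. \<forall>A\<in>?F. \<exists>k. A *v b a = k *s b a" "\<And>a c. omega (b a) (b c) = symplectic_J $ a $ c"
    using symplectic_eigenbasis[of ?F "common_eigenvectors ?F"] theta_sp t
    unfolding common_eigenvectors_def by blast
  have "\<forall>a H. \<exists>k. H \<in> t \<longrightarrow> \<theta> H *v b a = k *s b a" using b(1) by blast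
  then obtain k where k: "\<And>a H. H \<in> t \<Longrightarrow> \<theta> H *v b a = k a H *s b a" by metis
  define B where "B = (\<chi> i a. b a $ i)"
  obtain C where C: "C ** B = mat 1" "B ** C = mat 1" using omega_matrix[OF b(2)] unfolding B_def by blast
  note f = frame_of_eigenbasis[OF b(2) t cartan k B_def C]
  interpret f: sp_frame g "\<lambda>X. C ** \<theta> X ** B" t by (rule f(1))
  have fwt: "f.wt a H = k a H" if "H \<in> t" for a H unfolding f.wt_def using f(2)[OF _ _ _ that] by simp
  obtain s where s: "\<And>i j. i \<in> {1..r} \<Longrightarrow> j \<in> {1..r} \<Longrightarrow> i \<noteq> j \<Longrightarrow> s i \<noteq> s j \<and> s i \<noteq> bar (s j)"
    "\<And>H. H \<in> t \<Longrightarrow> \<sigma> r H = 2 * k (s r) H"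
    "\<And>H i. H \<in> t \<Longrightarrow> i \<in> {1..<r} \<Longrightarrow> \<sigma> i H = k (s i) H - k (s (Suc i)) H"
  proof -
    from f.simple_roots_signed[OF r(2) simple bour] obtain s where
      "\<forall>i\<in>{1..r}. \<forall>j\<in>{1..r}. i \<noteq> j \<longrightarrow> s i \<noteq> s j \<and> s i \<noteq> bar (s j)"
      "\<forall>H\<in>t. \<sigma> r H = 2 * f.wt (s r) H \<and> (\<forall>i\<in>{1..<r}. \<sigma> i H = f.wt (s i) H - f.wt (s (Suc i)) H)"
      by blast
    then show ?thesis using that[of s] fwt by metis
  qed
  obtain idx where idx: "bij_betw idx {1..r} (UNIV :: 'r set)"
    using ex_bij_betw_nat_finite_1[of "UNIV :: 'r set"] r(1) by auto
  define pos where "pos = inv_into {1..r} idx"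
  have pos: "pos i \<in> {1..r}" "idx (pos i) = i" "n \<in> {1..r} \<Longrightarrow> pos (idx n) = n" for i n
    using inv_into_into[of i idx "{1..r}"] f_inv_into_f[of i idx "{1..r}"] inv_into_f_f[of idx "{1..r}" n] idx
    unfolding pos_def bij_betw_def by simp_all
  have pos_inj: "pos i = pos j \<longleftrightarrow> i = j" for i j using pos(2) by metis
  \<comment> \<open>If the chosen index is an \<open>Inr\<close>, passing to its bar reverses the
    sign of \<open>omega\<close>; the factor \<open>sg\<close> restores the value 1 on the renamed
    pair.\<close>
  define b' where "b' a = (case a of Inl i \<Rightarrow> b (s (pos i)) | Inr i \<Rightarrow> sg (s (pos i)) *s b (bar (s (pos i))))" for a
  define k' where "k' a = (case a of Inl i \<Rightarrow> k (s (pos i)) | Inr i \<Rightarrow> k (bar (s (pos i))))" for a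
  have ne: "s (pos j) \<noteq> bar (s (pos i))" "bar (s (pos j)) \<noteq> s (pos i)" for i j
  proof -
    show 1: "s (pos j) \<noteq> bar (s (pos i))" for i j
      using s(1)[OF pos(1) pos(1), of j i] by (cases "i = j") (auto simp: pos_inj)
    show "bar (s (pos j)) \<noteq> s (pos i)" using 1[of i j] by auto
  qed
  have inj: "s (pos j) = s (pos i) \<longleftrightarrow> i = j" for i j
    using s(1)[OF pos(1) pos(1), of j i] by (cases "i = j") (auto simp: pos_inj)
  have b'J: "omega (b' a) (b' c) = symplectic_J $ a $ c" for a c
    by (cases a; cases c) (auto simp: b'_def omega_scale b(2) J_nth ne inj)
  have b'k: "\<theta> H *v b' a = k' a H *s b' a" if "H \<in> t" for a H
    by (cases a) (auto simp: b'_def k'_def vector_scalar_commute k[OF that] vector_smult_assoc mult_ac)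
  define B' where "B' = (\<chi> i a. b' a $ i)"
  obtain C' where C': "C' ** B' = mat 1" "B' ** C' = mat 1" using omega_matrix[OF b'J] unfolding B'_def by blast
  note f' = frame_of_eigenbasis[OF b'J t cartan b'k B'_def C']
  have w: "(C' ** \<theta> H ** B') $ Inl (idx i) $ Inl (idx i) = k (s i) H" if "H \<in> t" "i \<in> {1..r}" for H i
    using f'(2)[OF _ _ _ that(1), of "Inl (idx i)"] pos(3)[OF that(2)] by (simp add: k'_def)
  show ?thesis
  proof (intro exI conjI ballI)
    show "sp_frame g (\<lambda>X. C' ** \<theta> X ** B') t" by (rule f'(1))
    show "\<sigma> r H = 2 * (C' ** \<theta> H ** B') $ Inl (idx r) $ Inl (idx r)" if "H \<in> t" for H
      using s(2)[OF that] w[OF that, of r] r by simp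
    show "\<sigma> i H = (C' ** \<theta> H ** B') $ Inl (idx i) $ Inl (idx i) - (C' ** \<theta> H ** B') $ Inl (idx (Suc i)) $ Inl (idx (Suc i))"
      if "H \<in> t" "i \<in> {1..<r}" for H i
      using s(3)[OF that] w[OF that(1), of i] w[OF that(1), of "Suc i"] that(2) by simp
  qed (use idx C' in simp_all)
qed

section \<open>Weights of representations of the symplectic Lie algebra\<close>

lemma scale_mv: "scale_mat c M *v u = c *s (M *v u)"
  by (simp add: vec_eq_iff matrix_vector_mult_def sum_distrib_left mult.assoc)

lemma minus_mv: "(- M) *v u = - (M *v (u :: complex^'v))"
  by (simp add: vec_eq_iff matrix_vector_mult_def sum_negf)

text \<open>The coordinates of e_a - e_b, that is, the shift of the eigenvalue of
  \<open>R c c\<close> under \<open>R a b\<close>. For \<open>b = bar a\<close> the contributions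
  coincide in pairs and the value at \<open>a\<close> is 2.\<close>

definition root :: "'r + 'r \<Rightarrow> 'r + 'r \<Rightarrow> 'r + 'r \<Rightarrow> int" where
  "root a b c = (if c = a then 1 else 0) - (if c = b then 1 else 0) - (if c = bar a then 1 else 0) + (if c = bar b then 1 else 0)"

lemma root_swap: "root b a c = - root a b c"
  by (simp add: root_def)

text \<open>The relations of the matrices \<open>Xm\<close> imposed on abstract operators, so that
  the weight arguments are independent of how the Lie algebra is realized.\<close>

locale sp_rep =
  fixes R :: "'r::finite + 'r \<Rightarrow> 'r + 'r \<Rightarrow> complex^'v^'v"
  assumes comm: "lie_bracket (R a b) (R c d) = (if b = c then R a d else 0) - (if d = a then R c b else 0)
      - scale_mat (sg a * sg b) ((if c = bar a then R (bar b) d else 0) - (if d = bar b then R c (bar a) else 0))"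
    and skew: "R (bar b) (bar a) = scale_mat (- (sg a * sg b)) (R a b)"
begin

lemma commv: "R a b *v (R c d *v x) = R c d *v (R a b *v x)
    + (if b = c then R a d *v x else 0) - (if d = a then R c b *v x else 0)
    - (sg a * sg b) *s ((if c = bar a then R (bar b) d *v x else 0) - (if d = bar b then R c (bar a) *v x else 0))"
proof -
  have "R a b *v (R c d *v x) - R c d *v (R a b *v x) = lie_bracket (R a b) (R c d) *v x"
    by (simp add: lie_bracket_def matrix_vector_mult_diff_rdistrib matrix_vector_mul_assoc)
  also have "\<dots> = (if b = c then R a d *v x else 0) - (if d = a then R c b *v x else 0)
    - (sg a * sg b) *s ((if c = bar a then R (bar b) d *v x else 0) - (if d = bar b then R c (bar a) *v x else 0))"
    unfolding comm by (simp add: matrix_vector_mult_diff_rdistrib scale_mv)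
  finally show ?thesis by (simp add: algebra_simps)
qed

lemma R_bar: "R (bar a) (bar a) = - R a a"
  using skew[of a a] by (simp add: scale_mat_minus_one)

definition has_wt :: "('r + 'r \<Rightarrow> int) \<Rightarrow> complex^'v \<Rightarrow> bool" where
  "has_wt l x \<longleftrightarrow> (\<forall>a. R a a *v x = of_int (l a) *s x)"

lemma has_wt_bar: "has_wt l x \<Longrightarrow> x \<noteq> 0 \<Longrightarrow> l (bar a) = - l a"
proof -
  assume w: "has_wt l x" and x: "x \<noteq> 0"
  have "of_int (l (bar a)) *s x = - (of_int (l a) *s x)"
    using w R_bar[of a] unfolding has_wt_def by (metis minus_mv)
  then have "of_int (l (bar a) + l a) *s x = 0" by (simp add: vec.scale_left_distrib)
  then have "l (bar a) + l a = 0" using x by (simp only: vec.scale_eq_0_iff of_int_eq_0_iff simp_thms)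
  then show ?thesis by simp
qed

lemma H_comm: "R c c *v (R a b *v x) = R a b *v (R c c *v x) + of_int (root a b c) *s (R a b *v x)"
proof -
  have "- (of_int 1 *s ((if a = bar c then R (bar c) b *v x else 0) - (if b = bar c then R a (bar c) *v x else 0)))
     = (if c = bar b then 1 else 0) *s (R a b *v x) - (if c = bar a then 1 else 0) *s (R a b *v x)"
    by auto
  moreover have "(if c = a then R c b *v x else 0) - (if b = c then R a c *v x else 0) =
     (if c = a then 1 else 0) *s (R a b *v x) - (if c = b then 1 else 0) *s (R a b *v x)" by auto
  ultimately show ?thesis
    unfolding commv[of c c a b x] root_def
    by (simp add: vec.scale_left_distrib vec.scale_left_diff_distrib algebra_simps)
qed

lemma has_wt_R: "has_wt l x \<Longrightarrow> has_wt (\<lambda>c. l c + root a b c) (R a b *v x)"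
  unfolding has_wt_def by (simp add: H_comm vector_scalar_commute vec.scale_left_distrib)

lemma has_wt_funpow: "has_wt l x \<Longrightarrow> has_wt (\<lambda>c. l c + int n * root a b c) ((((*v) (R a b)) ^^ n) x)"
proof (induction n)
  case (Suc n)
  have "(\<lambda>c. l c + int (Suc n) * root a b c) = (\<lambda>c. (l c + int n * root a b c) + root a b c)"
    by (simp add: algebra_simps)
  then show ?case using has_wt_R[OF Suc.IH[OF Suc.prems], of a b] by simp
qed simp

definition submod :: "(complex^'v) set \<Rightarrow> bool" where
  "submod U \<longleftrightarrow> vec.subspace U \<and> (\<forall>a b. \<forall>x\<in>U. R a b *v x \<in> U)"

lemma submod_funpow: "submod U \<Longrightarrow> x \<in> U \<Longrightarrow> (((*v) (R a b)) ^^ n) x \<in> U"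
  by (induction n) (auto simp: submod_def)

definition weights :: "(complex^'v) set \<Rightarrow> ('r + 'r \<Rightarrow> int) set" where
  "weights U = {l. \<exists>x\<in>U. x \<noteq> 0 \<and> has_wt l x}"

lemma weights_bar: "l \<in> weights U \<Longrightarrow> l (bar a) = - l a"
  by (auto simp: weights_def has_wt_bar)

text \<open>The value of the weight \<open>l\<close> at a coroot: \<open>R a a\<close> for a long
  root, \<open>R a a - R b b\<close> for a short one.\<close>

definition pairing :: "('r + 'r \<Rightarrow> int) \<Rightarrow> 'r + 'r \<Rightarrow> 'r + 'r \<Rightarrow> int" where
  "pairing l a b = (if b = bar a then l a else l a - l b)"

lemma sl2_triple:
  assumes "a \<noteq> b"
  defines "c \<equiv> if b = bar a then 1/4 else 1 :: complex"
  defines "H \<equiv> if b = bar a then R a a else R a a - R b b"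
  shows "scale_mat c (R a b) ** R b a - R b a ** scale_mat c (R a b) = H"
    "H ** scale_mat c (R a b) - scale_mat c (R a b) ** H = scale_mat 2 (scale_mat c (R a b))"
    "H ** R b a - R b a ** H = scale_mat (-2) (R b a)"
proof -
  have br: "M ** N - N ** M = lie_bracket M N" for M N :: "complex^'v^'v" by (simp add: lie_bracket_def)
  have bs: "lie_bracket (scale_mat k M) N = scale_mat k (lie_bracket M N)"
    "lie_bracket N (scale_mat k M) = scale_mat k (lie_bracket N M)"
    "lie_bracket (M - M') N = lie_bracket M N - lie_bracket M' N" for k and M M' N :: "complex^'v^'v"
    by (simp_all add: lie_bracket_def vec_eq_iff matrix_mult_nth algebra_simps sum_distrib_left sum_subtractf)
  show "scale_mat c (R a b) ** R b a - R b a ** scale_mat c (R a b) = H"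
    unfolding br bs comm c_def H_def using assms(1) by (auto simp: R_bar vec_eq_iff)
  show "H ** scale_mat c (R a b) - scale_mat c (R a b) ** H = scale_mat 2 (scale_mat c (R a b))"
    unfolding br bs H_def using assms(1) by (auto simp: bs comm vec_eq_iff)
  show "H ** R b a - R b a ** H = scale_mat (-2) (R b a)"
    unfolding br H_def using assms(1) by (auto simp: bs comm vec_eq_iff)
qed

lemma weights_string:
  assumes U: "submod U" and l: "l \<in> weights U" and ab: "a \<noteq> b" and k: "int k \<le> pairing l a b"
  shows "(\<lambda>c. l c - int k * root a b c) \<in> weights U"
proof -
  obtain x where x: "x \<in> U" "x \<noteq> 0" "has_wt l x" using l by (auto simp: weights_def)
  let ?c = "if b = bar a then 1/4 else 1 :: complex"
  let ?H = "if b = bar a then R a a else R a a - R b b"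
  have "?H *v x = of_int (pairing l a b) *s x"
    using x(3) by (auto simp: pairing_def has_wt_def matrix_vector_mult_diff_rdistrib vec.scale_left_diff_distrib)
  from sl2_string[OF sl2_triple[OF ab] x(2) this] obtain n j where n: "pairing l a b = n"
    and nz: "\<forall>k::nat. int k \<le> n \<longrightarrow> (((*v) (R b a)) ^^ (k + j)) ((((*v) (scale_mat ?c (R a b))) ^^ j) x) \<noteq> 0"
    by auto
  have sc: "(((*v) (scale_mat ?c (R a b))) ^^ j) x = (?c ^ j) *s ((((*v) (R a b)) ^^ j) x)"
    by (induction j) (simp_all add: scale_mv vector_scalar_commute vector_smult_assoc)
  let ?y = "(((*v) (R b a)) ^^ (k + j)) ((((*v) (R a b)) ^^ j) x)"
  have fs: "(((*v) M) ^^ i) (d *s u) = d *s ((((*v) M) ^^ i) u)" for M :: "complex^'v^'v" and i d u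
    by (induction i) (simp_all add: vector_scalar_commute)
  have "?y \<noteq> 0" using nz k n unfolding sc fs by auto
  moreover have "?y \<in> U" using x(1) by (intro submod_funpow U)
  moreover have "has_wt (\<lambda>c. (l c + int j * root a b c) + int (k + j) * root b a c) ?y"
    by (intro has_wt_funpow x(3))
  moreover have "(\<lambda>c. (l c + int j * root a b c) + int (k + j) * root b a c) = (\<lambda>c. l c - int k * root a b c)"
    by (simp add: root_swap[of b a] algebra_simps)
  ultimately show ?thesis by (auto simp: weights_def)
qed

lemma weight_integral:
  assumes "x \<noteq> 0" "R a a *v x = c *s x"
  shows "\<exists>n. c = of_int n"
proof -
  have "(if bar a = bar a then R a a else R a a - R (bar a) (bar a)) *v x = c *s x" using assms(2) by simp
  from sl2_string[OF sl2_triple[of a "bar a"] assms(1) this] show ?thesis by auto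
qed

text \<open>The reflections of the Weyl group as permutations of signed indices: an exchange of two
  coordinates, or, for \<open>b = bar a\<close>, a change of sign.\<close>

definition swp :: "'r + 'r \<Rightarrow> 'r + 'r \<Rightarrow> 'r + 'r \<Rightarrow> 'r + 'r" where
  "swp a b c = (if c = a then b else if c = b then a else if c = bar a then bar b else if c = bar b then bar a else c)"

text \<open>The reflected weight is the far end of the root string through \<open>l\<close>: the
  root is subtracted as often as the pairing says. If the pairing is negative, the indices change
  roles.\<close>

lemma weights_swap:
  assumes U: "submod U" and l: "l \<in> weights U" and ab: "a \<noteq> b" "b \<noteq> bar a"
  shows "l \<circ> swp a b \<in> weights U"
proof -
  have lb: "l (bar c) = - l c" for c by (rule weights_bar[OF l])
  have *: "l \<circ> swp a b \<in> weights U" if "l b \<le> l a" "a \<noteq> b" "b \<noteq> bar a" for a b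
  proof -
    have "(\<lambda>c. l c - int (nat (l a - l b)) * root a b c) \<in> weights U"
      using that by (intro weights_string[OF U l]) (auto simp: pairing_def)
    moreover have "(\<lambda>c. l c - int (nat (l a - l b)) * root a b c) = l \<circ> swp a b"
      using that by (auto simp: fun_eq_iff swp_def root_def lb)
    ultimately show ?thesis by simp
  qed
  have "swp a b = swp b a" using ab by (auto simp: swp_def fun_eq_iff)
  moreover have "a \<noteq> bar b" using ab by auto
  ultimately show ?thesis using *[of a b] *[of b a] ab by (cases "l b \<le> l a") auto
qed

lemma weights_flip:
  assumes U: "submod U" and l: "l \<in> weights U"
  shows "l \<circ> swp a (bar a) \<in> weights U"
proof -
  have lb: "l (bar c) = - l c" for c by (rule weights_bar[OF l])
  have *: "l \<circ> swp a (bar a) \<in> weights U" if "0 \<le> l a" for a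
  proof -
    have "(\<lambda>c. l c - int (nat (l a)) * root a (bar a) c) \<in> weights U"
      using that by (intro weights_string[OF U l]) (auto simp: pairing_def)
    moreover have "(\<lambda>c. l c - int (nat (l a)) * root a (bar a) c) = l \<circ> swp a (bar a)"
      using that by (auto simp: fun_eq_iff swp_def root_def lb)
    ultimately show ?thesis by simp
  qed
  have "swp a (bar a) = swp (bar a) a" by (auto simp: swp_def fun_eq_iff)
  then show ?thesis using *[of a] *[of "bar a"] lb[of a] by (cases "0 \<le> l a") auto
qed

definition mult_free :: "(complex^'v) set \<Rightarrow> bool" where
  "mult_free U \<longleftrightarrow> (\<forall>l x y. has_wt l x \<longrightarrow> has_wt l y \<longrightarrow> x \<in> U \<longrightarrow> y \<in> U \<longrightarrow> y \<noteq> 0 \<longrightarrow> (\<exists>c. x = c *s y))"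

lemma R_vanish:
  assumes "submod U" "has_wt l x" "x \<in> U" "(\<lambda>c. l c + root a b c) \<notin> weights U"
  shows "R a b *v x = 0"
  using assms has_wt_R[of l x a b] unfolding weights_def submod_def by blast

text \<open>From \<open>x = c *s y\<close> one gets \<open>A' = c A\<close> and
  \<open>B = c B'\<close>, hence \<open>A' B' = A B\<close>, against the inequalities. In other
  words the determinant of the four raising coefficients is positive.\<close>

lemma two_strings:
  fixes p q :: "complex^'v" and A B A' B' :: int
  assumes "E1 *v x = of_int A' *s p" "E1 *v y = of_int A *s p" "E2 *v x = of_int B *s q" "E2 *v y = of_int B' *s q"
    and "p \<noteq> 0" "q \<noteq> 0" "0 < A" "A < A'" "0 < B" "B < B'" "x = c *s y"
  shows False
proof -
  have "of_int A' *s p = (c * of_int A) *s p" "of_int B *s q = (c * of_int B') *s q"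
    by (metis assms(1,2,11) vector_scalar_commute vector_smult_assoc)
      (metis assms(3,4,11) vector_scalar_commute vector_smult_assoc)
  then have "of_int A' = c * of_int A" "of_int B = c * of_int B'" using assms(5,6) by simp_all
  then have "of_int (A' * B') = (of_int (A * B) :: complex)"
    by (simp add: mult_ac)
  then have "A' * B' = A * B" by (simp only: of_int_eq_iff)
  moreover have "A * B < A' * B'" using assms(7-10) by (intro mult_strict_mono) auto
  ultimately show False by simp
qed

text \<open>The weight vectors \<open>f\<^sub>\<alpha> f\<^sub>\<beta> v\<close> and \<open>f\<^sub>\<beta> f\<^sub>\<alpha> v\<close> are independent if \<open>v\<close> is extremal for \<open>\<alpha>\<close> and
  \<open>\<beta>\<close>, and these span a root system of type \<open>A\<^sub>2\<close> or \<open>B\<^sub>2\<close> with \<open>\<alpha>, \<beta>\<close> as simple roots.\<close>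

lemma not_mult_free_A2:
  assumes U: "submod U" "mult_free U" and v: "v \<in> U" "v \<noteq> 0" "has_wt l v"
    and abc: "a \<noteq> b" "b \<noteq> bar a" "b \<noteq> c" "c \<noteq> bar b" "a \<noteq> c" "c \<noteq> bar a"
    and l: "l a > l b" "l b > l c" and kill: "R a b *v v = 0" "R b c *v v = 0"
  shows False
proof -
  have H: "R d d *v v = of_int (l d) *s v" for d using v(3) by (simp add: has_wt_def)
  define p q where "p = R c b *v v" and "q = R b a *v v"
  define x y where "x = R b a *v p" and "y = R c b *v q"
  have Hp: "R d d *v p = of_int (l d + root c b d) *s p" for d
    using has_wt_R[OF v(3), of c b] by (simp add: has_wt_def p_def)
  have Hq: "R d d *v q = of_int (l d + root b a d) *s q" for d
    using has_wt_R[OF v(3), of b a] by (simp add: has_wt_def q_def)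
  have n: "b \<noteq> a" "c \<noteq> b" "c \<noteq> a" "a \<noteq> bar b" "b \<noteq> bar c" "a \<noteq> bar c" using abc by auto
  have 1: "R b c *v p = of_int (l b - l c) *s v"
    unfolding p_def commv[of b c c b v] using abc n by (simp add: kill H vec.scale_left_diff_distrib)
  have 2: "R a b *v q = of_int (l a - l b) *s v"
    unfolding q_def commv[of a b b a v] using abc n by (simp add: kill H vec.scale_left_diff_distrib)
  have p0: "p \<noteq> 0" using 1 l v(2) by auto
  have q0: "q \<noteq> 0" using 2 l v(2) by auto
  have 3: "R a b *v p = 0" unfolding p_def commv[of a b c b v] using abc n by (simp add: kill)
  have 4: "R b c *v q = 0" unfolding q_def commv[of b c b a v] using abc n by (simp add: kill)
  have 5: "R a b *v x = of_int (l a - l b + 1) *s p"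
    unfolding x_def commv[of a b b a p] using abc n by (simp add: 3 Hp root_def)
  have 6: "R a b *v y = of_int (l a - l b) *s p"
    unfolding y_def commv[of a b c b q] using abc n by (simp add: 2 vector_scalar_commute matrix_vector_mult_diff_distrib p_def)
  have 7: "R b c *v x = of_int (l b - l c) *s q"
    unfolding x_def commv[of b c b a p] using abc n by (simp add: 1 vector_scalar_commute matrix_vector_mult_diff_distrib q_def)
  have 8: "R b c *v y = of_int (l b - l c + 1) *s q"
    unfolding y_def commv[of b c c b q] using abc n by (simp add: 4 Hq root_def)
  have wx: "has_wt (\<lambda>d. l d + root c b d + root b a d) x" "has_wt (\<lambda>d. l d + root b a d + root c b d) y"
    unfolding x_def y_def p_def q_def by (intro has_wt_R v(3))+
  have xy: "x \<in> U" "y \<in> U" using v(1) U(1) by (auto simp: x_def y_def p_def q_def submod_def)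
  have "y \<noteq> 0" using 6 p0 l by auto
  moreover have "(\<lambda>d. l d + root c b d + root b a d) = (\<lambda>d. l d + root b a d + root c b d)" by auto
  ultimately obtain k where "x = k *s y" using U(2) wx xy unfolding mult_free_def by metis
  from two_strings[OF 5 6 7 8 p0 q0 _ _ _ _ this] show False using l by auto
qed

lemma not_mult_free_B2:
  assumes U: "submod U" "mult_free U" and v: "v \<in> U" "v \<noteq> 0" "has_wt l v"
    and ab: "a \<noteq> b" "b \<noteq> bar a"
    and l: "l a > l b" "l b > 0" and kill: "R a b *v v = 0" "R b (bar b) *v v = 0"
  shows False
proof -
  have lb: "l (bar b) = - l b" using has_wt_bar[OF v(3,2)] .
  have H: "R d d *v v = of_int (l d) *s v" for d using v(3) by (simp add: has_wt_def)
  define p q where "p = R (bar b) b *v v" and "q = R b a *v v"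
  define x y where "x = R b a *v p" and "y = R (bar b) b *v q"
  have Hp: "R d d *v p = of_int (l d + root (bar b) b d) *s p" for d
    using has_wt_R[OF v(3), of "bar b" b] by (simp add: has_wt_def p_def)
  have Hq: "R d d *v q = of_int (l d + root b a d) *s q" for d
    using has_wt_R[OF v(3), of b a] by (simp add: has_wt_def q_def)
  have n: "b \<noteq> a" "a \<noteq> bar b" "bar b \<noteq> a" "bar a \<noteq> b" using ab by auto
  have m: "(- R b b) *v u = - (R b b *v u)" for u by (rule minus_mv)
  have 1: "R b (bar b) *v p = of_int (4 * l b) *s v"
    unfolding p_def commv[of b "bar b" "bar b" b v] using ab n
    by (simp add: kill H R_bar m) (simp add: vec_eq_iff)
  have 2: "R a b *v q = of_int (l a - l b) *s v"
    unfolding q_def commv[of a b b a v] using ab n by (simp add: kill H vec.scale_left_diff_distrib)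
  have p0: "p \<noteq> 0" using 1 l v(2) by auto
  have q0: "q \<noteq> 0" using 2 l v(2) by auto
  have 3: "R a b *v p = 0" unfolding p_def commv[of a b "bar b" b v] using ab n by (simp add: kill)
  have 4: "R b (bar b) *v q = 0" unfolding q_def commv[of b "bar b" b a v] using ab n by (simp add: kill)
  have 5: "R a b *v x = of_int (l a - l b + 2) *s p"
    unfolding x_def commv[of a b b a p] using ab n by (simp add: 3 Hp root_def)
  have 6: "R a b *v y = of_int (l a - l b) *s p"
    unfolding y_def commv[of a b "bar b" b q] using ab n by (simp add: 2 vector_scalar_commute matrix_vector_mult_diff_distrib p_def)
  have 7: "R b (bar b) *v x = of_int (4 * l b) *s q"
    unfolding x_def commv[of b "bar b" b a p] using ab n by (simp add: 1 vector_scalar_commute matrix_vector_mult_diff_distrib q_def)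
  have 8: "R b (bar b) *v y = of_int (4 * l b + 4) *s q"
    unfolding y_def commv[of b "bar b" "bar b" b q] using ab n
    by (simp add: 4 Hq root_def R_bar m) (simp add: vec_eq_iff algebra_simps)
  have wx: "has_wt (\<lambda>d. l d + root (bar b) b d + root b a d) x" "has_wt (\<lambda>d. l d + root b a d + root (bar b) b d) y"
    unfolding x_def y_def p_def q_def by (intro has_wt_R v(3))+
  have xy: "x \<in> U" "y \<in> U" using v(1) U(1) by (auto simp: x_def y_def p_def q_def submod_def)
  have "y \<noteq> 0" using 6 p0 l by auto
  moreover have "(\<lambda>d. l d + root (bar b) b d + root b a d) = (\<lambda>d. l d + root b a d + root (bar b) b d)" by auto
  ultimately obtain k where "x = k *s y" using U(2) wx xy unfolding mult_free_def by metis
  from two_strings[OF 5 6 7 8 p0 q0 _ _ _ _ this] show False using l by auto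
qed

text \<open>The weight reduced by 2 e_a is reached by lowering along e_a - e_b and e_a + e_b in
  either order. With k = \<open>l a\<close>, raising back gives the coefficients k and k - 2
  crosswise, and the determinant k^2 - (k - 2)^2 = 4 (k - 1) vanishes only for k = 1.\<close>

lemma not_mult_free_multiple_e1:
  assumes U: "submod U" "mult_free U" and v: "v \<in> U" "v \<noteq> 0" "has_wt l v"
    and ab: "a \<noteq> b" "b \<noteq> bar a" and l: "l a \<ge> 2" "l b = 0"
    and kill: "R a b *v v = 0" "R a (bar b) *v v = 0" "R b (bar b) *v v = 0" "R (bar b) b *v v = 0"
  shows False
proof -
  have lb: "l (bar b) = 0" using has_wt_bar[OF v(3,2), of b] l by simp
  have H: "R d d *v v = of_int (l d) *s v" for d using v(3) by (simp add: has_wt_def)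
  define p q where "p = R b a *v v" and "q = R (bar b) a *v v"
  define x y where "x = R b a *v q" and "y = R (bar b) a *v p"
  have Hp: "R d d *v p = of_int (l d + root b a d) *s p" for d
    using has_wt_R[OF v(3), of b a] by (simp add: has_wt_def p_def)
  have Hq: "R d d *v q = of_int (l d + root (bar b) a d) *s q" for d
    using has_wt_R[OF v(3), of "bar b" a] by (simp add: has_wt_def q_def)
  have n: "b \<noteq> a" "a \<noteq> bar b" "bar b \<noteq> a" "bar a \<noteq> b" using ab by auto
  have 1: "R a b *v p = of_int (l a) *s v"
    unfolding p_def commv[of a b b a v] using ab n by (simp add: kill H l)
  have 2: "R a (bar b) *v q = of_int (l a) *s v"
    unfolding q_def commv[of a "bar b" "bar b" a v] using ab n by (simp add: kill H l lb)
  have 3: "R a b *v q = 0" unfolding q_def commv[of a b "bar b" a v] using ab n by (simp add: kill)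
  have 4: "R a (bar b) *v p = 0" unfolding p_def commv[of a "bar b" b a v] using ab n by (simp add: kill)
  have 5: "R (bar b) b *v p = 2 *s q"
    unfolding p_def commv[of "bar b" b b a v] using ab n by (simp add: kill q_def) (simp add: vec_eq_iff)
  have 6: "R b (bar b) *v q = 2 *s p"
    unfolding q_def commv[of b "bar b" "bar b" a v] using ab n by (simp add: kill p_def) (simp add: vec_eq_iff)
  have p0: "p \<noteq> 0" using 1 l v(2) by auto
  have q0: "q \<noteq> 0" using 2 l v(2) by auto
  have 7: "R a b *v x = of_int (l a) *s q"
    unfolding x_def commv[of a b b a q] using ab n by (simp add: 3 Hq root_def l)
  have 8: "R a b *v y = of_int (l a - 2) *s q"
    unfolding y_def commv[of a b "bar b" a p] using ab n
    by (simp add: 1 5 vector_scalar_commute q_def[symmetric])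
  have 9: "R a (bar b) *v y = of_int (l a) *s p"
    unfolding y_def commv[of a "bar b" "bar b" a p] using ab n by (simp add: 4 Hp root_def l lb)
  have 10: "R a (bar b) *v x = of_int (l a - 2) *s p"
    unfolding x_def commv[of a "bar b" b a q] using ab n
    by (simp add: 2 6 vector_scalar_commute p_def[symmetric])
  have wx: "has_wt (\<lambda>d. l d + root (bar b) a d + root b a d) x" "has_wt (\<lambda>d. l d + root b a d + root (bar b) a d) y"
    unfolding x_def y_def p_def q_def by (intro has_wt_R v(3))+
  have xy: "x \<in> U" "y \<in> U" using v(1) U(1) by (auto simp: x_def y_def p_def q_def submod_def)
  have "y \<noteq> 0" using 9 p0 l by auto
  moreover have "(\<lambda>d. l d + root (bar b) a d + root b a d) = (\<lambda>d. l d + root b a d + root (bar b) a d)" by auto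
  ultimately obtain k where k: "x = k *s y" using U(2) wx xy unfolding mult_free_def by metis
  have "of_int (l a) *s q = (k * of_int (l a - 2)) *s q" "of_int (l a - 2) *s p = (k * of_int (l a)) *s p"
    by (metis 7 8 k vector_scalar_commute vector_smult_assoc)
      (metis 9 10 k vector_scalar_commute vector_smult_assoc)
  then have e: "of_int (l a) = k * of_int (l a - 2)" "of_int (l a - 2) = k * of_int (l a)"
    using p0 q0 by (simp_all only: vec.scale_cancel_right simp_thms)
  then have "(of_int (l a * l a) :: complex) = of_int ((l a - 2) * (l a - 2))"
    unfolding of_int_mult by (metis mult.assoc mult.commute)
  then have "l a * l a = (l a - 2) * (l a - 2)" by (simp only: of_int_eq_iff)
  then show False using l by (simp add: algebra_simps)
qed

text \<open>The weight reduced by 2 e_a + 2 e_b is reached through the two long roots, or through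
  e_a + e_b twice. With k = \<open>l a\<close> the determinant of the raising coefficients is 4 k (4
  k - 2) - 8 = 8 (2 k + 1) (k - 1), which is nonzero for k at least 2.\<close>

lemma not_mult_free_multiple_e1e2:
  assumes U: "submod U" "mult_free U" and v: "v \<in> U" "v \<noteq> 0" "has_wt l v"
    and ab: "a \<noteq> b" "b \<noteq> bar a" and l: "l a \<ge> 2" "l b = l a"
    and kill: "R a (bar a) *v v = 0" "R b (bar b) *v v = 0" "R a (bar b) *v v = 0" "R a b *v v = 0" "R b a *v v = 0"
  shows False
proof -
  have lb: "l (bar b) = - l a" using has_wt_bar[OF v(3,2), of b] l by simp
  have H: "R d d *v v = of_int (l d) *s v" for d using v(3) by (simp add: has_wt_def)
  have sk: "R (bar d) (bar c) *v u = - (sg c * sg d) *s (R c d *v u)" for c d u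
    using skew[of d c] by (simp add: scale_mv)
  define p q where "p = R (bar b) b *v v" and "q = R (bar b) a *v v"
  define x y where "x = R (bar a) a *v p" and "y = R (bar b) a *v q"
  have Hp: "R d d *v p = of_int (l d + root (bar b) b d) *s p" for d
    using has_wt_R[OF v(3), of "bar b" b] by (simp add: has_wt_def p_def)
  have Hq: "R d d *v q = of_int (l d + root (bar b) a d) *s q" for d
    using has_wt_R[OF v(3), of "bar b" a] by (simp add: has_wt_def q_def)
  have n: "b \<noteq> a" "a \<noteq> bar b" "bar b \<noteq> a" "bar a \<noteq> b" using ab by auto
  have ss: "sg a * sg b * (sg a * sg b) = 1" by (metis mult.assoc mult.commute sg_simps(4) mult_1)
  have k1: "R (bar b) (bar a) *v v = 0" using sk[of b a v] kill by simp
  have 1: "R b (bar b) *v p = of_int (4 * l a) *s v"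
    unfolding p_def commv[of b "bar b" "bar b" b v] using ab n
    by (simp add: kill H R_bar minus_mv l) (simp add: vec_eq_iff)
  have p0: "p \<noteq> 0" using 1 l v(2) by auto
  have 2: "R a (bar b) *v q = of_int (2 * l a) *s v"
    unfolding q_def commv[of a "bar b" "bar b" a v] using ab n by (simp add: kill H l lb) (simp add: vec_eq_iff)
  have q0: "q \<noteq> 0" using 2 l v(2) by auto
  have 3: "R a (bar a) *v p = 0" unfolding p_def commv[of a "bar a" "bar b" b v] using ab n by (simp add: kill)
  have 4: "R a (bar a) *v x = of_int (4 * l a) *s p"
    unfolding x_def commv[of a "bar a" "bar a" a p] using ab n
    by (simp add: 3 Hp R_bar minus_mv root_def) (simp add: vec_eq_iff)
  have 5: "R a (bar a) *v q = 0"
    unfolding q_def commv[of a "bar a" "bar b" a v] using ab n by (simp add: kill k1)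
  have 6: "R (bar b) (bar a) *v q = (sg a * sg b) *s p"
    unfolding q_def commv[of "bar b" "bar a" "bar b" a v] using ab n by (simp add: k1 p_def mult.commute)
  have 7: "R a (bar a) *v y = (- 2 * (sg a * sg b)) *s p"
    unfolding y_def commv[of a "bar a" "bar b" a q] using ab n by (simp add: 5 6) (simp add: vec_eq_iff)
  have 8: "R a (bar b) *v p = 0"
    unfolding p_def commv[of a "bar b" "bar b" b v] using ab n by (simp add: kill k1)
  have 9: "R b a *v p = - (2 *s q)"
    unfolding p_def commv[of b a "bar b" b v] using ab n sk[of a "bar b" v]
    by (simp add: kill q_def vector_smult_assoc mult_ac) (simp add: vec_eq_iff)
  have 10: "R a (bar b) *v x = (- 4 * (sg a * sg b)) *s q"
    unfolding x_def commv[of a "bar b" "bar a" a p] using ab n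
    by (simp add: 8 9 mult.commute sk[of a b]) (simp add: vec_eq_iff)
  have 11: "R a (bar b) *v y = of_int (4 * l a - 2) *s q"
    unfolding y_def commv[of a "bar b" "bar b" a q] using ab n
    by (simp add: 2 Hq root_def l lb vector_scalar_commute q_def[symmetric]) (simp add: vec_eq_iff algebra_simps)
  have wx: "has_wt (\<lambda>d. l d + root (bar b) b d + root (bar a) a d) x" "has_wt (\<lambda>d. l d + root (bar b) a d + root (bar b) a d) y"
    unfolding x_def y_def p_def q_def by (intro has_wt_R v(3))+
  have xy: "x \<in> U" "y \<in> U" using v(1) U(1) by (auto simp: x_def y_def p_def q_def submod_def)
  have "4 * l a - 2 \<noteq> 0" using l by simp
  then have "of_int (4 * l a - 2) \<noteq> (0 :: complex)" by (simp only: of_int_eq_0_iff simp_thms)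
  then have "y \<noteq> 0" using 11 q0 by (metis matrix_vector_mult_0_right vec.scale_eq_0_iff)
  moreover have "(\<lambda>d. l d + root (bar b) b d + root (bar a) a d) = (\<lambda>d. l d + root (bar b) a d + root (bar b) a d)"
    using n by (auto simp: root_def fun_eq_iff)
  ultimately obtain k where k: "x = k *s y" using U(2) wx xy unfolding mult_free_def by metis
  have "of_int (4 * l a) *s p = (k * (- 2 * (sg a * sg b))) *s p" "(- 4 * (sg a * sg b)) *s q = (k * of_int (4 * l a - 2)) *s q"
    by (metis 4 7 k vector_scalar_commute vector_smult_assoc)
      (metis 10 11 k vector_scalar_commute vector_smult_assoc)
  then have e: "of_int (4 * l a) = k * (- 2 * (sg a * sg b))" "- 4 * (sg a * sg b) = k * of_int (4 * l a - 2)"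
    using p0 q0 by (simp_all only: vec.scale_cancel_right simp_thms)
  have "of_int (4 * l a) * of_int (4 * l a - 2) = k * of_int (4 * l a - 2) * (- 2 * (sg a * sg b))"
    unfolding e(1) by (simp add: mult_ac)
  also have "\<dots> = 8 * (sg a * sg b * (sg a * sg b))" unfolding e(2)[symmetric] by (simp add: mult_ac)
  finally have "(of_int (4 * l a * (4 * l a - 2)) :: complex) = of_int 8" unfolding ss by simp
  then have "4 * l a * (4 * l a - 2) = 8" by (simp only: of_int_eq_iff)
  moreover have "8 * 2 \<le> 4 * l a * (4 * l a - 2)" using l by (intro mult_mono) auto
  ultimately show False by simp
qed

end

section \<open>Multiplicity-free representations\<close>

context sp_rep begin

definition wt_norm :: "('r + 'r \<Rightarrow> int) \<Rightarrow> int" where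
  "wt_norm l = (\<Sum>c\<in>UNIV. (l c)\<^sup>2)"

text \<open>Expanding the square adds the positive norm of the root and twice its inner product with
  \<open>l\<close>, which is nonnegative because \<open>l b \<le> l a\<close>.\<close>

lemma wt_norm_root:
  assumes "\<And>c. l (bar c) = - l c" "a \<noteq> b" "l b \<le> l a"
  shows "wt_norm l < wt_norm (\<lambda>c. l c + root a b c)"
proof -
  have "(\<Sum>c\<in>UNIV. l c * root a b c) = (\<Sum>c\<in>UNIV. (if c = a then l c else 0)) - (\<Sum>c\<in>UNIV. (if c = b then l c else 0))
     - (\<Sum>c\<in>UNIV. (if c = bar a then l c else 0)) + (\<Sum>c\<in>UNIV. (if c = bar b then l c else 0))"
    unfolding sum_subtractf[symmetric] sum.distrib[symmetric]
    by (intro sum.cong refl) (auto simp: root_def)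
  also have "\<dots> = 2 * (l a - l b)" using assms(1) by simp
  finally have 1: "(\<Sum>c\<in>UNIV. l c * root a b c) = 2 * (l a - l b)" .
  have le: "(root a b a)\<^sup>2 \<le> (\<Sum>c\<in>UNIV. (root a b c)\<^sup>2)" by (rule member_le_sum) auto
  have "0 < (root a b a)\<^sup>2" using assms(2) by (auto simp: root_def)
  from this le have "0 < (\<Sum>c\<in>UNIV. (root a b c)\<^sup>2)" by (rule less_le_trans)
  moreover have "wt_norm (\<lambda>c. l c + root a b c) = wt_norm l + 2 * (\<Sum>c\<in>UNIV. l c * root a b c) + (\<Sum>c\<in>UNIV. (root a b c)\<^sup>2)"
    by (simp add: wt_norm_def power2_sum sum.distrib sum_distrib_left algebra_simps)
  ultimately show ?thesis using 1 assms(3) by simp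
qed

definition unit_wt :: "'r + 'r \<Rightarrow> 'r + 'r \<Rightarrow> int" where
  "unit_wt a c = (if c = a then 1 else 0) - (if c = bar a then 1 else 0)"

text \<open>For rank 2 and 3 these are the weights of the fundamental module with highest weight e_1
  + ... + e_r: the sign vectors, and the sign vectors with two entries replaced by 0.\<close>

definition spin_wts :: "('r + 'r \<Rightarrow> int) set" where
  "spin_wts = {l. (\<forall>a. l (bar a) = - l a \<and> l a \<le> 1) \<and> even ((\<Sum>i\<in>UNIV. l (Inl i)) - int CARD('r))}"

text \<open>Good weights contain the largest entry \<open>M\<close> that occurs anywhere and have
  the largest norm among such weights. If one could be raised along a root that pairs nonnegatively
  with it, the bound \<open>M\<close> would force some entry equal to \<open>M\<close> to survive
  while the norm grows. The double maximization also supplies the bounds on entries and norms by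
  which the remaining weights are identified.\<close>

lemma weights_extremal:
  assumes U: "submod U" and fin: "finite (weights U)" and ne: "weights U \<noteq> {}"
  obtains M good where "\<And>l a. l \<in> weights U \<Longrightarrow> l a \<le> M"
    "\<And>l. good l \<Longrightarrow> l \<in> weights U" "\<And>l. good l \<Longrightarrow> \<exists>a. l a = M"
    "\<And>l a b. good l \<Longrightarrow> a \<noteq> b \<Longrightarrow> l b \<le> l a \<Longrightarrow> (\<lambda>c. l c + root a b c) \<notin> weights U"
    "\<exists>l. good l" "\<And>l l'. good l \<Longrightarrow> l' \<in> weights U \<Longrightarrow> (\<exists>a. l' a = M) \<Longrightarrow> wt_norm l' \<le> wt_norm l"
proof -
  let ?V = "(\<lambda>(l, a). l a) ` (weights U \<times> UNIV)"
  have finV: "finite ?V" "?V \<noteq> {}" using fin ne by auto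
  define M where "M = Max ?V"
  have M: "l a \<le> M" if "l \<in> weights U" for l a
    unfolding M_def using that by (intro Max_ge finV(1)) force
  obtain l0 a0 where l0: "l0 \<in> weights U" "l0 a0 = M" using Max_in[OF finV] unfolding M_def by auto
  let ?W = "{l \<in> weights U. \<exists>a. l a = M}"
  have finW: "finite (wt_norm ` ?W)" "wt_norm ` ?W \<noteq> {}" using fin l0 by auto
  define good where "good l \<longleftrightarrow> l \<in> ?W \<and> wt_norm l = Max (wt_norm ` ?W)" for l
  have ex: "\<exists>l. good l" using Max_in[OF finW] unfolding good_def by force
  have max: "wt_norm l' \<le> wt_norm l" if "good l" "l' \<in> weights U" "\<exists>a. l' a = M" for l l'
    using that Max_ge[OF finW(1), of "wt_norm l'"] unfolding good_def by force
  have up: "(\<lambda>c. l c + root a b c) \<notin> weights U" if g: "good l" and ab: "a \<noteq> b" "l b \<le> l a" for l a b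
  proof
    let ?l = "\<lambda>c. l c + root a b c"
    assume w: "?l \<in> weights U"
    have lP: "l \<in> weights U" and "\<exists>e. l e = M" using g by (auto simp: good_def)
    then obtain e where e: "l e = M" by blast
    have lb: "l (bar c) = - l c" for c by (rule weights_bar[OF lP])
    have a: "l a \<noteq> M" using M[OF w, of a] ab(1) by (auto simp: root_def split: if_splits)
    have b: "l (bar b) \<noteq> M" using M[OF w, of "bar b"] ab(1) by (auto simp: root_def split: if_splits)
    have "e \<noteq> a" "e \<noteq> bar b" using a b e by auto
    moreover have "e \<noteq> b" using e ab(2) a M[OF lP, of a] by auto
    moreover have "e \<noteq> bar a" using e ab(2) b M[OF lP, of "bar b"] by (auto simp: lb)
    ultimately have "?l e = M" using e by (simp add: root_def)
    then have "wt_norm ?l \<le> wt_norm l" using max[OF g w] by blast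
    then show False using wt_norm_root[of l a b] lb ab by auto
  qed
  show ?thesis
    by (rule that[of M good]) (use M up ex max in \<open>auto simp: good_def\<close>)
qed

lemma fresh_index:
  assumes "length as < CARD('r)"
  shows "\<exists>i :: 'r. \<forall>a\<in>set as. a \<noteq> Inl i \<and> a \<noteq> Inr i"
proof -
  let ?u = "\<lambda>a. case a of Inl i \<Rightarrow> i | Inr i \<Rightarrow> (i :: 'r)"
  have "card (set (map ?u as)) < CARD('r)"
    using card_length[of "map ?u as"] assms by simp
  then have "set (map ?u as) \<noteq> UNIV" by auto
  then obtain i where "i \<notin> set (map ?u as)" by blast
  then show ?thesis by (intro exI[of _ i]) force
qed

text \<open>A strictly decreasing chain of three signed coordinates is excluded by
  \<open>not_mult_free_A2\<close>, its boundary case in rank 2 by \<open>not_mult_free_B2\<close>.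
  This leaves multiples of a unit vector and vectors with all coordinates \<open>M\<close> or
  \<open>- M\<close>; the two lemmas on multiples then force \<open>M = 1\<close>.\<close>

lemma good_shape:
  assumes U: "submod U" "mult_free U" and r: "2 \<le> CARD('r)"
    and fin: "finite (weights U)" and ne: "weights U \<noteq> {}"
  obtains l M where "l \<in> weights U" "\<And>l a. l \<in> weights U \<Longrightarrow> l a \<le> M"
    "M = 0 \<or> (M = 1 \<and> (\<exists>a. l = unit_wt a) \<and> (\<forall>l'\<in>weights U. (\<exists>a. l' a = 1) \<longrightarrow> wt_norm l' \<le> 2)) \<or>
      (M = 1 \<and> CARD('r) \<le> 3 \<and> (\<forall>a. l a = 1 \<or> l a = -1))"
proof -
  obtain M good where M: "\<And>l a. l \<in> weights U \<Longrightarrow> l a \<le> M"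
    and gP: "\<And>l. good l \<Longrightarrow> l \<in> weights U" and gM: "\<And>l. good l \<Longrightarrow> \<exists>a. l a = M"
    and up: "\<And>l a b. good l \<Longrightarrow> a \<noteq> b \<Longrightarrow> l b \<le> l a \<Longrightarrow> (\<lambda>c. l c + root a b c) \<notin> weights U"
    and ex: "\<exists>l. good l"
    and max: "\<And>l l'. good l \<Longrightarrow> l' \<in> weights U \<Longrightarrow> (\<exists>a. l' a = M) \<Longrightarrow> wt_norm l' \<le> wt_norm l"
    by (rule weights_extremal[OF U(1) fin ne]) (rule that; assumption)
  obtain l where l: "good l" using ex by blast
  have lP: "l \<in> weights U" by (rule gP[OF l])
  have lb: "l (bar c) = - l c" for c by (rule weights_bar[OF lP])
  obtain v where v: "v \<in> U" "v \<noteq> 0" "has_wt l v" using lP by (auto simp: weights_def)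
  have kill: "R a b *v v = 0" if "a \<noteq> b" "l b \<le> l a" for a b
    using up[OF l that] by (rule R_vanish[OF U(1) v(3,1)])
  obtain a where a: "l a = M" using gM[OF l] by blast
  have M0: "0 \<le> M" using a M[OF lP, of "bar a"] by (simp add: lb)
  have tri: False if "a' \<noteq> b" "b \<noteq> bar a'" "b \<noteq> c" "c \<noteq> bar b" "a' \<noteq> c" "c \<noteq> bar a'" "l a' > l b" "l b > l c" for a' b c
    using not_mult_free_A2[OF U v, of a' b c] that kill by auto
  have abs_val: "l b = 0 \<or> l b = M" if b: "b \<noteq> a" "b \<noteq> bar a" "0 \<le> l b" for b
  proof (rule ccontr)
    assume "\<not> ?thesis"
    then have lbM: "0 < l b" "l b < M" using b M[OF lP, of b] by auto
    show False
    proof (cases "CARD('r) = 2")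
      case True
      show False
        using not_mult_free_B2[OF U v, of a b] b lbM a kill[of a b] kill[of b "bar b"] lb[of b] by auto
    next
      case False
      then have "length [a, b] < CARD('r)" using r by simp
      from fresh_index[OF this] obtain i where i: "\<forall>d\<in>set [a, b]. d \<noteq> Inl i \<and> d \<noteq> Inr i" by blast
      have ne: "Inl i \<noteq> a" "Inr i \<noteq> a" "Inl i \<noteq> bar a" "Inl i \<noteq> b" "Inl i \<noteq> bar b" "Inr i \<noteq> b" "Inr i \<noteq> bar a" "Inr i \<noteq> bar b"
        using i[rule_format, of a] i[rule_format, of b] by (cases a; cases b; auto)+
      \<comment> \<open>The sign of the third index is chosen so that its coordinate is nonpositive
        and completes the chain \<open>a\<close>, \<open>b\<close>, \<open>c\<close>.\<close>
      define c where "c = (if 0 \<le> l (Inl i) then bar (Inl i) else Inl i)"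
      have c: "l c \<le> 0" "c \<noteq> a" "c \<noteq> bar a" "c \<noteq> b" "c \<noteq> bar b"
        using ne lb[of "Inl i"] by (auto simp: c_def)
      show False using tri[of a b c] b c lbM a by auto
    qed
  qed
  show ?thesis
  proof (cases "M = 0")
    case True
    then show ?thesis using that[of l M] lP M by auto
  next
    case False
    then have Mp: "0 < M" using M0 by simp
    have cases: "(\<forall>b. b \<noteq> a \<longrightarrow> b \<noteq> bar a \<longrightarrow> l b = 0) \<or> (\<forall>b. l b = M \<or> l b = - M)"
    proof (rule ccontr)
      assume "\<not> ?thesis"
      then obtain b c where bc: "b \<noteq> a" "b \<noteq> bar a" "l b \<noteq> 0" "l c \<noteq> M" "l c \<noteq> - M" by blast
      have ca: "c \<noteq> a" "c \<noteq> bar a" using bc a lb[of a] by auto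
      have val: "l d = 0 \<or> l d = M \<or> l d = - M" if "d \<noteq> a" "d \<noteq> bar a" for d
      proof -
        have "bar d \<noteq> a" using that by auto
        then show ?thesis using abs_val[of d] abs_val[of "bar d"] that lb[of d] by (cases "0 \<le> l d") auto
      qed
      then have c0: "l c = 0" using bc ca by blast
      define b' where "b' = (if l b = M then b else bar b)"
      have b': "l b' = M" "b' \<noteq> a" "b' \<noteq> bar a"
        using val[OF bc(1,2)] bc lb[of b] by (auto simp: b'_def)
      have "c \<noteq> b'" "c \<noteq> bar b'" "a \<noteq> bar b'" using c0 b' Mp lb[of b'] by auto
      then show False using tri[of a c "bar b'"] ca b' c0 a Mp lb[of b'] by auto
    qed
    then show ?thesis
    proof
      assume z: "\<forall>b. b \<noteq> a \<longrightarrow> b \<noteq> bar a \<longrightarrow> l b = 0"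
      have "length [a] < CARD('r)" using r by simp
      from fresh_index[OF this] obtain i where i: "\<forall>d\<in>set [a]. d \<noteq> Inl i \<and> d \<noteq> Inr i" by blast
      have b: "a \<noteq> Inl i" "Inl i \<noteq> bar a" using i[rule_format, of a] by (cases a; auto)+
      have "M = 1"
      proof (rule ccontr)
        assume "M \<noteq> 1"
        then have "2 \<le> l a" using Mp a by simp
        moreover have l0: "l (Inl i) = 0" "l (bar (Inl i)) = 0" using z b lb[of "Inl i"] by auto
        moreover have "a \<noteq> bar (Inl i)" using b(2) by (metis bar_simps(3))
        ultimately show False
          using not_mult_free_multiple_e1[OF U v b(1) b(2)] kill[of a "Inl i"] kill[of a "bar (Inl i)"]
            kill[of "Inl i" "bar (Inl i)"] kill[of "bar (Inl i)" "Inl i"] b by (auto simp del: bar_simps(1))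
      qed
      moreover have lu: "l = unit_wt a" using z a lb[of a] \<open>M = 1\<close> by (auto simp: unit_wt_def fun_eq_iff)
      moreover have "wt_norm l = 2"
      proof -
        have "wt_norm l = (\<Sum>c\<in>UNIV. (if c = a then 1 else 0) + (if c = bar a then 1 else 0))"
          unfolding wt_norm_def lu by (intro sum.cong refl) (auto simp: unit_wt_def)
        then show ?thesis by (simp add: sum.distrib)
      qed
      ultimately show ?thesis using that[of l M] lP M max[OF l] by auto
    next
      assume z: "\<forall>b. l b = M \<or> l b = - M"
      have pick: "\<exists>b. l b = M \<and> (b = Inl i \<or> b = bar (Inl i))" for i
        using z lb[of "Inl i"] by (metis minus_minus)
      have "length [a] < CARD('r)" using r by simp
      from fresh_index[OF this] obtain i where i: "\<forall>d\<in>set [a]. d \<noteq> Inl i \<and> d \<noteq> Inr i" by blast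
      have b0: "a \<noteq> Inl i" "a \<noteq> Inr i" "Inl i \<noteq> bar a" "Inr i \<noteq> bar a" using i[rule_format, of a] by (cases a; auto)+
      obtain b where b: "l b = M" "b = Inl i \<or> b = bar (Inl i)" using pick by blast
      have ab: "a \<noteq> b" "b \<noteq> bar a" using b b0 by auto
      have M1: "M = 1"
      proof (rule ccontr)
        assume "M \<noteq> 1"
        then have "2 \<le> l a" "l b = l a" using Mp a b by auto
        moreover have "a \<noteq> bar b" using ab(2) by auto
        ultimately show False
          using not_mult_free_multiple_e1e2[OF U v ab] kill[of a "bar a"] kill[of b "bar b"] kill[of a "bar b"]
            kill[of a b] kill[of b a] ab lb[of a] lb[of b] a b Mp by auto
      qed
      have "CARD('r) \<le> 3"
      proof (rule ccontr)
        assume r4: "\<not> ?thesis"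
        have "length [a, b] < CARD('r)" using r4 by simp
        from fresh_index[OF this] obtain j where j: "\<forall>d\<in>set [a, b]. d \<noteq> Inl j \<and> d \<noteq> Inr j" by blast
        have "length [a, b, Inl j] < CARD('r)" using r4 by simp
        from fresh_index[OF this] obtain k where k: "\<forall>d\<in>set [a, b, Inl j]. d \<noteq> Inl k \<and> d \<noteq> Inr k" by blast
        obtain c where c: "l c = M" "c = Inl j \<or> c = bar (Inl j)" using pick by blast
        obtain d where d: "l d = M" "d = Inl k \<or> d = bar (Inl k)" using pick by blast
        have nc: "c \<noteq> a" "c \<noteq> bar a" "c \<noteq> b" "c \<noteq> bar b"
          using j[rule_format, of a] j[rule_format, of b] c(2) by (cases a; cases b; auto)+
        have nd: "d \<noteq> a" "d \<noteq> bar a" "d \<noteq> b" "d \<noteq> bar b" "d \<noteq> c" "d \<noteq> bar c"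
          using k[rule_format, of a] k[rule_format, of b] k[rule_format, of "Inl j"] c(2) d(2) by (cases a; cases b; auto)+
        have nd': "bar d \<noteq> a" "bar d \<noteq> b" "bar d \<noteq> c" "c \<noteq> bar d" "a \<noteq> bar d" "b \<noteq> bar d"
          using nd by (metis bar_simps(3))+
        have nc': "bar c \<noteq> a" "bar c \<noteq> b" "a \<noteq> bar c" "b \<noteq> bar c" using nc by (metis bar_simps(3))+
        \<comment> \<open>Replacing the entries at \<open>c\<close> and \<open>d\<close> by 0 keeps
          \<open>a\<close> and \<open>b\<close> at 1, so \<open>a\<close>, \<open>c\<close>,
          \<open>bar b\<close> is the chain 1 > 0 > -1. The two raising operators still kill a
          vector of this weight, since they would create an entry 2 beyond
          \<open>M = 1\<close>.\<close>
        define l1 where "l1 = (\<lambda>e. l e - int 1 * root c (bar d) e)"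
        have l1P: "l1 \<in> weights U" unfolding l1_def
          using nd nd' lb[of d] c d M1 by (intro weights_string[OF U(1) lP]) (auto simp: pairing_def)
        obtain v' where v': "v' \<in> U" "v' \<noteq> 0" "has_wt l1 v'" using l1P by (auto simp: weights_def)
        have nn: "a \<noteq> c" "a \<noteq> d" "b \<noteq> c" "b \<noteq> d" "c \<noteq> d" "bar b \<noteq> c" "bar b \<noteq> d" using nc nd by auto
        have l1: "l1 a = 1" "l1 c = 0" "l1 (bar b) = -1" "l1 b = 1"
          using nn nd nd' nc nc' lb[of b] a b c M1 ab by (auto simp: l1_def root_def)
        have "R a c *v v' = 0"
        proof (rule R_vanish[OF U(1) v'(3,1)])
          show "(\<lambda>e. l1 e + root a c e) \<notin> weights U"
            using M[of "\<lambda>e. l1 e + root a c e" a] l1(1) nc nc' M1 by (auto simp: root_def)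
        qed
        moreover have "R c (bar b) *v v' = 0"
        proof (rule R_vanish[OF U(1) v'(3,1)])
          show "(\<lambda>e. l1 e + root c (bar b) e) \<notin> weights U"
            using M[of "\<lambda>e. l1 e + root c (bar b) e" b] l1(4) nc nc' M1 by (auto simp: root_def)
        qed
        moreover have "a \<noteq> bar b" using ab by auto
        ultimately show False
          using not_mult_free_A2[OF U v', of a c "bar b"] l1 nc nn nc' ab by auto
      qed
      then show ?thesis using that[of l M] lP M M1 z by auto
    qed
  qed
qed

section \<open>Parity of weights and minimal submodules\<close>

definition wt_sum :: "('r + 'r \<Rightarrow> int) \<Rightarrow> int" where
  "wt_sum l = (\<Sum>i\<in>UNIV. l (Inl i))"

text \<open>The root lattice of type C consists of the integral vectors with even coordinate
  sum.\<close>

lemma wt_sum_root: "even (wt_sum (\<lambda>c. l c + root a b c) - wt_sum l)"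
proof -
  have *: "(\<Sum>i\<in>UNIV. (if Inl i = a then 1 else 0) - (if Inl i = bar a then 1 else 0)) = (if isl a then 1 else - 1 :: int)" for a :: "'r + 'r"
    by (cases a) (simp_all add: sum_subtractf sum_negf)
  have "wt_sum (\<lambda>c. l c + root a b c) - wt_sum l = (\<Sum>i\<in>UNIV. root a b (Inl i))"
    by (simp add: wt_sum_def sum.distrib)
  also have "\<dots> = (\<Sum>i\<in>UNIV. ((if Inl i = a then 1 else 0) - (if Inl i = bar a then 1 else 0)) - ((if Inl i = b then 1 else 0) - (if Inl i = bar b then 1 else 0)))"
    by (intro sum.cong refl) (simp add: root_def)
  also have "\<dots> = (if isl a then 1 else - 1) - (if isl b then 1 else - 1)"
    unfolding sum_subtractf[of "\<lambda>i. (if Inl i = a then 1 else 0) - (if Inl i = bar a then 1 else 0)"] * ..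
  also have "even \<dots>" by simp
  finally show ?thesis .
qed

definition min_submod :: "(complex^'v) set \<Rightarrow> bool" where
  "min_submod U \<longleftrightarrow> submod U \<and> U \<noteq> {0} \<and> (\<forall>W. submod W \<longrightarrow> W \<subseteq> U \<longrightarrow> W = {0} \<or> W = U)"

lemma min_submod_exists:
  assumes "submod W" "W \<noteq> {0}"
  shows "\<exists>U\<subseteq>W. min_submod U"
  using assms
proof (induction "vec.dim W" arbitrary: W rule: less_induct)
  case less
  show ?case
  proof (cases "min_submod W")
    case False
    then obtain W' where W': "submod W'" "W' \<subset> W" "W' \<noteq> {0}"
      using less.prems unfolding min_submod_def by blast
    have "vec.span W' = W'" "vec.span W = W"
      using W'(1) less.prems(1) by (auto simp: submod_def vec.span_eq_iff)
    then have "vec.span W' \<subset> vec.span W" using W'(2) by (simp only:)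
    then have "vec.dim W' < vec.dim W" by (rule vec.dim_psubset)
    then show ?thesis using less.hyps[OF _ W'(1,3)] W'(2) by blast
  qed auto
qed

end

text \<open>Isolates what the classification of weights takes from the grading element: it belongs
  to the Cartan subalgebra, is diagonalizable, and has lines as eigenspaces.\<close>

locale simple_grading = sp_rep R for R :: "'r::finite + 'r \<Rightarrow> 'r + 'r \<Rightarrow> complex^'v^'v" +
  fixes A :: "complex^'v^'v" and tt :: "'r \<Rightarrow> complex"
  assumes A: "A = (\<Sum>i\<in>UNIV. scale_mat (tt i) (R (Inl i) (Inl i)))"
    and diag: "diagonalizable A"
    and simple: "A *v x = k *s x \<Longrightarrow> A *v y = k *s y \<Longrightarrow> y \<noteq> 0 \<Longrightarrow> \<exists>c. x = c *s y"
    and card: "2 \<le> CARD('r)"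
begin

definition tau :: "('r + 'r \<Rightarrow> int) \<Rightarrow> complex" where
  "tau l = (\<Sum>i\<in>UNIV. tt i * of_int (l (Inl i)))"

lemma A_mv: "A *v x = (\<Sum>i\<in>UNIV. tt i *s (R (Inl i) (Inl i) *v x))"
  by (simp add: A sum_mv scale_mv)

lemma A_wt: "has_wt l x \<Longrightarrow> A *v x = tau l *s x"
  by (simp add: A_mv has_wt_def tau_def vector_smult_assoc vec.scale_sum_left)

text \<open>Each \<open>R a a\<close> commutes with \<open>A\<close> and so preserves every
  eigenline of \<open>A\<close>; its eigenvalue there is an integer by
  \<open>weight_integral\<close>.\<close>

lemma eigen_wt:
  assumes "A *v x = k *s x" "x \<noteq> 0"
  shows "\<exists>l. has_wt l x"
proof -
  have "\<exists>n. R a a *v x = of_int n *s x" for a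
  proof -
    have c: "R b b *v (R a a *v x) = R a a *v (R b b *v x)" for b
      unfolding H_comm[of b a a x] by (simp add: root_def)
    have "A *v (R a a *v x) = R a a *v (A *v x)"
      by (simp add: A_mv c vec.linear_sum[OF matrix_vector_mul_linear_gen] vector_scalar_commute)
    also have "\<dots> = k *s (R a a *v x)" by (simp add: assms(1) vector_scalar_commute)
    finally obtain d where "R a a *v x = d *s x" using simple[OF _ assms] by blast
    then show ?thesis using weight_integral[OF assms(2)] by metis
  qed
  then show ?thesis unfolding has_wt_def by metis
qed

lemma mf: "mult_free U"
  unfolding mult_free_def using simple A_wt by blast

lemma tau_inj:
  assumes "l \<in> weights UNIV" "l' \<in> weights UNIV" "tau l = tau l'"
  shows "l = l'"
proof -
  obtain x y where x: "x \<noteq> 0" "has_wt l x" and y: "y \<noteq> 0" "has_wt l' y" using assms(1,2) by (auto simp: weights_def)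
  obtain c where c: "x = c *s y" using simple[OF A_wt[OF x(2)] _ y(1)] A_wt[OF y(2)] assms(3) by auto
  have "l a = l' a" for a
  proof -
    have "R a a *v x = of_int (l' a) *s x"
      using y(2) by (simp add: c has_wt_def vector_scalar_commute vector_smult_assoc mult.commute)
    then have "of_int (l a) *s x = of_int (l' a) *s x" using x(2) by (simp add: has_wt_def)
    then show ?thesis using x(1) by (simp only: vec.scale_cancel_right of_int_eq_iff simp_thms)
  qed
  then show ?thesis by auto
qed

lemma weights_subset: "weights U \<subseteq> weights UNIV"
  by (auto simp: weights_def)

lemma weights_finite: "finite (weights U)"
proof (rule ccontr)
  assume "infinite (weights U)"
  then obtain f :: "nat \<Rightarrow> _" where f: "inj f" "range f \<subseteq> weights U"
    using infinite_countable_subset by blast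
  have "\<forall>i. \<exists>x. x \<noteq> 0 \<and> has_wt (f i) x" using f(2) by (auto simp: weights_def)
  then obtain x where x: "\<And>i. x i \<noteq> 0" "\<And>i. has_wt (f i) (x i)" by metis
  have "inj (\<lambda>i. tau (f i))"
  proof (rule injI)
    fix i j assume "tau (f i) = tau (f j)"
    then have "f i = f j" using f(2) weights_subset[of U] by (intro tau_inj) auto
    then show "i = j" using f(1) by (simp add: inj_eq)
  qed
  then show False using finite_eigenvalues[of "\<lambda>i. tau (f i)" x A] x A_wt by blast
qed

lemma A_stable: "submod U \<Longrightarrow> x \<in> U \<Longrightarrow> A *v x \<in> U"
  unfolding A_mv submod_def by (intro vec.subspace_sum vec.subspace_scale) auto

lemma submod_span:
  assumes "submod U"
  shows "U = vec.span {x\<in>U. x \<noteq> 0 \<and> (\<exists>l. has_wt l x)}"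
proof
  have sub: "vec.subspace U" using assms by (simp add: submod_def)
  show "U \<subseteq> vec.span {x\<in>U. x \<noteq> 0 \<and> (\<exists>l. has_wt l x)}"
  proof
    fix x assume "x \<in> U"
    then have "x \<in> vec.span {y\<in>U. \<exists>k. A *v y = k *s y}"
      using diagonalizable_stable[OF diag sub] A_stable[OF assms] by blast
    also have "\<dots> \<subseteq> vec.span {x\<in>U. x \<noteq> 0 \<and> (\<exists>l. has_wt l x)}"
    proof (rule vec.span_minimal, rule subsetI)
      fix y assume y: "y \<in> {y\<in>U. \<exists>k. A *v y = k *s y}"
      show "y \<in> vec.span {x\<in>U. x \<noteq> 0 \<and> (\<exists>l. has_wt l x)}"
      proof (cases "y = 0")
        case False
        then show ?thesis using y eigen_wt by (intro vec.span_base) blast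
      qed (simp add: vec.span_zero)
    qed (rule vec.subspace_span)
    finally show "x \<in> vec.span {x\<in>U. x \<noteq> 0 \<and> (\<exists>l. has_wt l x)}" .
  qed
  show "vec.span {x\<in>U. x \<noteq> 0 \<and> (\<exists>l. has_wt l x)} \<subseteq> U"
    by (intro vec.span_minimal sub) auto
qed

lemma weights_nonempty: "submod U \<Longrightarrow> U \<noteq> {0} \<Longrightarrow> weights U \<noteq> {}"
proof
  assume U: "submod U" "U \<noteq> {0}" and "weights U = {}"
  then have e: "{x\<in>U. x \<noteq> 0 \<and> (\<exists>l. has_wt l x)} = {}" by (auto simp: weights_def)
  have "U = vec.span {}" using submod_span[OF U(1)] unfolding e .
  then have "U = {0}" by simp
  then show False using U(2) by simp
qed

text \<open>Weight spaces of the whole module are lines, so a submodule, being spanned by its weight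
  vectors, contains the entire line of each of its weights.\<close>

lemma submod_eqI:
  assumes "submod U" "submod W" "weights U = weights W"
  shows "U = W"
proof -
  have "U \<subseteq> W" if UW: "submod U" "submod W" "weights U \<subseteq> weights W" for U W
  proof -
    have "{x\<in>U. x \<noteq> 0 \<and> (\<exists>l. has_wt l x)} \<subseteq> W"
    proof safe
      fix x l assume x: "x \<in> U" "x \<noteq> 0" "has_wt l x"
      then have "l \<in> weights W" using UW(3) by (auto simp: weights_def)
      then obtain y where y: "y \<in> W" "y \<noteq> 0" "has_wt l y" by (auto simp: weights_def)
      then obtain c where "x = c *s y" using simple[OF A_wt[OF x(3)] A_wt[OF y(3)]] by blast
      then show "x \<in> W" using y(1) UW(2) by (auto simp: submod_def vec.subspace_scale)
    qed
    from vec.span_minimal[OF this] have "vec.span {x\<in>U. x \<noteq> 0 \<and> (\<exists>l. has_wt l x)} \<subseteq> W"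
      using UW(2) by (simp add: submod_def)
    then show ?thesis by (rule subset_trans[OF equalityD1[OF submod_span[OF UW(1)]]])
  qed
  then show ?thesis using assms by (simp add: subset_antisym)
qed

lemma dim_weights: "submod U \<Longrightarrow> vec.dim U = card (weights U)"
proof -
  assume U: "submod U"
  have "\<forall>l. \<exists>x. l \<in> weights U \<longrightarrow> x \<in> U \<and> x \<noteq> 0 \<and> has_wt l x" by (auto simp: weights_def)
  then obtain v where v: "\<And>l. l \<in> weights U \<Longrightarrow> v l \<in> U \<and> v l \<noteq> 0 \<and> has_wt l (v l)" by metis
  have inj: "inj_on v (weights U)"
  proof (rule inj_onI)
    fix l l' assume l: "l \<in> weights U" "l' \<in> weights U" "v l = v l'"
    have "tau l *s v l = tau l' *s v l"
      using A_wt[of l "v l"] A_wt[of l' "v l'"] v[OF l(1)] v[OF l(2)] l(3) by simp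
    then have "tau l = tau l'" using v[OF l(1)] by simp
    then show "l = l'" using l weights_subset by (intro tau_inj) auto
  qed
  have "vec.independent (v ` weights U)"
  proof
    assume "vec.dependent (v ` weights U)"
    then obtain l where l: "l \<in> weights U" "v l \<in> vec.span (v ` weights U - {v l})"
      by (auto simp: vec.dependent_def)
    have "v ` weights U - {v l} \<subseteq> {y. \<exists>k\<in>tau ` (weights U - {l}). A *v y = k *s y}"
    proof
      fix y assume "y \<in> v ` weights U - {v l}"
      then obtain m where m: "m \<in> weights U" "m \<noteq> l" "y = v m" by blast
      then have "A *v y = tau m *s y" using v A_wt by simp
      then show "y \<in> {y. \<exists>k\<in>tau ` (weights U - {l}). A *v y = k *s y}" using m by blast
    qed
    then have "v l \<in> vec.span {y. \<exists>k\<in>tau ` (weights U - {l}). A *v y = k *s y}"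
      using l(2) vec.span_mono by blast
    moreover have "tau l \<notin> tau ` (weights U - {l})"
    proof
      assume "tau l \<in> tau ` (weights U - {l})"
      then obtain m where "m \<in> weights U" "m \<noteq> l" "tau l = tau m" by blast
      then show False using tau_inj[of l m] l(1) weights_subset by blast
    qed
    ultimately have "v l = 0"
      using eigen_span_zero[of "v l" "tau ` (weights U - {l})" A "tau l"] A_wt v[OF l(1)] by simp
    then show False using v[OF l(1)] by simp
  qed
  moreover have "U \<subseteq> vec.span (v ` weights U)"
  proof -
    have "{x\<in>U. x \<noteq> 0 \<and> (\<exists>l. has_wt l x)} \<subseteq> vec.span (v ` weights U)"
    proof safe
      fix x l assume x: "x \<in> U" "x \<noteq> 0" "has_wt l x"
      then have l: "l \<in> weights U" by (auto simp: weights_def)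
      then obtain c where "x = c *s v l" using simple[OF A_wt[OF x(3)]] A_wt v by blast
      moreover have "v l \<in> vec.span (v ` weights U)" using l by (intro vec.span_base) simp
      ultimately show "x \<in> vec.span (v ` weights U)" by (simp add: vec.span_scale)
    qed
    from vec.span_minimal[OF this vec.subspace_span]
    show ?thesis by (rule subset_trans[OF equalityD1[OF submod_span[OF U]]])
  qed
  ultimately have "vec.dim U = card (v ` weights U)"
    using v by (intro vec.dim_unique[of "v ` weights U"]) auto
  then show ?thesis using inj by (simp add: card_image)
qed

text \<open>Roots have even coordinate sum, so the weight vectors of one parity span a submodule; by
  minimality it is all of \<open>U\<close>.\<close>

lemma weights_parity:
  assumes U: "min_submod U" and l: "l \<in> weights U" "l' \<in> weights U"
  shows "even (wt_sum l' - wt_sum l)"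
proof (rule ccontr)
  assume odd: "\<not> ?thesis"
  have sU: "submod U" using U by (simp add: min_submod_def)
  let ?G = "{x\<in>U. x \<noteq> 0 \<and> (\<exists>m. has_wt m x \<and> even (wt_sum m - wt_sum l))}"
  have "submod (vec.span ?G)" unfolding submod_def
  proof (intro conjI allI ballI vec.subspace_span)
    fix a b x assume "x \<in> vec.span ?G"
    then show "R a b *v x \<in> vec.span ?G"
    proof (induction rule: vec.span_induct_alt)
      case (step c x y)
      then obtain m where x: "x \<in> U" "x \<noteq> 0" "has_wt m x" "even (wt_sum m - wt_sum l)" by blast
      have "R a b *v x \<in> vec.span ?G"
      proof (cases "R a b *v x = 0")
        case False
        have "even (wt_sum (\<lambda>c. m c + root a b c) - wt_sum l)" using wt_sum_root[of m a b] x(4) by presburger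
        then show ?thesis using False has_wt_R[OF x(3), of a b] x(1) sU
          by (intro vec.span_base) (auto simp: submod_def)
      qed (simp add: vec.span_zero)
      then show ?case using step.IH by (simp add: matrix_vector_right_distrib vector_scalar_commute vec.span_add vec.span_scale)
    qed (simp add: vec.span_zero)
  qed
  moreover have "vec.span ?G \<subseteq> U" using sU by (intro vec.span_minimal) (auto simp: submod_def)
  moreover have "vec.span ?G \<noteq> {0}"
  proof -
    obtain x where x: "x \<in> U" "x \<noteq> 0" "has_wt l x" using l(1) by (auto simp: weights_def)
    then have "x \<in> vec.span ?G" by (intro vec.span_base) auto
    then show ?thesis using x(2) by auto
  qed
  ultimately have eq: "vec.span ?G = U" using U unfolding min_submod_def by blast
  obtain x where x: "x \<in> U" "x \<noteq> 0" "has_wt l' x" using l(2) by (auto simp: weights_def)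
  let ?L = "{tau m | m. m \<in> weights U \<and> even (wt_sum m - wt_sum l)}"
  have "?G \<subseteq> {y. \<exists>k\<in>?L. A *v y = k *s y}" using A_wt by (auto simp: weights_def)
  then have "x \<in> vec.span {y. \<exists>k\<in>?L. A *v y = k *s y}" using eq x(1) vec.span_mono by blast
  moreover have "tau l' \<notin> ?L"
  proof
    assume "tau l' \<in> ?L"
    then obtain m where m: "m \<in> weights U" "even (wt_sum m - wt_sum l)" "tau l' = tau m" by blast
    then have "l' = m" using l(2) weights_subset by (intro tau_inj) auto
    then show False using m(2) odd by simp
  qed
  ultimately have "x = 0" using eigen_span_zero[of x ?L A "tau l'"] A_wt[OF x(3)] by simp
  then show False using x(2) by simp
qed

lemma weights_full_flip:
  assumes U: "submod U" and l: "l \<in> weights U" and l': "\<And>a. l' (bar a) = - l' a" "\<And>a. l' a = l a \<or> l' a = - l a"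
  shows "l' \<in> weights U"
proof -
  let ?g = "\<lambda>S c. if c \<in> Inl ` S \<union> Inr ` S then - l c else l c"
  have "?g S \<in> weights U" if "finite S" for S
    using that
  proof (induction S rule: finite_induct)
    case empty show ?case using l by simp
  next
    case (insert i S)
    have "?g S \<circ> swp (Inl i) (bar (Inl i)) \<in> weights U"
      by (rule weights_flip[OF U insert.IH])
    moreover have "?g S \<circ> swp (Inl i) (bar (Inl i)) = ?g (insert i S)"
      using insert.hyps(2) weights_bar[OF l, of "Inl i"] by (auto simp: fun_eq_iff swp_def)
    ultimately show ?case by simp
  qed
  from this[of "{i. l' (Inl i) \<noteq> l (Inl i)}"]
  have "?g {i. l' (Inl i) \<noteq> l (Inl i)} \<in> weights U" by simp
  moreover have "?g {i. l' (Inl i) \<noteq> l (Inl i)} = l'"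
  proof
    fix c
    show "?g {i. l' (Inl i) \<noteq> l (Inl i)} c = l' c"
    proof (cases c)
      case (Inl i)
      then show ?thesis using l'(2)[of "Inl i"] by auto
    next
      case (Inr i)
      then show ?thesis using l'(2)[of "Inl i"] l'(1)[of "Inl i"] weights_bar[OF l, of "Inl i"] by auto
    qed
  qed
  ultimately show ?thesis by simp
qed

lemma weights_cases:
  assumes U: "min_submod U"
  shows "weights U = {\<lambda>_. 0} \<or> weights U = range unit_wt \<or> (CARD('r) \<le> 3 \<and> weights U = spin_wts)"
proof -
  have sU: "submod U" and U0: "U \<noteq> {0}" using U by (auto simp: min_submod_def)
  obtain l M where l: "l \<in> weights U" and M: "\<And>l a. l \<in> weights U \<Longrightarrow> l a \<le> M" and
    "M = 0 \<or> (M = 1 \<and> (\<exists>a. l = unit_wt a) \<and> (\<forall>l'\<in>weights U. (\<exists>a. l' a = 1) \<longrightarrow> wt_norm l' \<le> 2)) \<or>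
      (M = 1 \<and> CARD('r) \<le> 3 \<and> (\<forall>a. l a = 1 \<or> l a = -1))" (is "_ \<or> ?b \<or> ?c")
    by (rule good_shape[OF sU mf card weights_finite weights_nonempty[OF sU U0]]) (rule that; assumption)
  then consider "M = 0" | ?b | ?c by blast
  then show ?thesis
  proof cases
    case 1
    have "l' = (\<lambda>_. 0)" if "l' \<in> weights U" for l'
    proof
      fix a
      show "l' a = 0" using M[OF that, of a] M[OF that, of "bar a"] weights_bar[OF that, of a] 1 by simp
    qed
    then show ?thesis using l by blast
  next
    case 2
    then obtain a where a: "l = unit_wt a" by blast
    have sum: "odd (wt_sum l)"
    proof -
      have "wt_sum l = (\<Sum>i\<in>UNIV. (if Inl i = a then 1 else 0) - (if Inl i = bar a then 1 else 0))"
        by (simp add: wt_sum_def a unit_wt_def)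
      also have "\<dots> = (if isl a then 1 else -1)" by (cases a) (simp_all add: sum_subtractf sum_negf)
      finally show ?thesis by simp
    qed
    have "l' \<in> range unit_wt" if l': "l' \<in> weights U" for l'
    proof -
      have lb: "l' (bar c) = - l' c" for c by (rule weights_bar[OF l'])
      \<comment> \<open>Without an entry 1 all entries are nonpositive, so the weight is 0 by
        oddness under \<open>bar\<close>; its even coordinate sum contradicts
        \<open>weights_parity\<close>.\<close>
      have "\<exists>b. l' b = 1"
      proof (rule ccontr)
        assume no: "\<not> ?thesis"
        have "l' c \<le> 0" for c using M[OF l', of c] 2 no by (metis order_le_less zle_add1_eq_le add_0)
        then have "l' c = 0" for c using lb[of c] by (metis neg_le_0_iff_le order_antisym)
        then have "wt_sum l' = 0" by (simp add: wt_sum_def)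
        then show False using weights_parity[OF U l l'] sum by simp
      qed
      then obtain b where b: "l' b = 1" by blast
      have n: "wt_norm l' \<le> 2" using 2 l' b by blast
      have "l' c = 0" if c: "c \<noteq> b" "c \<noteq> bar b" for c
      proof (rule ccontr)
        assume "l' c \<noteq> 0"
        then have "0 < (l' c)\<^sup>2" by simp
        moreover have "(\<Sum>d\<in>{c, b, bar b}. (l' d)\<^sup>2) \<le> wt_norm l'"
          unfolding wt_norm_def by (intro sum_mono2) auto
        moreover have "(\<Sum>d\<in>{c, b, bar b}. (l' d)\<^sup>2) = (l' c)\<^sup>2 + 2" using c b lb[of b] by simp
        ultimately show False using n by linarith
      qed
      then have "l' = unit_wt b" using b lb[of b] by (auto simp: unit_wt_def fun_eq_iff)
      then show ?thesis by blast
    qed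
    moreover have "unit_wt b \<in> weights U" for b
    proof (cases "b = a \<or> b = bar a")
      case True
      have "unit_wt b c = l c \<or> unit_wt b c = - l c" for c using True by (auto simp: a unit_wt_def)
      moreover have "unit_wt b (bar c) = - unit_wt b c" for c by (auto simp: unit_wt_def)
      ultimately show ?thesis by (intro weights_full_flip[OF sU l])
    next
      case False
      then have "l \<circ> swp a b \<in> weights U" by (intro weights_swap[OF sU l]) auto
      moreover have "l \<circ> swp a b = unit_wt b" using False by (auto simp: a unit_wt_def swp_def fun_eq_iff)
      ultimately show ?thesis by simp
    qed
    ultimately show ?thesis by blast
  next
    case 3
    have l1: "l a = 1 \<or> l a = -1" for a using 3 by blast
    have sum: "even (wt_sum l - int CARD('r))"
    proof -
      have "wt_sum l - int CARD('r) = (\<Sum>i\<in>UNIV. l (Inl i) - 1)"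
        by (simp add: wt_sum_def sum_subtractf)
      also have "even \<dots>"
      proof (rule dvd_sum)
        fix i show "even (l (Inl i) - 1)" using l1[of "Inl i"] by auto
      qed
      finally show ?thesis .
    qed
    have full: "l' \<in> weights U" if "\<And>a. l' (bar a) = - l' a" "\<And>a. l' a = 1 \<or> l' a = -1" for l'
      using that l1 by (intro weights_full_flip[OF sU l]) (metis minus_minus)+
    have "l' \<in> spin_wts" if l': "l' \<in> weights U" for l'
      using weights_bar[OF l'] M[OF l'] 3 weights_parity[OF U l l'] sum
      unfolding spin_wts_def wt_sum_def by (auto simp: even_diff)
    moreover have "l' \<in> weights U" if l': "l' \<in> spin_wts" for l'
    proof -
      have lb: "l' (bar a) = - l' a" and le: "l' a \<le> 1" for a using l' by (auto simp: spin_wts_def)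
      have v: "l' a = 0 \<or> l' a = 1 \<or> l' a = -1" for a using le[of a] le[of "bar a"] lb[of a] by auto
      \<comment> \<open>The number of zeros is even by the parity condition, hence 0 or 2 as there
        are at most three coordinates. Two zeros arise from a sign vector \<open>m\<close> by
        subtracting e_i + e_j.\<close>
      let ?Z = "{i. l' (Inl i) = 0}"
      have "even (card ?Z)"
      proof -
        have "(\<Sum>i\<in>UNIV. l' (Inl i)) - int CARD('r) + int (card ?Z) = (\<Sum>i\<in>UNIV. l' (Inl i) - 1 + (if l' (Inl i) = 0 then 1 else 0))"
          by (simp add: sum.distrib sum_subtractf sum.If_cases)
        also have "even \<dots>"
        proof (rule dvd_sum)
          fix i show "even (l' (Inl i) - 1 + (if l' (Inl i) = 0 then 1 else 0))" using v[of "Inl i"] by auto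
        qed
        finally have "even ((\<Sum>i\<in>UNIV. l' (Inl i)) - int CARD('r) + int (card ?Z))" .
        moreover have "even ((\<Sum>i\<in>UNIV. l' (Inl i)) - int CARD('r))" using l' by (simp add: spin_wts_def)
        ultimately show ?thesis by simp
      qed
      moreover have "card ?Z \<le> 3" using card_mono[of UNIV ?Z] 3 by simp
      ultimately have "card ?Z = 0 \<or> card ?Z = 2" by (cases "card ?Z" rule: nat.exhaust) presburger+
      then show ?thesis
      proof
        assume "card ?Z = 0"
        then have "?Z = {}" by simp
        then have "l' (Inl i) \<noteq> 0" for i by blast
        then have "l' a \<noteq> 0" for a using lb[of "Inl (case a of Inl i \<Rightarrow> i | Inr i \<Rightarrow> i)"] by (cases a) auto
        then have "l' a = 1 \<or> l' a = -1" for a using v[of a] by blast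
        then show ?thesis using lb by (intro full)
      next
        assume "card ?Z = 2"
        then obtain i j where ij: "?Z = {i, j}" "i \<noteq> j" by (meson card_2_iff)
        define m where "m c = (if c = Inl i \<or> c = Inl j then 1 else if c = Inr i \<or> c = Inr j then -1 else l' c)" for c
        have mb: "m (bar a) = - m a" for a using lb[of a] by (cases a) (auto simp: m_def)
        have Z: "l' (Inl k) = 0 \<longleftrightarrow> k = i \<or> k = j" for k using ij(1) by blast
        have Zr: "l' (Inr k) = 0 \<longleftrightarrow> k = i \<or> k = j" for k using Z[of k] lb[of "Inl k"] by simp
        have mP: "m \<in> weights U"
        proof (rule full[of m, OF mb])
          fix a show "m a = 1 \<or> m a = -1" using v[of a] Z Zr by (cases a) (auto simp: m_def)
        qed
        have "(\<lambda>c. m c - int 1 * root (Inl i) (bar (Inl j)) c) \<in> weights U"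
          using ij(2) by (intro weights_string[OF sU mP]) (auto simp: pairing_def m_def)
        moreover have "(\<lambda>c. m c - int 1 * root (Inl i) (bar (Inl j)) c) = l'"
        proof
          fix c show "m c - int 1 * root (Inl i) (bar (Inl j)) c = l' c"
            using ij(2) Z Zr by (cases c) (auto simp: m_def root_def)
        qed
        ultimately show ?thesis by simp
      qed
    qed
    ultimately show ?thesis using 3 by blast
  qed
qed

end

section \<open>The grading determined by a principal representation\<close>

context simple_grading begin

lemma spin_card_2:
  assumes "UNIV = {i, j :: 'r}" "i \<noteq> j"
  defines "mk \<equiv> \<lambda>(x :: int, y :: int) c. (case c of Inl k \<Rightarrow> if k = i then x else y | Inr k \<Rightarrow> if k = i then - x else - y)"
  shows "spin_wts = mk ` {(0,0), (1,1), (1,-1), (-1,1), (-1,-1)}" "card spin_wts = 5"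
proof -
  have "inj mk"
  proof (rule injI)
    fix p q assume e: "mk p = mk q"
    from fun_cong[OF e, of "Inl i"] fun_cong[OF e, of "Inl j"] show "p = q"
      using assms(2) by (cases p; cases q) (simp add: mk_def)
  qed
  show eq: "spin_wts = mk ` {(0,0), (1,1), (1,-1), (-1,1), (-1,-1)}"
  proof
    show "spin_wts \<subseteq> mk ` {(0,0), (1,1), (1,-1), (-1,1), (-1,-1)}"
    proof
      fix l assume l: "l \<in> spin_wts"
      then have lb: "l (bar a) = - l a" and le: "l a \<le> 1" and ev: "even (l (Inl i) + l (Inl j) - 2)" for a
        using assms(2) by (auto simp: spin_wts_def assms(1))
      have v: "l a = 0 \<or> l a = 1 \<or> l a = -1" for a using le[of a] le[of "bar a"] lb[of a] by auto
      have "l c = mk (l (Inl i), l (Inl j)) c" for c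
      proof (cases c)
        case (Inl k)
        then show ?thesis using assms(1) by (auto simp: mk_def)
      next
        case (Inr k)
        then show ?thesis using assms(1) lb[of "Inl i"] lb[of "Inl j"] by (auto simp: mk_def)
      qed
      then have "l = mk (l (Inl i), l (Inl j))" by (rule ext)
      moreover have "(l (Inl i), l (Inl j)) \<in> {(0,0), (1,1), (1,-1), (-1,1), (-1,-1)}"
        using v[of "Inl i"] v[of "Inl j"] ev by auto
      ultimately show "l \<in> mk ` {(0,0), (1,1), (1,-1), (-1,1), (-1,-1)}" by blast
    qed
    show "mk ` {(0,0), (1,1), (1,-1), (-1,1), (-1,-1)} \<subseteq> spin_wts"
      using assms(2) by (auto simp: spin_wts_def mk_def assms(1) bar_def split: sum.splits)
  qed
  show "card spin_wts = 5" unfolding eq by (subst card_image[OF inj_on_subset[OF \<open>inj mk\<close>]]) auto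
qed

lemma spin_card_3:
  assumes "UNIV = {i, j, k :: 'r}" "i \<noteq> j" "i \<noteq> k" "j \<noteq> k"
  defines "mk \<equiv> \<lambda>(x :: int, y :: int, z :: int) c. (case c of Inl n \<Rightarrow> if n = i then x else if n = j then y else z
      | Inr n \<Rightarrow> if n = i then - x else if n = j then - y else - z)"
    and "S \<equiv> {(1,1,1), (1,1,-1), (1,-1,1), (1,-1,-1), (-1,1,1), (-1,1,-1), (-1,-1,1), (-1,-1,-1),
      (1,0,0), (-1,0,0), (0,1,0), (0,-1,0), (0,0,1), (0,0,-1)}"
  shows "spin_wts = mk ` S" "card spin_wts = 14"
proof -
  have "inj mk"
  proof (rule injI)
    fix p q assume e: "mk p = mk q"
    from fun_cong[OF e, of "Inl i"] fun_cong[OF e, of "Inl j"] fun_cong[OF e, of "Inl k"] show "p = q"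
      using assms(2-4) by (cases p; cases q) (simp add: mk_def)
  qed
  show eq: "spin_wts = mk ` S"
  proof
    show "spin_wts \<subseteq> mk ` S"
    proof
      fix l assume l: "l \<in> spin_wts"
      then have lb: "l (bar a) = - l a" and le: "l a \<le> 1" and ev: "even (l (Inl i) + l (Inl j) + l (Inl k) - 3)" for a
        using assms(2-4) by (auto simp: spin_wts_def assms(1) add.assoc)
      have v: "l a = 0 \<or> l a = 1 \<or> l a = -1" for a using le[of a] le[of "bar a"] lb[of a] by auto
      have "l c = mk (l (Inl i), l (Inl j), l (Inl k)) c" for c
      proof (cases c)
        case (Inl n)
        then show ?thesis using assms(1) by (auto simp: mk_def)
      next
        case (Inr n)
        then show ?thesis using assms(1) lb[of "Inl i"] lb[of "Inl j"] lb[of "Inl k"] by (auto simp: mk_def)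
      qed
      then have "l = mk (l (Inl i), l (Inl j), l (Inl k))" by (rule ext)
      moreover have "(l (Inl i), l (Inl j), l (Inl k)) \<in> S"
        using v[of "Inl i"] v[of "Inl j"] v[of "Inl k"] ev by (elim disjE) (simp_all add: S_def)
      ultimately show "l \<in> mk ` S" by blast
    qed
    show "mk ` S \<subseteq> spin_wts"
      using assms(2-4) by (auto simp: S_def spin_wts_def mk_def assms(1) bar_def split: sum.splits)
  qed
  show "card spin_wts = 14" unfolding eq by (subst card_image[OF inj_on_subset[OF \<open>inj mk\<close>]]) (auto simp: S_def)
qed

lemma card_unit_wts: "card (range (unit_wt :: 'r + 'r \<Rightarrow> _)) = 2 * CARD('r)"
proof -
  have "inj (unit_wt :: 'r + 'r \<Rightarrow> _)"
  proof (rule injI)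
    fix a b :: "'r + 'r" assume "unit_wt a = unit_wt b"
    from fun_cong[OF this, of a] show "a = b" by (auto simp: unit_wt_def split: if_splits)
  qed
  then show ?thesis by (simp add: card_image)
qed

lemma min_submod_unique:
  assumes "min_submod U" "min_submod W" "vec.dim U = vec.dim W"
  shows "U = W"
proof -
  have s: "submod U" "submod W" using assms by (auto simp: min_submod_def)
  have c: "card (weights U) = card (weights W)" using assms(3) dim_weights s by simp
  have sp: "card spin_wts \<noteq> 1 \<and> card spin_wts \<noteq> 2 * CARD('r)" if "CARD('r) \<le> 3"
  proof -
    have "CARD('r) = 2 \<or> CARD('r) = 3" using card that by auto
    then show ?thesis
    proof
      assume r: "CARD('r) = 2"
      then obtain i j where "UNIV = {i, j :: 'r}" "i \<noteq> j" by (meson card_2_iff)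
      from spin_card_2(2)[OF this] show ?thesis using r by simp
    next
      assume r: "CARD('r) = 3"
      then obtain i j k where "UNIV = {i, j, k :: 'r}" "i \<noteq> j" "i \<noteq> k" "j \<noteq> k" by (metis card_3_iff)
      from spin_card_3(2)[OF this] show ?thesis using r by simp
    qed
  qed
  have "weights U = weights W"
    using weights_cases[OF assms(1)] weights_cases[OF assms(2)] c sp card_unit_wts card by auto
  then show ?thesis by (rule submod_eqI[OF s])
qed

end

text \<open>\<open>tt\<close> holds the coordinates of the grading element in an adapted frame, and
  \<open>dominant\<close> is nonnegativity of the simple roots on it. The order is the one on
  complex numbers, so these inequalities also make the coordinates real.\<close>

locale principal_grading = simple_grading R A tt
  for R :: "'r::finite + 'r \<Rightarrow> 'r + 'r \<Rightarrow> complex^'v^'v" and A :: "complex^'v^'v" and tt :: "'r \<Rightarrow> complex" +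
  fixes N :: nat and idx :: "nat \<Rightarrow> 'r" and r :: nat
  assumes spectrum: "tau ` weights UNIV = (\<lambda>k. of_real (real N / 2 - real k)) ` {..N}"
    and idx: "bij_betw idx {1..r} UNIV"
    and dominant: "\<And>i. i \<in> {1..<r} \<Longrightarrow> 0 \<le> tt (idx i) - tt (idx (Suc i))" "0 \<le> 2 * tt (idx r)"
begin

lemma r_card: "r = CARD('r)"
  using bij_betw_same_card[OF idx] by simp

lemma N_card: "N + 1 = card (weights UNIV)"
proof -
  have "inj_on tau (weights UNIV)" using tau_inj by (auto intro: inj_onI)
  then have "card (weights UNIV) = card (tau ` weights UNIV)" by (simp add: card_image)
  also have "\<dots> = card {..N}" unfolding spectrum
  proof (intro card_image inj_onI)
    fix x y assume "complex_of_real (real N / 2 - real x) = of_real (real N / 2 - real y)"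
    then have "real N / 2 - real x = real N / 2 - real y" by (rule of_real_eq_iff[THEN iffD1])
    then show "x = y" by simp
  qed
  finally show ?thesis by simp
qed

definition tr :: "nat \<Rightarrow> real" where "tr i = Re (tt (idx i))"

lemma tt_real: "i \<in> {1..r} \<Longrightarrow> tt (idx i) = of_real (tr i) \<and> 0 \<le> tr i"
proof (induction "r - i" arbitrary: i)
  case 0
  then have "i = r" by simp
  then show ?case using dominant(2) by (auto simp: tr_def less_eq_complex_def complex_eq_iff)
next
  case (Suc n)
  then have "tt (idx (Suc i)) = of_real (tr (Suc i)) \<and> 0 \<le> tr (Suc i)" by simp
  moreover have "0 \<le> tt (idx i) - tt (idx (Suc i))" using Suc by (intro dominant) auto
  ultimately show ?case by (auto simp: tr_def less_eq_complex_def complex_eq_iff)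
qed

lemma tr_mono: "i \<in> {1..<r} \<Longrightarrow> tr (Suc i) \<le> tr i"
  using dominant(1)[of i] by (simp add: tr_def less_eq_complex_def)

lemma idx_eq: "i \<in> {1..r} \<Longrightarrow> j \<in> {1..r} \<Longrightarrow> idx i = idx j \<longleftrightarrow> i = j"
  using idx by (auto simp: bij_betw_def dest: inj_onD)

lemma in_spectrum: "l \<in> weights UNIV \<Longrightarrow> tau l = of_real x \<Longrightarrow> \<exists>k\<le>N. x = real N / 2 - real k"
proof -
  assume "l \<in> weights UNIV" "tau l = of_real x"
  then have "of_real x \<in> (\<lambda>k. complex_of_real (real N / 2 - real k)) ` {..N}" using spectrum by (metis imageI)
  then obtain k where "k \<le> N" "complex_of_real x = of_real (real N / 2 - real k)" by auto
  then show ?thesis by (metis of_real_eq_iff)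
qed

lemma spectrum_ex: "k \<le> N \<Longrightarrow> \<exists>l\<in>weights UNIV. tau l = of_real (real N / 2 - real k)"
proof -
  assume "k \<le> N"
  then have "of_real (real N / 2 - real k) \<in> tau ` weights UNIV" unfolding spectrum by blast
  then show ?thesis by auto
qed

lemma tau_unit: "tau (unit_wt (Inl i)) = tt i" "tau (unit_wt (Inr i)) = - tt i"
proof -
  have "tau (unit_wt (Inl i)) = (\<Sum>j\<in>UNIV. if j = i then tt j else 0)"
    unfolding tau_def by (intro sum.cong refl) (auto simp: unit_wt_def)
  then show "tau (unit_wt (Inl i)) = tt i" by simp
  have "tau (unit_wt (Inr i)) = (\<Sum>j\<in>UNIV. if j = i then - tt j else 0)"
    unfolding tau_def by (intro sum.cong refl) (auto simp: unit_wt_def)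
  then show "tau (unit_wt (Inr i)) = - tt i" by simp
qed

text \<open>The eigenvalues \<open>tr i\<close> are distinct and congruent modulo 1, so consecutive
  ones differ by at least 1. Counting gaps upward from \<open>tr r \<ge> 1/2\<close> and downward
  from the maximum \<open>N / 2\<close> bounds \<open>tr i\<close> below and above by the same
  number.\<close>

lemma grading_standard:
  assumes w: "weights UNIV = range unit_wt"
  shows "i \<in> {1..r} \<Longrightarrow> tr i = real r - real i + 1/2"
proof -
  have N: "N + 1 = 2 * r" using N_card card_unit_wts r_card w by simp
  have r2: "2 \<le> r" using card r_card by simp
  have P: "unit_wt a \<in> weights UNIV" for a using w by blast
  have lower: "tr i \<ge> real r - real i + 1/2" if "i \<in> {1..r}" for i
    using that
  proof (induction "r - i" arbitrary: i)
    case 0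
    then have i: "i = r" by simp
    have r: "r \<in> {1..r}" using r2 by simp
    \<comment> \<open>Otherwise the weight at the last coordinate and its negative would share the
      eigenvalue 0.\<close>
    have "tr r \<noteq> 0"
    proof
      assume "tr r = 0"
      then have "unit_wt (Inl (idx r)) = unit_wt (Inr (idx r))"
        using tt_real[OF r] by (intro tau_inj P) (simp add: tau_unit)
      from fun_cong[OF this, of "Inl (idx r)"] show False by (simp add: unit_wt_def)
    qed
    then have "0 < tr r" using tt_real[OF r] by simp
    moreover obtain k where "tr r = real N / 2 - real k"
      using in_spectrum[OF P, of "Inl (idx r)" "tr r"] tt_real[OF r] by (auto simp: tau_unit)
    ultimately have "2 * k < N" "2 * tr r = real N - 2 * real k" by auto
    then have "2 * k + 1 \<le> N" by simp
    then show ?case using \<open>2 * tr r = real N - 2 * real k\<close> i by simp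
  next
    case (Suc n)
    have IH: "tr (Suc i) \<ge> real r - real (Suc i) + 1/2" by (rule Suc.hyps(1)) (use Suc in auto)
    have i: "i \<in> {1..r}" "Suc i \<in> {1..r}" using Suc by auto
    obtain k k' where k: "tr i = real N / 2 - real k" "tr (Suc i) = real N / 2 - real k'"
      using in_spectrum[OF P, of "Inl (idx i)" "tr i"] tt_real[OF i(1)]
        in_spectrum[OF P, of "Inl (idx (Suc i))" "tr (Suc i)"] tt_real[OF i(2)] by (auto simp: tau_unit)
    have "tr i \<noteq> tr (Suc i)"
    proof
      assume "tr i = tr (Suc i)"
      then have "unit_wt (Inl (idx i)) = unit_wt (Inl (idx (Suc i)))"
        using tt_real[OF i(1)] tt_real[OF i(2)] by (intro tau_inj P) (simp add: tau_unit)
      from fun_cong[OF this, of "Inl (idx i)"] show False using idx_eq[OF i] by (simp add: unit_wt_def split: if_splits)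
    qed
    then have "tr (Suc i) < tr i" using tr_mono[of i] i by auto
    then have "k < k'" using k by simp
    then have "real k + 1 \<le> real k'" by simp
    then show ?case using k IH by simp
  qed
  have upper: "tr i \<le> real N / 2 - (real i - 1)" if "i \<in> {1..r}" for i
    using that
  proof (induction i)
    case (Suc i)
    show ?case
    proof (cases "i = 0")
      case True
      then show ?thesis
        using in_spectrum[OF P, of "Inl (idx 1)" "tr 1"] tt_real[of 1] Suc.prems by (auto simp: tau_unit)
    next
      case False
      then have i: "i \<in> {1..r}" "Suc i \<in> {1..r}" using Suc by auto
      obtain k k' where k: "tr i = real N / 2 - real k" "tr (Suc i) = real N / 2 - real k'"
        using in_spectrum[OF P, of "Inl (idx i)" "tr i"] tt_real[OF i(1)]
          in_spectrum[OF P, of "Inl (idx (Suc i))" "tr (Suc i)"] tt_real[OF i(2)] by (auto simp: tau_unit)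
      have "tr i \<noteq> tr (Suc i)"
      proof
        assume "tr i = tr (Suc i)"
        then have "unit_wt (Inl (idx i)) = unit_wt (Inl (idx (Suc i)))"
          using tt_real[OF i(1)] tt_real[OF i(2)] by (intro tau_inj P) (simp add: tau_unit)
        from fun_cong[OF this, of "Inl (idx i)"] show False using idx_eq[OF i] by (simp add: unit_wt_def split: if_splits)
      qed
      then have "tr (Suc i) < tr i" using tr_mono[of i] i by auto
      then have "k < k'" using k by simp
      then have "real k + 1 \<le> real k'" by simp
      then show ?thesis using k Suc.IH[OF i(1)] by simp
    qed
  qed simp
  assume "i \<in> {1..r}"
  from lower[OF this] upper[OF this] N show ?thesis
    by (simp add: field_simps)
qed

text \<open>The maximum 2 is t_1 + t_2, and among the remaining weights only t_1 - t_2 can supply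
  the eigenvalue 1.\<close>

lemma grading_spin_2:
  assumes w: "weights UNIV = spin_wts" and r: "r = 2"
  shows "tr 1 = 3/2" "tr 2 = 1/2"
proof -
  have U: "UNIV = {idx 1, idx 2}" using idx r by (auto simp: bij_betw_def numeral_2_eq_2 atLeastAtMostSuc_conv)
  have ne: "idx 1 \<noteq> idx 2" using idx_eq[of 1 2] r by simp
  note sp = spin_card_2[OF U ne]
  have N: "N = 4" using N_card w sp(2) by simp
  have t: "tt (idx 1) = of_real (tr 1)" "tt (idx 2) = of_real (tr 2)" "0 \<le> tr 2" "tr 2 \<le> tr 1"
    using tt_real[of 1] tt_real[of 2] tr_mono[of 1] r by (auto simp: numeral_2_eq_2)
  define mk where "mk = (\<lambda>(x :: int, y :: int) c. (case c of Inl k \<Rightarrow> if k = idx 1 then x else y | Inr k \<Rightarrow> if k = idx 1 then - x else - y))"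
  have tau: "tau (mk (x, y)) = of_real (of_int x * tr 1 + of_int y * tr 2)" for x y
    using ne by (simp add: tau_def mk_def U t[unfolded One_nat_def] mult.commute)
  have P: "p \<in> {(0,0), (1,1), (1,-1), (-1,1), (-1,-1)} \<Longrightarrow> mk p \<in> weights UNIV" for p
    unfolding w sp(1) mk_def by blast
  have ex: "\<exists>x y. (x, y) \<in> {(0,0), (1,1), (1,-1), (-1,1), (-1,-1 :: int)} \<and> of_int x * tr 1 + of_int y * tr 2 = 2 - real k" if k4: "k \<le> 4" for k
  proof -
    obtain l where l: "l \<in> weights UNIV" "tau l = of_real (2 - real k)" using spectrum_ex[of k] k4 N by auto
    then obtain x y where "l = mk (x, y)" "(x, y) \<in> {(0,0), (1,1), (1,-1), (-1,1), (-1,-1 :: int)}"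
      unfolding w sp(1) mk_def[symmetric] by auto
    then show ?thesis using l(2) tau[of x y] by (metis of_real_eq_iff)
  qed
  have "tr 1 + tr 2 \<le> 2"
    using in_spectrum[OF P, of "(1,1)" "tr 1 + tr 2"] tau[of 1 1] N by auto
  moreover have "tr 1 + tr 2 \<ge> 2" using ex[of 0] t by auto
  ultimately have "tr 1 + tr 2 = 2" by simp
  moreover have "tr 1 - tr 2 = 1" using ex[of 1] t calculation by auto
  ultimately show "tr 1 = 3/2" "tr 2 = 1/2" by auto
qed

text \<open>The two largest eigenvalues are t_1 + t_2 + t_3 = 13/2 and t_1 + t_2 - t_3 = 11/2, so
  t_3 = 1/2 and t_1 + t_2 = 6. Now t_2 is half an odd integer, larger than t_3 and at most 3, hence
  3/2 or 5/2; the value 5/2 would give t_1 - t_2 - t_3 = 1/2 = t_3, a repeated eigenvalue.\<close>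

lemma grading_spin_3:
  assumes w: "weights UNIV = spin_wts" and r: "r = 3"
  shows "tr 1 = 9/2" "tr 2 = 3/2" "tr 3 = 1/2"
proof -
  have "{1..3::nat} = {1, 2, 3}" by auto
  then have U: "UNIV = {idx 1, idx 2, idx 3}" using idx r by (auto simp: bij_betw_def)
  have ne: "idx 1 \<noteq> idx 2" "idx 1 \<noteq> idx 3" "idx 2 \<noteq> idx 3"
    using idx_eq[of 1 2] idx_eq[of 1 3] idx_eq[of 2 3] r by auto
  note sp = spin_card_3[OF U ne]
  have N: "N = 13" using N_card w sp(2) by simp
  have t: "tt (idx 1) = of_real (tr 1)" "tt (idx 2) = of_real (tr 2)" "tt (idx 3) = of_real (tr 3)"
    "0 \<le> tr 3" "tr 3 \<le> tr 2" "tr 2 \<le> tr 1"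
    using tt_real[of 1] tt_real[of 2] tt_real[of 3] tr_mono[of 1] tr_mono[of 2] r by (auto simp: numeral_2_eq_2 numeral_3_eq_3)
  define mk where "mk = (\<lambda>(x :: int, y :: int, z :: int) c. (case c of Inl n \<Rightarrow> if n = idx 1 then x else if n = idx 2 then y else z
      | Inr n \<Rightarrow> if n = idx 1 then - x else if n = idx 2 then - y else - z))"
  define S :: "(int \<times> int \<times> int) set" where "S = {(1,1,1), (1,1,-1), (1,-1,1), (1,-1,-1), (-1,1,1), (-1,1,-1), (-1,-1,1), (-1,-1,-1),
      (1,0,0), (-1,0,0), (0,1,0), (0,-1,0), (0,0,1), (0,0,-1)}"
  define val where "val p = (case p of (x, y, z) \<Rightarrow> of_int x * tr 1 + of_int y * tr 2 + of_int z * tr 3)" for p :: "int \<times> int \<times> int"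
  have tau: "tau (mk p) = of_real (val p)" for p
  proof -
    obtain x y z where p: "p = (x, y, z)" by (cases p)
    have "tau (mk p) = (\<Sum>n\<in>{idx 1, idx 2, idx 3}. tt n * of_int (mk p (Inl n)))"
      unfolding tau_def U ..
    also have "\<dots> = tt (idx 1) * of_int x + (tt (idx 2) * of_int y + tt (idx 3) * of_int z)"
      using ne by (simp add: p mk_def)
    also have "\<dots> = of_real (val p)"
      unfolding t(1-3) by (simp add: val_def p mult.commute)
    finally show ?thesis .
  qed
  have P: "p \<in> S \<Longrightarrow> mk p \<in> weights UNIV" for p
    unfolding w sp(1)[folded mk_def S_def] by (rule imageI)
  have mk_inj: "p = q" if "mk p = mk q" for p q
    using fun_cong[OF that, of "Inl (idx 1)"] fun_cong[OF that, of "Inl (idx 2)"] fun_cong[OF that, of "Inl (idx 3)"] ne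
    by (cases p; cases q) (simp add: mk_def)
  have inj: "p = q" if "p \<in> S" "q \<in> S" "val p = val q" for p q
    using tau_inj[OF P[OF that(1)] P[OF that(2)]] that(3) mk_inj by (simp add: tau)
  have ex: "\<exists>p\<in>S. val p = 13/2 - real k" if k4: "k \<le> 13" for k
  proof -
    obtain l where l: "l \<in> weights UNIV" "tau l = of_real (13/2 - real k)" using spectrum_ex[of k] k4 N by auto
    then obtain p where "l = mk p" "p \<in> S"
      unfolding w sp(1)[folded mk_def S_def] by blast
    then show ?thesis using l(2) tau[of p] by (metis of_real_eq_iff)
  qed
  have in_sp: "\<exists>k. val p = 13/2 - real k" if "p \<in> S" for p
    using in_spectrum[OF P[OF that] tau] N by auto
  have S: "(1,1,1) \<in> S" "(1,1,-1) \<in> S" "(0,0,1) \<in> S" "(0,1,0) \<in> S" "(1,-1,-1) \<in> S" by (simp_all add: S_def)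
  have top: "tr 1 + tr 2 + tr 3 = 13/2"
  proof -
    have "tr 1 + tr 2 + tr 3 \<le> 13/2" using in_sp[OF S(1)] by (auto simp: val_def)
    moreover have "tr 1 + tr 2 + tr 3 \<ge> 13/2" using ex[of 0] t by (auto simp: S_def val_def)
    ultimately show ?thesis by simp
  qed
  have second: "tr 1 + tr 2 - tr 3 = 11/2"
  proof -
    obtain k where k: "val (1,1,-1) = 13/2 - real k" using in_sp[OF S(2)] by blast
    have "val (1,1,-1) \<noteq> val (1,1,1)" using inj[OF S(2,1)] by auto
    then have "k \<noteq> 0" using k top by (simp add: val_def)
    then have "tr 1 + tr 2 - tr 3 \<le> 11/2" using k by (simp add: val_def)
    moreover have "tr 1 + tr 2 - tr 3 \<ge> 11/2" using ex[of 1] t top by (auto simp: S_def val_def)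
    ultimately show ?thesis by simp
  qed
  have t3: "tr 3 = 1/2" using top second by simp
  obtain k where k: "tr 2 = 13/2 - real k" using in_sp[OF S(4)] by (auto simp: val_def)
  have "tr 2 \<noteq> tr 3" using inj[OF S(3,4)] by (auto simp: val_def)
  then have "k < 6" "3 < k" using k t t3 top by auto
  then have "k = 4 \<or> k = 5" by auto
  moreover have "k \<noteq> 4"
  proof
    assume "k = 4"
    then have "val (1,-1,-1) = val (0,0,1)" using k t3 top by (simp add: val_def)
    then show False using inj[OF S(5,3)] by simp
  qed
  ultimately have "tr 2 = 3/2" using k by simp
  then show "tr 1 = 9/2" "tr 2 = 3/2" "tr 3 = 1/2" using t3 top by auto
qed

end

section \<open>Exterior powers of the standard representation\<close>

lemma tensor_action_Nil [simp]: "tensor_action A x [] = 0"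
  by (simp add: tensor_action_def)

lemma tensor_action_Cons:
  "tensor_action A x (b # bs) = (\<Sum>a\<in>UNIV. A $ b $ a * x (a # bs)) + tensor_action A (\<lambda>cs. x (b # cs)) bs"
  unfolding tensor_action_def by (simp add: sum.lessThan_Suc_shift del: sum.lessThan_Suc)

lemma tensor_action_add: "tensor_action A (\<lambda>bs. x bs + y bs) bs = tensor_action A x bs + tensor_action A y bs"
  and tensor_action_scale: "tensor_action A (\<lambda>bs. c * x bs) bs = c * tensor_action A x bs"
  and tensor_action_zero: "tensor_action A (\<lambda>bs. 0) bs = 0"
  and tensor_action_mat_add: "tensor_action (A + B) x bs = tensor_action A x bs + tensor_action B x bs"
  and tensor_action_mat_scale: "tensor_action (scale_mat c A) x bs = c * tensor_action A x bs"
  and tensor_action_mat_zero: "tensor_action 0 x bs = 0"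
  by (simp_all add: tensor_action_def sum.distrib sum_distrib_left algebra_simps)

lemma tensor_action_mat_diff: "tensor_action (A - B) x bs = tensor_action A x bs - tensor_action B x bs"
  by (simp add: tensor_action_def sum_subtractf algebra_simps)

lemma tensor_action_sum: "tensor_action A (\<lambda>bs. \<Sum>i\<in>I. f i bs) bs = (\<Sum>i\<in>I. tensor_action A (f i) bs)"
  by (induction I rule: infinite_finite_induct) (simp_all add: tensor_action_add tensor_action_zero)

lemma tensor_action_mat_sum: "tensor_action (\<Sum>i\<in>I. F i) x bs = (\<Sum>i\<in>I. tensor_action (F i) x bs)"
  by (induction I rule: infinite_finite_induct) (simp_all add: tensor_action_mat_add tensor_action_mat_zero)

text \<open>In the product of two derivations the mixed terms, one matrix acting on the head and the
  other on the tail of the list, are symmetric in the two matrices and cancel in the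
  commutator.\<close>

lemma tensor_action_bracket:
  "tensor_action (lie_bracket A B) x bs = tensor_action A (tensor_action B x) bs - tensor_action B (tensor_action A x) bs"
proof (induction bs arbitrary: x)
  case (Cons b bs)
  have prod: "tensor_action A (tensor_action B x) (b # bs) =
      (\<Sum>c\<in>UNIV. (A ** B) $ b $ c * x (c # bs)) + (\<Sum>a\<in>UNIV. A $ b $ a * tensor_action B (\<lambda>cs. x (a # cs)) bs)
      + (\<Sum>a\<in>UNIV. B $ b $ a * tensor_action A (\<lambda>cs. x (a # cs)) bs) + tensor_action A (tensor_action B (\<lambda>cs. x (b # cs))) bs" for A B
  proof -
    have "tensor_action A (\<lambda>cs. tensor_action B x (b # cs)) bs =
       (\<Sum>a\<in>UNIV. B $ b $ a * tensor_action A (\<lambda>cs. x (a # cs)) bs) + tensor_action A (tensor_action B (\<lambda>cs. x (b # cs))) bs"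
      unfolding tensor_action_Cons by (simp add: tensor_action_add tensor_action_sum tensor_action_scale)
    moreover have "(\<Sum>a\<in>UNIV. A $ b $ a * tensor_action B x (a # bs)) = (\<Sum>c\<in>UNIV. (A ** B) $ b $ c * x (c # bs))
       + (\<Sum>a\<in>UNIV. A $ b $ a * tensor_action B (\<lambda>cs. x (a # cs)) bs)"
    proof -
      have "(\<Sum>a\<in>UNIV. A $ b $ a * (\<Sum>c\<in>UNIV. B $ a $ c * x (c # bs))) = (\<Sum>c\<in>UNIV. (A ** B) $ b $ c * x (c # bs))"
        unfolding matrix_mult_nth sum_distrib_left sum_distrib_right
        by (subst sum.swap) (simp add: mult.assoc)
      then show ?thesis unfolding tensor_action_Cons by (simp add: distrib_left sum.distrib)
    qed
    ultimately show ?thesis unfolding tensor_action_Cons[of A] by simp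
  qed
  have "tensor_action (lie_bracket A B) x (b # bs) =
      (\<Sum>c\<in>UNIV. (A ** B) $ b $ c * x (c # bs)) - (\<Sum>c\<in>UNIV. (B ** A) $ b $ c * x (c # bs))
      + tensor_action (lie_bracket A B) (\<lambda>cs. x (b # cs)) bs"
    unfolding tensor_action_Cons[of "lie_bracket A B"]
    by (simp add: lie_bracket_def left_diff_distrib sum_subtractf)
  then show ?case unfolding prod Cons.IH by simp
qed simp

lemma ext_power_swap:
  assumes "x \<in> ext_power k" "length bs = k" "i < k" "j < k" "i \<noteq> j"
  shows "x (bs[i := bs ! j, j := bs ! i]) = - x bs"
proof (cases "i < j")
  case True
  then show ?thesis using assms by (auto simp: ext_power_def)
next
  case False
  then have "x (bs[j := bs ! i, i := bs ! j]) = - x bs" using assms by (auto simp: ext_power_def)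
  then show ?thesis using assms(5) by (simp add: list_update_swap)
qed

lemma ext_power_action:
  assumes x: "x \<in> ext_power k"
  shows "tensor_action A x \<in> ext_power k"
  unfolding ext_power_def
proof (intro CollectI conjI allI impI)
  fix bs :: "'a list" assume "length bs \<noteq> k"
  then have "x (bs[i := a]) = 0" for i a using x by (simp add: ext_power_def)
  then show "tensor_action A x bs = 0" by (simp add: tensor_action_def)
next
  fix bs :: "'a list" and i j assume *: "length bs = k \<and> i < j \<and> j < k"
  let ?sw = "\<lambda>bs. bs[i := bs ! j, j := bs ! i] :: 'a list"
  define p where "p = (\<lambda>n. if n = i then j else if n = j then i else n)"
  have bij: "bij_betw p {..<k} {..<k}"
    using * by (intro bij_betw_byWitness[of _ p]) (auto simp: p_def)
  have "tensor_action A x (?sw bs) = (\<Sum>n<k. \<Sum>a\<in>UNIV. A $ (?sw bs ! n) $ a * x ((?sw bs)[n := a]))"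
    using * by (simp add: tensor_action_def)
  also have "\<dots> = (\<Sum>n<k. \<Sum>a\<in>UNIV. A $ (bs ! p n) $ a * - x (bs[p n := a]))"
  proof (intro sum.cong refl)
    fix n a assume n: "n \<in> {..<k}"
    have 1: "?sw bs ! n = bs ! p n" using * n by (auto simp: p_def nth_list_update)
    have 2: "(?sw bs)[n := a] = ?sw (bs[p n := a])"
      using * n by (intro nth_equalityI) (auto simp: p_def nth_list_update)
    have 3: "x (?sw (bs[p n := a])) = - x (bs[p n := a])"
      using * by (intro ext_power_swap[OF x]) auto
    show "A $ (?sw bs ! n) $ a * x ((?sw bs)[n := a]) = A $ (bs ! p n) $ a * - x (bs[p n := a])"
      unfolding 1 2 3 ..
  qed
  also have "\<dots> = (\<Sum>n<k. \<Sum>a\<in>UNIV. A $ (bs ! n) $ a * - x (bs[n := a]))"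
    by (rule sum.reindex_bij_betw[OF bij])
  also have "\<dots> = - tensor_action A x bs"
    using * by (simp add: tensor_action_def sum_negf)
  finally show "tensor_action A x (?sw bs) = - tensor_action A x bs" .
qed

text \<open>Contraction of the first two slots with the symplectic form. On alternating tensors of
  degree k up to the rank, its kernel is the primitive part of the exterior power, the classical
  model of the module with highest weight omega_k.\<close>

definition contraction :: "('b::finite + 'b) list itself \<Rightarrow> (('b + 'b) list \<Rightarrow> complex) \<Rightarrow> ('b + 'b) list \<Rightarrow> complex" where
  "contraction _ x cs = (\<Sum>a\<in>UNIV. sg a * x (a # bar a # cs))"

abbreviation "ct \<equiv> contraction TYPE(('b::finite + 'b) list)"

lemma contraction_action:
  assumes A: "A \<in> sp"
  shows "ct (tensor_action A x) cs = tensor_action A (ct x) cs"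
proof -
  have "ct (tensor_action A x) cs =
     (\<Sum>a\<in>UNIV. \<Sum>c\<in>UNIV. sg a * A $ a $ c * x (c # bar a # cs)) + (\<Sum>a\<in>UNIV. \<Sum>c\<in>UNIV. sg a * A $ bar a $ c * x (a # c # cs))
     + (\<Sum>a\<in>UNIV. sg a * tensor_action A (\<lambda>cs. x (a # bar a # cs)) cs)"
    unfolding contraction_def tensor_action_Cons
    by (simp add: distrib_left sum.distrib sum_distrib_left mult.assoc)
  also have "(\<Sum>a\<in>UNIV. \<Sum>c\<in>UNIV. sg a * A $ a $ c * x (c # bar a # cs)) =
      (\<Sum>a\<in>UNIV. \<Sum>c\<in>UNIV. sg (bar a) * A $ bar a $ c * x (c # bar (bar a) # cs))"
    by (rule sum_bar[symmetric])
  also have "\<dots> = (\<Sum>c\<in>UNIV. \<Sum>a\<in>UNIV. - (sg c * A $ bar c $ a * x (c # a # cs)))"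
  proof (subst sum.swap, intro sum.cong refl)
    fix a c :: "'a + 'a"
    show "sg (bar a) * A $ bar a $ c * x (c # bar (bar a) # cs) = - (sg c * A $ bar c $ a * x (c # a # cs))"
      using spD[OF A, of a c] by simp
  qed
  also have "(\<Sum>a\<in>UNIV. sg a * tensor_action A (\<lambda>cs. x (a # bar a # cs)) cs) = tensor_action A (ct x) cs"
    unfolding contraction_def by (simp add: tensor_action_sum tensor_action_scale)
  finally show ?thesis by (simp add: sum_negf)
qed

lemma tensor_action_diag:
  assumes "\<And>p q. p \<noteq> q \<Longrightarrow> A $ p $ q = 0"
  shows "tensor_action A x bs = (\<Sum>b\<leftarrow>bs. A $ b $ b) * x bs"
proof (induction bs arbitrary: x)
  case (Cons b bs)
  have "(\<Sum>a\<in>UNIV. A $ b $ a * x (a # bs)) = (\<Sum>a\<in>UNIV. if a = b then A $ b $ b * x (b # bs) else 0)"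
    using assms by (intro sum.cong refl) auto
  then show ?case by (simp add: tensor_action_Cons Cons.IH distrib_right)
qed simp

text \<open>The signed indices carry no order, so an injection \<open>f\<close> into the natural
  numbers provides one; an alternating array is determined by its values at increasing
  arguments.\<close>

lemma alt2_zero:
  fixes Z :: "'x \<Rightarrow> 'x \<Rightarrow> complex"
  assumes alt: "\<And>a b. Z b a = - Z a b" and f: "inj f"
    and Z: "\<And>a b. f a < (f b :: nat) \<Longrightarrow> Z a b = 0"
  shows "Z a b = 0"
proof -
  have "Z a a = 0" using alt[of a a] by simp
  then show ?thesis using Z[of a b] Z[of b a] alt[of a b] f by (cases "f a" "f b" rule: linorder_cases) (auto dest: injD)
qed

lemma alt3_zero:
  fixes Z :: "'x \<Rightarrow> 'x \<Rightarrow> 'x \<Rightarrow> complex"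
  assumes alt: "\<And>a b c. Z b a c = - Z a b c" "\<And>a b c. Z a c b = - Z a b c" and f: "inj f"
    and Z: "\<And>a b c. f a < (f b :: nat) \<Longrightarrow> f b < f c \<Longrightarrow> Z a b c = 0"
  shows "Z a b c = 0"
proof -
  have e: "Z a a c = 0" "Z a c c = 0" for a c using alt(1)[of a a c] alt(2)[of a c c] by simp_all
  have e': "Z a c a = 0" for a c using alt(2)[of a c a] e(1)[of a c] by simp
  have "a = b \<or> b = c \<or> a = c \<or> (f a < f b \<and> f b < f c) \<or> (f a < f c \<and> f c < f b) \<or> (f b < f a \<and> f a < f c)
    \<or> (f b < f c \<and> f c < f a) \<or> (f c < f a \<and> f a < f b) \<or> (f c < f b \<and> f b < f a)"
    using f by (metis injD linorder_neqE_nat)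
  then show ?thesis
  proof (elim disjE conjE)
    assume "f a < f c" "f c < f b"
    then show ?thesis using Z[of a c b] alt(2)[where a=a and b=c and c=b] by simp
  next
    assume "f b < f a" "f a < f c"
    then show ?thesis using Z[of b a c] alt(1)[where a=b and b=a and c=c] by simp
  next
    assume "f b < f c" "f c < f a"
    then show ?thesis using Z[of b c a] alt(2)[where a=b and b=c and c=a] alt(1)[where a=b and b=a and c=c] by simp
  next
    assume "f c < f a" "f a < f b"
    then show ?thesis using Z[of c a b] alt(1)[where a=c and b=a and c=b] alt(2)[where a=a and b=c and c=b] by simp
  next
    assume "f c < f b" "f b < f a"
    then show ?thesis using Z[of c b a] alt(1)[where a=c and b=b and c=a] alt(2)[where a=b and b=c and c=a]
      alt(1)[where a=b and b=a and c=c] by simp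
  qed (simp_all add: e e' Z)
qed

lemma ext2_alt: "x \<in> ext_power 2 \<Longrightarrow> x [b, a] = - x [a, b]"
  using ext_power_swap[of x 2 "[a, b]" 0 1] by simp

lemma ext3_alt: "x \<in> ext_power 3 \<Longrightarrow> x [b, a, c] = - x [a, b, c]" "x \<in> ext_power 3 \<Longrightarrow> x [a, c, b] = - x [a, b, c]"
  using ext_power_swap[of x 3 "[a, b, c]" 0 1] ext_power_swap[of x 3 "[a, b, c]" 1 2] by (simp_all add: numeral_2_eq_2)

lemma ext_power_length: "x \<in> ext_power k \<Longrightarrow> length bs \<noteq> k \<Longrightarrow> x bs = 0"
  by (simp add: ext_power_def)

section \<open>Gradings on the kernel of the contraction\<close>

definition ext_kernel :: "nat \<Rightarrow> (('r::finite + 'r) list \<Rightarrow> complex) set" where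
  "ext_kernel k = {x \<in> ext_power k. \<forall>cs. ct x cs = 0}"

lemma ext_kernel_closed:
  "(\<lambda>_. 0) \<in> ext_kernel k"
  "x \<in> ext_kernel k \<Longrightarrow> y \<in> ext_kernel k \<Longrightarrow> (\<lambda>bs. x bs + y bs) \<in> ext_kernel k"
  "x \<in> ext_kernel k \<Longrightarrow> (\<lambda>bs. c * x bs) \<in> ext_kernel k"
  "x \<in> ext_kernel k \<Longrightarrow> A \<in> sp \<Longrightarrow> tensor_action A x \<in> ext_kernel k"
proof -
  show "x \<in> ext_kernel k \<Longrightarrow> A \<in> sp \<Longrightarrow> tensor_action A x \<in> ext_kernel k"
  proof -
    assume x: "x \<in> ext_kernel k" and A: "A \<in> sp"
    then have "ct x = (\<lambda>_. 0)" by (auto simp: ext_kernel_def)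
    then show ?thesis using x by (simp add: ext_kernel_def ext_power_action contraction_action[OF A] tensor_action_zero)
  qed
qed (auto simp: ext_kernel_def ext_power_def contraction_def sum.distrib distrib_left mult.left_commute sum_distrib_left[symmetric])

definition list_sum :: "('r + 'r \<Rightarrow> complex) \<Rightarrow> ('r + 'r) list \<Rightarrow> complex" where
  "list_sum \<tau> bs = (\<Sum>b\<leftarrow>bs. \<tau> b)"

text \<open>Replaces dimension counts. On the kernel of the contraction each eigenspace of the
  grading is detected by a single coordinate \<open>b0\<close>, hence is at most a line; and a
  nonzero alternating tensor has a nonzero coordinate whose degree is among N/2, N/2 - 1, ..., -
  N/2.\<close>

definition simple_graded :: "nat \<Rightarrow> nat \<Rightarrow> ('r::finite + 'r \<Rightarrow> complex) \<Rightarrow> bool" where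
  "simple_graded k N \<tau> \<longleftrightarrow>
     (\<forall>\<kappa>. \<exists>b0. \<forall>x\<in>ext_kernel k. (\<forall>bs. x bs \<noteq> 0 \<longrightarrow> list_sum \<tau> bs = \<kappa>) \<longrightarrow> x b0 = 0 \<longrightarrow> x = (\<lambda>_. 0)) \<and>
     (\<forall>x\<in>ext_power k. (\<forall>bs n. n \<le> N \<longrightarrow> list_sum \<tau> bs = of_real (real N / 2 - real n) \<longrightarrow> x bs = 0) \<longrightarrow> x = (\<lambda>_. 0))"

lemma simple_graded_1:
  fixes \<tau> :: "'r::finite + 'r \<Rightarrow> complex"
  assumes inj: "inj \<tau>" and val: "\<And>a. \<exists>n\<le>N. \<tau> a = of_real (real N / 2 - real n)"
  shows "simple_graded 1 N \<tau>"
  unfolding simple_graded_def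
proof (intro conjI allI ballI impI)
  fix \<kappa>
  show "\<exists>b0. \<forall>x\<in>ext_kernel 1. (\<forall>bs. x bs \<noteq> 0 \<longrightarrow> list_sum \<tau> bs = \<kappa>) \<longrightarrow> x b0 = 0 \<longrightarrow> x = (\<lambda>_. 0)"
  proof (rule exI[of _ "[inv \<tau> \<kappa>]"], intro ballI impI ext)
    fix x bs assume x: "x \<in> ext_kernel 1" "\<forall>bs. x bs \<noteq> 0 \<longrightarrow> list_sum \<tau> bs = \<kappa>" "x [inv \<tau> \<kappa>] = 0"
    show "x bs = 0"
    proof (rule ccontr)
      assume nz: "x bs \<noteq> 0"
      then have "length bs = 1" using x(1) ext_power_length[of x 1 bs] by (auto simp: ext_kernel_def)
      then obtain b where b: "bs = [b]" by (auto simp: length_Suc_conv)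
      then have "\<tau> b = \<kappa>" using x(2) nz by (auto simp: list_sum_def)
      then show False using nz x(3) b inv_f_f[OF inj, of b] by simp
    qed
  qed
next
  fix x assume x: "x \<in> ext_power 1" "\<forall>bs n. n \<le> N \<longrightarrow> list_sum \<tau> bs = of_real (real N / 2 - real n) \<longrightarrow> x bs = 0"
  show "x = (\<lambda>_. 0)"
  proof
    fix bs
    show "x bs = 0"
    proof (cases "length bs = 1")
      case True
      then obtain b where b: "bs = [b]" by (auto simp: length_Suc_conv)
      obtain n where "n \<le> N" "\<tau> b = of_real (real N / 2 - real n)" using val by blast
      then show ?thesis using x(2)[rule_format, of n bs] b by (simp add: list_sum_def)
    qed (use x(1) ext_power_length in blast)
  qed
qed

text \<open>Of the six independent coordinates of an alternating tensor only two share a degree,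
  namely 0, and the contraction relates them. The last branch of \<open>?b0\<close> serves degree -2
  and the values that do not occur as degrees.\<close>

lemma simple_graded_2:
  fixes \<tau> :: "'r::finite + 'r \<Rightarrow> complex"
  assumes U: "UNIV = {i, j :: 'r}" and ne: "i \<noteq> j"
    and \<tau>: "\<tau> (Inl i) = 3/2" "\<tau> (Inr i) = - (3/2)" "\<tau> (Inl j) = 1/2" "\<tau> (Inr j) = - (1/2)"
  shows "simple_graded 2 4 \<tau>"
proof -
  define f :: "'r + 'r \<Rightarrow> nat" where
    "f a = (case a of Inl n \<Rightarrow> if n = i then 0 else 2 | Inr n \<Rightarrow> if n = i then 1 else 3)" for a
  have all: "a = Inl i \<or> a = Inr i \<or> a = Inl j \<or> a = Inr j" for a using U by (cases a) auto
  have f: "f (Inl i) = 0" "f (Inr i) = 1" "f (Inl j) = 2" "f (Inr j) = 3" using ne by (simp_all add: f_def)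
  have injf: "inj f"
  proof (rule injI)
    fix a b assume "f a = f b" then show "a = b" using all[of a] all[of b] f by auto
  qed
  have zero: "x = (\<lambda>_. 0)" if x: "x \<in> ext_power 2" and
    z: "x [Inl i, Inr i] = 0" "x [Inl i, Inl j] = 0" "x [Inl i, Inr j] = 0" "x [Inr i, Inl j] = 0" "x [Inr i, Inr j] = 0" "x [Inl j, Inr j] = 0" for x
  proof
    fix bs
    show "x bs = 0"
    proof (cases "length bs = 2")
      case True
      then obtain a b where bs: "bs = [a, b]" by (auto simp: length_Suc_conv numeral_2_eq_2)
      have "x [a, b] = 0"
      proof (rule alt2_zero[of "\<lambda>a b. x [a, b]" f])
        show "x [b, a] = - x [a, b]" for a b by (rule ext2_alt[OF x])
        fix a b assume "f a < f b"
        then show "x [a, b] = 0" using all[of a] all[of b] f z by auto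
      qed (rule injf)
      then show ?thesis using bs by simp
    qed (use x ext_power_length in blast)
  qed
  show ?thesis unfolding simple_graded_def
  proof (intro conjI allI ballI impI)
    fix \<kappa> :: complex
    let ?b0 = "if \<kappa> = 2 then [Inl i, Inl j] else if \<kappa> = 1 then [Inl i, Inr j] else if \<kappa> = 0 then [Inl i, Inr i]
      else if \<kappa> = -1 then [Inr i, Inl j] else [Inr i, Inr j]"
    show "\<exists>b0. \<forall>x\<in>ext_kernel 2. (\<forall>bs. x bs \<noteq> 0 \<longrightarrow> list_sum \<tau> bs = \<kappa>) \<longrightarrow> x b0 = 0 \<longrightarrow> x = (\<lambda>_. 0)"
    proof (rule exI[of _ ?b0], intro ballI impI)
      fix x assume x: "x \<in> ext_kernel 2" and s: "\<forall>bs. x bs \<noteq> 0 \<longrightarrow> list_sum \<tau> bs = \<kappa>" and x0: "x ?b0 = 0"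
      have xe: "x \<in> ext_power 2" and ct0: "ct x [] = 0" using x by (auto simp: ext_kernel_def)
      have c: "x [Inl i, Inr i] + x [Inl j, Inr j] = 0"
      proof -
        have "2 * (x [Inl i, Inr i] + x [Inl j, Inr j]) = ct x []"
          using ne ext2_alt[OF xe, of "Inr i" "Inl i"] ext2_alt[OF xe, of "Inr j" "Inl j"]
          by (simp add: contraction_def sum_UNIV_Plus U)
        from trans[OF this ct0] show ?thesis by (simp only: mult_eq_0_iff) simp
      qed
      have h: "x [Inl i, Inr i] \<noteq> 0 \<Longrightarrow> \<kappa> = 0" "x [Inl i, Inl j] \<noteq> 0 \<Longrightarrow> \<kappa> = 2" "x [Inl i, Inr j] \<noteq> 0 \<Longrightarrow> \<kappa> = 1"
        "x [Inr i, Inl j] \<noteq> 0 \<Longrightarrow> \<kappa> = -1" "x [Inr i, Inr j] \<noteq> 0 \<Longrightarrow> \<kappa> = -2" "x [Inl j, Inr j] \<noteq> 0 \<Longrightarrow> \<kappa> = 0"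
        using s by (auto simp: list_sum_def \<tau>)
      show "x = (\<lambda>_. 0)" by (rule zero[OF xe]) (use h x0 c in \<open>auto split: if_splits\<close>)
    qed
  next
    fix x assume x: "x \<in> ext_power 2"
      "\<forall>bs n. n \<le> 4 \<longrightarrow> list_sum \<tau> bs = of_real (real 4 / 2 - real n) \<longrightarrow> x bs = 0"
    show "x = (\<lambda>_. 0)"
      by (rule zero[OF x(1)])
        (rule x(2)[rule_format, of 2], simp, simp add: list_sum_def \<tau>,
         rule x(2)[rule_format, of 0], simp, simp add: list_sum_def \<tau>,
         rule x(2)[rule_format, of 1], simp, simp add: list_sum_def \<tau>,
         rule x(2)[rule_format, of 3], simp, simp add: list_sum_def \<tau>,
         rule x(2)[rule_format, of 4], simp, simp add: list_sum_def \<tau>,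
         rule x(2)[rule_format, of 2], simp, simp add: list_sum_def \<tau>)
  qed
qed

text \<open>The 20 independent coordinates lie in 14 degrees: eight degrees occur once, and six
  occur twice, each such pair being tied by one contraction identity. The last branch of
  \<open>?b0\<close> serves degree -1/2 and the values that do not occur. The numbers 9/2, 3/2, 1/2
  are those of \<open>grading_spin_3\<close>.\<close>

lemma simple_graded_3:
  fixes \<tau> :: "'r::finite + 'r \<Rightarrow> complex"
  assumes U: "UNIV = {i, j, k :: 'r}" and ne: "i \<noteq> j" "i \<noteq> k" "j \<noteq> k"
    and \<tau>: "\<tau> (Inl i) = 9/2" "\<tau> (Inr i) = - (9/2)" "\<tau> (Inl j) = 3/2" "\<tau> (Inr j) = - (3/2)" "\<tau> (Inl k) = 1/2" "\<tau> (Inr k) = - (1/2)"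
  shows "simple_graded 3 13 \<tau>"
proof -
  define f :: "'r + 'r \<Rightarrow> nat" where
    "f a = (case a of Inl n \<Rightarrow> if n = i then 0 else if n = j then 2 else 4 | Inr n \<Rightarrow> if n = i then 1 else if n = j then 3 else 5)" for a
  have all: "a = Inl i \<or> a = Inr i \<or> a = Inl j \<or> a = Inr j \<or> a = Inl k \<or> a = Inr k" for a using U by (cases a) auto
  have f: "f (Inl i) = 0" "f (Inr i) = 1" "f (Inl j) = 2" "f (Inr j) = 3" "f (Inl k) = 4" "f (Inr k) = 5" using ne by (simp_all add: f_def)
  have injf: "inj f"
  proof (rule injI)
    fix a b assume "f a = f b" then show "a = b" using all[of a] all[of b] f by auto
  qed
  have zero: "x = (\<lambda>_. 0)" if x: "x \<in> ext_power 3" and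
    z: "x [Inl i, Inr i, Inl j] = 0"
      "x [Inl i, Inr i, Inr j] = 0"
      "x [Inl i, Inr i, Inl k] = 0"
      "x [Inl i, Inr i, Inr k] = 0"
      "x [Inl i, Inl j, Inr j] = 0"
      "x [Inl i, Inl j, Inl k] = 0"
      "x [Inl i, Inl j, Inr k] = 0"
      "x [Inl i, Inr j, Inl k] = 0"
      "x [Inl i, Inr j, Inr k] = 0"
      "x [Inl i, Inl k, Inr k] = 0"
      "x [Inr i, Inl j, Inr j] = 0"
      "x [Inr i, Inl j, Inl k] = 0"
      "x [Inr i, Inl j, Inr k] = 0"
      "x [Inr i, Inr j, Inl k] = 0"
      "x [Inr i, Inr j, Inr k] = 0"
      "x [Inr i, Inl k, Inr k] = 0"
      "x [Inl j, Inr j, Inl k] = 0"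
      "x [Inl j, Inr j, Inr k] = 0"
      "x [Inl j, Inl k, Inr k] = 0"
      "x [Inr j, Inl k, Inr k] = 0" for x
  proof
    fix bs
    show "x bs = 0"
    proof (cases "length bs = 3")
      case True
      then obtain a b c where bs: "bs = [a, b, c]" by (auto simp: length_Suc_conv numeral_3_eq_3)
      have "x [a, b, c] = 0"
      proof (rule alt3_zero[of "\<lambda>a b c. x [a, b, c]" f])
        show "x [b, a, c] = - x [a, b, c]" "x [a, c, b] = - x [a, b, c]" for a b c by (rule ext3_alt[OF x])+
        fix a b c assume "f a < f b" "f b < f c"
        then show "x [a, b, c] = 0"
          using all[of a] all[of b] all[of c] by (elim disjE) (simp_all add: f z)
      qed (rule injf)
      then show ?thesis using bs by simp
    qed (use x ext_power_length in blast)
  qed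
  show ?thesis unfolding simple_graded_def
  proof (intro conjI allI ballI impI)
    fix \<kappa> :: complex
    let ?b0 = "if \<kappa> = 13/2 then [Inl i, Inl j, Inl k] else if \<kappa> = 11/2 then [Inl i, Inl j, Inr k] else if \<kappa> = 7/2 then [Inl i, Inr j, Inl k] else if \<kappa> = 5/2 then [Inl i, Inr j, Inr k] else if \<kappa> = - (5/2) then [Inr i, Inl j, Inl k] else if \<kappa> = - (7/2) then [Inr i, Inl j, Inr k] else if \<kappa> = - (11/2) then [Inr i, Inr j, Inl k] else if \<kappa> = - (13/2) then [Inr i, Inr j, Inr k] else if \<kappa> = 9/2 then [Inl i, Inl j, Inr j] else if \<kappa> = - (9/2) then [Inr i, Inl j, Inr j] else if \<kappa> = 3/2 then [Inl i, Inr i, Inl j] else if \<kappa> = - (3/2) then [Inl i, Inr i, Inr j] else if \<kappa> = 1/2 then [Inl i, Inr i, Inl k] else [Inl i, Inr i, Inr k]"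
    show "\<exists>b0. \<forall>x\<in>ext_kernel 3. (\<forall>bs. x bs \<noteq> 0 \<longrightarrow> list_sum \<tau> bs = \<kappa>) \<longrightarrow> x b0 = 0 \<longrightarrow> x = (\<lambda>_. 0)"
    proof (rule exI[of _ ?b0], intro ballI impI)
      fix x assume x: "x \<in> ext_kernel 3" and s: "\<forall>bs. x bs \<noteq> 0 \<longrightarrow> list_sum \<tau> bs = \<kappa>" and x0: "x ?b0 = 0"
      have xe: "x \<in> ext_power 3" and ct: "ct x [c] = 0" for c using x by (auto simp: ext_kernel_def)
      have rep: "x [a, b, b] = 0" "x [b, b, a] = 0" "x [b, a, b] = 0" for a b
        using ext3_alt(1)[OF xe, of b b a] ext3_alt(2)[OF xe, of a b b] ext3_alt(2)[OF xe, of b a b] ext3_alt(1)[OF xe, of b b a] by simp_all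
      have bal: "x [Inl i, Inr i, c] + x [Inl j, Inr j, c] + x [Inl k, Inr k, c] = 0" for c
      proof -
        have "2 * (x [Inl i, Inr i, c] + x [Inl j, Inr j, c] + x [Inl k, Inr k, c]) = ct x [c]"
          using ne ext3_alt(1)[OF xe, of "Inr i" "Inl i" c] ext3_alt(1)[OF xe, of "Inr j" "Inl j" c] ext3_alt(1)[OF xe, of "Inr k" "Inl k" c]
          by (simp add: contraction_def sum_UNIV_Plus U)
        from trans[OF this ct[of c]] show ?thesis by (simp only: mult_eq_0_iff) simp
      qed
      have cyc: "x [b, c, a] = x [a, b, c]" for a b c
        using ext3_alt(1)[OF xe, of b a c] ext3_alt(2)[OF xe, of b a c] by simp
      have c: "x [Inl i, Inl j, Inr j] + x [Inl i, Inl k, Inr k] = 0"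
        "x [Inr i, Inl j, Inr j] + x [Inr i, Inl k, Inr k] = 0"
        "x [Inl i, Inr i, Inl j] + x [Inl j, Inl k, Inr k] = 0"
        "x [Inl i, Inr i, Inr j] + x [Inr j, Inl k, Inr k] = 0"
        "x [Inl i, Inr i, Inl k] + x [Inl j, Inr j, Inl k] = 0"
        "x [Inl i, Inr i, Inr k] + x [Inl j, Inr j, Inr k] = 0"
        using bal[of "Inl i"] bal[of "Inr i"] bal[of "Inl j"] bal[of "Inr j"] bal[of "Inl k"] bal[of "Inr k"]
        by (simp_all add: rep cyc[of "Inl j" "Inr j" "Inl i"] cyc[of "Inl k" "Inr k" "Inl i"] cyc[of "Inl j" "Inr j" "Inr i"]
          cyc[of "Inl k" "Inr k" "Inr i"] cyc[of "Inl k" "Inr k" "Inl j"] cyc[of "Inl k" "Inr k" "Inr j"])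
      have h: "x [Inl i, Inr i, Inl j] = 0 \<or> \<kappa> = 3/2"
        "x [Inl i, Inr i, Inr j] = 0 \<or> \<kappa> = - (3/2)"
        "x [Inl i, Inr i, Inl k] = 0 \<or> \<kappa> = 1/2"
        "x [Inl i, Inr i, Inr k] = 0 \<or> \<kappa> = - (1/2)"
        "x [Inl i, Inl j, Inr j] = 0 \<or> \<kappa> = 9/2"
        "x [Inl i, Inl j, Inl k] = 0 \<or> \<kappa> = 13/2"
        "x [Inl i, Inl j, Inr k] = 0 \<or> \<kappa> = 11/2"
        "x [Inl i, Inr j, Inl k] = 0 \<or> \<kappa> = 7/2"
        "x [Inl i, Inr j, Inr k] = 0 \<or> \<kappa> = 5/2"
        "x [Inl i, Inl k, Inr k] = 0 \<or> \<kappa> = 9/2"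
        "x [Inr i, Inl j, Inr j] = 0 \<or> \<kappa> = - (9/2)"
        "x [Inr i, Inl j, Inl k] = 0 \<or> \<kappa> = - (5/2)"
        "x [Inr i, Inl j, Inr k] = 0 \<or> \<kappa> = - (7/2)"
        "x [Inr i, Inr j, Inl k] = 0 \<or> \<kappa> = - (11/2)"
        "x [Inr i, Inr j, Inr k] = 0 \<or> \<kappa> = - (13/2)"
        "x [Inr i, Inl k, Inr k] = 0 \<or> \<kappa> = - (9/2)"
        "x [Inl j, Inr j, Inl k] = 0 \<or> \<kappa> = 1/2"
        "x [Inl j, Inr j, Inr k] = 0 \<or> \<kappa> = - (1/2)"
        "x [Inl j, Inl k, Inr k] = 0 \<or> \<kappa> = 3/2"
        "x [Inr j, Inl k, Inr k] = 0 \<or> \<kappa> = - (3/2)"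
        using s by (auto simp: list_sum_def \<tau>)
      have "x ?b0 = 0 \<Longrightarrow> x [Inl i, Inr i, Inl j] = 0 \<and>
        x [Inl i, Inr i, Inr j] = 0 \<and>
        x [Inl i, Inr i, Inl k] = 0 \<and>
        x [Inl i, Inr i, Inr k] = 0 \<and>
        x [Inl i, Inl j, Inr j] = 0 \<and>
        x [Inl i, Inl j, Inl k] = 0 \<and>
        x [Inl i, Inl j, Inr k] = 0 \<and>
        x [Inl i, Inr j, Inl k] = 0 \<and>
        x [Inl i, Inr j, Inr k] = 0 \<and>
        x [Inl i, Inl k, Inr k] = 0 \<and>
        x [Inr i, Inl j, Inr j] = 0 \<and>
        x [Inr i, Inl j, Inl k] = 0 \<and>
        x [Inr i, Inl j, Inr k] = 0 \<and>
        x [Inr i, Inr j, Inl k] = 0 \<and>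
        x [Inr i, Inr j, Inr k] = 0 \<and>
        x [Inr i, Inl k, Inr k] = 0 \<and>
        x [Inl j, Inr j, Inl k] = 0 \<and>
        x [Inl j, Inr j, Inr k] = 0 \<and>
        x [Inl j, Inl k, Inr k] = 0 \<and>
        x [Inr j, Inl k, Inr k] = 0"
      proof -
        consider "\<kappa> = 13/2" | "\<kappa> = 11/2" | "\<kappa> = 7/2" | "\<kappa> = 5/2" | "\<kappa> = - (5/2)" | "\<kappa> = - (7/2)" | "\<kappa> = - (11/2)" | "\<kappa> = - (13/2)" | "\<kappa> = 9/2" | "\<kappa> = - (9/2)" | "\<kappa> = 3/2" | "\<kappa> = - (3/2)" | "\<kappa> = 1/2" | "\<kappa> = - (1/2)" | "\<kappa> \<noteq> 13/2 \<and> \<kappa> \<noteq> 11/2 \<and> \<kappa> \<noteq> 7/2 \<and> \<kappa> \<noteq> 5/2 \<and> \<kappa> \<noteq> - (5/2) \<and> \<kappa> \<noteq> - (7/2) \<and> \<kappa> \<noteq> - (11/2) \<and> \<kappa> \<noteq> - (13/2) \<and> \<kappa> \<noteq> 9/2 \<and> \<kappa> \<noteq> - (9/2) \<and> \<kappa> \<noteq> 3/2 \<and> \<kappa> \<noteq> - (3/2) \<and> \<kappa> \<noteq> 1/2 \<and> \<kappa> \<noteq> - (1/2)" by blast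
        then show ?thesis
        proof cases
          case 1 show ?thesis using h[unfolded 1] x0[unfolded 1] c by simp
        next
          case 2 show ?thesis using h[unfolded 2] x0[unfolded 2] c by simp
        next
          case 3 show ?thesis using h[unfolded 3] x0[unfolded 3] c by simp
        next
          case 4 show ?thesis using h[unfolded 4] x0[unfolded 4] c by simp
        next
          case 5 show ?thesis using h[unfolded 5] x0[unfolded 5] c by simp
        next
          case 6 show ?thesis using h[unfolded 6] x0[unfolded 6] c by simp
        next
          case 7 show ?thesis using h[unfolded 7] x0[unfolded 7] c by simp
        next
          case 8 show ?thesis using h[unfolded 8] x0[unfolded 8] c by simp
        next
          case 9 show ?thesis using h[unfolded 9] x0[unfolded 9] c by simp
        next
          case 10 show ?thesis using h[unfolded 10] x0[unfolded 10] c by simp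
        next
          case 11 show ?thesis using h[unfolded 11] x0[unfolded 11] c by simp
        next
          case 12 show ?thesis using h[unfolded 12] x0[unfolded 12] c by simp
        next
          case 13 show ?thesis using h[unfolded 13] x0[unfolded 13] c by simp
        next
          case 14 show ?thesis using h[unfolded 14] x0[unfolded 14] c by simp
        next
          case 15 then show ?thesis using h by simp
        qed
      qed
      then show "x = (\<lambda>_. 0)" using x0 by (intro zero[OF xe]) simp_all
    qed
  next
    fix x assume x: "x \<in> ext_power 3"
      "\<forall>bs n. n \<le> 13 \<longrightarrow> list_sum \<tau> bs = of_real (real 13 / 2 - real n) \<longrightarrow> x bs = 0"
    show "x = (\<lambda>_. 0)"
      by (rule zero[OF x(1)])
        (rule x(2)[rule_format, of 5], simp, simp add: list_sum_def \<tau>,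
         rule x(2)[rule_format, of 8], simp, simp add: list_sum_def \<tau>,
         rule x(2)[rule_format, of 6], simp, simp add: list_sum_def \<tau>,
         rule x(2)[rule_format, of 7], simp, simp add: list_sum_def \<tau>,
         rule x(2)[rule_format, of 2], simp, simp add: list_sum_def \<tau>,
         rule x(2)[rule_format, of 0], simp, simp add: list_sum_def \<tau>,
         rule x(2)[rule_format, of 1], simp, simp add: list_sum_def \<tau>,
         rule x(2)[rule_format, of 3], simp, simp add: list_sum_def \<tau>,
         rule x(2)[rule_format, of 4], simp, simp add: list_sum_def \<tau>,
         rule x(2)[rule_format, of 2], simp, simp add: list_sum_def \<tau>,
         rule x(2)[rule_format, of 11], simp, simp add: list_sum_def \<tau>,
         rule x(2)[rule_format, of 9], simp, simp add: list_sum_def \<tau>,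
         rule x(2)[rule_format, of 10], simp, simp add: list_sum_def \<tau>,
         rule x(2)[rule_format, of 12], simp, simp add: list_sum_def \<tau>,
         rule x(2)[rule_format, of 13], simp, simp add: list_sum_def \<tau>,
         rule x(2)[rule_format, of 11], simp, simp add: list_sum_def \<tau>,
         rule x(2)[rule_format, of 6], simp, simp add: list_sum_def \<tau>,
         rule x(2)[rule_format, of 7], simp, simp add: list_sum_def \<tau>,
         rule x(2)[rule_format, of 5], simp, simp add: list_sum_def \<tau>,
         rule x(2)[rule_format, of 8], simp, simp add: list_sum_def \<tau>)
  qed
qed

lemma list_sum_update:
  assumes "i < length bs"
  shows "list_sum \<tau> (bs[i := a]) = list_sum \<tau> bs + \<tau> a - \<tau> (bs ! i)"
  using assms
proof (induction bs arbitrary: i)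
  case (Cons b bs)
  then show ?case by (cases i) (auto simp: list_sum_def)
qed simp

text \<open>Each of the two entries of \<open>Xm a b\<close> replaces one index of the list; both
  replacements change the degree by the same amount because \<open>\<tau>\<close> is odd under
  \<open>bar\<close>.\<close>

lemma tensor_action_Xm_support:
  assumes \<tau>: "\<And>a. \<tau> (bar a) = - \<tau> a" and nz: "tensor_action (Xm a b) z bs \<noteq> 0"
  shows "\<exists>cs. z cs \<noteq> 0 \<and> list_sum \<tau> bs = list_sum \<tau> cs + \<tau> a - \<tau> b"
proof -
  obtain i c where i: "i < length bs" and c: "Xm a b $ (bs ! i) $ c * z (bs[i := c]) \<noteq> 0"
    using nz unfolding tensor_action_def by (meson sum.not_neutral_contains_not_neutral lessThan_iff)
  then have z: "z (bs[i := c]) \<noteq> 0" and "Xm a b $ (bs ! i) $ c \<noteq> 0" by auto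
  then have "(bs ! i = a \<and> c = b) \<or> (bs ! i = bar b \<and> c = bar a)" by (auto simp: Xm_def split: if_splits)
  then have "list_sum \<tau> bs = list_sum \<tau> (bs[i := c]) + \<tau> a - \<tau> b"
    using list_sum_update[OF i, of \<tau> c] \<tau> by auto
  then show ?thesis using z by blast
qed

lemma tensor_action_mat_if: "tensor_action (if P then A else 0) x bs = (if P then tensor_action A x bs else 0)"
  by (simp add: tensor_action_mat_zero)

section \<open>Homomorphisms into exterior powers\<close>

text \<open>The action of a matrix in all slots at once. It transports tensors between the given
  coordinates and an adapted frame.\<close>

primrec tensor_map :: "complex^'b^'b \<Rightarrow> ('b::finite list \<Rightarrow> complex) \<Rightarrow> 'b list \<Rightarrow> complex" where
  "tensor_map B x [] = x []"
| "tensor_map B x (b # bs) = (\<Sum>c\<in>UNIV. B $ b $ c * tensor_map B (\<lambda>cs. x (c # cs)) bs)"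

lemma tensor_map_add: "tensor_map B (\<lambda>bs. x bs + y bs) bs = tensor_map B x bs + tensor_map B y bs"
  by (induction bs arbitrary: x y) (simp_all add: distrib_left sum.distrib)

lemma tensor_map_scale: "tensor_map B (\<lambda>bs. c * x bs) bs = c * tensor_map B x bs"
  by (induction bs arbitrary: x) (simp_all add: sum_distrib_left mult.left_commute)

lemma tensor_map_0: "tensor_map B (\<lambda>bs. 0) bs = 0"
  using tensor_map_scale[of B 0 "\<lambda>_. 0" bs] by simp

lemma tensor_map_sum: "tensor_map B (\<lambda>bs. \<Sum>i\<in>I. f i bs) bs = (\<Sum>i\<in>I. tensor_map B (f i) bs)"
  by (induction I rule: infinite_finite_induct) (simp_all add: tensor_map_0 tensor_map_add)

lemma tensor_map_one: "tensor_map (mat 1) x bs = x bs"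
  by (induction bs arbitrary: x) (simp_all add: mat_nth if_distrib if_distribR cong: if_cong)

lemma tensor_map_mult: "tensor_map C (tensor_map B x) bs = tensor_map (C ** B) x bs"
proof (induction bs arbitrary: x)
  case (Cons b bs)
  have "tensor_map C (tensor_map B x) (b # bs)
    = (\<Sum>c\<in>UNIV. C $ b $ c * (\<Sum>d\<in>UNIV. B $ c $ d * tensor_map (C ** B) (\<lambda>cs. x (d # cs)) bs))"
    by (simp add: tensor_map_sum tensor_map_scale Cons)
  also have "\<dots> = (\<Sum>d\<in>UNIV. (\<Sum>c\<in>UNIV. C $ b $ c * B $ c $ d) * tensor_map (C ** B) (\<lambda>cs. x (d # cs)) bs)"
    by (subst (2) sum_distrib_right[symmetric, THEN sym] | simp add: sum_distrib_left sum_distrib_right mult.assoc)+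
      (rule sum.swap)
  finally show ?case by (simp add: matrix_mult_nth)
qed simp

lemma tensor_map_action:
  assumes AB: "A ** B = B ** A'"
  shows "tensor_action A (tensor_map B x) bs = tensor_map B (tensor_action A' x) bs"
proof (induction bs arbitrary: x)
  case (Cons b bs)
  let ?T = "\<lambda>c. tensor_map B (\<lambda>cs. x (c # cs)) bs" and ?S = "\<lambda>c. tensor_map B (tensor_action A' (\<lambda>cs. x (c # cs))) bs"
  have "tensor_action A (tensor_map B x) (b # bs)
    = (\<Sum>a\<in>UNIV. A $ b $ a * (\<Sum>c\<in>UNIV. B $ a $ c * ?T c)) + (\<Sum>c\<in>UNIV. B $ b $ c * ?S c)"
    by (simp add: tensor_action_Cons tensor_action_sum tensor_action_scale Cons)
  also have "(\<Sum>a\<in>UNIV. A $ b $ a * (\<Sum>c\<in>UNIV. B $ a $ c * ?T c)) = (\<Sum>c\<in>UNIV. (A ** B) $ b $ c * ?T c)"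
    unfolding matrix_mult_nth sum_distrib_left sum_distrib_right by (subst sum.swap) (simp add: mult.assoc)
  also have "\<dots> = (\<Sum>a\<in>UNIV. B $ b $ a * (\<Sum>c\<in>UNIV. A' $ a $ c * ?T c))"
    unfolding AB matrix_mult_nth sum_distrib_left sum_distrib_right by (subst sum.swap) (simp add: mult.assoc)
  also have "\<dots> + (\<Sum>c\<in>UNIV. B $ b $ c * ?S c) = tensor_map B (tensor_action A' x) (b # bs)"
    by (simp add: tensor_action_Cons tensor_map_add tensor_map_sum tensor_map_scale distrib_left sum.distrib)
  finally show ?case .
qed simp

text \<open>The recursion singles out the first slot; the explicit sum treats all slots alike, as is
  needed for exchanging two of them.\<close>

lemma tensor_map_explicit:
  "tensor_map B x bs = (\<Sum>cs\<in>{cs. length cs = length bs}. (\<Prod>i<length bs. B $ (bs ! i) $ (cs ! i)) * x cs)"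
proof (induction bs arbitrary: x)
  case (Cons b bs)
  have e: "{cs :: 'a list. length cs = length (b # bs)} = (\<lambda>(c, cs). c # cs) ` (UNIV \<times> {cs. length cs = length bs})"
    by (auto simp: length_Suc_conv image_iff)
  have i: "inj_on (\<lambda>(c, cs). c # cs) (UNIV \<times> {cs :: 'a list. length cs = length bs})"
    by (auto simp: inj_on_def)
  show ?case unfolding e sum.reindex[OF i]
    by (simp add: Cons sum.cartesian_product case_prod_unfold prod.lessThan_Suc_shift sum_distrib_left mult.assoc
        del: prod.lessThan_Suc)
qed (simp add: length_0_conv)

lemma tensor_map_ext_power:
  assumes x: "x \<in> ext_power k"
  shows "tensor_map B x \<in> ext_power k"
proof -
  have len: "tensor_map B x bs = 0" if "length bs \<noteq> k" for bs
    unfolding tensor_map_explicit using that x by (auto simp: ext_power_def intro!: sum.neutral)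
  have sw: "tensor_map B x (bs[i := bs ! j, j := bs ! i]) = - tensor_map B x bs"
    if b: "length bs = k" "i < j" "j < k" for bs i j
  proof -
    let ?p = "\<lambda>n. if n = i then j else if n = j then i else n"
    let ?s = "\<lambda>cs. cs[i := cs ! j, j := cs ! i]"
    have nth: "?s cs ! n = cs ! ?p n" if "length cs = k" "n < k" for cs :: "'a list" and n
      using that b by (auto simp: nth_list_update)
    have ss: "?s (?s cs) = cs" if "length cs = k" for cs :: "'a list"
      using that b by (intro nth_equalityI) (auto simp: nth_list_update)
    have "tensor_map B x (?s bs) = (\<Sum>cs\<in>{cs. length cs = k}. (\<Prod>n<k. B $ (?s bs ! n) $ (cs ! n)) * x cs)"
      unfolding tensor_map_explicit using b by simp
    also have "\<dots> = (\<Sum>cs\<in>{cs. length cs = k}. (\<Prod>n<k. B $ (?s bs ! n) $ (?s cs ! n)) * x (?s cs))"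
      by (rule sum.reindex_bij_witness[of _ ?s ?s]) (auto simp: ss)
    also have "\<dots> = (\<Sum>cs\<in>{cs. length cs = k}. (\<Prod>n<k. B $ (bs ! n) $ (cs ! n)) * - x cs)"
    proof (rule sum.cong[OF refl])
      fix cs :: "'a list" assume cs: "cs \<in> {cs. length cs = k}"
      have "(\<Prod>n<k. B $ (?s bs ! n) $ (?s cs ! n)) = (\<Prod>n<k. B $ (bs ! ?p n) $ (cs ! ?p n))"
        using cs b(1) by (intro prod.cong[OF refl]) (simp add: nth del: if_split)
      also have "\<dots> = (\<Prod>n<k. B $ (bs ! n) $ (cs ! n))"
        by (rule prod.reindex_bij_witness[of _ ?p ?p]) (use b in \<open>auto split: if_splits\<close>)
      finally show "(\<Prod>n<k. B $ (?s bs ! n) $ (?s cs ! n)) * x (?s cs) = (\<Prod>n<k. B $ (bs ! n) $ (cs ! n)) * - x cs"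
        using x cs b by (simp add: ext_power_def)
    qed
    also have "\<dots> = - tensor_map B x bs" unfolding tensor_map_explicit using b by (simp add: sum_negf)
    finally show ?thesis .
  qed
  show ?thesis unfolding ext_power_def using len sw by blast
qed

context principal_grading begin

definition eps :: "'r + 'r \<Rightarrow> complex" where
  "eps a = (case a of Inl i \<Rightarrow> tt i | Inr i \<Rightarrow> - tt i)"

lemma eps_bar: "eps (bar a) = - eps a"
  by (cases a) (simp_all add: eps_def)

lemma eps_real: "eps a = of_real (Re (eps a))"
proof -
  have "\<exists>n. i = idx n \<and> n \<in> {1..r}" for i
    using idx unfolding bij_betw_def by (metis UNIV_I imageE)
  then have "tt i = of_real (Re (tt i))" for i using tt_real tr_def by metis
  then show ?thesis by (cases a) (simp_all add: eps_def)
qed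

lemma A_R: "A *v (R a b *v x) = R a b *v (A *v x) + (eps a - eps b) *s (R a b *v x)"
proof -
  have r: "(\<Sum>i\<in>UNIV. tt i * of_int (root a b (Inl i))) = eps a - eps b"
  proof -
    have d: "(\<Sum>i\<in>UNIV. tt i * (if Inl i = p then 1 else 0)) = (case p of Inl j \<Rightarrow> tt j | Inr j \<Rightarrow> 0)" for p :: "'r + 'r"
      by (cases p) (simp_all add: if_distrib cong: if_cong)
    have "tt i * of_int (root a b (Inl i)) = tt i * (if Inl i = a then 1 else 0) - tt i * (if Inl i = b then 1 else 0)
      - tt i * (if Inl i = bar a then 1 else 0) + tt i * (if Inl i = bar b then 1 else 0)" for i
      unfolding root_def by (simp add: algebra_simps)
    then show ?thesis
      by (simp only: sum.distrib sum_subtractf d) (cases a; cases b; simp add: eps_def)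
  qed
  have "A *v (R a b *v x) = (\<Sum>i\<in>UNIV. tt i *s (R a b *v (R (Inl i) (Inl i) *v x)) + (tt i * of_int (root a b (Inl i))) *s (R a b *v x))"
    unfolding A_mv by (intro sum.cong[OF refl]) (simp add: H_comm vec.scale_right_distrib)
  also have "\<dots> = R a b *v (A *v x) + (\<Sum>i\<in>UNIV. tt i * of_int (root a b (Inl i))) *s (R a b *v x)"
    by (simp add: A_mv sum.distrib vec.scale_sum_left vec.linear_sum[OF matrix_vector_mul_linear_gen] vector_scalar_commute)
  finally show ?thesis unfolding r .
qed

lemma grading_tensor: "(\<Sum>i\<in>UNIV. tt i * tensor_action (Xm (Inl i) (Inl i)) z bs) = list_sum eps bs * z bs"
proof -
  let ?D = "\<Sum>i\<in>UNIV. scale_mat (tt i) (Xm (Inl i) (Inl i))"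
  have X: "Xm (Inl i) (Inl i) $ p $ q = 0" if "p \<noteq> q" for i and p q :: "'r + 'r" using that by (auto simp: Xm_def)
  have X1: "Xm (Inl i) (Inl i) $ Inl j $ Inl j = (if i = j then 1 else 0)"
    "Xm (Inl i) (Inl i) $ Inr j $ Inr j = - (if i = j then 1 else 0)" for i j :: 'r by (auto simp: Xm_def)
  have "?D $ p $ p = eps p" for p :: "'r + 'r"
    by (cases p) (simp_all only: X1 sum_component scale_mat_nth, simp_all add: eps_def sum_negf if_distrib cong: if_cong)
  then have off: "?D $ p $ q = (if p = q then eps p else 0)" for p q :: "'r + 'r"
    by (simp add: X)
  have "(\<Sum>i\<in>UNIV. tt i * tensor_action (Xm (Inl i) (Inl i)) z bs) = tensor_action ?D z bs"
    by (simp add: tensor_action_mat_sum tensor_action_mat_scale)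
  also have "\<dots> = (\<Sum>b\<leftarrow>bs. ?D $ b $ b) * z bs"
    by (rule tensor_action_diag) (subst off, simp)
  also have "\<dots> = list_sum eps bs * z bs" by (simp only: off list_sum_def simp_thms if_True)
  finally show ?thesis .
qed

text \<open>The homomorphism from the module to tensors that maps \<open>v\<close> to \<open>y\<close> is obtained as a submodule
  of the direct sum, namely the one generated by \<open>(v, y)\<close>.\<close>

inductive_set graph :: "complex^'v \<Rightarrow> (('r + 'r) list \<Rightarrow> complex) \<Rightarrow> ((complex^'v) \<times> (('r + 'r) list \<Rightarrow> complex)) set"
  for v y where
    base: "(v, y) \<in> graph v y"
  | add: "(x, z) \<in> graph v y \<Longrightarrow> (x', z') \<in> graph v y \<Longrightarrow> (x + x', \<lambda>bs. z bs + z' bs) \<in> graph v y"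
  | scale: "(x, z) \<in> graph v y \<Longrightarrow> (c *s x, \<lambda>bs. c * z bs) \<in> graph v y"
  | lower: "(x, z) \<in> graph v y \<Longrightarrow> Re (eps a) < Re (eps b) \<Longrightarrow> (R a b *v x, tensor_action (Xm a b) z) \<in> graph v y"

lemma graph_0: "(0, \<lambda>_. 0) \<in> graph v y"
  using graph.scale[OF graph.base, of 0] by simp

lemma graph_diff:
  assumes "(x, z) \<in> graph v y" "(x', z') \<in> graph v y"
  shows "(x - x', \<lambda>bs. z bs - z' bs) \<in> graph v y"
  using graph.add[OF assms(1) graph.scale[OF assms(2), of "-1"]] by simp

lemma graph_if:
  assumes "(x, z) \<in> graph v y"
  shows "(if P then x else 0, \<lambda>bs. if P then z bs else 0) \<in> graph v y"
  using assms graph_0 by simp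

lemma graph_sum:
  assumes "finite S" "\<And>i. i \<in> S \<Longrightarrow> (x i, z i) \<in> graph v y"
  shows "(\<Sum>i\<in>S. x i, \<lambda>bs. \<Sum>i\<in>S. z i bs) \<in> graph v y"
  using assms by induction (auto intro: graph_0 graph.add)

text \<open>By construction the graph is closed only under operators that lower the degree. An
  arbitrary operator is commuted past them down to \<open>(v, y)\<close>; the commutators belong to
  the same family and are covered by the induction hypothesis, which ranges over all
  indices.\<close>

lemma graph_stable:
  assumes base: "\<And>c d. (R c d *v v, tensor_action (Xm c d) y) \<in> graph v y"
  shows "(x, z) \<in> graph v y \<Longrightarrow> (R c d *v x, tensor_action (Xm c d) z) \<in> graph v y"
proof (induction x z arbitrary: c d rule: graph.induct)
  case base
  show ?case by (rule assms)
next
  case (add x z x' z')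
  then show ?case using graph.add[OF add(3,4)]
    by (simp add: matrix_vector_right_distrib tensor_action_add[abs_def])
next
  case (scale x z s)
  then show ?case using graph.scale[OF scale(2), of s c d]
    by (simp add: vector_scalar_commute tensor_action_scale[abs_def])
next
  case (lower x z a b)
  have e: "tensor_action (Xm c d) (tensor_action (Xm a b) z) =
    (\<lambda>bs. tensor_action (Xm a b) (tensor_action (Xm c d) z) bs + (if d = a then tensor_action (Xm c b) z bs else 0)
      - (if b = c then tensor_action (Xm a d) z bs else 0)
      - (sg c * sg d) * ((if a = bar c then tensor_action (Xm (bar d) b) z bs else 0)
          - (if b = bar d then tensor_action (Xm a (bar c)) z bs else 0)))"
  proof
    fix bs
    show "tensor_action (Xm c d) (tensor_action (Xm a b) z) bs = tensor_action (Xm a b) (tensor_action (Xm c d) z) bs + (if d = a then tensor_action (Xm c b) z bs else 0)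
      - (if b = c then tensor_action (Xm a d) z bs else 0)
      - (sg c * sg d) * ((if a = bar c then tensor_action (Xm (bar d) b) z bs else 0)
          - (if b = bar d then tensor_action (Xm a (bar c)) z bs else 0))"
      using tensor_action_bracket[of "Xm c d" "Xm a b" z bs]
      unfolding Xm_bracket tensor_action_mat_diff tensor_action_mat_scale tensor_action_mat_if by (simp add: algebra_simps)
  qed
  show ?case unfolding commv[of c d a b] e
    by (intro graph_diff graph.add graph.scale graph_if lower.IH graph.lower[OF lower.IH lower.hyps(2)])
qed

lemma graph_kernel:
  assumes "(x, z) \<in> graph v y" "y \<in> ext_kernel k"
  shows "z \<in> ext_kernel k"
  using assms by induction (auto intro: ext_kernel_closed Xm_sp)

text \<open>Lowering strictly decreases degrees in both components, so the top parts of a pair are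
  multiples of \<open>v\<close> and of \<open>y\<close> with a common factor \<open>c\<close>. For
  nonzero \<open>v\<close> and \<open>y\<close> this keeps \<open>v\<close> from being paired with
  the tensor 0.\<close>

lemma graph_top:
  fixes M :: real
  assumes v: "A *v v = of_real M *s v" and y: "\<And>bs. y bs \<noteq> 0 \<Longrightarrow> Re (list_sum eps bs) = M"
  defines "Lo \<equiv> vec.span {z. \<exists>k\<in>{k. Re k < M}. A *v z = k *s z}"
  shows "(x, z) \<in> graph v y \<Longrightarrow> \<exists>c. x - c *s v \<in> Lo \<and> (\<forall>bs. z bs - c * y bs \<noteq> 0 \<longrightarrow> Re (list_sum eps bs) < M)"
proof (induction x z rule: graph.induct)
  case base
  show ?case by (rule exI[of _ 1]) (simp add: Lo_def vec.span_zero)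
next
  case (add x z x' z')
  obtain c where c: "x - c *s v \<in> Lo" "\<And>bs. z bs - c * y bs \<noteq> 0 \<Longrightarrow> Re (list_sum eps bs) < M" using add by blast
  obtain c' where c': "x' - c' *s v \<in> Lo" "\<And>bs. z' bs - c' * y bs \<noteq> 0 \<Longrightarrow> Re (list_sum eps bs) < M" using add by blast
  have e: "x + x' - (c + c') *s v = (x - c *s v) + (x' - c' *s v)" by (simp add: vec.scale_left_distrib)
  have "x + x' - (c + c') *s v \<in> Lo" unfolding e Lo_def by (rule vec.span_add[OF c(1)[unfolded Lo_def] c'(1)[unfolded Lo_def]])
  moreover have "z bs + z' bs - (c + c') * y bs = (z bs - c * y bs) + (z' bs - c' * y bs)" for bs
    by (simp add: algebra_simps)
  then have "z bs + z' bs - (c + c') * y bs \<noteq> 0 \<Longrightarrow> Re (list_sum eps bs) < M" for bs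
    using c(2)[of bs] c'(2)[of bs] by (metis add_0_left add.right_neutral)
  ultimately show ?case by (intro exI[of _ "c + c'"]) blast
next
  case (scale x z s)
  then obtain c where c: "x - c *s v \<in> Lo" "\<And>bs. z bs - c * y bs \<noteq> 0 \<Longrightarrow> Re (list_sum eps bs) < M" by blast
  have "s *s x - (s * c) *s v = s *s (x - c *s v)" by (simp add: vec.scale_right_diff_distrib)
  moreover have "s * z bs - s * c * y bs = s * (z bs - c * y bs)" for bs by (simp add: algebra_simps)
  ultimately show ?case using vec.span_scale[OF c(1)[unfolded Lo_def], of s] c(2)
    by (intro exI[of _ "s * c"]) (auto simp: Lo_def)
next
  case (lower x z a b)
  then obtain c where c: "x - c *s v \<in> Lo" "\<And>bs. z bs - c * y bs \<noteq> 0 \<Longrightarrow> Re (list_sum eps bs) < M" by blast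
  have R: "R a b *v u \<in> Lo" if "A *v u = k *s u" "Re k \<le> M" for u k
    unfolding Lo_def using that lower.hyps(2) A_R[of a b u]
    by (intro vec.span_base CollectI bexI[of _ "k + (eps a - eps b)"])
      (simp_all add: vector_scalar_commute vec.scale_left_distrib)
  have sub: "vec.subspace {w. R a b *v w \<in> Lo}"
    unfolding vec.subspace_def Lo_def
    by (auto simp: matrix_vector_right_distrib vector_scalar_commute vec.span_zero intro: vec.span_add vec.span_scale)
  have "Lo \<subseteq> {w. R a b *v w \<in> Lo}"
    by (subst Lo_def, rule vec.span_minimal[OF _ sub]) (use R in fastforce)
  then have "R a b *v (x - c *s v) \<in> Lo" using c(1) by blast
  moreover have "c *s (R a b *v v) \<in> Lo" using R[OF v] unfolding Lo_def by (simp add: vec.span_scale)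
  ultimately have "R a b *v (x - c *s v) + c *s (R a b *v v) \<in> Lo" unfolding Lo_def by (rule vec.span_add)
  then have "R a b *v x - 0 *s v \<in> Lo"
    by (simp add: matrix_vector_mult_diff_distrib vector_scalar_commute)
  moreover have "Re (list_sum eps bs) < M" if nz: "tensor_action (Xm a b) z bs \<noteq> 0" for bs
  proof -
    obtain cs where cs: "z cs \<noteq> 0" "list_sum eps bs = list_sum eps cs + eps a - eps b"
      using tensor_action_Xm_support[of eps, OF eps_bar nz] by blast
    have "Re (list_sum eps cs) \<le> M" using c(2)[of cs] y[of cs] cs(1) by force
    then show ?thesis using cs(2) lower.hyps(2) by simp
  qed
  ultimately show ?case by (intro exI[of _ 0]) simp
qed

text \<open>Lagrange interpolation at the finitely many degrees of lists of length \<open>n\<close>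
  expresses the projection to degree \<open>k\<close> as a polynomial in the grading operator. The
  same polynomial fixes \<open>x\<close>, whose eigenvalue is \<open>k\<close>, so the projected
  pair stays in the graph.\<close>

lemma graph_project:
  assumes st: "\<And>x z c d. (x, z) \<in> graph v y \<Longrightarrow> (R c d *v x, tensor_action (Xm c d) z) \<in> graph v y"
    and xz: "(x, z) \<in> graph v y" and x: "A *v x = k *s x" and len: "\<And>bs. length bs \<noteq> n \<Longrightarrow> z bs = 0"
  shows "(x, \<lambda>bs. if list_sum eps bs = k then z bs else 0) \<in> graph v y"
proof -
  have D: "(A *v x, \<lambda>bs. list_sum eps bs * z bs) \<in> graph v y" if "(x, z) \<in> graph v y" for x z
    using graph_sum[OF _ graph.scale[OF st[OF that]], of UNIV tt "\<lambda>i. Inl i" "\<lambda>i. Inl i"]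
    by (simp add: grading_tensor A_mv)
  have pr: "finite F \<Longrightarrow> k \<notin> F \<Longrightarrow> (x, \<lambda>bs. (\<Prod>l\<in>F. (list_sum eps bs - l) / (k - l)) * z bs) \<in> graph v y" for F
  proof (induction F rule: finite_induct)
    case (insert l F)
    let ?z = "\<lambda>bs. (\<Prod>l\<in>F. (list_sum eps bs - l) / (k - l)) * z bs"
    have kl: "k - l \<noteq> 0" using insert by auto
    have z: "(x, ?z) \<in> graph v y" using insert by blast
    have "(1 / (k - l)) *s (A *v x - l *s x) = x"
      unfolding x vec.scale_left_diff_distrib[symmetric] by (simp only: vector_smult_assoc) (use kl in simp)
    moreover have "(\<lambda>bs. 1 / (k - l) * (list_sum eps bs * ?z bs - l * ?z bs)) =
      (\<lambda>bs. (\<Prod>l\<in>insert l F. (list_sum eps bs - l) / (k - l)) * z bs)"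
      using kl insert by (simp add: divide_simps) (simp add: algebra_simps)
    ultimately show ?case using graph.scale[OF graph_diff[OF D[OF z] graph.scale[OF z, of l]], of "1 / (k - l)"] by simp
  qed (use xz in simp)
  have fin: "finite (list_sum eps ` {bs. length bs = n})"
    using finite_lists_length_eq[of "UNIV :: ('r + 'r) set" n] by simp
  have e: "(\<lambda>bs. (\<Prod>l\<in>list_sum eps ` {bs. length bs = n} - {k}. (list_sum eps bs - l) / (k - l)) * z bs)
    = (\<lambda>bs. if list_sum eps bs = k then z bs else 0)"
  proof
    fix bs
    show "(\<Prod>l\<in>list_sum eps ` {bs. length bs = n} - {k}. (list_sum eps bs - l) / (k - l)) * z bs
      = (if list_sum eps bs = k then z bs else 0)"
    proof (cases "length bs = n \<and> list_sum eps bs \<noteq> k")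
      case True
      then show ?thesis using fin by (auto simp: prod_zero_iff)
    next
      case False
      then consider "list_sum eps bs = k" | "z bs = 0" using len by blast
      then show ?thesis by cases (auto intro!: disjI2 prod.neutral split: if_splits)
    qed
  qed
  show ?thesis unfolding e[symmetric] by (rule pr) (use fin in simp_all)
qed

text \<open>The submodule \<open>graph v y\<close> is shown to be the graph of an injective map. By
  irreducibility every vector is paired with some tensor, and only 0 is paired with the tensor 0. If
  0 were paired with a nonzero \<open>z\<close>, choose a degree of the spectrum where
  \<open>z\<close> has a nonzero component: there the tensor of an eigenvector \<open>u\<close> is a
  multiple of that component, as one coordinate detects the degree, and subtracting it pairs
  \<open>u\<close> with 0.\<close>

lemma embedding:
  assumes irr: "\<And>U. submod U \<Longrightarrow> U = {0} \<or> U = UNIV" and sgr: "simple_graded k N eps"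
    and inj: "inj eps"
    and v: "has_wt l v" "v \<noteq> 0" "tau l = of_real (real N / 2)"
    and y: "y \<in> ext_kernel k" "y \<noteq> (\<lambda>_. 0)" "\<And>bs. y bs \<noteq> 0 \<Longrightarrow> list_sum eps bs = of_real (real N / 2)"
      "\<And>a. tensor_action (Xm a a) y = (\<lambda>bs. of_int (l a) * y bs)"
  shows "\<exists>f. (\<forall>u w. f (u + w) = (\<lambda>bs. f u bs + f w bs)) \<and> (\<forall>c u. f (c *s u) = (\<lambda>bs. c * f u bs)) \<and>
    inj f \<and> range f \<subseteq> ext_kernel k \<and> (\<forall>a b u. f (R a b *v u) = tensor_action (Xm a b) (f u))"
proof -
  let ?M = "real N / 2" and ?G = "graph v y"
  have Av: "A *v v = of_real ?M *s v" using A_wt[OF v(1)] v(3) by simp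
  have spec: "\<exists>n\<le>N. k = of_real (?M - real n)" if kx: "A *v x = k *s x" "x \<noteq> 0" for k x
  proof -
    obtain m where m: "has_wt m x" using eigen_wt[OF kx] by blast
    then have "tau m *s x = k *s x" using A_wt kx by metis
    then have "tau m = k" using kx(2) by (metis vec.scale_right_imp_eq)
    moreover have "m \<in> weights UNIV" using m kx(2) unfolding weights_def by blast
    ultimately show ?thesis using spectrum by auto
  qed
  \<comment> \<open>The degrees \<open>eps\<close> are real and distinct, so \<open>R c d\<close>
    lowers the degree, is diagonal, or raises it. Raising exceeds the largest degree
    \<open>N / 2\<close>: for \<open>v\<close> this contradicts the spectrum, for \<open>y\<close>
    the second clause of \<open>simple_graded\<close>, so both images are 0.\<close>
  have base: "(R c d *v v, tensor_action (Xm c d) y) \<in> ?G" for c d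
  proof -
    consider "Re (eps c) < Re (eps d)" | "c = d" | "Re (eps c) > Re (eps d)"
      using eps_real inj by (metis injD linorder_less_linear)
    then show ?thesis
    proof cases
      case 1 then show ?thesis by (rule graph.lower[OF graph.base])
    next
      case 2 then show ?thesis using graph.scale[OF graph.base, of "of_int (l c)" v y] v(1) y(4) by (simp add: has_wt_def)
    next
      case 3
      have "R c d *v v = 0"
      proof (rule ccontr)
        assume nz: "R c d *v v \<noteq> 0"
        have "A *v (R c d *v v) = (of_real ?M + (eps c - eps d)) *s (R c d *v v)"
          unfolding A_R Av by (simp add: vector_scalar_commute vec.scale_left_distrib)
        from spec[OF this nz] obtain n where "of_real ?M + (eps c - eps d) = of_real (?M - real n)" by blast
        from arg_cong[OF this, of Re] show False using 3 by simp
      qed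
      moreover have "tensor_action (Xm c d) y = (\<lambda>_. 0)"
      proof -
        have "tensor_action (Xm c d) y bs = 0" if "list_sum eps bs = of_real (?M - real n)" for bs n
        proof (rule ccontr)
          assume "tensor_action (Xm c d) y bs \<noteq> 0"
          then obtain cs where "y cs \<noteq> 0" "list_sum eps bs = list_sum eps cs + eps c - eps d"
            using tensor_action_Xm_support[of eps, OF eps_bar] by blast
          then have "of_real (?M - real n) = of_real ?M + eps c - eps d" using that y(3) by metis
          from arg_cong[OF this, of Re] show False using 3 by simp
        qed
        moreover have "tensor_action (Xm c d) y \<in> ext_power k"
          using y(1) ext_power_action by (auto simp: ext_kernel_def)
        ultimately show ?thesis using sgr unfolding simple_graded_def by blast
      qed
      ultimately show ?thesis using graph_0 by simp
    qed
  qed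
  note st = graph_stable[OF base]
  have y': "Re (list_sum eps bs) = ?M" if "y bs \<noteq> 0" for bs using arg_cong[OF y(3)[OF that], of Re] by simp
  have K: "x = 0" if "(x, \<lambda>_. 0) \<in> ?G" for x
  proof -
    let ?K = "{x. (x, \<lambda>_. 0) \<in> ?G}"
    have tz: "tensor_action X (\<lambda>_. 0) = (\<lambda>_. 0)" for X by (rule ext) (rule tensor_action_zero)
    have "submod ?K" unfolding submod_def vec.subspace_def
      using graph_0 graph.add[of _ "\<lambda>_. 0" v y _ "\<lambda>_. 0"] graph.scale[of _ "\<lambda>_. 0" v y] st[of _ "\<lambda>_. 0", unfolded tz]
      by auto
    moreover have "v \<notin> ?K"
    proof
      assume "v \<in> ?K"
      then have vk: "(v, \<lambda>_. 0) \<in> ?G" by simp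
      obtain c where c: "v - c *s v \<in> vec.span {z. \<exists>k\<in>{k. Re k < ?M}. A *v z = k *s z}"
        "\<And>bs. 0 - c * y bs \<noteq> 0 \<Longrightarrow> Re (list_sum eps bs) < ?M"
        using graph_top[OF Av y' vk] by blast
      obtain bs where "y bs \<noteq> 0" using y(2) by blast
      then have "c = 0" using c(2)[of bs] y'[of bs] by auto
      then have "v - c *s v = v" by simp
      from eigen_span_zero[OF c(1)[unfolded this] Av] have "v = 0" by simp
      then show False using v(2) by simp
    qed
    ultimately show ?thesis using irr[of ?K] that by blast
  qed
  have ker: "z \<in> ext_kernel k" if "(x, z) \<in> ?G" for x z using graph_kernel[OF that y(1)] .
  have D: "\<exists>z. (x, z) \<in> ?G" for x
  proof -
    let ?D = "{x. \<exists>z. (x, z) \<in> ?G}"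
    have "submod ?D" unfolding submod_def vec.subspace_def
      using graph_0 graph.add[of _ _ v y] graph.scale[of _ _ v y] st by blast
    moreover have "v \<in> ?D" using graph.base by blast
    ultimately show ?thesis using irr[of ?D] v(2) by blast
  qed
  have Z: "z = (\<lambda>_. 0)" if z: "(0, z) \<in> ?G" for z
  proof (rule ccontr)
    assume "z \<noteq> (\<lambda>_. 0)"
    moreover have "z \<in> ext_power k" using ker[OF z] by (simp add: ext_kernel_def)
    ultimately obtain bs n where n: "n \<le> N" "list_sum eps bs = of_real (?M - real n)" "z bs \<noteq> 0"
      using sgr unfolding simple_graded_def by blast
    let ?k = "of_real (?M - real n) :: complex"
    obtain m where m: "m \<in> weights UNIV" "tau m = ?k" using spectrum_ex[OF n(1)] by blast
    then obtain u where u: "u \<noteq> 0" "A *v u = ?k *s u" using A_wt unfolding weights_def by fastforce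
    obtain z' where z': "(u, z') \<in> ?G" using D by blast
    have len: "length bs \<noteq> k \<Longrightarrow> w bs = 0" if "(x, w) \<in> ?G" for x w bs
      using ker[OF that] ext_power_length by (auto simp: ext_kernel_def)
    let ?p = "\<lambda>w bs. if list_sum eps bs = ?k then w bs else 0"
    have p: "(0, ?p z) \<in> ?G" "(u, ?p z') \<in> ?G"
      using graph_project[OF st z, of ?k k] graph_project[OF st z' u(2), of k] len z z' by auto
    obtain b0 where b0: "\<And>x. x \<in> ext_kernel k \<Longrightarrow> (\<And>bs. x bs \<noteq> 0 \<Longrightarrow> list_sum eps bs = ?k) \<Longrightarrow> x b0 = 0 \<Longrightarrow> x = (\<lambda>_. 0)"
      using sgr unfolding simple_graded_def by metis
    have "?p z b0 \<noteq> 0"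
    proof
      assume "?p z b0 = 0"
      then have "?p z = (\<lambda>_. 0)" using ker[OF p(1)] by (intro b0) (auto split: if_splits)
      from fun_cong[OF this, of bs] show False using n by simp
    qed
    define c where "c = ?p z' b0 / ?p z b0"
    have q: "(u, \<lambda>bs. ?p z' bs - c * ?p z bs) \<in> ?G"
      using graph_diff[OF p(2) graph.scale[OF p(1), of c]] by simp
    have "(\<lambda>bs. ?p z' bs - c * ?p z bs) = (\<lambda>_. 0)"
      by (rule b0[OF ker[OF q]]) (use \<open>?p z b0 \<noteq> 0\<close> in \<open>auto simp: c_def split: if_splits\<close>)
    then show False using K q u(1) by simp
  qed
  define f where "f x = (THE z. (x, z) \<in> ?G)" for x
  have uniq: "z = z'" if "(x, z) \<in> ?G" "(x, z') \<in> ?G" for x z z'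
  proof -
    have "(\<lambda>bs. z bs - z' bs) = (\<lambda>_. 0)" using Z graph_diff[OF that] by simp
    then show ?thesis by (metis eq_iff_diff_eq_0 ext)
  qed
  have f: "(x, f x) \<in> ?G" for x unfolding f_def using D[of x] uniq by (metis the_equality)
  have fI: "f x = z" if "(x, z) \<in> ?G" for x z using uniq f that by blast
  have "inj f"
  proof (rule injI)
    fix u w assume "f u = f w"
    then have "(u - w, \<lambda>_. 0) \<in> ?G" using graph_diff[OF f f, of u w] by simp
    then show "u = w" using K by force
  qed
  then show ?thesis using f ker
    by (intro exI[of _ f]) (auto intro!: fI graph.add graph.scale st f)
qed

end

section \<open>Principal endomorphisms\<close>

lemma eigenspace_nontrivial: "eigenspace A l \<noteq> {0} \<longleftrightarrow> (\<exists>x. x \<noteq> 0 \<and> A *v x = l *s x)"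
proof -
  have n: "0 \<in> E \<Longrightarrow> E \<noteq> {0} \<longleftrightarrow> (\<exists>x. x \<noteq> 0 \<and> x \<in> E)" for E :: "(complex^'b) set" by blast
  have "0 \<in> eigenspace A l" by (simp add: eigenspace_def)
  from n[OF this] show ?thesis by (simp add: eigenspace_def)
qed

lemma dim_1_nontrivial: "vec.dim E = 1 \<Longrightarrow> E \<noteq> {0 :: complex^'n}"
  by (rule notI) (simp add: vec.dim_insert)

text \<open>The tensors bound every eigenspace by a line and confine the eigenvalues to the listed
  values; \<open>att\<close> provides an eigenvector for each of these.\<close>

lemma principal_of_tensors:
  fixes A :: "complex^'v^'v" and f :: "complex^'v \<Rightarrow> ('r::finite + 'r) list \<Rightarrow> complex"
  assumes add: "\<And>u w. f (u + w) = (\<lambda>bs. f u bs + f w bs)" and scale: "\<And>c u. f (c *s u) = (\<lambda>bs. c * f u bs)"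
    and inj: "inj f" and ker: "range f \<subseteq> ext_kernel k"
    and act: "\<And>u bs. f (A *v u) bs = list_sum \<tau> bs * f u bs" and sgr: "simple_graded k N \<tau>"
    and att: "\<And>n. n \<le> N \<Longrightarrow> \<exists>v. v \<noteq> 0 \<and> A *v v = of_real (real N / 2 - real n) *s v"
  shows "is_principal A"
proof -
  have f0: "f 0 = (\<lambda>_. 0)" using scale[of 0 0] by simp
  have fz: "v = 0" if "f v = (\<lambda>_. 0)" for v using injD[OF inj, of v 0] that f0 by simp
  have sup: "list_sum \<tau> bs = l" if "A *v v = l *s v" "f v bs \<noteq> 0" for v l bs
    using act[of v bs] that by (simp add: scale)
  have val: "\<exists>n\<le>N. l = of_real (real N / 2 - real n)" if v: "A *v v = l *s v" "v \<noteq> 0" for v l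
  proof -
    have "f v \<in> ext_power k" using ker by (auto simp: ext_kernel_def)
    then obtain bs n where "n \<le> N" "list_sum \<tau> bs = of_real (real N / 2 - real n)" "f v bs \<noteq> 0"
      using sgr fz v(2) unfolding simple_graded_def by blast
    then show ?thesis using sup[OF v(1)] by metis
  qed
  have dim: "vec.dim (eigenspace A (of_real (real N / 2 - real n))) = 1" if n: "n \<le> N" for n
  proof -
    let ?l = "of_real (real N / 2 - real n) :: complex"
    obtain v where v: "v \<noteq> 0" "A *v v = ?l *s v" using att[OF n] by blast
    obtain b0 where b0: "\<And>x. x \<in> ext_kernel k \<Longrightarrow> (\<And>bs. x bs \<noteq> 0 \<Longrightarrow> list_sum \<tau> bs = ?l) \<Longrightarrow> x b0 = 0 \<Longrightarrow> x = (\<lambda>_. 0)"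
      using sgr unfolding simple_graded_def by metis
    have e0: "u = 0" if "A *v u = ?l *s u" "f u b0 = 0" for u
      by (rule fz, rule b0) (use ker sup[OF that(1)] that(2) in auto)
    have "eigenspace A ?l = vec.span {v}"
    proof
      show "eigenspace A ?l \<subseteq> vec.span {v}"
      proof
        fix u assume "u \<in> eigenspace A ?l"
        then have u: "A *v u = ?l *s u" by (simp add: eigenspace_def)
        define c where "c = f u b0 / f v b0"
        have "f v b0 \<noteq> 0" using e0 v by blast
        have e: "u - c *s v = u + (- c) *s v" by simp
        have "f (u - c *s v) b0 = 0" unfolding e add scale using \<open>f v b0 \<noteq> 0\<close> by (simp add: c_def)
        moreover have "A *v (u - c *s v) = ?l *s (u - c *s v)"
          by (simp add: matrix_vector_mult_diff_distrib vector_scalar_commute u v(2) vec.scale_right_diff_distrib vec.scale_left_commute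
              del: of_real_diff of_real_divide)
        ultimately have "u - c *s v = 0" by (intro e0)
        then have "u = c *s v" by simp
        then show "u \<in> vec.span {v}" unfolding vec.span_singleton by blast
      qed
      show "vec.span {v} \<subseteq> eigenspace A ?l"
        unfolding vec.span_singleton eigenspace_def using v(2)
        by (auto simp: vector_scalar_commute vec.scale_left_commute simp del: of_real_diff of_real_divide)
    qed
    then show ?thesis using v(1) by (simp add: vec.dim_span vec.dim_insert)
  qed
  show ?thesis unfolding is_principal_def
  proof (intro exI[of _ "real N / 2"] conjI allI impI)
    have "vec.dim (eigenspace A (of_real (real N / 2 - real 0))) = 1" using dim[of 0] by simp
    from dim_1_nontrivial[OF this] show "eigenspace A (of_real (real N / 2)) \<noteq> {0}" by simp
    show "l \<le> of_real (real N / 2)" if el: "eigenspace A l \<noteq> {0}" for l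
    proof -
      obtain v where "v \<noteq> 0" "A *v v = l *s v" using el unfolding eigenspace_nontrivial by blast
      then obtain n where "l = of_real (real N / 2 - real n)" using val by blast
      then show ?thesis by (simp add: less_eq_complex_def)
    qed
    show "vec.dim (eigenspace A (of_real (real N / 2 - real n))) = 1" if "real n \<le> 2 * (real N / 2)" for n
      using that by (intro dim) simp
  qed
qed

text \<open>The parity of \<open>w\<close> makes all eigenvalues congruent modulo 1, and
  \<open>conj\<close> makes the spectrum symmetric about 0. Hence the values from the maximum
  \<open>m\<close> down to \<open>- m\<close> in steps of 1, at which \<open>is_principal\<close>
  asks for lines, exhaust the spectrum.\<close>

lemma principal_spectrum:
  fixes A :: "complex^'v^'v"
  assumes p: "is_principal A" and span: "vec.span {y. \<exists>k::int. even (k - w) \<and> A *v y = (of_int k / 2) *s y} = UNIV"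
    and conj: "\<And>x. A *v cnj_vec x = - cnj_vec (A *v x)"
  shows "\<exists>N. (\<forall>\<kappa>. (\<exists>x. x \<noteq> 0 \<and> A *v x = \<kappa> *s x) \<longleftrightarrow> (\<exists>n\<le>N. \<kappa> = of_real (real N / 2 - real n))) \<and>
    (\<forall>\<kappa> x y. A *v x = \<kappa> *s x \<longrightarrow> A *v y = \<kappa> *s y \<longrightarrow> y \<noteq> 0 \<longrightarrow> (\<exists>c. x = c *s y)) \<and> diagonalizable A"
proof -
  let ?L = "{of_int k / 2 :: complex | k. even (k - w)}"
  have span': "vec.span {y. \<exists>k\<in>?L. A *v y = k *s y} = UNIV"
  proof -
    have "{y. \<exists>k\<in>?L. A *v y = k *s y} = {y. \<exists>k::int. even (k - w) \<and> A *v y = (of_int k / 2) *s y}" by blast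
    then show ?thesis using span by simp
  qed
  have half: "\<exists>k. even (k - w) \<and> \<kappa> = of_int k / 2" if "x \<noteq> 0" "A *v x = \<kappa> *s x" for x \<kappa>
    using eigen_span_zero[where x = x and A = A and L = ?L and a = \<kappa>] that span' by blast
  have neg: "\<exists>y. y \<noteq> 0 \<and> A *v y = (- of_int k / 2) *s y" if x: "x \<noteq> 0" "A *v x = (of_int k / 2) *s x" for x and k :: int
  proof (intro exI[of _ "cnj_vec x"] conjI)
    show "cnj_vec x \<noteq> 0" using x(1) by (auto simp: cnj_vec_def vec_eq_iff)
    show "A *v cnj_vec x = (- of_int k / 2) *s cnj_vec x" unfolding conj x(2) by (simp add: cnj_vec_def vec_eq_iff)
  qed
  obtain m where m: "eigenspace A (of_real m) \<noteq> {0}" "\<And>l. eigenspace A l \<noteq> {0} \<Longrightarrow> l \<le> of_real m"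
    "\<And>k. real k \<le> 2 * m \<Longrightarrow> vec.dim (eigenspace A (of_real (m - real k))) = 1"
    using p unfolding is_principal_def by blast
  note es = eigenspace_nontrivial[of A]
  obtain x where x: "x \<noteq> 0" "A *v x = of_real m *s x" using m(1) es by blast
  obtain k0 where k0: "even (k0 - w)" "of_real m = (of_int k0 / 2 :: complex)" using half[OF x] by blast
  have m0: "m = of_int k0 / 2" using arg_cong[OF k0(2), of Re] by simp
  have le: "k \<le> k0" if "x \<noteq> 0" "A *v x = (of_int k / 2) *s x" for k x
  proof -
    have "of_int k / 2 \<le> complex_of_real m" using that es by (intro m(2)) blast
    then have "of_int k / 2 \<le> m" by (simp add: less_eq_complex_def)
    then show ?thesis unfolding m0 by simp
  qed
  have le': "- k \<le> k0" if "x \<noteq> 0" "A *v x = (of_int k / 2) *s x" for k x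
    using neg[OF that] le[of _ "- k"] by auto
  define N where "N = nat k0"
  have "0 \<le> k0" using le'[OF x(1)] x(2) k0(2) by force
  then have N: "real N / 2 = m" by (simp add: N_def m0)
  have spec: "(\<exists>x. x \<noteq> 0 \<and> A *v x = \<kappa> *s x) \<longleftrightarrow> (\<exists>n\<le>N. \<kappa> = of_real (real N / 2 - real n))" for \<kappa>
  proof
    assume "\<exists>x. x \<noteq> 0 \<and> A *v x = \<kappa> *s x"
    then obtain x where x: "x \<noteq> 0" "A *v x = \<kappa> *s x" by blast
    obtain k where k: "even (k - w)" "\<kappa> = of_int k / 2" using half[OF x] by blast
    have "k \<le> k0" "- k \<le> k0" using le le' x unfolding k(2) by blast+
    moreover obtain n where n: "k0 - k = 2 * n" using k(1) k0(1) by (metis add_diff_cancel_right' diff_add_cancel even_diff evenE even_add)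
    ultimately have "nat n \<le> N" "\<kappa> = of_real (real N / 2 - real (nat n))"
      using \<open>0 \<le> k0\<close> unfolding N_def k(2) by (auto simp: field_simps complex_eq_iff)
    then show "\<exists>n\<le>N. \<kappa> = of_real (real N / 2 - real n)" by blast
  next
    assume "\<exists>n\<le>N. \<kappa> = of_real (real N / 2 - real n)"
    then obtain n where n: "n \<le> N" "\<kappa> = of_real (real N / 2 - real n)" by blast
    then have "vec.dim (eigenspace A \<kappa>) = 1" using m(3)[of n] N by simp
    from dim_1_nontrivial[OF this] show "\<exists>x. x \<noteq> 0 \<and> A *v x = \<kappa> *s x" unfolding es .
  qed
  have "\<exists>c. x = c *s y" if xy: "A *v x = \<kappa> *s x" "A *v y = \<kappa> *s y" "y \<noteq> 0" for \<kappa> x y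
  proof -
    obtain n where n: "n \<le> N" "\<kappa> = of_real (real N / 2 - real n)" using spec xy by blast
    then have "vec.dim (eigenspace A \<kappa>) = 1" using m(3)[of n] N by simp
    then have "eigenspace A \<kappa> \<subseteq> vec.span {y}"
      using xy by (intro vec.card_ge_dim_independent) (auto simp: eigenspace_def vec.dependent_single)
    then show ?thesis using xy(1) by (auto simp: eigenspace_def vec.span_singleton)
  qed
  moreover have "diagonalizable A"
  proof -
    have "vec.span {y. \<exists>k\<in>?L. A *v y = k *s y} \<subseteq> vec.span {y. \<exists>k. A *v y = k *s y}" by (rule vec.span_mono) blast
    then show ?thesis unfolding diagonalizable_def span' by blast
  qed
  ultimately show ?thesis using spec by blast
qed

text \<open>These are wedge products of distinct basis vectors of type \<open>Inl\<close>. No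
  opposite indices meet in their support, so the contraction kills them; the support consists of
  rearrangements of one multiset, from which degree and weight are read off.\<close>

lemma top_tensor:
  fixes i j k :: "'r::finite"
  shows "\<exists>y\<in>ext_kernel 1. y \<noteq> (\<lambda>_. 0) \<and> (\<forall>bs. y bs \<noteq> 0 \<longrightarrow> mset bs = {#Inl i#})"
    and "i \<noteq> j \<Longrightarrow> \<exists>y\<in>ext_kernel 2. y \<noteq> (\<lambda>_. 0) \<and> (\<forall>bs. y bs \<noteq> 0 \<longrightarrow> mset bs = {#Inl i, Inl j#})"
    and "i \<noteq> j \<Longrightarrow> i \<noteq> k \<Longrightarrow> j \<noteq> k \<Longrightarrow>
      \<exists>y\<in>ext_kernel 3. y \<noteq> (\<lambda>_. 0) \<and> (\<forall>bs. y bs \<noteq> 0 \<longrightarrow> mset bs = {#Inl i, Inl j, Inl k#})"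
proof -
  define e :: "'r \<Rightarrow> 'r + 'r \<Rightarrow> complex" where "e n b = (if b = Inl n then 1 else 0)" for n b
  have e: "e n (Inl m) = (if m = n then 1 else 0)" "e n (Inr m) = 0" for n m by (auto simp: e_def)
  have e0: "e n a * e m (bar a) = 0" for n m a by (cases a) (simp_all add: e_def)
  define y1 where "y1 bs = (if length bs = 1 then e i (bs ! 0) else 0)" for bs
  have "y1 \<in> ext_kernel 1" by (auto simp: ext_kernel_def ext_power_def y1_def contraction_def)
  moreover have "y1 [Inl i] \<noteq> 0" by (simp add: y1_def e)
  moreover have "\<forall>bs. y1 bs \<noteq> 0 \<longrightarrow> mset bs = {#Inl i#}"
    by (auto simp: y1_def e_def length_Suc_conv split: if_splits)
  ultimately show "\<exists>y\<in>ext_kernel 1. y \<noteq> (\<lambda>_. 0) \<and> (\<forall>bs. y bs \<noteq> 0 \<longrightarrow> mset bs = {#Inl i#})"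
    by (intro bexI[of _ y1]) auto
  show "\<exists>y\<in>ext_kernel 2. y \<noteq> (\<lambda>_. 0) \<and> (\<forall>bs. y bs \<noteq> 0 \<longrightarrow> mset bs = {#Inl i, Inl j#})" if ij: "i \<noteq> j"
  proof -
    define y2 where "y2 bs = (if length bs = 2 then e i (bs ! 0) * e j (bs ! 1) - e j (bs ! 0) * e i (bs ! 1) else 0)" for bs
    have "y2 (bs[p := bs ! q, q := bs ! p]) = - y2 bs" if pq: "length bs = 2" "p < q" "q < 2" for bs p q
    proof -
      have "p = 0" "q = 1" using pq by auto
      moreover obtain a b where "bs = [a, b]" using pq by (auto simp: length_Suc_conv numeral_2_eq_2)
      ultimately show ?thesis by (simp add: y2_def algebra_simps)
    qed
    then have "y2 \<in> ext_power 2" unfolding ext_power_def by (auto simp: y2_def)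
    then have "y2 \<in> ext_kernel 2" by (auto simp: ext_kernel_def contraction_def y2_def e0 intro!: sum.neutral)
    moreover have "y2 [Inl i, Inl j] \<noteq> 0" using ij by (simp add: y2_def e)
    moreover have "mset bs = {#Inl i, Inl j#}" if nz: "y2 bs \<noteq> 0" for bs
    proof -
      have "length bs = 2" using nz by (auto simp: y2_def split: if_splits)
      then obtain a b where bs: "bs = [a, b]" by (auto simp: length_Suc_conv numeral_2_eq_2)
      then have "e i a * e j b \<noteq> 0 \<or> e j a * e i b \<noteq> 0" using nz by (auto simp: y2_def)
      then show ?thesis unfolding bs by (auto simp: e_def split: if_splits)
    qed
    ultimately show ?thesis by (intro bexI[of _ y2]) auto
  qed
  show "\<exists>y\<in>ext_kernel 3. y \<noteq> (\<lambda>_. 0) \<and> (\<forall>bs. y bs \<noteq> 0 \<longrightarrow> mset bs = {#Inl i, Inl j, Inl k#})"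
    if ij: "i \<noteq> j" "i \<noteq> k" "j \<noteq> k"
  proof -
    define d where "d a b c = e i a * (e j b * e k c - e k b * e j c) - e j a * (e i b * e k c - e k b * e i c)
      + e k a * (e i b * e j c - e j b * e i c)" for a b c
    define y3 where "y3 bs = (if length bs = 3 then d (bs ! 0) (bs ! 1) (bs ! 2) else 0)" for bs
    have alt: "d b a c = - d a b c" "d c b a = - d a b c" "d a c b = - d a b c" for a b c
      by (simp_all add: d_def algebra_simps)
    have "y3 (bs[p := bs ! q, q := bs ! p]) = - y3 bs" if pq: "length bs = 3" "p < q" "q < 3" for bs p q
    proof -
      consider "p = 0 \<and> q = 1" | "p = 0 \<and> q = 2" | "p = 1 \<and> q = 2" using pq by linarith
      moreover obtain a b c where bs: "bs = [a, b, c]" using pq by (auto simp: length_Suc_conv numeral_3_eq_3)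
      ultimately show ?thesis
        by cases (simp_all add: y3_def bs, (subst alt, simp)?, (subst alt(2), simp)?, (subst alt(3), simp)?)
    qed
    then have "y3 \<in> ext_power 3" unfolding ext_power_def by (auto simp: y3_def)
    moreover have "d a (bar a) c = 0" for a c by (cases a) (simp_all add: d_def e algebra_simps)
    ultimately have "y3 \<in> ext_kernel 3"
      by (auto simp: ext_kernel_def contraction_def y3_def intro!: sum.neutral)
    moreover have "y3 [Inl i, Inl j, Inl k] \<noteq> 0" using ij by (simp add: y3_def e d_def)
    moreover have "mset bs = {#Inl i, Inl j, Inl k#}" if nz: "y3 bs \<noteq> 0" for bs
    proof -
      have "length bs = 3" using nz by (auto simp: y3_def split: if_splits)
      then obtain a b c where bs: "bs = [a, b, c]" by (auto simp: length_Suc_conv numeral_3_eq_3)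
      then have "d a b c \<noteq> 0" using nz by (auto simp: y3_def)
      then show ?thesis unfolding bs d_def by (auto simp: e_def split: if_splits)
    qed
    ultimately show ?thesis by (intro bexI[of _ y3]) auto
  qed
qed

lemma mset_tensor_action:
  assumes "\<And>bs. y bs \<noteq> 0 \<Longrightarrow> mset bs = M"
  shows "tensor_action (Xm a a) y = (\<lambda>bs. (of_nat (count M a) - of_nat (count M (bar a))) * y bs)"
proof
  fix bs
  have "(\<Sum>b\<leftarrow>bs. Xm a a $ b $ b) = of_nat (count (mset bs) a) - of_nat (count (mset bs) (bar a))"
    by (induction bs) (auto simp: Xm_def)
  then show "tensor_action (Xm a a) y bs = (of_nat (count M a) - of_nat (count M (bar a))) * y bs"
    using assms[of bs] Xm_diag[of a] by (subst tensor_action_diag) (auto simp: sp_diag_def)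
qed

context sp_rep begin

lemma weights_flip_coordinate:
  assumes U: "submod U" and l: "l \<in> weights U"
  shows "\<exists>l'\<in>weights U. \<forall>j. l' (Inl j) = (if j = i then - l (Inl j) else l (Inl j))"
  using weights_bar[OF l, of "Inl i"]
  by (intro bexI[OF _ weights_flip[OF U l, of "Inl i"]]) (auto simp: swp_def)

lemma weights_lower_pair:
  assumes U: "submod U" and l: "l \<in> weights U" "l (Inl i) = 1" "l (Inl j) = 1" and ij: "i \<noteq> j"
  shows "\<exists>l'\<in>weights U. \<forall>n. l' (Inl n) = (if n = i \<or> n = j then 0 else l (Inl n))"
proof -
  have "(\<lambda>c. l c - int 1 * root (Inl i) (Inr j) c) \<in> weights U"
    by (rule weights_string[OF U l(1)]) (use weights_bar[OF l(1), of "Inl j"] l ij in \<open>auto simp: pairing_def\<close>)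
  then show ?thesis using l ij by (intro bexI) (auto simp: root_def)
qed

end

lemma sp_sum: "(\<And>i. i \<in> S \<Longrightarrow> A i \<in> sp) \<Longrightarrow> (\<Sum>i\<in>S. A i) \<in> sp"
  by (induction S rule: infinite_finite_induct) (auto intro: sp_0 sp_add)

text \<open>The factor 1/2 accounts for \<open>Xm a b\<close> and \<open>Xm (bar b) (bar a)\<close>
  being proportional: most root vectors are counted twice, and the long ones, counted once, are
  twice an elementary matrix.\<close>

lemma sp_expand:
  assumes A: "A \<in> sp"
  shows "A = (\<Sum>a\<in>UNIV. \<Sum>b\<in>UNIV. scale_mat (A $ a $ b / 2) (Xm a b))"
proof -
  have "(\<Sum>a\<in>UNIV. \<Sum>b\<in>UNIV. A $ a $ b / 2 * Xm a b $ p $ q) = A $ p $ q" for p q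
  proof -
    have d: "A $ a $ b / 2 * Xm a b $ p $ q =
      (if b = q then if a = p then A $ a $ b / 2 else 0 else 0)
       - (if b = bar p then if a = bar q then sg a * sg b * A $ a $ b / 2 else 0 else 0)" for a b
      by (auto simp: Xm_def)
    have "(\<Sum>a\<in>UNIV. \<Sum>b\<in>UNIV. A $ a $ b / 2 * Xm a b $ p $ q) = A $ p $ q / 2 - sg q * sg p * A $ bar q $ bar p / 2"
      unfolding d by (simp add: sum_subtractf)
    also have "sg q * sg p * A $ bar q $ bar p = - A $ p $ q"
      using spD[OF A, of "bar p" q] by (simp add: mult.commute)
    finally show ?thesis by simp
  qed
  then show ?thesis by (simp add: vec_eq_iff)
qed

lemma sp_diag_expand:
  assumes A: "A \<in> sp_diag"
  shows "A = (\<Sum>i\<in>UNIV. scale_mat (A $ Inl i $ Inl i) (Xm (Inl i) (Inl i)))"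
proof -
  have X: "Xm (Inl i) (Inl i) $ p $ q = 0" if "p \<noteq> q" for i and p q :: "'a + 'a" using that by (auto simp: Xm_def)
  have X1: "Xm (Inl i) (Inl i) $ Inl j $ Inl j = (if i = j then 1 else 0)"
    "Xm (Inl i) (Inl i) $ Inr j $ Inr j = - (if i = j then 1 else 0)" for i j :: 'a by (auto simp: Xm_def)
  have D: "(\<Sum>i\<in>UNIV. A $ Inl i $ Inl i * Xm (Inl i) (Inl i) $ p $ p) = A $ p $ p" for p
    using sp_diag_bar[OF A, of "Inl (projr p)"]
    by (cases p) (simp_all only: X1, simp_all add: sum_negf if_distrib cong: if_cong)
  have "(\<Sum>i\<in>UNIV. A $ Inl i $ Inl i * Xm (Inl i) (Inl i) $ p $ q) = A $ p $ q" for p q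
    using A D[of p] X[of p q] by (cases "p = q") (simp_all add: sp_diag_def)
  then show ?thesis by (simp add: vec_eq_iff)
qed

lemma Xm_skew: "Xm (bar b) (bar a) = scale_mat (- (sg a * sg b)) (Xm a b)"
proof -
  have "sg a * sg b * (sg a * sg b) = (sg a * sg a) * (sg b * sg b)" by (simp only: mult_ac)
  then have "sg a * sg b * (sg a * sg b) = 1" by simp
  then show ?thesis by (auto simp: vec_eq_iff Xm_def mult.commute)
qed

section \<open>The grading element of a Hodge representation\<close>

locale sp_module = algebraic_hom K G H \<pi> + sp_frame "lie_alg G" \<theta> t
  for K :: "complex set" and G :: "(complex^'n^'n) set" and H :: "(complex^'v^'v) set"
    and \<pi> :: "complex^'n^'n \<Rightarrow> complex^'v^'v"
    and \<theta> :: "complex^'n^'n \<Rightarrow> complex^('r::finite + 'r)^('r + 'r)" and t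
begin

definition P :: "complex^('r + 'r)^('r + 'r) \<Rightarrow> complex^'v^'v" where
  "P A = \<rho> (inv_theta A)"

definition RR :: "'r + 'r \<Rightarrow> 'r + 'r \<Rightarrow> complex^'v^'v" where
  "RR a b = \<rho> (Xg a b)"

lemma RR_P: "RR a b = P (Xm a b)"
  by (simp add: RR_def P_def Xg_def)

lemma rho_P: "X \<in> lie_alg G \<Longrightarrow> \<rho> X = P (\<theta> X)"
  by (simp add: P_def inv_theta_theta)

lemma sp_bracket:
  fixes A B :: "complex^('r + 'r)^('r + 'r)"
  shows "A \<in> sp \<Longrightarrow> B \<in> sp \<Longrightarrow> lie_bracket A B \<in> sp"
  using theta_sp[OF g_bracket[OF inv_theta(1) inv_theta(1)], of A B] by (simp add: theta_bracket inv_theta)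

lemma P_add: "A \<in> sp \<Longrightarrow> B \<in> sp \<Longrightarrow> P (A + B) = P A + P B"
proof -
  assume AB: "A \<in> sp" "B \<in> sp"
  have "inv_theta (A + B) = inv_theta A + inv_theta B"
    by (rule theta_inj) (simp_all add: AB sp_add inv_theta g_add theta_add)
  then show ?thesis by (simp add: P_def differential_add inv_theta AB)
qed

lemma P_scale: "A \<in> sp \<Longrightarrow> P (scale_mat c A) = scale_mat c (P A)"
proof -
  assume A: "A \<in> sp"
  have "inv_theta (scale_mat c A) = scale_mat c (inv_theta A)"
    by (rule theta_inj) (simp_all add: A sp_scale inv_theta g_scale theta_scale)
  then show ?thesis by (simp add: P_def differential_scale inv_theta A)
qed

lemma P_bracket: "A \<in> sp \<Longrightarrow> B \<in> sp \<Longrightarrow> P (lie_bracket A B) = lie_bracket (P A) (P B)"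
proof -
  assume AB: "A \<in> sp" "B \<in> sp"
  have "inv_theta (lie_bracket A B) = lie_bracket (inv_theta A) (inv_theta B)"
    by (rule theta_inj) (simp_all add: AB sp_bracket inv_theta g_bracket theta_bracket)
  then show ?thesis by (simp add: P_def differential_bracket inv_theta AB)
qed

lemma P_0: "P 0 = 0"
  using P_scale[OF sp_0, of 0] by simp

lemma P_if: "P (if b then A else 0) = (if b then P A else 0)"
  by (simp add: P_0)

lemma P_diff: "A \<in> sp \<Longrightarrow> B \<in> sp \<Longrightarrow> P (A - B) = P A - P B"
  using P_add[of A "scale_mat (-1) B"] P_scale[of B "-1"] sp_scale[of B "-1"] by (simp add: scale_mat_minus_one)

lemma P_sum: "(\<And>i. i \<in> S \<Longrightarrow> A i \<in> sp) \<Longrightarrow> P (\<Sum>i\<in>S. A i) = (\<Sum>i\<in>S. P (A i))"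
  by (induction S rule: infinite_finite_induct) (auto simp: P_0 P_add sp_sum)

sublocale sp_rep RR
proof
  fix a b c d :: "'r + 'r"
  have i: "(if b then Xm p q else 0) \<in> sp" for b and p q :: "'r + 'r" by (simp add: Xm_sp sp_0)
  show "lie_bracket (RR a b) (RR c d) = (if b = c then RR a d else 0) - (if d = a then RR c b else 0)
      - scale_mat (sg a * sg b) ((if c = bar a then RR (bar b) d else 0) - (if d = bar b then RR c (bar a) else 0))"
    unfolding RR_P P_bracket[OF Xm_sp Xm_sp, symmetric] Xm_bracket
    by (simp only: P_diff P_scale P_if i sp_diff sp_scale)
  show "RR (bar b) (bar a) = scale_mat (- (sg a * sg b)) (RR a b)"
    unfolding RR_P Xm_skew by (rule P_scale[OF Xm_sp])
qed

lemma rho_expand: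
  assumes X: "X \<in> lie_alg G"
  shows "\<rho> X *v x = (\<Sum>a\<in>UNIV. \<Sum>b\<in>UNIV. (\<theta> X $ a $ b / 2) *s (RR a b *v x))"
proof -
  have "\<rho> X = (\<Sum>a\<in>UNIV. \<Sum>b\<in>UNIV. scale_mat (\<theta> X $ a $ b / 2) (RR a b))"
    unfolding rho_P[OF X] RR_P
    by (subst sp_expand[OF theta_sp[OF X]]) (simp add: P_sum sp_sum sp_scale Xm_sp P_scale)
  then show ?thesis by (simp add: sum_mv scale_mv)
qed

lemma rho_t:
  assumes X: "X \<in> t"
  shows "\<rho> X = (\<Sum>i\<in>UNIV. scale_mat (wt (Inl i) X) (RR (Inl i) (Inl i)))"
proof -
  have "X \<in> lie_alg G" using X tg by blast
  then have "\<rho> X = P (\<theta> X)" by (rule rho_P)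
  also have "\<dots> = P (\<Sum>i\<in>UNIV. scale_mat (\<theta> X $ Inl i $ Inl i) (Xm (Inl i) (Inl i)))"
    by (subst sp_diag_expand[OF theta_t[OF X]]) (rule refl)
  also have "\<dots> = (\<Sum>i\<in>UNIV. scale_mat (wt (Inl i) X) (RR (Inl i) (Inl i)))"
    by (simp add: P_sum sp_scale Xm_sp P_scale RR_P wt_def)
  finally show ?thesis .
qed

lemma rho_t_wt:
  assumes "X \<in> t" "has_wt l x"
  shows "\<rho> X *v x = (\<Sum>i\<in>UNIV. wt (Inl i) X * of_int (l (Inl i))) *s x"
  unfolding rho_t[OF assms(1)] using assms(2) by (simp add: sum_mv scale_mv has_wt_def vec.scale_sum_left)

lemma submod_rho: "submod U \<longleftrightarrow> vec.subspace U \<and> (\<forall>X\<in>lie_alg G. \<forall>x\<in>U. \<rho> X *v x \<in> U)"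
proof
  assume U: "submod U"
  then show "vec.subspace U \<and> (\<forall>X\<in>lie_alg G. \<forall>x\<in>U. \<rho> X *v x \<in> U)"
    by (auto simp: submod_def rho_expand intro!: vec.subspace_sum vec.subspace_scale)
qed (auto simp: submod_def RR_def Xg)

text \<open>Moving \<open>\<rho> X\<close> past \<open>\<pi> h\<close> replaces \<open>X\<close> by
  its conjugate under the inverse of \<open>h\<close>, which again lies in the Lie algebra. This
  covers elements of \<open>G\<close> outside the identity component.\<close>

lemma submod_translate:
  assumes U: "submod U" and h: "h \<in> G"
  shows "submod ((*v) (\<pi> h) ` U)"
  unfolding submod_rho
proof (intro conjI ballI)
  show "vec.subspace ((*v) (\<pi> h) ` U)"
    using U unfolding submod_def by (intro vec.subspace_image matrix_vector_mul_linear_gen) blast+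
  fix X x assume X: "X \<in> lie_alg G" and "x \<in> (*v) (\<pi> h) ` U"
  then obtain u where u: "u \<in> U" "x = \<pi> h *v u" by blast
  let ?Y = "matrix_inv h ** X ** matrix_inv (matrix_inv h)"
  have hh: "h ** matrix_inv h = mat 1" using matrix_inv_mult[OF Ginv[OF h]] by blast
  have hh': "matrix_inv h ** matrix_inv (matrix_inv h) = mat 1" using matrix_inv_mult[OF Ginv[OF Gi[OF h]]] by blast
  have hi: "matrix_inv (matrix_inv h) = h"
    using hh hh' by (metis matrix_mul_assoc matrix_mul_lid matrix_mul_rid)
  have Y: "?Y \<in> lie_alg G" by (rule lie_alg_conj[OF X Gi[OF h]])
  have "h ** ?Y ** matrix_inv h = (h ** matrix_inv h) ** X ** (h ** matrix_inv h)"
    unfolding hi by (simp add: matrix_mul_assoc)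
  then have "\<pi> h ** \<rho> ?Y = \<rho> X ** \<pi> h" using differential_Ad[OF Y h] by (simp add: hh)
  then have "\<rho> X *v x = \<pi> h *v (\<rho> ?Y *v u)" unfolding u(2) by (metis matrix_vector_mul_assoc)
  moreover have "\<rho> ?Y *v u \<in> U" using U u Y unfolding submod_rho by blast
  ultimately show "\<rho> X *v x \<in> (*v) (\<pi> h) ` U" by blast
qed

lemma translate_inverse:
  assumes h: "h \<in> G"
  shows "(*v) (\<pi> h) ` ((*v) (\<pi> (matrix_inv h)) ` U) = U" "(*v) (\<pi> (matrix_inv h)) ` ((*v) (\<pi> h) ` U) = U"
  by (simp_all add: image_image matrix_vector_mul_assoc pi_inv[OF h])

lemma min_submod_translate:
  assumes U: "min_submod U" and h: "h \<in> G"
  shows "min_submod ((*v) (\<pi> h) ` U)"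
  unfolding min_submod_def
proof (intro conjI allI impI)
  show "submod ((*v) (\<pi> h) ` U)" using U h submod_translate unfolding min_submod_def by blast
  have z: "(*v) M ` {0} = {0}" for M :: "complex^'v^'v" by simp
  show "(*v) (\<pi> h) ` U \<noteq> {0}"
    using U translate_inverse(2)[OF h, of U] z[of "\<pi> (matrix_inv h)"] unfolding min_submod_def by metis
  fix W assume W: "submod W" "W \<subseteq> (*v) (\<pi> h) ` U"
  let ?W = "(*v) (\<pi> (matrix_inv h)) ` W"
  have "submod ?W" by (rule submod_translate[OF W(1) Gi[OF h]])
  moreover have "?W \<subseteq> U" using image_mono[OF W(2), of "(*v) (\<pi> (matrix_inv h))"] translate_inverse(2)[OF h, of U] by simp
  ultimately have "?W = {0} \<or> ?W = U" using U unfolding min_submod_def by blast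
  then show "W = {0} \<or> W = (*v) (\<pi> h) ` U" using translate_inverse(1)[OF h, of W] z[of "\<pi> h"] by metis
qed

lemma dim_translate:
  assumes h: "h \<in> G"
  shows "vec.dim ((*v) (\<pi> h) ` U) = vec.dim U"
proof -
  have "inj ((*v) (\<pi> h))"
    by (rule inj_on_inverseI[of _ "(*v) (\<pi> (matrix_inv h))"]) (simp add: matrix_vector_mul_assoc pi_inv[OF h])
  then show ?thesis by (intro vec.dim_image_eq matrix_vector_mul_linear_gen) (auto intro: inj_on_subset)
qed

lemma tensor_equivariant:
  fixes f :: "complex^'v \<Rightarrow> ('r + 'r) list \<Rightarrow> complex"
  assumes add: "\<And>u w. f (u + w) = (\<lambda>bs. f u bs + f w bs)" and scale: "\<And>c u. f (c *s u) = (\<lambda>bs. c * f u bs)"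
    and eq: "\<And>a b u. f (RR a b *v u) = tensor_action (Xm a b) (f u)" and X: "X \<in> lie_alg G"
  shows "f (\<rho> X *v u) = tensor_action (\<theta> X) (f u)"
proof
  fix bs
  have sum: "f (\<Sum>i\<in>S. x i) bs = (\<Sum>i\<in>S. f (x i) bs)" for S and x :: "'x \<Rightarrow> complex^'v"
    using scale[of 0 0] by (induction S rule: infinite_finite_induct) (simp_all add: add)
  have "f (\<rho> X *v u) bs = tensor_action (\<Sum>a\<in>UNIV. \<Sum>b\<in>UNIV. scale_mat (\<theta> X $ a $ b / 2) (Xm a b)) (f u) bs"
    unfolding rho_expand[OF X] by (simp add: sum scale eq tensor_action_mat_sum tensor_action_mat_scale)
  then show "f (\<rho> X *v u) bs = tensor_action (\<theta> X) (f u) bs" using sp_expand[OF theta_sp[OF X]] by simp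
qed

end

section \<open>Change of frame for modules of tensors\<close>

lemma functional_linear_iff:
  "Vector_Spaces.linear (*s) (*) (h :: complex^'v \<Rightarrow> complex) \<longleftrightarrow> (\<forall>u w. h (u + w) = h u + h w) \<and> (\<forall>c u. h (c *s u) = c * h u)"
  unfolding Vector_Spaces.linear_iff using vec.vector_space_axioms vector_space_over_itself.vector_space_axioms by blast

text \<open>The matrices \<open>C ** \<theta>0 X ** B\<close> give the action in the adapted frame.
  Applying \<open>B\<close> or \<open>C\<close> in every slot turns an embedding that is equivariant
  for one frame into one for the other.\<close>

lemma submodule_of_ext_power_frame:
  fixes \<theta>0 :: "complex^'n^'n \<Rightarrow> complex^'b^'b" and B C :: "complex^'b^'b" and \<rho> :: "complex^'n^'n \<Rightarrow> complex^'v^'v"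
  assumes BC: "B ** C = mat 1" "C ** B = mat 1"
  shows "submodule_of_ext_power g \<rho> k \<theta>0 \<longleftrightarrow>
    (\<exists>f. (\<forall>u w. f (u + w) = (\<lambda>bs. f u bs + f w bs)) \<and> (\<forall>c u. f (c *s u) = (\<lambda>bs. c * f u bs)) \<and>
      inj f \<and> range f \<subseteq> ext_power k \<and> (\<forall>X\<in>g. \<forall>v. f (\<rho> X *v v) = tensor_action (C ** \<theta>0 X ** B) (f v)))"
    (is "?L \<longleftrightarrow> ?R")
proof
  have inj: "inj (tensor_map B)" if "B' ** B = mat 1" for B B' :: "complex^'b^'b"
    by (rule inj_on_inverseI[of _ "tensor_map B'"]) (rule ext, simp add: tensor_map_mult that tensor_map_one)
  {
    assume ?L
    then obtain f where f0: "(\<forall>bs. Vector_Spaces.linear (*s) (*) (\<lambda>v. f v bs)) \<and> inj f \<and> range f \<subseteq> ext_power k \<and>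
        (\<forall>X\<in>g. \<forall>v. f (\<rho> X *v v) = tensor_action (\<theta>0 X) (f v))"
      unfolding submodule_of_ext_power_def by (rule exE)
    have f: "\<And>u w bs. f (u + w) bs = f u bs + f w bs" "\<And>c u bs. f (c *s u) bs = c * f u bs"
      "inj f" "range f \<subseteq> ext_power k" "\<And>X v. X \<in> g \<Longrightarrow> f (\<rho> X *v v) = tensor_action (\<theta>0 X) (f v)"
      using f0 by (simp_all add: functional_linear_iff)
    have e: "f (u + w) = (\<lambda>bs. f u bs + f w bs)" "f (c *s u) = (\<lambda>bs. c * f u bs)" for u w c using f(1,2) by blast+
    have "(C ** \<theta>0 X ** B) ** C = C ** \<theta>0 X" for X
      using BC(1) by (metis matrix_mul_assoc matrix_mul_rid)
    then have "tensor_map C (f (\<rho> X *v v)) = tensor_action (C ** \<theta>0 X ** B) (tensor_map C (f v))" if "X \<in> g" for X v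
      unfolding f(5)[OF that] using tensor_map_action[of "C ** \<theta>0 X ** B" C "\<theta>0 X"] by auto
    moreover have "inj (\<lambda>v. tensor_map C (f v))" using inj_compose[OF inj[OF BC(1)] f(3)] by (simp add: comp_def)
    moreover have "tensor_map C (f v) \<in> ext_power k" for v by (rule tensor_map_ext_power) (use f(4) in blast)
    ultimately show ?R
      by (intro exI[of _ "\<lambda>v. tensor_map C (f v)"]) (auto simp: e tensor_map_add tensor_map_scale)
  }
  {
    assume ?R
    then obtain f where f0: "(\<forall>u w. f (u + w) = (\<lambda>bs. f u bs + f w bs)) \<and> (\<forall>c u. f (c *s u) = (\<lambda>bs. c * f u bs)) \<and>
      inj f \<and> range f \<subseteq> ext_power k \<and> (\<forall>X\<in>g. \<forall>v. f (\<rho> X *v v) = tensor_action (C ** \<theta>0 X ** B) (f v))"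
      by (rule exE)
    note f1 = conjunct2[OF conjunct2[OF f0]]
    note f = conjunct1[OF f0, rule_format] conjunct1[OF conjunct2[OF f0], rule_format] conjunct1[OF f1]
      conjunct1[OF conjunct2[OF f1]] conjunct2[OF conjunct2[OF f1], rule_format]
    have "\<theta>0 X ** B = B ** (C ** \<theta>0 X ** B)" for X
      using BC(1) by (metis matrix_mul_assoc matrix_mul_lid)
    then have "tensor_map B (f (\<rho> X *v v)) = tensor_action (\<theta>0 X) (tensor_map B (f v))" if "X \<in> g" for X v
      unfolding f(5)[OF that] using tensor_map_action[of "\<theta>0 X" B "C ** \<theta>0 X ** B"] by auto
    moreover have "inj (\<lambda>v. tensor_map B (f v))" using inj_compose[OF inj[OF BC(2)] f(3)] by (simp add: comp_def)
    moreover have "tensor_map B (f v) \<in> ext_power k" for v by (rule tensor_map_ext_power) (use f(4) in blast)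
    ultimately show ?L unfolding submodule_of_ext_power_def functional_linear_iff
      by (intro exI[of _ "\<lambda>v. tensor_map B (f v)"]) (auto simp: f(1,2) tensor_map_add tensor_map_scale)
  }
qed

lemma ext_power_1: "x \<in> ext_power 1 \<longleftrightarrow> (\<forall>bs. length bs \<noteq> 1 \<longrightarrow> x bs = 0)"
  by (auto simp: ext_power_def)

lemma tensor_action_singleton: "tensor_action A x [b] = (A *v (\<chi> a. x [a])) $ b"
  by (simp add: tensor_action_def matrix_vector_mult_def)

text \<open>Tensors of degree 1 are vectors indexed by singleton lists, and an injective equivariant
  map between spaces of the same dimension is an isomorphism.\<close>

lemma isomorphic_modulesI:
  fixes \<theta>0 :: "complex^'n^'n \<Rightarrow> complex^'b^'b" and f :: "complex^'v \<Rightarrow> 'b list \<Rightarrow> complex"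
  assumes BC: "B ** C = mat 1" "C ** B = mat 1" and card: "CARD('v) = CARD('b)"
    and add: "\<And>u w. f (u + w) = (\<lambda>bs. f u bs + f w bs)" and scale: "\<And>c u. f (c *s u) = (\<lambda>bs. c * f u bs)"
    and inj: "inj f" and ext: "range f \<subseteq> ext_power 1"
    and eq: "\<And>X v. X \<in> g \<Longrightarrow> f (\<rho> X *v v) = tensor_action (C ** \<theta>0 X ** B) (f v)"
  shows "isomorphic_modules g \<rho> \<theta>0"
proof -
  define F where "F v = B *v (\<chi> b. f v [b])" for v
  have lin: "Vector_Spaces.linear (*s) (*s) F"
    unfolding Vector_Spaces.linear_iff
  proof (intro conjI allI vec.vector_space_axioms)
    show "F (u + w) = F u + F w" for u w
      unfolding F_def matrix_vector_right_distrib[symmetric] by (rule arg_cong[of _ _ "(*v) B"]) (simp add: add vec_eq_iff)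
    show "F (c *s u) = c *s F u" for u c
      unfolding F_def vector_scalar_commute[symmetric] by (rule arg_cong[of _ _ "(*v) B"]) (simp add: scale vec_eq_iff)
  qed
  have injF: "inj F"
  proof (rule injI)
    fix u w assume "F u = F w"
    then have "C *v (B *v (\<chi> b. f u [b])) = C *v (B *v (\<chi> b. f w [b]))" by (simp add: F_def)
    then have 1: "f u [b] = f w [b]" for b unfolding matrix_vector_mul_assoc BC(2) by (simp add: vec_eq_iff)
    have "f u bs = f w bs" for bs
    proof (cases "length bs = 1")
      case True
      then obtain b where "bs = [b]" by (auto simp: length_Suc_conv)
      then show ?thesis using 1 by simp
    next
      case False
      then show ?thesis using ext unfolding image_subset_iff ext_power_1 by simp
    qed
    then have "f u = f w" by blast
    then show "u = w" using inj by (rule injD[rotated])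
  qed
  have "vec.dim (range F) = CARD('b)"
    using vec.dim_image_eq[OF lin, of UNIV] injF card by (simp only: vec_dim_card vec.span_UNIV)
  then have "vec.span (range F) = UNIV" by (metis vec.dim_eq_full vec.span_UNIV vec_dim_card)
  moreover have "vec.subspace (range F)"
    using lin unfolding Vector_Spaces.linear_iff vec.subspace_def
    by (metis (mono_tags, lifting) rangeE rangeI vec.scale_zero_left)
  ultimately have "surj F" by (metis vec.span_eq_iff)
  moreover have "F (\<rho> X *v v) = \<theta>0 X *v F v" if "X \<in> g" for X v
  proof -
    have "F (\<rho> X *v v) = (B ** (C ** \<theta>0 X ** B)) *v (\<chi> b. f v [b])"
      unfolding F_def matrix_vector_mul_assoc[symmetric]
      by (rule arg_cong[of _ _ "(*v) B"]) (simp add: eq[OF that] tensor_action_singleton vec_eq_iff matrix_vector_mul_assoc matrix_mul_assoc)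
    also have "B ** (C ** \<theta>0 X ** B) = \<theta>0 X ** B" using BC(1) by (metis matrix_mul_assoc matrix_mul_lid)
    finally show ?thesis by (simp add: F_def matrix_vector_mul_assoc)
  qed
  ultimately show ?thesis unfolding isomorphic_modules_def using lin injF by (intro exI[of _ F]) (simp add: bij_def)
qed

lemma isomorphic_modulesD:
  fixes \<theta>0 :: "complex^'n^'n \<Rightarrow> complex^'b^'b" and \<rho> :: "complex^'n^'n \<Rightarrow> complex^'v^'v"
  assumes BC: "B ** C = mat 1" "C ** B = mat 1" and iso: "isomorphic_modules g \<rho> \<theta>0"
  obtains f where "\<And>u w. f (u + w) = (\<lambda>bs. f u bs + f w bs)" "\<And>c u. f (c *s u) = (\<lambda>bs. c * f u bs)"
    "inj f" "range f \<subseteq> ext_power 1" "\<And>X v. X \<in> g \<Longrightarrow> f (\<rho> X *v v) = tensor_action (C ** \<theta>0 X ** B) (f v)"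
    "\<And>b. \<exists>v. \<forall>bs. f v bs = (if bs = [b] then 1 else 0)"
proof -
  obtain F where F: "Vector_Spaces.linear (*s) (*s) F" "bij F" "\<And>X v. X \<in> g \<Longrightarrow> F (\<rho> X *v v) = \<theta>0 X *v F v"
    using iso unfolding isomorphic_modules_def by blast
  define f where "f v bs = (if length bs = 1 then (C *v F v) $ hd bs else 0)" for v bs
  have lin: "F (u + w) = F u + F w" "F (c *s u) = c *s F u" for u w c
    using F(1) unfolding Vector_Spaces.linear_iff by blast+
  have E: "(\<chi> a. f v [a]) = C *v F v" for v by (simp add: f_def vec_eq_iff)
  have CB: "(C ** \<theta>0 X ** B) ** C = C ** \<theta>0 X" for X using BC(1) by (metis matrix_mul_assoc matrix_mul_rid)
  show thesis
  proof
    show "f (u + w) = (\<lambda>bs. f u bs + f w bs)" "f (c *s u) = (\<lambda>bs. c * f u bs)" for u w c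
      by (auto simp: f_def lin matrix_vector_right_distrib vector_scalar_commute)
    show "inj f"
    proof (rule injI)
      fix u w assume "f u = f w"
      then have "B *v (C *v F u) = B *v (C *v F w)" using E[of u] E[of w] by simp
      then have "F u = F w" unfolding matrix_vector_mul_assoc BC(1) by simp
      then show "u = w" using F(2) by (metis bij_is_inj injD)
    qed
    show "range f \<subseteq> ext_power 1" unfolding image_subset_iff ext_power_1 by (simp add: f_def)
    show "f (\<rho> X *v v) = tensor_action (C ** \<theta>0 X ** B) (f v)" if X: "X \<in> g" for X v
    proof
      fix bs
      show "f (\<rho> X *v v) bs = tensor_action (C ** \<theta>0 X ** B) (f v) bs"
      proof (cases "length bs = 1")
        case True
        then obtain b where b: "bs = [b]" by (auto simp: length_Suc_conv)
        show ?thesis unfolding b tensor_action_singleton E matrix_vector_mul_assoc CB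
          by (simp add: f_def F(3)[OF X] matrix_vector_mul_assoc)
      next
        case False
        then show ?thesis by (simp add: f_def tensor_action_def)
      qed
    qed
    show "\<exists>v. \<forall>bs. f v bs = (if bs = [b] then 1 else 0)" for b
    proof -
      obtain v where v: "F v = B *v axis b 1" using F(2) by (metis bij_pointE)
      have "f v bs = (if bs = [b] then 1 else 0)" for bs
        unfolding f_def v matrix_vector_mul_assoc BC(2) by (cases bs) (auto simp: axis_def)
      then show ?thesis by blast
    qed
  qed
qed

section \<open>Simple roots and submodules in an adapted frame\<close>

locale sp_based = sp_module K G H \<pi> \<theta> t
  for K :: "complex set" and G :: "(complex^'n^'n) set" and H :: "(complex^'v^'v) set"
    and \<pi> :: "complex^'n^'n \<Rightarrow> complex^'v^'v"
    and \<theta> :: "complex^'n^'n \<Rightarrow> complex^('r::finite + 'r)^('r + 'r)" and t +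
  fixes r :: nat and idx :: "nat \<Rightarrow> 'r" and \<sigma> :: "nat \<Rightarrow> complex^'n^'n \<Rightarrow> complex"
  assumes rank: "r = CARD('r)" "2 \<le> r" and idx: "bij_betw idx {1..r} UNIV"
    and sigma_long: "Y \<in> t \<Longrightarrow> \<sigma> r Y = 2 * wt (Inl (idx r)) Y"
    and sigma_short: "Y \<in> t \<Longrightarrow> i \<in> {1..<r} \<Longrightarrow> \<sigma> i Y = wt (Inl (idx i)) Y - wt (Inl (idx (Suc i))) Y"
begin

lemma idx_surj: "\<exists>i\<in>{1..r}. x = idx i"
  using idx unfolding bij_betw_def by (metis UNIV_I imageE)

lemma idx_inj: "i \<in> {1..r} \<Longrightarrow> j \<in> {1..r} \<Longrightarrow> idx i = idx j \<Longrightarrow> i = j"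
  using idx unfolding bij_betw_def by (meson inj_onD)

lemma sigma_cases:
  assumes "i \<in> {1..r}"
  obtains "i = r" | "i \<in> {1..<r}"
  using assms by fastforce

lemma sigma_add: "i \<in> {1..r} \<Longrightarrow> X \<in> t \<Longrightarrow> Y \<in> t \<Longrightarrow> \<sigma> i (X + Y) = \<sigma> i X + \<sigma> i Y"
  by (erule sigma_cases) (simp_all add: sigma_long sigma_short t_add wt_add)

lemma sigma_scale: "i \<in> {1..r} \<Longrightarrow> X \<in> t \<Longrightarrow> \<sigma> i (scale_mat c X) = c * \<sigma> i X"
  by (erule sigma_cases) (simp_all add: sigma_long sigma_short t_scale wt_scale algebra_simps)

lemma t_0: "0 \<in> t"
  using t_scale[OF Xg_t, of 0] by simp

lemma t_sum: "(\<And>j. j \<in> S \<Longrightarrow> F j \<in> t) \<Longrightarrow> (\<Sum>j\<in>S. F j) \<in> t"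
  by (induction S rule: infinite_finite_induct) (auto intro: t_0 t_add)

lemma additive_sum:
  assumes add: "\<And>X Y. X \<in> t \<Longrightarrow> Y \<in> t \<Longrightarrow> h (X + Y) = h X + (h Y :: complex)"
    and scale: "\<And>c X. X \<in> t \<Longrightarrow> h (scale_mat c X) = c * h X" and F: "\<And>j. j \<in> S \<Longrightarrow> F j \<in> t"
  shows "h (\<Sum>j\<in>S. scale_mat (c j) (F j)) = (\<Sum>j\<in>S. c j * h (F j))"
  using F
proof (induction S rule: infinite_finite_induct)
  case (insert j S)
  then show ?case by (simp add: add scale t_sum t_scale)
qed (use scale[OF t_0, of 0] in simp_all)

lemma wt_down:
  assumes X: "X \<in> t" and i: "i \<in> {1..<r}"
  shows "wt (Inl (idx i)) X = \<sigma> i X + wt (Inl (idx (Suc i))) X"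
  using sigma_short[OF X i] by simp

lemma sigma_eqI:
  assumes X: "X \<in> t" and Y: "Y \<in> t" and eq: "\<And>i. i \<in> {1..r} \<Longrightarrow> \<sigma> i X = \<sigma> i Y"
  shows "X = Y"
proof (rule wt_eqI[OF X Y])
  have "wt (Inl (idx i)) X = wt (Inl (idx i)) Y" if i: "1 \<le> i" "i \<le> r" for i
    using i(2)
  proof (induction rule: inc_induct)
    case base
    then show ?case using eq[of r] sigma_long[OF X] sigma_long[OF Y] rank by simp
  next
    case (step n)
    then show ?case using eq[of n] wt_down[OF X, of n] wt_down[OF Y, of n] i by simp
  qed
  then show "wt (Inl i) X = wt (Inl i) Y" for i using idx_surj[of i] by auto
qed

lemma sigma_dual_basis:
  assumes D: "dual_basis t r \<sigma> D" and X: "X \<in> t"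
  shows "(\<forall>i\<in>{1..r}. \<sigma> i X = c i) \<longleftrightarrow> X = (\<Sum>j\<in>{1..r}. scale_mat (c j) (D j))"
proof -
  have Dt: "D j \<in> t" and Ds: "\<sigma> i (D j) = (if i = j then 1 else 0)" if "i \<in> {1..r}" "j \<in> {1..r}" for i j
    using D that unfolding dual_basis_def by auto
  have s: "\<sigma> i (\<Sum>j\<in>{1..r}. scale_mat (c j) (D j)) = c i" if i: "i \<in> {1..r}" for i
  proof -
    have "\<sigma> i (\<Sum>j\<in>{1..r}. scale_mat (c j) (D j)) = (\<Sum>j\<in>{1..r}. c j * \<sigma> i (D j))"
      by (rule additive_sum) (use i Dt[OF i] sigma_add sigma_scale in auto)
    also have "\<dots> = (\<Sum>j\<in>{1..r}. if i = j then c j else 0)" by (rule sum.cong) (use Ds[OF i] in auto)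
    finally show ?thesis using i by simp
  qed
  have "(\<Sum>j\<in>{1..r}. scale_mat (c j) (D j)) \<in> t" using Dt by (intro t_sum t_scale) auto
  then show ?thesis using sigma_eqI[OF X] s by auto
qed

text \<open>The last coordinate vector is the coroot of \<open>\<sigma> r\<close>, and the other
  simple coroots are differences of consecutive coordinate vectors. So \<open>\<omega> r\<close> is
  1 on the last coordinate vector and, going down, on all of them.\<close>

lemma last_fundamental_weight:
  assumes \<omega>: "fundamental_weights (lie_alg G) t r \<sigma> \<omega>" and X: "X \<in> t"
  shows "\<omega> r X = (\<Sum>i\<in>UNIV. wt (Inl i) X)"
proof -
  have rr: "r \<in> {1..r}" using rank by simp
  have add: "\<omega> r (X + Y) = \<omega> r X + \<omega> r Y" and scale: "\<omega> r (scale_mat c X) = c * \<omega> r X"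
    if "X \<in> t" "Y \<in> t" for X Y c
    using \<omega> rr that unfolding fundamental_weights_def functional_on_def by blast+
  have co: "\<omega> r Y = (if r = j then 1 else 0)" if "is_coroot (lie_alg G) t (\<sigma> j) Y" "j \<in> {1..r}" for j Y
    using \<omega> rr that unfolding fundamental_weights_def by blast
  let ?E = "\<lambda>j. Xg (Inl (idx j)) (Inl (idx j))"
  have "\<omega> r (?E j) = 1" if j: "1 \<le> j" "j \<le> r" for j
    using j(2)
  proof (induction rule: inc_induct)
    case base
    have "is_coroot (lie_alg G) t (\<sigma> r) (?E r)"
      by (rule coroot_long) (use sigma_long wt_bar[of _ "Inl (idx r)"] in simp)
    then show ?case using co[OF _ rr] by simp
  next
    case (step n)
    then have n: "n \<in> {1..<r}" using j by simp
    have "idx n \<noteq> idx (Suc n)" using idx_inj[of n "Suc n"] n by auto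
    then have "is_coroot (lie_alg G) t (\<sigma> n) (?E n - ?E (Suc n))"
      by (intro coroot_short sigma_short) (use n in auto)
    then have "\<omega> r (?E n - ?E (Suc n)) = 0" using co[of n] n by auto
    moreover have "\<omega> r (?E n - ?E (Suc n)) = \<omega> r (?E n) - \<omega> r (?E (Suc n))"
      using add[OF Xg_t t_scale[OF Xg_t], of "Inl (idx n)" "-1" "Inl (idx (Suc n))"] scale[OF Xg_t Xg_t, of "-1" "Inl (idx (Suc n))"]
      by (simp add: scale_mat_minus_one)
    ultimately show ?case using step by simp
  qed
  then have one: "\<omega> r (Xg (Inl i) (Inl i)) = 1" for i using idx_surj[of i] by auto
  have S: "(\<Sum>i\<in>UNIV. scale_mat (wt (Inl i) X) (Xg (Inl i) (Inl i))) \<in> t" by (intro t_sum t_scale Xg_t)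
  have "X = (\<Sum>i\<in>UNIV. scale_mat (wt (Inl i) X) (Xg (Inl i) (Inl i)))"
  proof (rule wt_eqI[OF X S])
    fix k
    have w: "wt (Inl k) (Xg (Inl i) (Inl i)) = (if i = k then 1 else 0)" for i by (simp add: wt_Xg)
    have "wt (Inl k) (\<Sum>i\<in>UNIV. scale_mat (wt (Inl i) X) (Xg (Inl i) (Inl i))) = (\<Sum>i\<in>UNIV. wt (Inl i) X * wt (Inl k) (Xg (Inl i) (Inl i)))"
      by (rule additive_sum) (auto simp: wt_add wt_scale Xg_t)
    then show "wt (Inl k) X = wt (Inl k) (\<Sum>i\<in>UNIV. scale_mat (wt (Inl i) X) (Xg (Inl i) (Inl i)))"
      by (simp add: w if_distrib cong: if_cong)
  qed
  then have "\<omega> r X = \<omega> r (\<Sum>i\<in>UNIV. scale_mat (wt (Inl i) X) (Xg (Inl i) (Inl i)))" by simp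
  also have "\<dots> = (\<Sum>i\<in>UNIV. wt (Inl i) X * \<omega> r (Xg (Inl i) (Inl i)))"
    by (rule additive_sum) (use add scale Xg_t in auto)
  finally show ?thesis by (simp add: one)
qed

text \<open>A subspace stable under conjugation is the complexification of its real points, to which
  irreducibility over the reals applies.\<close>

lemma real_irreducible_min_submod:
  assumes irr: "irreducible_real_module G \<pi>" and U: "min_submod U"
    and st: "\<And>h. h \<in> G \<Longrightarrow> (*v) (\<pi> h) ` U = U" and cnj: "\<And>x. x \<in> U \<Longrightarrow> cnj_vec x \<in> U"
  shows "U = UNIV"
proof -
  have sub: "vec.subspace U" and ne: "U \<noteq> {0}" using U unfolding min_submod_def submod_def by blast+
  define cx :: "real^'v \<Rightarrow> complex^'v" where "cx w = (\<chi> i. of_real (w $ i))" for w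
  define W where "W = {w. cx w \<in> U}"
  have mk: "(\<chi> i. Complex (x $ i) (y $ i)) = cx x + \<i> *s cx y" for x y
    by (simp add: cx_def vec_eq_iff complex_eq_iff)
  have cxa: "cx (x + y) = cx x + cx y" "cx (c *\<^sub>R x) = of_real c *s cx x" "cx 0 = 0" for x y c
    by (simp_all add: cx_def vec_eq_iff)
  have W: "subspace W"
    unfolding subspace_def W_def
    using sub by (auto simp: cxa vec.subspace_0 intro: vec.subspace_add vec.subspace_scale)
  have CW: "complexify_subspace W = U"
  proof (intro equalityI subsetI)
    fix u assume "u \<in> complexify_subspace W"
    then obtain x y where "x \<in> W" "y \<in> W" "u = cx x + \<i> *s cx y" unfolding complexify_subspace_def mk by blast
    then show "u \<in> U" unfolding W_def using sub by (auto intro: vec.subspace_add vec.subspace_scale)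
  next
    fix u assume u: "u \<in> U"
    define x y where "x = (\<chi> i. Re (u $ i))" and "y = (\<chi> i. Im (u $ i))"
    have "cx x = (1/2) *s (u + cnj_vec u)" "cx y = (1 / (2 * \<i>)) *s (u - cnj_vec u)"
      by (simp_all add: cx_def x_def y_def cnj_vec_def vec_eq_iff complex_eq_iff)
    moreover have "(1/2) *s (u + cnj_vec u) \<in> U" "(1 / (2 * \<i>)) *s (u - cnj_vec u) \<in> U"
      using sub u cnj[OF u] by (auto intro!: vec.subspace_add vec.subspace_scale vec.subspace_diff)
    ultimately have "x \<in> W" "y \<in> W" by (simp_all add: W_def)
    moreover have "u = (\<chi> i. Complex (x $ i) (y $ i))" by (simp add: x_def y_def vec_eq_iff)
    ultimately show "u \<in> complexify_subspace W" unfolding complexify_subspace_def by blast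
  qed
  have "\<pi> h *v x \<in> complexify_subspace W" if "h \<in> G" "x \<in> complexify_subspace W" for h x
    using st[OF that(1)] that(2) unfolding CW by blast
  then have "W = {0} \<or> W = UNIV" using irr W unfolding irreducible_real_module_def by blast
  then show "U = UNIV"
  proof
    assume "W = {0}"
    then have "U = {0}" unfolding CW[symmetric] complexify_subspace_def mk by (auto simp: cxa)
    then show ?thesis using ne by contradiction
  next
    assume "W = UNIV"
    then have "cx x + \<i> *s cx y \<in> U" for x y unfolding CW[symmetric] complexify_subspace_def mk by blast
    moreover have "u = cx (\<chi> i. Re (u $ i)) + \<i> *s cx (\<chi> i. Im (u $ i))" for u
      by (simp add: cx_def vec_eq_iff complex_eq_iff)
    ultimately show ?thesis by (metis UNIV_eq_I)
  qed
qed

lemma principal_irreducible: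
  assumes T: "T \<in> t" and irr: "irreducible_real_module G \<pi>"
    and conj: "\<And>x. \<rho> T *v cnj_vec x = - cnj_vec (\<rho> T *v x)"
    and span: "vec.span {y. \<exists>k::int. even (k - w) \<and> \<rho> T *v y = (of_int k / 2) *s y} = UNIV"
    and norm: "\<forall>i\<in>{1..r}. 0 \<le> \<sigma> i T" and p: "is_principal (\<rho> T)"
  shows "\<exists>N. principal_grading RR (\<rho> T) (\<lambda>i. wt (Inl i) T) N idx r \<and> min_submod UNIV"
proof -
  obtain N where spec: "\<And>\<kappa>. (\<exists>x. x \<noteq> 0 \<and> \<rho> T *v x = \<kappa> *s x) \<longleftrightarrow> (\<exists>n\<le>N. \<kappa> = of_real (real N / 2 - real n))"
    and simple: "\<And>\<kappa> x y. \<rho> T *v x = \<kappa> *s x \<Longrightarrow> \<rho> T *v y = \<kappa> *s y \<Longrightarrow> y \<noteq> 0 \<Longrightarrow> \<exists>c. x = c *s y"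
    and diag: "diagonalizable (\<rho> T)"
    using principal_spectrum[OF p span conj] by blast
  interpret sgd: simple_grading RR "\<rho> T" "\<lambda>i. wt (Inl i) T"
  proof
    show "\<rho> T = (\<Sum>i\<in>UNIV. scale_mat (wt (Inl i) T) (RR (Inl i) (Inl i)))" by (rule rho_t[OF T])
    show "diagonalizable (\<rho> T)" by (rule diag)
    show "\<exists>c. x = c *s y" if "\<rho> T *v x = k *s x" "\<rho> T *v y = k *s y" "y \<noteq> 0" for x y k by (rule simple[OF that])
    show "2 \<le> CARD('r)" using rank by simp
  qed
  have tau: "\<exists>n\<le>N. sgd.tau l = of_real (real N / 2 - real n)" if l: "l \<in> weights UNIV" for l
  proof -
    obtain x where x: "x \<noteq> 0" "has_wt l x" using l unfolding weights_def by blast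
    then have "\<exists>x. x \<noteq> 0 \<and> \<rho> T *v x = sgd.tau l *s x" using sgd.A_wt[OF x(2)] by blast
    then show ?thesis unfolding spec .
  qed
  have spectrum: "sgd.tau ` weights UNIV = (\<lambda>k. of_real (real N / 2 - real k)) ` {..N}"
  proof (intro equalityI subsetI)
    fix \<kappa> assume "\<kappa> \<in> sgd.tau ` weights UNIV"
    then show "\<kappa> \<in> (\<lambda>k. of_real (real N / 2 - real k)) ` {..N}" using tau by blast
  next
    fix \<kappa> :: complex assume "\<kappa> \<in> (\<lambda>k. of_real (real N / 2 - real k)) ` {..N}"
    then obtain x where x: "x \<noteq> 0" "\<rho> T *v x = \<kappa> *s x" using spec by blast
    then obtain l where l: "has_wt l x" using sgd.eigen_wt by blast
    then have "sgd.tau l *s x = \<kappa> *s x" using sgd.A_wt x(2) by metis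
    then have "sgd.tau l = \<kappa>" using x(1) by (metis vec.scale_right_imp_eq)
    then show "\<kappa> \<in> sgd.tau ` weights UNIV" using l x(1) unfolding weights_def by blast
  qed
  have pg: "principal_grading RR (\<rho> T) (\<lambda>i. wt (Inl i) T) N idx r"
  proof
    show "sgd.tau ` weights UNIV = (\<lambda>k. of_real (real N / 2 - real k)) ` {..N}" by (rule spectrum)
    show "bij_betw idx {1..r} UNIV" by (rule idx)
    show "0 \<le> wt (Inl (idx i)) T - wt (Inl (idx (Suc i))) T" if "i \<in> {1..<r}" for i
      using bspec[OF norm, of i] that unfolding sigma_short[OF T that, symmetric] by simp
    show "0 \<le> 2 * wt (Inl (idx r)) T" using bspec[OF norm, of r] rank(2) unfolding sigma_long[OF T, symmetric] by simp
  qed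
  have "submod UNIV" by (simp add: submod_def vec.subspace_UNIV)
  moreover have "(UNIV :: (complex^'v) set) \<noteq> {0}" using spec[of "of_real (real N / 2 - real 0)"] by blast
  ultimately obtain U where U: "min_submod U" using min_submod_exists by blast
  then have sU: "submod U" unfolding min_submod_def by blast
  \<comment> \<open>A translate of \<open>U\<close> is minimal of the same dimension, and such a
    submodule is unique; so the whole group, connected or not, preserves \<open>U\<close>.\<close>
  have st: "(*v) (\<pi> h) ` U = U" if h: "h \<in> G" for h
    by (rule sgd.min_submod_unique[OF min_submod_translate[OF U h] U dim_translate[OF h]])
  have cnj: "cnj_vec x \<in> U" if "x \<in> U" for x
  proof -
    have cv: "cnj_vec (x + y) = cnj_vec x + cnj_vec y" "cnj_vec (c *s x) = cnj c *s cnj_vec x" "cnj_vec 0 = 0"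
      for x y :: "complex^'v" and c by (simp_all add: cnj_vec_def vec_eq_iff)
    have sub: "vec.subspace {x. cnj_vec x \<in> U}"
      using sU unfolding submod_def vec.subspace_def by (simp add: cv)
    \<comment> \<open>Conjugation negates the real eigenvalue of a weight vector, and the negative
      of its weight is again a weight of \<open>U\<close> by sign changes. Eigenspaces being lines,
      the conjugate is a multiple of a vector of \<open>U\<close>.\<close>
    have "cnj_vec x \<in> U" if x: "x \<in> U" "x \<noteq> 0" "has_wt l x" for x l
    proof -
      have l: "l \<in> weights U" using x unfolding weights_def by blast
      then have "(\<lambda>a. - l a) \<in> weights U"
        by (rule sgd.weights_full_flip[OF sU]) (simp_all add: weights_bar[OF l])
      then obtain y where y: "y \<in> U" "y \<noteq> 0" "has_wt (\<lambda>a. - l a) y" unfolding weights_def by blast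
      obtain n where n: "sgd.tau l = of_real (real N / 2 - real n)" using tau[of l] sgd.weights_subset[of U] l by blast
      have "sgd.tau (\<lambda>a. - l a) = - sgd.tau l" by (simp add: sgd.tau_def sum_negf)
      then have "\<rho> T *v y = (- sgd.tau l) *s y" using sgd.A_wt[OF y(3)] by simp
      moreover have "\<rho> T *v cnj_vec x = (- sgd.tau l) *s cnj_vec x"
        unfolding conj sgd.A_wt[OF x(3)] cv n complex_cnj_complex_of_real by simp
      ultimately obtain c where "cnj_vec x = c *s y" using simple y(2) by blast
      then show ?thesis using y(1) sU unfolding submod_def by (simp add: vec.subspace_scale)
    qed
    then have "vec.span {x\<in>U. x \<noteq> 0 \<and> (\<exists>l. has_wt l x)} \<subseteq> {x. cnj_vec x \<in> U}"
      by (intro vec.span_minimal sub) blast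
    then show ?thesis using sgd.submod_span[OF sU] that by blast
  qed
  have "U = UNIV" by (rule real_irreducible_min_submod[OF irr U st cnj])
  then show ?thesis using pg U by blast
qed

end

lemma list_sum_mset: "list_sum \<tau> bs = (\<Sum>b\<in>#mset bs. \<tau> b)"
  by (induction bs) (simp_all add: list_sum_def)

context sp_based begin

text \<open>Positive roots take positive values at \<open>T\<close>, because the simple roots do.
  Their root vectors would raise the eigenvalue of \<open>v\<close> beyond the maximum
  \<open>M\<close>, so they kill \<open>v\<close>.\<close>

lemma highest_weight_module:
  assumes T: "T \<in> t" and min: "min_submod UNIV" and pos: "\<And>i. i \<in> {1..r} \<Longrightarrow> \<exists>x>0. \<sigma> i T = of_real x"
    and \<omega>: "fundamental_weights (lie_alg G) t r \<sigma> \<omega>"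
    and v: "has_wt l v" "v \<noteq> 0" "\<And>i. l (Inl i) = 1" "\<rho> T *v v = of_real M *s v"
    and top: "\<And>\<kappa> x. x \<noteq> 0 \<Longrightarrow> \<rho> T *v x = \<kappa> *s x \<Longrightarrow> Re \<kappa> \<le> M"
  shows "irreducible_with_highest_weight (lie_alg G) t r \<sigma> \<rho> (\<omega> r)"
  unfolding irreducible_with_highest_weight_def
proof (intro conjI exI[of _ v] allI impI ballI)
  show "irreducible_module (lie_alg G) \<rho>"
    using min unfolding irreducible_module_def min_submod_def submod_rho by blast
  show "v \<noteq> 0" by (rule v)
  show "\<rho> X *v v = \<omega> r X *s v" if "X \<in> t" for X
    unfolding rho_t_wt[OF that v(1)] last_fundamental_weight[OF \<omega> that] by (simp add: v(3))
  fix \<alpha> X assume \<alpha>: "is_root (lie_alg G) t \<alpha> \<and> nat_combination t r \<sigma> \<alpha>" and X: "X \<in> root_space (lie_alg G) t \<alpha>"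
  obtain k :: "nat \<Rightarrow> nat" where k: "\<And>Y. Y \<in> t \<Longrightarrow> \<alpha> Y = (\<Sum>i\<in>{1..r}. of_nat (k i) * \<sigma> i Y)"
    using \<alpha> unfolding nat_combination_def by blast
  obtain Y where Y: "Y \<in> t" "\<alpha> Y \<noteq> 0" using \<alpha> unfolding is_root_def by blast
  then obtain j where j: "j \<in> {1..r}" "k j \<noteq> 0"
    using k[OF Y(1)] by (metis (no_types, lifting) mult_zero_left of_nat_0 sum.neutral)
  obtain x where x: "\<And>i. i \<in> {1..r} \<Longrightarrow> 0 < x i \<and> \<sigma> i T = of_real (x i)" using pos by metis
  have "\<alpha> T = of_real (\<Sum>i\<in>{1..r}. real (k i) * x i)" unfolding k[OF T] by (simp add: x)
  moreover have "0 < (\<Sum>i\<in>{1..r}. real (k i) * x i)"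
  proof (rule sum_pos2[of _ j])
    show "0 \<le> real (k i) * x i" if "i \<in> {1..r}" for i
      using x[OF that] by (intro mult_nonneg_nonneg) simp_all
    show "0 < real (k j) * x j" using j x[OF j(1)] by simp
  qed (use j in simp_all)
  ultimately have a: "0 < Re (\<alpha> T)" by simp
  have g: "X \<in> lie_alg G" "T \<in> lie_alg G" "lie_bracket T X = scale_mat (\<alpha> T) X"
    using X T tg unfolding root_space_def by auto
  have "lie_bracket (\<rho> T) (\<rho> X) = scale_mat (\<alpha> T) (\<rho> X)"
    using differential_bracket[OF g(2,1)] differential_scale[OF g(1)] g(3) by simp
  then have "\<rho> T ** \<rho> X = \<rho> X ** \<rho> T + scale_mat (\<alpha> T) (\<rho> X)" unfolding lie_bracket_def by (simp add: algebra_simps)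
  then have "\<rho> T *v (\<rho> X *v v) = (\<rho> X ** \<rho> T + scale_mat (\<alpha> T) (\<rho> X)) *v v" by (simp add: matrix_vector_mul_assoc)
  also have "\<dots> = (of_real M + \<alpha> T) *s (\<rho> X *v v)"
    by (simp add: matrix_vector_mult_add_rdistrib scale_mv v(4) vector_scalar_commute vec.scale_left_distrib
        flip: matrix_vector_mul_assoc)
  finally show "\<rho> X *v v = 0" using top[of "\<rho> X *v v" "of_real M + \<alpha> T"] a by auto
qed

lemma forward:
  fixes \<theta>0 :: "complex^'n^'n \<Rightarrow> complex^('r + 'r)^('r + 'r)" and B C :: "complex^('r + 'r)^('r + 'r)"
  assumes pg: "principal_grading RR (\<rho> T) (\<lambda>i. wt (Inl i) T) N idx r" and min: "min_submod UNIV" and T: "T \<in> t"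
    and \<omega>: "fundamental_weights (lie_alg G) t r \<sigma> \<omega>" and inj: "inj_on \<rho> (lie_alg G)"
    and \<theta>: "\<And>X. \<theta> X = C ** \<theta>0 X ** B" and BC: "B ** C = mat 1" "C ** B = mat 1"
  shows "(isomorphic_modules (lie_alg G) \<rho> \<theta>0 \<and> (\<forall>i\<in>{1..r}. \<sigma> i T = 1)) \<or>
    ((r = 2 \<and> (\<forall>i\<in>{1..r}. \<sigma> i T = 1) \<or> r = 3 \<and> (\<forall>i\<in>{1..r}. \<sigma> i T = (if i = 1 then 3 else 1))) \<and>
      submodule_of_ext_power (lie_alg G) \<rho> r \<theta>0 \<and> irreducible_with_highest_weight (lie_alg G) t r \<sigma> \<rho> (\<omega> r))"
proof -
  interpret pg: principal_grading RR "\<rho> T" "\<lambda>i. wt (Inl i) T" N idx r by (rule pg)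
  have irr: "U = {0} \<or> U = UNIV" if "submod U" for U using min that unfolding min_submod_def by blast
  have tt: "wt (Inl (idx i)) T = of_real (pg.tr i)" if "i \<in> {1..r}" for i using pg.tt_real[OF that] by blast
  have eps: "pg.eps (Inl i) = wt (Inl i) T" "pg.eps (Inr i) = - wt (Inl i) T" for i by (simp_all add: pg.eps_def)
  \<comment> \<open>The embedding common to all cases: the support of \<open>y\<close> consists of
    rearrangements of \<open>M\<close>, and the conditions on \<open>M\<close> say that
    \<open>y\<close> has the degree and the weight of the top vector of the module.\<close>
  have main: "\<exists>f. (\<forall>u w. f (u + w) = (\<lambda>bs. f u bs + f w bs)) \<and> (\<forall>c u. f (c *s u) = (\<lambda>bs. c * f u bs)) \<and> inj f \<and>
      range f \<subseteq> ext_power k \<and> (\<forall>X\<in>lie_alg G. \<forall>u. f (\<rho> X *v u) = tensor_action (C ** \<theta>0 X ** B) (f u))"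
    if sgr: "simple_graded k N pg.eps" and inje: "inj pg.eps" and l: "l \<in> weights UNIV" "pg.tau l = of_real (real N / 2)"
      and y: "y \<in> ext_kernel k" "y \<noteq> (\<lambda>_. 0)" "\<And>bs. y bs \<noteq> 0 \<Longrightarrow> mset bs = M"
      and M: "(\<Sum>b\<in>#M. pg.eps b) = of_real (real N / 2)" "\<And>a. of_nat (count M a) - of_nat (count M (bar a)) = (of_int (l a) :: complex)"
    for k l y M
  proof -
    obtain v where v: "has_wt l v" "v \<noteq> 0" using l(1) unfolding weights_def by blast
    have "\<exists>f. (\<forall>u w. f (u + w) = (\<lambda>bs. f u bs + f w bs)) \<and> (\<forall>c u. f (c *s u) = (\<lambda>bs. c * f u bs)) \<and> inj f \<and>
      range f \<subseteq> ext_kernel k \<and> (\<forall>a b u. f (RR a b *v u) = tensor_action (Xm a b) (f u))"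
      by (rule pg.embedding[OF irr sgr inje v l(2) y(1,2)])
        (use y(3) M in \<open>simp_all add: list_sum_mset mset_tensor_action\<close>)
    then obtain f where f: "(\<forall>u w. f (u + w) = (\<lambda>bs. f u bs + f w bs)) \<and> (\<forall>c u. f (c *s u) = (\<lambda>bs. c * f u bs)) \<and> inj f \<and>
      range f \<subseteq> ext_kernel k \<and> (\<forall>a b u. f (RR a b *v u) = tensor_action (Xm a b) (f u))" by (rule exE)
    have "f (\<rho> X *v u) = tensor_action (C ** \<theta>0 X ** B) (f u)" if "X \<in> lie_alg G" for X u
      unfolding \<theta>[symmetric] by (rule tensor_equivariant[OF _ _ _ that]) (use f in blast)+
    moreover have "range f \<subseteq> ext_power k" using f unfolding ext_kernel_def by blast
    ultimately show ?thesis using f by (intro exI[of _ f]) simp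
  qed
  \<comment> \<open>Shared by ranks 2 and 3: \<open>M\<close> contains every \<open>Inl i\<close>
    once, so \<open>y\<close> has the weight (1, ..., 1), and \<open>sum\<close> says that this
    weight has the largest eigenvalue.\<close>
  have spin: "submodule_of_ext_power (lie_alg G) \<rho> r \<theta>0 \<and> irreducible_with_highest_weight (lie_alg G) t r \<sigma> \<rho> (\<omega> r)"
    if w: "weights UNIV = spin_wts" and sgr: "simple_graded r N pg.eps" and inje: "inj pg.eps"
      and y: "\<exists>y\<in>ext_kernel r. y \<noteq> (\<lambda>_. 0) \<and> (\<forall>bs. y bs \<noteq> 0 \<longrightarrow> mset bs = M)"
      and M: "(\<Sum>b\<in>#M. pg.eps b) = of_real (real N / 2)" "\<And>i. count M (Inl i) = 1" "\<And>i. count M (Inr i) = 0"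
      and sum: "(\<Sum>i\<in>UNIV. wt (Inl i) T) = of_real (real N / 2)"
      and pos: "\<And>i. i \<in> {1..r} \<Longrightarrow> \<exists>x>0. \<sigma> i T = of_real x" for M
  proof -
    define l :: "'r + 'r \<Rightarrow> int" where "l a = (case a of Inl _ \<Rightarrow> 1 | Inr _ \<Rightarrow> -1)" for a
    have l1: "l (Inl i) = 1" "l (Inr i) = -1" for i by (simp_all add: l_def)
    have lb: "l (bar a) = - l a \<and> l a \<le> 1" for a by (cases a) (simp_all add: l1)
    have l: "l \<in> weights UNIV" unfolding w spin_wts_def using lb by (simp add: l1)
    have tau: "pg.tau l = of_real (real N / 2)" using sum by (simp add: pg.tau_def l1)
    obtain y where y: "y \<in> ext_kernel r" "y \<noteq> (\<lambda>_. 0)" "\<And>bs. y bs \<noteq> 0 \<Longrightarrow> mset bs = M" using y by blast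
    have cnt: "of_nat (count M a) - of_nat (count M (bar a)) = (of_int (l a) :: complex)" for a
      by (cases a) (simp_all add: M l1)
    have "submodule_of_ext_power (lie_alg G) \<rho> r \<theta>0"
      unfolding submodule_of_ext_power_frame[OF BC] by (rule main[OF sgr inje l tau y M(1) cnt])
    moreover obtain v where v: "has_wt l v" "v \<noteq> 0" using l unfolding weights_def by blast
    have "irreducible_with_highest_weight (lie_alg G) t r \<sigma> \<rho> (\<omega> r)"
    proof (rule highest_weight_module[OF T min pos \<omega> v l1(1)])
      show "\<rho> T *v v = of_real (real N / 2) *s v" using pg.A_wt[OF v(1)] tau by simp
      fix \<kappa> x assume x: "x \<noteq> 0" "\<rho> T *v x = \<kappa> *s x"
      then obtain m where m: "has_wt m x" using pg.eigen_wt by blast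
      then have "pg.tau m *s x = \<kappa> *s x" using pg.A_wt x(2) by metis
      then have "pg.tau m = \<kappa>" using x(1) by (metis vec.scale_right_imp_eq)
      moreover have "m \<in> weights UNIV" using m x(1) unfolding weights_def by blast
      ultimately have "\<kappa> \<in> (\<lambda>k. of_real (real N / 2 - real k)) ` {..N}" using pg.spectrum by blast
      then show "Re \<kappa> \<le> real N / 2" by auto
    qed
    ultimately show ?thesis by blast
  qed
  have cs: "\<sigma> i T = of_real (if i = r then 2 * pg.tr r else pg.tr i - pg.tr (Suc i))" if i: "i \<in> {1..r}" for i
    using i by (rule sigma_cases) (use sigma_long[OF T] sigma_short[OF T] tt rank in auto)
  consider "weights UNIV = {\<lambda>_. 0}" | "weights UNIV = range unit_wt" | "CARD('r) \<le> 3" "weights UNIV = spin_wts"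
    using pg.weights_cases[OF min] by blast
  then show ?thesis
  proof cases
    case 1
    \<comment> \<open>If 0 were the only weight, the torus would act trivially, contrary to
      injectivity of the differential.\<close>
    have z: "has_wt (\<lambda>_. 0) x" if "has_wt l x" "x \<noteq> 0" for l x
    proof -
      have "l \<in> weights UNIV" using that unfolding weights_def by blast
      then show ?thesis using that(1) 1 by simp
    qed
    have "RR a a *v x = 0" for a x
    proof -
      have "vec.subspace {x. RR a a *v x = 0}"
        by (auto simp: vec.subspace_def matrix_vector_right_distrib vector_scalar_commute)
      then have "vec.span {x\<in>UNIV. x \<noteq> 0 \<and> (\<exists>l. has_wt l x)} \<subseteq> {x. RR a a *v x = 0}"
        using z by (intro vec.span_minimal) (auto simp: has_wt_def)
      moreover have "submod UNIV" by (simp add: submod_def vec.subspace_UNIV)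
      ultimately show ?thesis using pg.submod_span[of UNIV] by blast
    qed
    then have R0: "RR a a = 0" for a by (metis matrix_eq matrix_vector_mult_0)
    \<comment> \<open>An arbitrary signed index, at which \<open>Xg a a\<close> is a nonzero element
      of the torus.\<close>
    obtain a :: "'r + 'r" where True by simp
    have "\<rho> 0 = 0" using differential_scale[OF lie_alg_0, of 0] by simp
    then have "\<rho> (Xg a a) = \<rho> 0" using R0[of a] by (simp add: RR_def)
    then have "Xg a a = 0" by (rule inj_onD[OF inj _ Xg(1) lie_alg_0])
    then have "wt a (0 :: complex^'n^'n) = 1" using wt_Xg[of a a] by simp
    then show ?thesis by (simp add: wt_def theta_0)
  next
    case 2
    have tr: "pg.tr i = real r - real i + 1/2" if "i \<in> {1..r}" for i by (rule pg.grading_standard[OF 2 that])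
    have s: "\<sigma> i T = 1" if "i \<in> {1..r}" for i
      using cs[OF that] tr[OF that] tr[of "Suc i"] that by (auto split: if_splits)
    have et: "pg.eps a = pg.tau (unit_wt a)" for a by (cases a) (simp_all add: eps pg.tau_unit)
    have inje: "inj pg.eps"
    proof (rule injI)
      fix a b assume "pg.eps a = pg.eps b"
      then have "unit_wt a = unit_wt b" using pg.tau_inj[of "unit_wt a" "unit_wt b"] 2 et by auto
      moreover have "unit_wt a a = 1" by (simp add: unit_wt_def)
      ultimately have "unit_wt b a = 1" by simp
      then show "a = b" by (auto simp: unit_wt_def split: if_splits)
    qed
    have sgr: "simple_graded 1 N pg.eps"
    proof (rule simple_graded_1[OF inje])
      fix a
      have "pg.tau (unit_wt a) \<in> pg.tau ` weights UNIV" using 2 by blast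
      then show "\<exists>n\<le>N. pg.eps a = of_real (real N / 2 - real n)" unfolding pg.spectrum et by blast
    qed
    have N: "N + 1 = 2 * r" using pg.N_card 2 pg.card_unit_wts rank by simp
    then have "real N + 1 = 2 * real r" by linarith
    then have N2: "real N / 2 = real r - 1/2" by simp
    let ?i = "idx 1"
    have t1: "wt (Inl ?i) T = of_real (real N / 2)" using tt[of 1] tr[of 1] rank unfolding N2 by simp
    obtain y where y: "y \<in> ext_kernel 1" "y \<noteq> (\<lambda>_. 0)" "\<And>bs. y bs \<noteq> 0 \<Longrightarrow> mset bs = {#Inl ?i#}"
      using top_tensor(1)[of ?i] by blast
    have "\<exists>f. (\<forall>u w. f (u + w) = (\<lambda>bs. f u bs + f w bs)) \<and> (\<forall>c u. f (c *s u) = (\<lambda>bs. c * f u bs)) \<and> inj f \<and>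
      range f \<subseteq> ext_power 1 \<and> (\<forall>X\<in>lie_alg G. \<forall>u. f (\<rho> X *v u) = tensor_action (C ** \<theta>0 X ** B) (f u))"
    proof (rule main[OF sgr inje _ _ y, of "unit_wt (Inl ?i)"])
      show "unit_wt (Inl ?i) \<in> weights UNIV" using 2 by blast
      show "pg.tau (unit_wt (Inl ?i)) = of_real (real N / 2)" unfolding pg.tau_unit by (rule t1)
      show "(\<Sum>b\<in>#{#Inl ?i#}. pg.eps b) = of_real (real N / 2)" using t1 by (simp add: eps)
      show "of_nat (count {#Inl ?i#} a) - of_nat (count {#Inl ?i#} (bar a)) = (of_int (unit_wt (Inl ?i) a) :: complex)" for a
        by (cases a) (auto simp: unit_wt_def)
    qed
    then obtain f where f: "(\<forall>u w. f (u + w) = (\<lambda>bs. f u bs + f w bs)) \<and> (\<forall>c u. f (c *s u) = (\<lambda>bs. c * f u bs)) \<and> inj f \<and>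
      range f \<subseteq> ext_power 1 \<and> (\<forall>X\<in>lie_alg G. \<forall>u. f (\<rho> X *v u) = tensor_action (C ** \<theta>0 X ** B) (f u))" by (rule exE)
    have "submod UNIV" by (simp add: submod_def vec.subspace_UNIV)
    then have card: "CARD('v) = CARD('r + 'r)"
      using pg.dim_weights[of UNIV] pg.card_unit_wts unfolding 2 vec_dim_card by simp
    have "isomorphic_modules (lie_alg G) \<rho> \<theta>0"
      by (rule isomorphic_modulesI[OF BC card, of f]) (use f in blast)+
    then show ?thesis using s by blast
  next
    case 3
    then consider "r = 2" | "r = 3" using rank by linarith
    then show ?thesis
    proof cases
      case r2: 1
      define i j where "i = idx 1" and "j = idx 2"
      have "{1..r} = {1, 2}" using r2 by auto
      then have U: "UNIV = {i, j}" using idx unfolding bij_betw_def i_def j_def by simp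
      have ij: "i \<noteq> j" using idx_inj[of 1 2] r2 by (auto simp: i_def j_def)
      have t: "wt (Inl i) T = 3/2" "wt (Inl j) T = 1/2"
        using tt[of 1, unfolded pg.grading_spin_2[OF 3(2) r2]] tt[of 2, unfolded pg.grading_spin_2[OF 3(2) r2]] r2
        by (simp_all add: i_def j_def)
      have N: "N = 4" using pg.N_card pg.spin_card_2(2)[OF U ij] 3(2) by simp
      have e: "pg.eps (Inl i) = 3/2" "pg.eps (Inr i) = - (3/2)" "pg.eps (Inl j) = 1/2" "pg.eps (Inr j) = - (1/2)"
        by (simp_all add: eps t)
      have all: "a = Inl i \<or> a = Inr i \<or> a = Inl j \<or> a = Inr j" for a using U by (cases a) auto
      have inje: "inj pg.eps"
      proof (rule injI)
        fix a b assume "pg.eps a = pg.eps b"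
        then show "a = b" using all[of a] all[of b] by (elim disjE) (simp_all add: e)
      qed
      have s: "\<sigma> k T = 1" if "k \<in> {1..r}" for k
      proof -
        have "\<sigma> 2 T = 2 * wt (Inl j) T" using sigma_long[OF T] unfolding r2 j_def .
        moreover have "\<sigma> 1 T = wt (Inl i) T - wt (Inl j) T"
          using sigma_short[OF T, of 1] r2 by (simp add: i_def j_def numeral_2_eq_2)
        moreover have "k = 1 \<or> k = 2" using that r2 by auto
        ultimately show ?thesis using t by auto
      qed
      have "submodule_of_ext_power (lie_alg G) \<rho> r \<theta>0 \<and> irreducible_with_highest_weight (lie_alg G) t r \<sigma> \<rho> (\<omega> r)"
      proof (rule spin[OF 3(2) _ inje, of "{#Inl i, Inl j#}"])
        show "simple_graded r N pg.eps" unfolding r2 N by (rule simple_graded_2[OF U ij e])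
        show "\<exists>y\<in>ext_kernel r. y \<noteq> (\<lambda>_. 0) \<and> (\<forall>bs. y bs \<noteq> 0 \<longrightarrow> mset bs = {#Inl i, Inl j#})"
          unfolding r2 by (rule top_tensor(2)[OF ij])
        show "(\<Sum>b\<in>#{#Inl i, Inl j#}. pg.eps b) = of_real (real N / 2)" by (simp add: e N)
        show "count {#Inl i, Inl j#} (Inl k) = 1" for k using U ij by auto
        show "(\<Sum>i\<in>UNIV. wt (Inl i) T) = of_real (real N / 2)" using ij by (simp add: U t N)
        show "\<exists>x>0. \<sigma> k T = of_real x" if "k \<in> {1..r}" for k using s[OF that] by (intro exI[of _ 1]) simp
      qed simp
      then show ?thesis using r2 s by blast
    next
      case r3: 2
      define i j k where "i = idx 1" and "j = idx 2" and "k = idx 3"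
      have "{1..r} = {1, 2, 3}" using r3 by auto
      then have U: "UNIV = {i, j, k}" using idx unfolding bij_betw_def i_def j_def k_def by simp
      have ij: "i \<noteq> j" "i \<noteq> k" "j \<noteq> k"
        using idx_inj[of 1 2] idx_inj[of 1 3] idx_inj[of 2 3] r3 by (auto simp: i_def j_def k_def)
      have t: "wt (Inl i) T = 9/2" "wt (Inl j) T = 3/2" "wt (Inl k) T = 1/2"
        using tt[of 1, unfolded pg.grading_spin_3[OF 3(2) r3]] tt[of 2, unfolded pg.grading_spin_3[OF 3(2) r3]]
          tt[of 3, unfolded pg.grading_spin_3[OF 3(2) r3]] r3
        by (simp_all add: i_def j_def k_def)
      have N: "N = 13" using pg.N_card pg.spin_card_3(2)[OF U ij] 3(2) by simp
      have e: "pg.eps (Inl i) = 9/2" "pg.eps (Inr i) = - (9/2)" "pg.eps (Inl j) = 3/2" "pg.eps (Inr j) = - (3/2)"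
        "pg.eps (Inl k) = 1/2" "pg.eps (Inr k) = - (1/2)"
        by (simp_all add: eps t)
      have all: "a = Inl i \<or> a = Inr i \<or> a = Inl j \<or> a = Inr j \<or> a = Inl k \<or> a = Inr k" for a using U by (cases a) auto
      have inje: "inj pg.eps"
      proof (rule injI)
        fix a b assume "pg.eps a = pg.eps b"
        then show "a = b" using all[of a] all[of b] by (elim disjE) (simp_all add: e)
      qed
      have s: "\<sigma> n T = (if n = 1 then 3 else 1)" if n: "n \<in> {1..r}" for n
      proof -
        consider "n = 1" | "n = 2" | "n = 3" using n r3 by fastforce
        moreover have "\<sigma> 3 T = 2 * wt (Inl k) T" using sigma_long[OF T] unfolding r3 k_def .
        moreover have "\<sigma> 1 T = wt (Inl i) T - wt (Inl j) T" "\<sigma> 2 T = wt (Inl j) T - wt (Inl k) T"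
          using sigma_short[OF T, of 1] sigma_short[OF T, of 2] r3
          by (simp_all add: i_def j_def k_def numeral_2_eq_2 numeral_3_eq_3)
        ultimately show ?thesis using t by cases auto
      qed
      have "submodule_of_ext_power (lie_alg G) \<rho> r \<theta>0 \<and> irreducible_with_highest_weight (lie_alg G) t r \<sigma> \<rho> (\<omega> r)"
      proof (rule spin[OF 3(2) _ inje, of "{#Inl i, Inl j, Inl k#}"])
        show "simple_graded r N pg.eps" unfolding r3 N by (rule simple_graded_3[OF U ij e])
        show "\<exists>y\<in>ext_kernel r. y \<noteq> (\<lambda>_. 0) \<and> (\<forall>bs. y bs \<noteq> 0 \<longrightarrow> mset bs = {#Inl i, Inl j, Inl k#})"
          unfolding r3 by (rule top_tensor(3)[OF ij])
        show "(\<Sum>b\<in>#{#Inl i, Inl j, Inl k#}. pg.eps b) = of_real (real N / 2)" by (simp add: e N)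
        show "count {#Inl i, Inl j, Inl k#} (Inl n) = 1" for n using U ij by auto
        show "(\<Sum>i\<in>UNIV. wt (Inl i) T) = of_real (real N / 2)" using ij by (simp add: U t N)
        show "\<exists>x>0. \<sigma> n T = of_real x" if "n \<in> {1..r}" for n
          using s[OF that] by (intro exI[of _ "if n = 1 then 3 else 1"]) simp
      qed simp
      then show ?thesis using r3 s by blast
    qed
  qed
qed

section \<open>The listed representations are principal\<close>

lemma converse:
  fixes f :: "complex^'v \<Rightarrow> ('r + 'r) list \<Rightarrow> complex"
  assumes T: "T \<in> t" and f: "\<And>u w. f (u + w) = (\<lambda>bs. f u bs + f w bs)" "\<And>c u. f (c *s u) = (\<lambda>bs. c * f u bs)"
      "inj f" "range f \<subseteq> ext_kernel k" "\<And>X v. X \<in> lie_alg G \<Longrightarrow> f (\<rho> X *v v) = tensor_action (\<theta> X) (f v)"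
    and sgr: "simple_graded k N (\<lambda>a. wt a T)"
    and att: "\<And>n. n \<le> N \<Longrightarrow> \<exists>v. v \<noteq> 0 \<and> \<rho> T *v v = of_real (real N / 2 - real n) *s v"
  shows "is_principal (\<rho> T)"
proof (rule principal_of_tensors[OF f(1-4) _ sgr att])
  have T': "T \<in> lie_alg G" using T tg by blast
  show "f (\<rho> T *v u) bs = list_sum (\<lambda>a. wt a T) bs * f u bs" for u bs
    unfolding f(5)[OF T'] using theta_t[OF T]
    by (subst tensor_action_diag) (simp_all add: sp_diag_def list_sum_def wt_def)
qed

lemma standard_converse:
  fixes f :: "complex^'v \<Rightarrow> ('r + 'r) list \<Rightarrow> complex"
  assumes T: "T \<in> t" and s: "\<forall>i\<in>{1..r}. \<sigma> i T = 1"
    and f: "\<And>u w. f (u + w) = (\<lambda>bs. f u bs + f w bs)" "\<And>c u. f (c *s u) = (\<lambda>bs. c * f u bs)"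
      "inj f" "range f \<subseteq> ext_power 1" "\<And>X v. X \<in> lie_alg G \<Longrightarrow> f (\<rho> X *v v) = tensor_action (\<theta> X) (f v)"
      "\<And>b. \<exists>v. \<forall>bs. f v bs = (if bs = [b] then 1 else 0)"
  shows "is_principal (\<rho> T)"
proof -
  have T': "T \<in> lie_alg G" using T tg by blast
  \<comment> \<open>The equations for the simple roots, solved downward from the long root: 1/2 at
    \<open>r\<close>, and one more at each step.\<close>
  define h where "h i = real r - real i + 1/2" for i
  have w: "wt (Inl (idx i)) T = of_real (h i)" if i: "1 \<le> i" "i \<le> r" for i
    using i(2)
  proof (induction rule: inc_induct)
    case base
    have "2 * wt (Inl (idx r)) T = 1" using bspec[OF s, of r] rank(2) unfolding sigma_long[OF T, symmetric] by simp
    then have "wt (Inl (idx r)) T = 1/2" by (simp add: field_simps)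
    then show ?case by (simp add: h_def)
  next
    case (step n)
    then have n: "n \<in> {1..<r}" using i by simp
    have "wt (Inl (idx n)) T = 1 + of_real (h (Suc n))" using wt_down[OF T n] step bspec[OF s, of n] n by simp
    then show ?case by (simp add: h_def)
  qed
  have w': "wt (Inr (idx i)) T = - of_real (h i)" if "1 \<le> i" "i \<le> r" for i
    using wt_bar[OF T, of "Inl (idx i)"] w[OF that] by simp
  define N where "N = 2 * r - 1"
  have N: "real N / 2 = real r - 1/2" using rank by (simp add: N_def of_nat_diff)
  have cs: "(\<exists>i. 1 \<le> i \<and> i \<le> r \<and> a = Inl (idx i) \<and> wt a T = of_real (h i)) \<or>
    (\<exists>i. 1 \<le> i \<and> i \<le> r \<and> a = Inr (idx i) \<and> wt a T = of_real (- h i))" for a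
  proof (cases a)
    case (Inl x)
    then show ?thesis using idx_surj[of x] w by auto
  next
    case (Inr x)
    then show ?thesis using idx_surj[of x] w' by auto
  qed
  have hp: "0 < h i" if "i \<le> r" for i using that by (simp add: h_def)
  have inj: "inj (\<lambda>a. wt a T)"
  proof (rule injI)
    fix a b assume e: "wt a T = wt b T"
    have hi: "i = j" if "h i = h j" for i j using that by (simp add: h_def)
    show "a = b" using cs[of a] cs[of b] e hp hi
      by (elim disjE exE conjE) (simp_all only: of_real_eq_iff, auto, (smt (verit))+)
  qed
  have val: "\<exists>n\<le>N. wt a T = of_real (real N / 2 - real n)" for a
    using cs[of a]
  proof (elim disjE exE conjE)
    fix i assume i: "1 \<le> i" "i \<le> r" "wt a T = of_real (h i)"
    have "h i = real N / 2 - real (i - 1)" using i unfolding N by (simp add: h_def of_nat_diff)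
    moreover have "i - 1 \<le> N" using i by (simp add: N_def)
    ultimately show ?thesis using i(3) by auto
  next
    fix i assume i: "1 \<le> i" "i \<le> r" "wt a T = of_real (- h i)"
    have "- h i = real N / 2 - real (2 * r - i)" using i unfolding N by (simp add: h_def of_nat_diff)
    moreover have "2 * r - i \<le> N" using i by (simp add: N_def)
    ultimately show ?thesis using i(3) by auto
  qed
  have ker: "range f \<subseteq> ext_kernel 1"
    using f(4) unfolding image_subset_iff ext_kernel_def by (auto simp: contraction_def ext_power_1[unfolded One_nat_def] intro!: sum.neutral)
  have ev: "\<exists>v. v \<noteq> 0 \<and> \<rho> T *v v = wt a T *s v" for a
  proof -
    obtain v where v: "\<And>bs. f v bs = (if bs = [a] then 1 else 0)" using f(6) by blast
    have "f (\<rho> T *v v) bs = f (wt a T *s v) bs" for bs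
      unfolding f(5)[OF T'] f(2) using theta_t[OF T]
      by (subst tensor_action_diag) (auto simp: sp_diag_def v wt_def)
    then have "\<rho> T *v v = wt a T *s v" by (intro injD[OF f(3)] ext)
    moreover have "v \<noteq> 0" using v[of "[a]"] f(2)[of 0 0] by auto
    ultimately show ?thesis by blast
  qed
  show ?thesis
  proof (rule converse[OF T f(1-3) ker f(5) simple_graded_1[OF inj val]])
    fix n assume n: "n \<le> N"
    show "\<exists>v. v \<noteq> 0 \<and> \<rho> T *v v = of_real (real N / 2 - real n) *s v"
    proof (cases "n < r")
      case True
      then have "h (n + 1) = real N / 2 - real n" unfolding N h_def by simp
      then show ?thesis using ev[of "Inl (idx (n + 1))"] w[of "n + 1"] True by simp
    next
      case False
      \<comment> \<open>The lower half of the spectrum consists of the weights at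
        \<open>Inr\<close>: the value r - 1/2 - n is minus \<open>h\<close> at the index 2 r -
        n.\<close>
      have nr: "1 \<le> 2 * r - n" "2 * r - n \<le> r" "n \<le> 2 * r" using False n rank by (auto simp: N_def)
      then have "- h (2 * r - n) = real N / 2 - real n" unfolding N h_def by (simp add: of_nat_diff)
      then have "wt (Inr (idx (2 * r - n))) T = of_real (real N / 2 - real n)"
        using w'[OF nr(1,2)] by (metis of_real_minus)
      then show ?thesis using ev[of "Inr (idx (2 * r - n))"] by simp
    qed
  qed
qed

text \<open>For the element \<open>E\<close>, on which every coordinate is 1, the highest weight has
  the value \<open>r\<close>. A list of length \<open>r\<close> that contains an opposite pair
  reaches at most r - 2, so the highest weight vector has no such coordinate and is contracted to 0;
  by irreducibility the contraction vanishes on the whole image.\<close>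

lemma kernel_of_highest_weight:
  fixes f :: "complex^'v \<Rightarrow> ('r + 'r) list \<Rightarrow> complex"
  assumes \<omega>: "fundamental_weights (lie_alg G) t r \<sigma> \<omega>"
    and hw: "irreducible_with_highest_weight (lie_alg G) t r \<sigma> \<rho> (\<omega> r)"
    and f: "\<And>u w. f (u + w) = (\<lambda>bs. f u bs + f w bs)" "\<And>c u. f (c *s u) = (\<lambda>bs. c * f u bs)"
      "inj f" "range f \<subseteq> ext_power r" "\<And>X v. X \<in> lie_alg G \<Longrightarrow> f (\<rho> X *v v) = tensor_action (\<theta> X) (f v)"
  shows "range f \<subseteq> ext_kernel r" and "\<exists>l\<in>weights UNIV. \<forall>i. l (Inl i) = 1"
proof -
  obtain v where v: "v \<noteq> 0" "\<And>X. X \<in> t \<Longrightarrow> \<rho> X *v v = \<omega> r X *s v"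
    using hw unfolding irreducible_with_highest_weight_def by blast
  define l :: "'r + 'r \<Rightarrow> int" where "l a = (case a of Inl _ \<Rightarrow> 1 | Inr _ \<Rightarrow> -1)" for a
  have wX: "wt (Inl i) (Xg (Inl k) (Inl k)) = (if i = k then 1 else 0)"
    "wt (Inl i) (Xg (Inr k) (Inr k)) = - (if i = k then 1 else 0)" for i k by (auto simp: wt_Xg)
  have om: "\<omega> r (Xg a a) = of_int (l a)" for a
    unfolding last_fundamental_weight[OF \<omega> Xg_t] by (cases a) (simp_all add: wX l_def sum_negf)
  have "has_wt l v" unfolding has_wt_def RR_def using v(2)[OF Xg_t] om by simp
  then show "\<exists>l\<in>weights UNIV. \<forall>i. l (Inl i) = 1" using v(1) unfolding weights_def by (intro bexI[of _ l]) (auto simp: l_def)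
  have sup: "(\<Sum>b\<leftarrow>bs. wt b X) = (\<Sum>i\<in>UNIV. wt (Inl i) X)" if X: "X \<in> t" and nz: "f v bs \<noteq> 0" for X bs
  proof -
    have "f (\<rho> X *v v) bs = (\<Sum>b\<leftarrow>bs. wt b X) * f v bs"
      using f(5)[of X v] X tg theta_t[OF X] tensor_action_diag[of "\<theta> X" "f v" bs] by (auto simp: sp_diag_def wt_def)
    moreover have "f (\<rho> X *v v) bs = (\<Sum>i\<in>UNIV. wt (Inl i) X) * f v bs"
      unfolding v(2)[OF X] f(2) last_fundamental_weight[OF \<omega> X] by (rule refl)
    ultimately show ?thesis using nz by simp
  qed
  define E where "E = (\<Sum>i\<in>UNIV. scale_mat 1 (Xg (Inl i) (Inl i) :: complex^'n^'n))"
  have E: "E \<in> t" unfolding E_def by (intro t_sum t_scale Xg_t)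
  have wE: "wt (Inl k) E = 1" for k
  proof -
    have "wt (Inl k) E = (\<Sum>i\<in>UNIV. 1 * wt (Inl k) (Xg (Inl i) (Inl i)))"
      unfolding E_def by (rule additive_sum) (auto simp: wt_add wt_scale Xg_t)
    then show ?thesis by (simp add: wX)
  qed
  have wE': "wt (bar a) E = - wt a E" "Re (wt a E) \<le> 1" for a
    using wt_bar[OF E, of a] wt_bar[OF E, of "Inl (projr a)"] wE by (cases a; simp)+
  have zero: "f v (a # bar a # cs) = 0" for a cs
  proof (rule ccontr)
    assume nz: "f v (a # bar a # cs) \<noteq> 0"
    then have len: "length cs + 2 = r" using f(4) ext_power_length[of "f v" r "a # bar a # cs"] by auto
    have "(\<Sum>b\<leftarrow>cs. wt b E) = of_nat r" using sup[OF E nz] wE'(1)[of a] by (simp add: wE rank)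
    moreover have "Re (\<Sum>b\<leftarrow>cs. wt b E) \<le> real (length cs)"
      by (induction cs) (use wE'(2) in \<open>auto intro: add_mono\<close>)
    ultimately show False using len by simp
  qed
  let ?K = "{u. \<forall>cs. ct (f u) cs = 0}"
  have ctl: "ct (\<lambda>bs. x bs + y bs) cs = ct x cs + ct y cs" "ct (\<lambda>bs. c * x bs) cs = c * ct x cs"
    for x y :: "('r + 'r) list \<Rightarrow> complex" and c cs
    by (simp_all add: contraction_def distrib_left sum.distrib sum_distrib_left mult.left_commute)
  have "vec.subspace ?K"
    using ctl(2)[of 0 "f 0"] f(2)[of 0 0] by (auto simp: vec.subspace_def f(1,2) ctl)
  moreover have "\<rho> X *v u \<in> ?K" if "X \<in> lie_alg G" "u \<in> ?K" for X u
  proof -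
    have z: "ct (f u) = (\<lambda>_. 0)" using that(2) by auto
    show ?thesis using f(5)[OF that(1), of u] contraction_action[OF theta_sp[OF that(1)], of "f u"]
      by (simp add: z tensor_action_zero)
  qed
  ultimately have "?K = {0} \<or> ?K = UNIV"
    using hw unfolding irreducible_with_highest_weight_def irreducible_module_def by blast
  moreover have "v \<in> ?K" by (simp add: contraction_def zero)
  ultimately have "?K = UNIV" using v(1) by blast
  then show "range f \<subseteq> ext_kernel r" using f(4) unfolding ext_kernel_def by blast
qed

text \<open>Eigenvectors for all required values come from the highest weight (1, ..., 1) by sign
  changes and by the strings along e_i + e_j, which replace two entries by 0. One-dimensionality
  comes from \<open>simple_graded\<close>.\<close>

lemma spin_converse:
  fixes f :: "complex^'v \<Rightarrow> ('r + 'r) list \<Rightarrow> complex"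
  assumes T: "T \<in> t"
    and s: "r = 2 \<and> (\<forall>i\<in>{1..r}. \<sigma> i T = 1) \<or> r = 3 \<and> (\<forall>i\<in>{1..r}. \<sigma> i T = (if i = 1 then 3 else 1))"
    and \<omega>: "fundamental_weights (lie_alg G) t r \<sigma> \<omega>"
    and hw: "irreducible_with_highest_weight (lie_alg G) t r \<sigma> \<rho> (\<omega> r)"
    and f: "\<And>u w. f (u + w) = (\<lambda>bs. f u bs + f w bs)" "\<And>c u. f (c *s u) = (\<lambda>bs. c * f u bs)"
      "inj f" "range f \<subseteq> ext_power r" "\<And>X v. X \<in> lie_alg G \<Longrightarrow> f (\<rho> X *v v) = tensor_action (\<theta> X) (f v)"
  shows "is_principal (\<rho> T)"
proof -
  note ker = kernel_of_highest_weight[OF \<omega> hw f]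
  obtain l0 where l0: "l0 \<in> weights UNIV" "\<And>i. l0 (Inl i) = 1" using ker(2) by blast
  have sub: "submod UNIV" by (simp add: submod_def vec.subspace_UNIV)
  have wI: "wt (Inr i) T = - wt (Inl i) T" for i using wt_bar[OF T, of "Inl i"] by simp
  have ev: "\<exists>v. v \<noteq> 0 \<and> \<rho> T *v v = \<kappa> *s v" if "l \<in> weights UNIV" "(\<Sum>i\<in>UNIV. wt (Inl i) T * of_int (l (Inl i))) = \<kappa>" for l \<kappa>
    using that rho_t_wt[OF T] unfolding weights_def by blast
  have long: "2 * wt (Inl (idx r)) T = \<sigma> r T" using sigma_long[OF T] by simp
  show ?thesis using s
  proof (elim disjE conjE)
    assume r2: "r = 2" and s: "\<forall>i\<in>{1..r}. \<sigma> i T = 1"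
    define i j where "i = idx 1" and "j = idx 2"
    have "{1..r} = {1, 2}" using r2 by auto
    then have U: "UNIV = {i, j}" using idx unfolding bij_betw_def i_def j_def by simp
    have ij: "i \<noteq> j" using idx_inj[of 1 2] r2 by (auto simp: i_def j_def)
    have tj: "wt (Inl j) T = 1/2" using long s r2 by (simp add: j_def field_simps)
    have ti: "wt (Inl i) T = 3/2" using wt_down[OF T, of 1] s r2 tj by (simp add: i_def j_def numeral_2_eq_2)
    define W where "W x y \<longleftrightarrow> (\<exists>l\<in>weights UNIV. l (Inl i) = x \<and> l (Inl j) = y)" for x y :: int
    have W1: "W 1 1" using l0 by (auto simp: W_def)
    have Wi: "W (- x) y" if "W x y" for x y
      using that weights_flip_coordinate[OF sub, of _ i] ij unfolding W_def by (metis (full_types))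
    have Wj: "W x (- y)" if "W x y" for x y
      using that weights_flip_coordinate[OF sub, of _ j] ij unfolding W_def by (metis (full_types))
    have W0: "W 0 0" using weights_lower_pair[OF sub l0(1) l0(2) l0(2) ij] unfolding W_def by (metis (full_types))
    have Wev: "\<exists>v. v \<noteq> 0 \<and> \<rho> T *v v = (3/2 * of_int x + 1/2 * of_int y) *s v" if W: "W x y" for x y
    proof -
      obtain l where "l \<in> weights UNIV" "l (Inl i) = x" "l (Inl j) = y" using W unfolding W_def by blast
      then show ?thesis using ij by (intro ev[of l]) (simp_all add: U ti tj)
    qed
    show ?thesis
    proof (rule converse[OF T f(1-3) ker(1) f(5)])
      show "simple_graded r 4 (\<lambda>a. wt a T)" unfolding r2 by (rule simple_graded_2[OF U ij]) (simp_all add: wI ti tj)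
      fix n :: nat assume "n \<le> 4"
      then consider "n = 0" | "n = 1" | "n = 2" | "n = 3" | "n = 4" by linarith
      then show "\<exists>v. v \<noteq> 0 \<and> \<rho> T *v v = of_real (real 4 / 2 - real n) *s v"
        by cases (use Wev[OF W1] Wev[OF Wj[OF W1]] Wev[OF W0] Wev[OF Wi[OF W1]] Wev[OF Wi[OF Wj[OF W1]]] in simp_all)
    qed
  next
    assume r3: "r = 3" and s: "\<forall>i\<in>{1..r}. \<sigma> i T = (if i = 1 then 3 else 1)"
    define i j k where "i = idx 1" and "j = idx 2" and "k = idx 3"
    have "{1..r} = {1, 2, 3}" using r3 by auto
    then have U: "UNIV = {i, j, k}" using idx unfolding bij_betw_def i_def j_def k_def by simp
    have ij: "i \<noteq> j" "i \<noteq> k" "j \<noteq> k"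
      using idx_inj[of 1 2] idx_inj[of 1 3] idx_inj[of 2 3] r3 by (auto simp: i_def j_def k_def)
    have tk: "wt (Inl k) T = 1/2" using long s r3 by (simp add: k_def field_simps)
    have tj: "wt (Inl j) T = 3/2" using wt_down[OF T, of 2] s r3 tk by (simp add: j_def k_def numeral_2_eq_2 numeral_3_eq_3)
    have ti: "wt (Inl i) T = 9/2" using wt_down[OF T, of 1] s r3 tj by (simp add: i_def j_def numeral_2_eq_2)
    define W where "W x y z \<longleftrightarrow> (\<exists>l\<in>weights UNIV. l (Inl i) = x \<and> l (Inl j) = y \<and> l (Inl k) = z)" for x y z :: int
    have W1: "W 1 1 1" using l0 by (auto simp: W_def)
    have Wi: "W (- x) y z" if "W x y z" for x y z
      using that weights_flip_coordinate[OF sub, of _ i] ij unfolding W_def by (metis (full_types))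
    have Wj: "W x (- y) z" if "W x y z" for x y z
      using that weights_flip_coordinate[OF sub, of _ j] ij unfolding W_def by (metis (full_types))
    have Wk: "W x y (- z)" if "W x y z" for x y z
      using that weights_flip_coordinate[OF sub, of _ k] ij unfolding W_def by (metis (full_types))
    have W0: "W 1 0 0" "W 0 1 0" "W 0 0 1"
      using weights_lower_pair[OF sub l0(1) l0(2) l0(2) ij(3)] weights_lower_pair[OF sub l0(1) l0(2) l0(2) ij(2)]
        weights_lower_pair[OF sub l0(1) l0(2) l0(2) ij(1)] ij l0(2) unfolding W_def by (metis (full_types))+
    have Wev: "\<exists>v. v \<noteq> 0 \<and> \<rho> T *v v = (9/2 * of_int x + (3/2 * of_int y + 1/2 * of_int z)) *s v" if W: "W x y z" for x y z
    proof -
      obtain l where "l \<in> weights UNIV" "l (Inl i) = x" "l (Inl j) = y" "l (Inl k) = z" using W unfolding W_def by blast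
      then show ?thesis using ij by (intro ev[of l]) (simp_all add: U ti tj tk)
    qed
    show ?thesis
    proof (rule converse[OF T f(1-3) ker(1) f(5)])
      show "simple_graded r 13 (\<lambda>a. wt a T)" unfolding r3 by (rule simple_graded_3[OF U ij]) (simp_all add: wI ti tj tk)
      fix n :: nat assume n: "n \<le> 13"
      \<comment> \<open>The 14 values are the signed sums of 9/2, 3/2, 1/2 together with these three
        numbers and their negatives.\<close>
      have "\<exists>x y z. W x y z \<and> of_real (real 13 / 2 - real n) = 9/2 * of_int x + (3/2 * of_int y + 1/2 * (of_int z :: complex))"
      proof -
        note W0 = W0(1) Wi[OF W0(1)] W0(2) Wj[OF W0(2)] W0(3) Wk[OF W0(3)]
        note W8 = W1 Wk[OF W1] Wj[OF W1] Wj[OF Wk[OF W1]] Wi[OF W1] Wi[OF Wk[OF W1]] Wi[OF Wj[OF W1]] Wi[OF Wj[OF Wk[OF W1]]]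
        consider "n = 0" | "n = 1" | "n = 2" | "n = 3" | "n = 4" | "n = 5" | "n = 6" | "n = 7" | "n = 8" | "n = 9"
          | "n = 10" | "n = 11" | "n = 12" | "n = 13"
        proof -
          have "n = 0 \<or> n = 1 \<or> n = 2 \<or> n = 3 \<or> n = 4 \<or> n = 5 \<or> n = 6 \<or> n = 7 \<or> n = 8 \<or> n = 9
            \<or> n = 10 \<or> n = 11 \<or> n = 12 \<or> n = 13" using n by presburger
          then show thesis using that by (elim disjE)
        qed
        then show ?thesis
        proof cases
          case 1 show ?thesis by (intro exI conjI, rule W8(1)) (simp add: 1)
        next case 2 show ?thesis by (intro exI conjI, rule W8(2)) (simp add: 2)
        next case 3 show ?thesis by (intro exI conjI, rule W0(1)) (simp add: 3)
        next case 4 show ?thesis by (intro exI conjI, rule W8(3)) (simp add: 4)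
        next case 5 show ?thesis by (intro exI conjI, rule W8(4)) (simp add: 5)
        next case 6 show ?thesis by (intro exI conjI, rule W0(3)) (simp add: 6)
        next case 7 show ?thesis by (intro exI conjI, rule W0(5)) (simp add: 7)
        next case 8 show ?thesis by (intro exI conjI, rule W0(6)) (simp add: 8)
        next case 9 show ?thesis by (intro exI conjI, rule W0(4)) (simp add: 9)
        next case 10 show ?thesis by (intro exI conjI, rule W8(5)) (simp add: 10)
        next case 11 show ?thesis by (intro exI conjI, rule W8(6)) (simp add: 11)
        next case 12 show ?thesis by (intro exI conjI, rule W0(2)) (simp add: 12)
        next case 13 show ?thesis by (intro exI conjI, rule W8(7)) (simp add: 13)
        next case 14 show ?thesis by (intro exI conjI, rule W8(8)) (simp add: 14)
        qed
      qed
      then show "\<exists>v. v \<noteq> 0 \<and> \<rho> T *v v = of_real (real 13 / 2 - real n) *s v" using Wev by metis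
    qed
  qed
qed

end

lemma scale_mat_one: "scale_mat 1 A = A"
  by (simp add: vec_eq_iff)

theorem theorem3p1:
  fixes G T :: "(complex^'n^'n) set"
    and \<theta> :: "complex^'n^'n \<Rightarrow> complex^('r::finite + 'r)^('r + 'r)"
    and w :: int
    and Q :: "rat^'v \<Rightarrow> rat^'v \<Rightarrow> rat"
    and \<pi> :: "complex^'n^'n \<Rightarrow> complex^'v^'v"
    and \<phi> :: "complex^(1 + 1)^(1 + 1) \<Rightarrow> complex^'n^'n"
    and T\<phi> :: "complex^'n^'n"
    and \<sigma> \<omega> :: "nat \<Rightarrow> complex^'n^'n \<Rightarrow> complex"
    and D :: "nat \<Rightarrow> complex^'n^'n"
    and r :: nat
  assumes r: "r = CARD('r)" "r \<ge> 2"
    and hodge_rep: "hodge_representation G w Q \<pi> \<phi>"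
    and sp2r: "lie_iso (lie_alg G) sp \<theta>"
    and irreducible: "irreducible_real_module G \<pi>"
    and torus: "compact_maximal_torus TYPE('r) G T" "\<phi> ` circle_group \<subseteq> T"
    and simple: "simple_roots (lie_alg G) (lie_alg T) r \<sigma>"
    and bourbaki: "bourbaki_numbering_C (lie_alg G) (lie_alg T) r \<sigma>"
    and fundamental: "fundamental_weights (lie_alg G) (lie_alg T) r \<sigma> \<omega>"
    and dual: "dual_basis (lie_alg T) r \<sigma> D"
    and grading: "grading_element G w \<pi> \<phi> T\<phi>"
    and normalization: "\<forall>i\<in>{1..r}. 0 \<le> \<sigma> i T\<phi>"
  shows "is_principal (differential G \<pi> T\<phi>) \<longleftrightarrow>
      (isomorphic_modules (lie_alg G) (differential G \<pi>) \<theta> \<and>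
         T\<phi> = (\<Sum>i\<in>{1..r}. D i)) \<or>
      (r = 2 \<and> submodule_of_ext_power (lie_alg G) (differential G \<pi>) 2 \<theta> \<and>
         irreducible_with_highest_weight (lie_alg G) (lie_alg T) r \<sigma> (differential G \<pi>) (\<omega> 2) \<and>
         T\<phi> = D 1 + D 2) \<or>
      (r = 3 \<and> submodule_of_ext_power (lie_alg G) (differential G \<pi>) 3 \<theta> \<and>
         irreducible_with_highest_weight (lie_alg G) (lie_alg T) r \<sigma> (differential G \<pi>) (\<omega> 3) \<and>
         T\<phi> = scale_mat 3 (D 1) + D 2 + D 3)"
proof -
  let ?g = "lie_alg G" and ?t = "lie_alg T" and ?R = "differential G \<pi>"
  have hr: "alg_group \<rat> G" "alg_hom \<rat> G (aut_form Q) \<pi>" "inj_on ?R ?g"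
    using hodge_rep unfolding hodge_representation_def by blast+
  interpret ah: algebraic_hom \<rat> G "aut_form Q" \<pi>
    by unfold_locales (use hr in \<open>auto simp: aut_form_def\<close>)
  interpret si: sp_iso ?g \<theta>
    by unfold_locales (use sp2r lie_alg_add lie_alg_scale lie_alg_bracket[OF ah.Gmc] in auto)
  have T: "alg_group \<real> T" "T \<subseteq> G" "cartan_subalgebra ?g ?t"
    using torus(1) unfolding compact_maximal_torus_def by blast+
  obtain \<psi> where \<psi>: "alg_iso \<real> (std_compact_torus :: (complex^('r + 'r)^('r + 'r)) set) T \<psi>"
    using torus(1) unfolding compact_maximal_torus_def by blast
  have tg: "?t \<subseteq> ?g" and cartan: "\<And>X. X \<in> ?g \<Longrightarrow> (\<And>Y. Y \<in> ?t \<Longrightarrow> lie_bracket X Y \<in> ?t) \<Longrightarrow> X \<in> ?t"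
    using T(3) unfolding cartan_subalgebra_def by blast+
  obtain B C :: "complex^('r + 'r)^('r + 'r)" and idx where BC: "B ** C = mat 1" "C ** B = mat 1"
    and frame: "sp_frame ?g (\<lambda>X. C ** \<theta> X ** B) ?t" and idx: "bij_betw idx {1..r} (UNIV :: 'r set)"
    and sig: "\<forall>H\<in>?t. \<sigma> r H = 2 * (C ** \<theta> H ** B) $ Inl (idx r) $ Inl (idx r) \<and>
      (\<forall>i\<in>{1..<r}. \<sigma> i H = (C ** \<theta> H ** B) $ Inl (idx i) $ Inl (idx i)
         - (C ** \<theta> H ** B) $ Inl (idx (Suc i)) $ Inl (idx (Suc i)))"
    using si.adapted_frame[OF r tg lie_alg_0 cartan torus_lie_alg(1)[OF T(1) \<psi>] torus_lie_alg(2)[OF T(1) \<psi>] simple bourbaki]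
    by blast
  have m: "sp_module \<rat> G (aut_form Q) \<pi> (\<lambda>X. C ** \<theta> X ** B) ?t"
    by (rule sp_module.intro[OF ah.algebraic_hom_axioms frame])
  interpret sb: sp_based \<rat> G "aut_form Q" \<pi> "\<lambda>X. C ** \<theta> X ** B" ?t r idx \<sigma>
    by (rule sp_based.intro[OF m], unfold_locales) (use r idx sig in \<open>auto simp: sp_frame.wt_def[OF frame]\<close>)
  note gd = grading_element_diagonalizable[OF hodge_rep torus(2) grading T(2)]
  obtain X where X: "X \<in> ?g" "\<And>i j. X $ i $ j \<in> \<real>" "T\<phi> = scale_mat \<i> X"
    using grading unfolding grading_element_def by blast
  \<comment> \<open>The grading element is \<i> times a real element, whose differential is a real
    matrix because \<open>\<pi>\<close> is defined over the rationals; conjugation therefore changes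
    its sign.\<close>
  have conj: "?R T\<phi> *v cnj_vec x = - cnj_vec (?R T\<phi> *v x)" for x
  proof -
    have "?R X *v cnj_vec x = cnj_vec (?R X *v x)"
      using ah.differential_real[OF rational_subset X(1,2)]
      by (simp add: cnj_vec_def matrix_vector_mult_def vec_eq_iff Reals_cnj_iff)
    then show ?thesis unfolding X(3) ah.differential_scale[OF X(1)] scale_mv
      by (simp add: cnj_vec_def vec_eq_iff)
  qed
  have S1: "(\<forall>i\<in>{1..r}. \<sigma> i T\<phi> = 1) \<longleftrightarrow> T\<phi> = (\<Sum>i\<in>{1..r}. D i)"
    using sb.sigma_dual_basis[OF dual gd(1), of "\<lambda>_. 1"] by (simp only: scale_mat_one)
  have S2: "(\<Sum>i\<in>{1..r}. D i) = D 1 + D 2" if "r = 2"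
  proof -
    have "{1..r} = {1, 2}" using that by auto
    then show ?thesis by simp
  qed
  have S3: "(\<forall>i\<in>{1..r}. \<sigma> i T\<phi> = (if i = 1 then 3 else 1)) \<longleftrightarrow> T\<phi> = scale_mat 3 (D 1) + D 2 + D 3" if "r = 3"
  proof -
    have "{1..r} = {1, 2, 3}" using that by auto
    then have "(\<Sum>i\<in>{1..r}. scale_mat (if i = 1 then 3 else 1) (D i)) = scale_mat 3 (D 1) + D 2 + D 3"
      by (simp add: scale_mat_one add.assoc)
    then show ?thesis using sb.sigma_dual_basis[OF dual gd(1), of "\<lambda>i. if i = 1 then 3 else 1"] by (simp only:)
  qed
  show ?thesis
  proof
    assume "is_principal (?R T\<phi>)"
    then obtain N where N: "principal_grading sb.RR (?R T\<phi>) (\<lambda>i. sb.wt (Inl i) T\<phi>) N idx r" "sb.min_submod UNIV"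
      using sb.principal_irreducible[OF gd(1) irreducible conj gd(2) normalization] by blast
    show "(isomorphic_modules ?g ?R \<theta> \<and> T\<phi> = (\<Sum>i\<in>{1..r}. D i)) \<or>
      (r = 2 \<and> submodule_of_ext_power ?g ?R 2 \<theta> \<and> irreducible_with_highest_weight ?g ?t r \<sigma> ?R (\<omega> 2) \<and>
         T\<phi> = D 1 + D 2) \<or>
      (r = 3 \<and> submodule_of_ext_power ?g ?R 3 \<theta> \<and> irreducible_with_highest_weight ?g ?t r \<sigma> ?R (\<omega> 3) \<and>
         T\<phi> = scale_mat 3 (D 1) + D 2 + D 3)"
      using sb.forward[OF N gd(1) fundamental hr(3) refl BC] S1 S2 S3 by metis
  next
    have spin: "is_principal (?R T\<phi>)"
      if s: "r = 2 \<and> (\<forall>i\<in>{1..r}. \<sigma> i T\<phi> = 1) \<or> r = 3 \<and> (\<forall>i\<in>{1..r}. \<sigma> i T\<phi> = (if i = 1 then 3 else 1))"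
        and sub: "submodule_of_ext_power ?g ?R r \<theta>" and hw: "irreducible_with_highest_weight ?g ?t r \<sigma> ?R (\<omega> r)"
    proof -
      obtain f where f: "(\<forall>u w. f (u + w) = (\<lambda>bs. f u bs + f w bs)) \<and> (\<forall>c u. f (c *s u) = (\<lambda>bs. c * f u bs)) \<and>
        inj f \<and> range f \<subseteq> ext_power r \<and> (\<forall>X\<in>?g. \<forall>v. f (?R X *v v) = tensor_action (C ** \<theta> X ** B) (f v))"
        using sub unfolding submodule_of_ext_power_frame[OF BC] by (rule exE)
      show ?thesis by (rule sb.spin_converse[OF gd(1) s fundamental hw, of f]) (use f in blast)+
    qed
    assume "(isomorphic_modules ?g ?R \<theta> \<and> T\<phi> = (\<Sum>i\<in>{1..r}. D i)) \<or>
      (r = 2 \<and> submodule_of_ext_power ?g ?R 2 \<theta> \<and> irreducible_with_highest_weight ?g ?t r \<sigma> ?R (\<omega> 2) \<and>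
         T\<phi> = D 1 + D 2) \<or>
      (r = 3 \<and> submodule_of_ext_power ?g ?R 3 \<theta> \<and> irreducible_with_highest_weight ?g ?t r \<sigma> ?R (\<omega> 3) \<and>
         T\<phi> = scale_mat 3 (D 1) + D 2 + D 3)"
    then consider (std) "isomorphic_modules ?g ?R \<theta>" "T\<phi> = (\<Sum>i\<in>{1..r}. D i)"
      | (two) "r = 2" "submodule_of_ext_power ?g ?R r \<theta>" "irreducible_with_highest_weight ?g ?t r \<sigma> ?R (\<omega> r)" "T\<phi> = D 1 + D 2"
      | (three) "r = 3" "submodule_of_ext_power ?g ?R r \<theta>" "irreducible_with_highest_weight ?g ?t r \<sigma> ?R (\<omega> r)"
          "T\<phi> = scale_mat 3 (D 1) + D 2 + D 3"
      by metis
    then show "is_principal (?R T\<phi>)"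
    proof cases
      case std
      have s: "\<forall>i\<in>{1..r}. \<sigma> i T\<phi> = 1" using std(2) S1 by blast
      show ?thesis
        by (rule isomorphic_modulesD[OF BC std(1)]) (rule sb.standard_converse[OF gd(1) s]; assumption)
    next
      case two
      have "\<forall>i\<in>{1..r}. \<sigma> i T\<phi> = 1" using two(4) S1 S2[OF two(1)] by simp
      then show ?thesis using two by (intro spin) simp_all
    next
      case three
      have "\<forall>i\<in>{1..r}. \<sigma> i T\<phi> = (if i = 1 then 3 else 1)" using three(4) S3[OF three(1)] by blast
      then show ?thesis using three(1) by (intro spin three(2,3)) blast
    qed
  qed
qed

end
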